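(* For every integral $A$-ideal $f$, the $G_f$-module $U'(f)$ is $G$-equivariantly isomorphic to $U(f)$.
   Context: Basic data: $\mathbf{K}$ is a locally compact nondiscrete topological field containing only finitely many roots of unity; $A\subset\mathbf{K}$ is a discrete cocompact integrally closed subring; $\mathrm{sgn}:\mathbf{K}^\times\to\{\text{roots of unity of }\mathbf{K}\}$ is a continuous homomorphism restricting to the identity on roots of unity. An element $x\in\mathbf{K}^\times$ is positive if $\mathrm{sgn}\,x=1$. $A$ is a Dedekind domain with finite unit group, finite class group and finite residue fields. Fractional, integral and maximal $A$-ideals are always nonzero; an integral $A$-ideal is one contained in $A$. Lattice translates: An $A$-lattice is a cocompact discrete $A$-submodule of $\mathbf{K}$. For a fractional $A$-ideal $I$ and an $A$-lattice $W$, $I\cdot W$ is the $A$-submodule generated by products $aw$, $a\in I,w\in W$; it is again an $A$-lattice. An $A$-lattice translate is a set $x+W$ with $x\in\mathbf{K}$, $W$ an $A$-lattice. $x_1+W_1\sim x_2+W_2$ (homothetic) if for some positive $y\in\mathbf{K}$ one has $yW_1=W_2$ and $yx_1-x_2\in W_2$. $x+W$ is $f$-torsion if $xf\subseteq W$, and of order $f$ if $\{a\in A: ax\in W\}=f$; it is torsion if $f$-torsion for some integral $A$-ideal $f$. $\Xi$ is the set of homothety classes $[x+W]$ of torsion $A$-lattice translates, and $\Xi(f)\subset\Xi$ the set of classes of $f$-torsion ones. $Y_f:\Xi\to\Xi$ is the map $[x+W]\mapsto[x+f^{-1}\cdot W]$. The group $G$: For integral $A$-ideals $f,I,J$ write $I\sim_f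 J$ if $I,J$ are prime to $f$ and there are nonzero $a,b\in A$ prime to $f$ with $b/a$ positive, $a\equiv b\bmod f$ and $aI=bJ$. $G_f$ is the finite abelian group of $\sim_f$-classes of integral $A$-ideals prime to $f$, and $G=\varprojlim G_f$. $G$ acts on $\Xi$: if $x+W$ has order $f$, $\sigma\in G$, and $I$ is an integral $A$-ideal prime to $f$ representing the image of $\sigma$ in $G_f$, then $\sigma[x+W]=[x+I^{-1}\cdot W]$. $U(f)$: Let $\mathcal{A}$ (resp. $\mathcal{A}(f)$) be the free abelian group on $\Xi$ (resp. $\Xi(f)$). $U(f)$ is the quotient of $\mathcal{A}(f)$ by the subgroup generated by all elements $\xi-\sum_{\eta\in\Xi,\,Y_p\eta=\xi}\eta$, where $p$ is a maximal $A$-ideal dividing $f$ and $\xi\in\Xi(f/p)$. The $G$-action descends to $U(f)$ and factors through $G_f$. $U'(f)$: A locally constant homomorphism $\chi:G\to\mathbf{C}^\times$ has conductor $c$ if for all integral $A$-ideals $f$, $\chi$ factors through $G_f$ if and only if $c$ divides $f$. For a maximal $A$-ideal $p$ put $\chi(p)=0$ if $p$ divides $c$, and otherwise $\chi(p)=\chi(\sigma)$ for any $\sigma\in G$ projecting to the class of $p$ in $G_c$. There is a unique homomorphism $u:\mathcal{A}\to\mathbf{Q}$ such that for all integral $A$-ideals $f$ and all locally constant homomorphisms $\chi:G\to\mathbf{C}^\times$ of conductor dividing $f$, $$\int_G u(\gamma[1+f])\chi(\gamma)\,d\mu(\gamma)=\frac1{|G_f|}\prod_{p\mid f}(1-\chi(p)),$$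 where $\mu$ is Haar probability measure on $G$ and $p$ runs over maximal $A$-ideals dividing $f$. $U'(f)$ is the $\mathbf{Z}[G_f]$-submodule of $\mathbf{Q}[G_f]$ generated by the elements $\sum_{\gamma\in G_f}u(\tilde\gamma[1+g])\gamma^{-1}$, where $g$ runs over integral $A$-ideals dividing $f$ and $\tilde\gamma\in G$ is any lift of $\gamma$. *)

theory Defs
  imports
    "HOL-Analysis.Analysis"
    "HOL-Algebra.Free_Abelian_Groups"
begin

class topological_field =
  field + topological_ab_group_add + topological_semigroup_mult + t2_space +
  assumes tendsto_inverse_nhds: "x \<noteq> 0 \<Longrightarrow> (inverse \<longlongrightarrow> inverse x) (nhds x)"

definition roots_of_unity :: "'k::field set" where
  "roots_of_unity = {z. \<exists>n>0. z ^ n = 1}"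

definition is_subring :: "'k::field set \<Rightarrow> bool" where
  "is_subring A \<longleftrightarrow> 1 \<in> A \<and> (\<forall>a\<in>A. \<forall>b\<in>A. a - b \<in> A \<and> a * b \<in> A)"

text \<open>Integrally closed means: in its own field of fractions, not in \<open>K\<close>
  (the integers are not integrally closed in the real numbers).\<close>

definition is_integrally_closed :: "'k::field set \<Rightarrow> bool" where
  "is_integrally_closed A \<longleftrightarrow>
     (\<forall>a\<in>A. \<forall>b\<in>A - {0}.
        (\<exists>P :: 'k poly. lead_coeff P = 1 \<and> (\<forall>i. coeff P i \<in> A) \<and> poly P (a / b) = 0)
        \<longrightarrow> a / b \<in> A)"

definition is_cocompact :: "'k::topological_field set \<Rightarrow> bool" where
  "is_cocompact W \<longleftrightarrow>
     (\<exists>T. quotient_map euclidean T (\<lambda>x. x +o W) \<and> compact_space T)"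

text \<open>A sign homomorphism is defined on the nonzero elements only; its value at \<open>0\<close> is
  irrelevant.\<close>

definition is_sign :: "('k::topological_field \<Rightarrow> 'k) \<Rightarrow> bool" where
  "is_sign sg \<longleftrightarrow>
     continuous_on (- {0}) sg \<and>
     (\<forall>x. x \<noteq> 0 \<longrightarrow> sg x \<in> roots_of_unity) \<and>
     (\<forall>x y. x \<noteq> 0 \<longrightarrow> y \<noteq> 0 \<longrightarrow> sg (x * y) = sg x * sg y) \<and>
     (\<forall>z\<in>roots_of_unity. sg z = z)"

definition basic_data :: "'k::topological_field set \<Rightarrow> ('k \<Rightarrow> 'k) \<Rightarrow> bool" where
  "basic_data A sg \<longleftrightarrow>
     locally_compact_space (euclidean :: 'k topology) \<and>
     \<not> discrete (UNIV :: 'k set) \<and>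
     finite (roots_of_unity :: 'k set) \<and>
     is_subring A \<and> discrete A \<and> is_cocompact A \<and> is_integrally_closed A \<and>
     is_sign sg"

definition is_positive :: "('k::field \<Rightarrow> 'k) \<Rightarrow> 'k \<Rightarrow> bool" where
  "is_positive sg x \<longleftrightarrow> x \<noteq> 0 \<and> sg x = 1"

definition is_submodule :: "'k::field set \<Rightarrow> 'k set \<Rightarrow> bool" where
  "is_submodule A W \<longleftrightarrow>
     0 \<in> W \<and> (\<forall>x\<in>W. \<forall>y\<in>W. x + y \<in> W) \<and> (\<forall>a\<in>A. \<forall>x\<in>W. a * x \<in> W)"

definition mod_prod :: "'k::field set \<Rightarrow> 'k set \<Rightarrow> 'k set \<Rightarrow> 'k set" where
  "mod_prod A I W = is_submodule A hull {a * w | a w. a \<in> I \<and> w \<in> W}"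

definition fractional_ideal :: "'k::field set \<Rightarrow> 'k set \<Rightarrow> bool" where
  "fractional_ideal A I \<longleftrightarrow>
     is_submodule A I \<and> I \<noteq> {0} \<and> (\<exists>d\<in>A - {0}. \<forall>x\<in>I. d * x \<in> A)"

definition integral_ideal :: "'k::field set \<Rightarrow> 'k set \<Rightarrow> bool" where
  "integral_ideal A I \<longleftrightarrow> fractional_ideal A I \<and> I \<subseteq> A"

definition maximal_ideal :: "'k::field set \<Rightarrow> 'k set \<Rightarrow> bool" where
  "maximal_ideal A p \<longleftrightarrow>
     integral_ideal A p \<and> p \<noteq> A \<and>
     (\<forall>J. integral_ideal A J \<longrightarrow> p \<subseteq> J \<longrightarrow> J = p \<or> J = A)"

text \<open>For nonzero \<open>I\<close> the following set is automatically contained in the fraction field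
  of \<open>A\<close>.\<close>

definition ideal_inv :: "'k::field set \<Rightarrow> 'k set \<Rightarrow> 'k set" where
  "ideal_inv A I = {x. \<forall>a\<in>I. x * a \<in> A}"

definition ideal_dvd :: "'k::field set \<Rightarrow> 'k set \<Rightarrow> 'k set \<Rightarrow> bool" where
  "ideal_dvd A g f \<longleftrightarrow> (\<exists>h. integral_ideal A h \<and> f = mod_prod A g h)"

definition prime_to :: "'k::field set \<Rightarrow> 'k set \<Rightarrow> 'k set \<Rightarrow> bool" where
  "prime_to A I f \<longleftrightarrow> {x + y | x y. x \<in> I \<and> y \<in> f} = A"

definition is_lattice :: "'k::topological_field set \<Rightarrow> 'k set \<Rightarrow> bool" where
  "is_lattice A W \<longleftrightarrow> is_submodule A W \<and> discrete W \<and> is_cocompact W"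

definition homothetic ::
  "'k::topological_field set \<Rightarrow> ('k \<Rightarrow> 'k) \<Rightarrow> 'k set \<Rightarrow> 'k set \<Rightarrow> bool" where
  "homothetic A sg X1 X2 \<longleftrightarrow>
     (\<exists>x1 W1 x2 W2. is_lattice A W1 \<and> is_lattice A W2 \<and> X1 = x1 +o W1 \<and> X2 = x2 +o W2 \<and>
        (\<exists>y. is_positive sg y \<and> y *o W1 = W2 \<and> y * x1 - x2 \<in> W2))"

definition hclass ::
  "'k::topological_field set \<Rightarrow> ('k \<Rightarrow> 'k) \<Rightarrow> 'k set \<Rightarrow> 'k set set" where
  "hclass A sg X = {X'. homothetic A sg X X'}"

definition torsion_by :: "'k::field set \<Rightarrow> 'k \<Rightarrow> 'k set \<Rightarrow> bool" where
  "torsion_by f x W \<longleftrightarrow> (\<forall>a\<in>f. x * a \<in> W)"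

definition order_of :: "'k::field set \<Rightarrow> 'k \<Rightarrow> 'k set \<Rightarrow> 'k set" where
  "order_of A x W = {a \<in> A. a * x \<in> W}"

definition Xi_tors ::
  "'k::topological_field set \<Rightarrow> ('k \<Rightarrow> 'k) \<Rightarrow> 'k set \<Rightarrow> 'k set set set" where
  "Xi_tors A sg f = {hclass A sg (x +o W) | x W. is_lattice A W \<and> torsion_by f x W}"

definition Xi :: "'k::topological_field set \<Rightarrow> ('k \<Rightarrow> 'k) \<Rightarrow> 'k set set set" where
  "Xi A sg = (\<Union>f\<in>{f. integral_ideal A f}. Xi_tors A sg f)"

definition Ymap ::
  "'k::topological_field set \<Rightarrow> ('k \<Rightarrow> 'k) \<Rightarrow> 'k set \<Rightarrow> 'k set set \<Rightarrow> 'k set set" where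
  "Ymap A sg f \<xi> =
     (THE \<eta>. \<exists>x W. is_lattice A W \<and> \<xi> = hclass A sg (x +o W) \<and>
                  \<eta> = hclass A sg (x +o mod_prod A (ideal_inv A f) W))"

definition ray_equiv ::
  "'k::field set \<Rightarrow> ('k \<Rightarrow> 'k) \<Rightarrow> 'k set \<Rightarrow> 'k set \<Rightarrow> 'k set \<Rightarrow> bool" where
  "ray_equiv A sg f I J \<longleftrightarrow>
     integral_ideal A I \<and> integral_ideal A J \<and> prime_to A I f \<and> prime_to A J f \<and>
     (\<exists>a\<in>A - {0}. \<exists>b\<in>A - {0}.
        prime_to A (a *o A) f \<and> prime_to A (b *o A) f \<and>
        is_positive sg (b / a) \<and> a - b \<in> f \<and> a *o I = b *o J)"

definition ray_class ::
  "'k::field set \<Rightarrow> ('k \<Rightarrow> 'k) \<Rightarrow> 'k set \<Rightarrow> 'k set \<Rightarrow> 'k set set" where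
  "ray_class A sg f I = {J. ray_equiv A sg f I J}"

text \<open>The product of two classes is written as the union of the classes of the products of
  their members; all these classes coincide.\<close>

definition ray_group ::
  "'k::field set \<Rightarrow> ('k \<Rightarrow> 'k) \<Rightarrow> 'k set \<Rightarrow> 'k set set monoid" where
  "ray_group A sg f =
     \<lparr>carrier = {ray_class A sg f I | I. integral_ideal A I \<and> prime_to A I f},
      mult = (\<lambda>X Y. \<Union>I\<in>X. \<Union>J\<in>Y. ray_class A sg f (mod_prod A I J)),
      one = ray_class A sg f A\<rparr>"

text \<open>The inverse limit is taken along divisibility of integral ideals; the transition map
  sends the class of \<open>I\<close> modulo \<open>g\<close> to the class of \<open>I\<close> modulo \<open>f\<close>. The projection of
  \<open>\<sigma>\<close> to the group of level \<open>f\<close> is \<open>\<sigma> f\<close>.\<close>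

definition ray_lim ::
  "'k::field set \<Rightarrow> ('k \<Rightarrow> 'k) \<Rightarrow> ('k set \<Rightarrow> 'k set set) monoid" where
  "ray_lim A sg =
     (let P = product_group {f. integral_ideal A f} (ray_group A sg) in
      P\<lparr>carrier := {\<sigma> \<in> carrier P.
          \<forall>f g. integral_ideal A f \<longrightarrow> integral_ideal A g \<longrightarrow> ideal_dvd A f g \<longrightarrow>
            (\<forall>I\<in>\<sigma> g. \<sigma> f = ray_class A sg f I)}\<rparr>)"

definition ray_top ::
  "'k::field set \<Rightarrow> ('k \<Rightarrow> 'k) \<Rightarrow> ('k set \<Rightarrow> 'k set set) topology" where
  "ray_top A sg =
     subtopology
       (product_topology (\<lambda>f. discrete_topology (carrier (ray_group A sg f)))
          {f. integral_ideal A f})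
       (carrier (ray_lim A sg))"

definition is_haar_prob ::
  "'k::field set \<Rightarrow> ('k \<Rightarrow> 'k) \<Rightarrow> ('k set \<Rightarrow> 'k set set) measure \<Rightarrow> bool" where
  "is_haar_prob A sg \<mu> \<longleftrightarrow>
     space \<mu> = carrier (ray_lim A sg) \<and>
     sets \<mu> = sigma_sets (carrier (ray_lim A sg)) {S. openin (ray_top A sg) S} \<and>
     emeasure \<mu> (space \<mu>) = 1 \<and>
     (\<forall>\<sigma>\<in>carrier (ray_lim A sg). \<forall>S\<in>sets \<mu>.
        emeasure \<mu> ((\<lambda>\<tau>. \<sigma> \<otimes>\<^bsub>ray_lim A sg\<^esub> \<tau>) ` S) = emeasure \<mu> S)"

definition act ::
  "'k::topological_field set \<Rightarrow> ('k \<Rightarrow> 'k) \<Rightarrow> ('k set \<Rightarrow> 'k set set) \<Rightarrow> 'k set set \<Rightarrow> 'k set set"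
  where
  "act A sg \<sigma> \<xi> =
     (THE \<eta>. \<exists>x W I. is_lattice A W \<and> \<xi> = hclass A sg (x +o W) \<and> I \<in> \<sigma> (order_of A x W) \<and>
                    \<eta> = hclass A sg (x +o mod_prod A (ideal_inv A I) W))"

definition dist_relators ::
  "'k::topological_field set \<Rightarrow> ('k \<Rightarrow> 'k) \<Rightarrow> 'k set \<Rightarrow> ('k set set \<Rightarrow>\<^sub>0 int) set" where
  "dist_relators A sg f =
     {frag_of \<xi> - (\<Sum>\<eta>\<in>{\<eta> \<in> Xi A sg. Ymap A sg p \<eta> = \<xi>}. frag_of \<eta>) | \<xi> p.
        maximal_ideal A p \<and> ideal_dvd A p f \<and>
        \<xi> \<in> Xi_tors A sg (mod_prod A f (ideal_inv A p))}"

definition Umod ::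
  "'k::topological_field set \<Rightarrow> ('k \<Rightarrow> 'k) \<Rightarrow> 'k set \<Rightarrow> ('k set set \<Rightarrow>\<^sub>0 int) set monoid" where
  "Umod A sg f =
     free_Abelian_group (Xi_tors A sg f) Mod
       generate (free_Abelian_group (Xi_tors A sg f)) (dist_relators A sg f)"

text \<open>The action on the quotient, described on cosets: the coset of \<open>x\<close> goes to the coset
  of \<open>\<sigma> x\<close>, which is the image of the former.\<close>

definition Uact ::
  "'k::topological_field set \<Rightarrow> ('k \<Rightarrow> 'k) \<Rightarrow> ('k set \<Rightarrow> 'k set set) \<Rightarrow>
     ('k set set \<Rightarrow>\<^sub>0 int) set \<Rightarrow> ('k set set \<Rightarrow>\<^sub>0 int) set" where
  "Uact A sg \<sigma> C = frag_extend (\<lambda>\<xi>. frag_of (act A sg \<sigma> \<xi>)) ` C"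

text \<open>The element \<open>\<Sum> c\<^sub>\<gamma> \<gamma>\<close> of the group ring is the finitely supported function
  \<open>\<gamma> \<mapsto> c\<^sub>\<gamma>\<close>.\<close>

definition rat_gring :: "('g, 'm) monoid_scheme \<Rightarrow> ('g \<Rightarrow>\<^sub>0 rat) set" where
  "rat_gring G = {x. Poly_Mapping.keys x \<subseteq> carrier G}"

definition int_gring :: "('g, 'm) monoid_scheme \<Rightarrow> ('g \<Rightarrow>\<^sub>0 rat) set" where
  "int_gring G = {x \<in> rat_gring G. \<forall>\<gamma>. Poly_Mapping.lookup x \<gamma> \<in> \<int>}"

definition gring_mult ::
  "('g, 'm) monoid_scheme \<Rightarrow> ('g \<Rightarrow>\<^sub>0 rat) \<Rightarrow> ('g \<Rightarrow>\<^sub>0 rat) \<Rightarrow> ('g \<Rightarrow>\<^sub>0 rat)" where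
  "gring_mult G x y =
     (\<Sum>\<gamma>\<in>Poly_Mapping.keys x. \<Sum>\<delta>\<in>Poly_Mapping.keys y.
        Poly_Mapping.single (\<gamma> \<otimes>\<^bsub>G\<^esub> \<delta>) (Poly_Mapping.lookup x \<gamma> * Poly_Mapping.lookup y \<delta>))"

definition int_gring_submodule :: "('g, 'm) monoid_scheme \<Rightarrow> ('g \<Rightarrow>\<^sub>0 rat) set \<Rightarrow> bool" where
  "int_gring_submodule G M \<longleftrightarrow>
     M \<subseteq> rat_gring G \<and> 0 \<in> M \<and> (\<forall>x\<in>M. \<forall>y\<in>M. x + y \<in> M) \<and>
     (\<forall>r\<in>int_gring G. \<forall>x\<in>M. gring_mult G r x \<in> M)"

definition complex_units :: "complex monoid" where
  "complex_units = \<lparr>carrier = - {0}, mult = (*), one = 1\<rparr>"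

definition rat_additive :: "rat monoid" where
  "rat_additive = \<lparr>carrier = UNIV, mult = (+), one = 0\<rparr>"

definition is_character ::
  "'k::field set \<Rightarrow> ('k \<Rightarrow> 'k) \<Rightarrow> (('k set \<Rightarrow> 'k set set) \<Rightarrow> complex) \<Rightarrow> bool" where
  "is_character A sg ch \<longleftrightarrow>
     ch \<in> hom (ray_lim A sg) complex_units \<and>
     (\<forall>\<sigma>\<in>carrier (ray_lim A sg). \<exists>S. openin (ray_top A sg) S \<and> \<sigma> \<in> S \<and> (\<forall>\<tau>\<in>S. ch \<tau> = ch \<sigma>))"

definition factors_through ::
  "'k::field set \<Rightarrow> ('k \<Rightarrow> 'k) \<Rightarrow> (('k set \<Rightarrow> 'k set set) \<Rightarrow> complex) \<Rightarrow> 'k set \<Rightarrow> bool" where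
  "factors_through A sg ch f \<longleftrightarrow>
     (\<exists>\<psi>\<in>hom (ray_group A sg f) complex_units. \<forall>\<sigma>\<in>carrier (ray_lim A sg). ch \<sigma> = \<psi> (\<sigma> f))"

definition has_conductor ::
  "'k::field set \<Rightarrow> ('k \<Rightarrow> 'k) \<Rightarrow> (('k set \<Rightarrow> 'k set set) \<Rightarrow> complex) \<Rightarrow> 'k set \<Rightarrow> bool" where
  "has_conductor A sg ch c \<longleftrightarrow>
     integral_ideal A c \<and>
     (\<forall>f. integral_ideal A f \<longrightarrow> (factors_through A sg ch f \<longleftrightarrow> ideal_dvd A c f))"

definition char_at ::
  "'k::field set \<Rightarrow> ('k \<Rightarrow> 'k) \<Rightarrow> (('k set \<Rightarrow> 'k set set) \<Rightarrow> complex) \<Rightarrow> 'k set \<Rightarrow> 'k set \<Rightarrow>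
     complex" where
  "char_at A sg ch c p =
     (if ideal_dvd A p c then 0
      else THE v. \<exists>\<sigma>\<in>carrier (ray_lim A sg). \<sigma> c = ray_class A sg c p \<and> v = ch \<sigma>)"

definition is_universal_hom ::
  "'k::topological_field set \<Rightarrow> ('k \<Rightarrow> 'k) \<Rightarrow> ('k set \<Rightarrow> 'k set set) measure \<Rightarrow>
     (('k set set \<Rightarrow>\<^sub>0 int) \<Rightarrow> rat) \<Rightarrow> bool" where
  "is_universal_hom A sg \<mu> u \<longleftrightarrow>
     u \<in> hom (free_Abelian_group (Xi A sg)) rat_additive \<and>
     (\<forall>f ch c. integral_ideal A f \<longrightarrow> is_character A sg ch \<longrightarrow> has_conductor A sg ch c \<longrightarrow>
        ideal_dvd A c f \<longrightarrow>
        (\<integral>\<gamma>. of_rat (u (frag_of (act A sg \<gamma> (hclass A sg (1 +o f))))) * ch \<gamma> \<partial>\<mu>) =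
          1 / of_nat (card (carrier (ray_group A sg f))) *
          (\<Prod>p\<in>{p. maximal_ideal A p \<and> ideal_dvd A p f}. 1 - char_at A sg ch c p))"

text \<open>The generators are formed with every possible choice \<open>t\<close> of lifts to the limit group;
  the result does not depend on the choice.\<close>

definition Uprime_gens ::
  "'k::topological_field set \<Rightarrow> ('k \<Rightarrow> 'k) \<Rightarrow> (('k set set \<Rightarrow>\<^sub>0 int) \<Rightarrow> rat) \<Rightarrow> 'k set \<Rightarrow>
     ('k set set \<Rightarrow>\<^sub>0 rat) set" where
  "Uprime_gens A sg u f =
     {\<Sum>\<gamma>\<in>carrier (ray_group A sg f).
        Poly_Mapping.single (inv\<^bsub>ray_group A sg f\<^esub> \<gamma>)
          (u (frag_of (act A sg (t \<gamma>) (hclass A sg (1 +o g))))) | g t.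
        integral_ideal A g \<and> ideal_dvd A g f \<and>
        (\<forall>\<gamma>\<in>carrier (ray_group A sg f). t \<gamma> \<in> carrier (ray_lim A sg) \<and> t \<gamma> f = \<gamma>)}"

definition Uprime ::
  "'k::topological_field set \<Rightarrow> ('k \<Rightarrow> 'k) \<Rightarrow> (('k set set \<Rightarrow>\<^sub>0 int) \<Rightarrow> rat) \<Rightarrow> 'k set \<Rightarrow>
     ('k set set \<Rightarrow>\<^sub>0 rat) monoid" where
  "Uprime A sg u f =
     \<lparr>carrier = int_gring_submodule (ray_group A sg f) hull Uprime_gens A sg u f,
      mult = (+), one = 0\<rparr>"

end

(* Send a class xi to the element sum_gamma u(gamma xi) gamma^-1 of Q[G_f]. Comparing Fourier
   coefficients on G_(pg) shows that u satisfies the distribution relations, so this induces a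
   G-equivariant map from U(f) onto U'(f): every class in Xi(f) is a translate of some [1 + g] with
   g dividing f. For injectivity, Kubert's reduction produces at most |G_f| generators of U(f):
   classes whose coordinate at each p dividing f is 0 or a unit modulo the p-part of f which is not
   congruent to 1; replacing the coordinates 0 by 1 embeds them into the classes of order f, a torsor
   under G_f. On the other hand, for each character chi of G_f with conductor g the chi-coefficient
   of the image of [1 + g] is nonzero, so U'(f) has full rank |G_f|. Hence the generators are
   independent and the map is injective. *)
theory Submission
  imports Defs
begin

text \<open>The hypotheses speak only of a topological field, so the arithmetic of A has to be
  extracted from compactness: an element \<open>cs\<close> that shrinks a compact neighbourhood of 0
  replaces an absolute value, and discreteness of A then gives finite residue rings, finitely many
  ideal classes and finitely many units. Together with integral closedness, finite residue rings
  make nonzero ideals invertible, and every A-lattice becomes a scaled ideal. Coordinates at the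
  primes dividing f are meaningful because a positive unit is 1: once a lattice is normalised by
  positive scaling, no freedom is left in the residue class. Kubert's reduction compares two sums
  over classes that agree away from p: one over all coordinates at p, one over the non-unit
  coordinates only. Subtracting leaves the unit coordinates, so the coordinate 1 is expressed by the
  others. The count also excludes torsion in U(f), which equality of ranks alone would not: the
  generators are integral, at most |G_f| in number, and their images are linearly independent over
  Q.\<close>

lemma mem_scale_iff: "y \<noteq> 0 \<Longrightarrow> x \<in> y *o W \<longleftrightarrow> x / y \<in> W" for x y :: "'k::field"
  by (auto simp: elt_set_times_def intro!: bexI[of _ "x / y"])

lemma scale_memI: "w \<in> W \<Longrightarrow> y * w \<in> y *o W" for y :: "'k::field"
  by (auto simp: elt_set_times_def)

lemma scale_cancel: "y \<noteq> 0 \<Longrightarrow> y *o V = y *o W \<Longrightarrow> V = W" for y :: "'k::field"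
  by (metis nonzero_mult_div_cancel_left mem_scale_iff subsetI subset_antisym)

lemma scale_flip: "y \<noteq> 0 \<Longrightarrow> y *o V = W \<Longrightarrow> inverse y *o W = V" for y :: "'k::field"
  by (metis left_inverse set_one_times set_times_rearrange2)

lemma coset_mem_iff: "x \<in> a +o W \<longleftrightarrow> x - a \<in> W" for x :: "'k::field"
  by (metis set_minus_plus)

section \<open>Modules over a subring of a field\<close>

locale subring_of_field =
  fixes A :: "'k::field set"
  assumes subring: "is_subring A"
begin

abbreviation mp (infixl "\<cdot>" 75) where "I \<cdot> J \<equiv> mod_prod A I J"
abbreviation "iv \<equiv> ideal_inv A"
abbreviation "sm \<equiv> is_submodule A"

lemma one_A: "1 \<in> A" and diff_A: "a \<in> A \<Longrightarrow> b \<in> A \<Longrightarrow> a - b \<in> A"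
  and mult_A: "a \<in> A \<Longrightarrow> b \<in> A \<Longrightarrow> a * b \<in> A"
  using subring by (auto simp: is_subring_def)

lemma zero_A: "0 \<in> A" using diff_A[OF one_A one_A] by simp
lemma uminus_A: "a \<in> A \<Longrightarrow> - a \<in> A" using diff_A[OF zero_A] by simp
lemma add_A: "a \<in> A \<Longrightarrow> b \<in> A \<Longrightarrow> a + b \<in> A" using diff_A[of a "-b"] uminus_A by simp

lemma sm_A: "sm A" by (simp add: is_submodule_def zero_A add_A mult_A)

lemma sm_zero: "sm W \<Longrightarrow> 0 \<in> W" and sm_add: "sm W \<Longrightarrow> x \<in> W \<Longrightarrow> y \<in> W \<Longrightarrow> x + y \<in> W"
  and sm_mult: "sm W \<Longrightarrow> a \<in> A \<Longrightarrow> x \<in> W \<Longrightarrow> a * x \<in> W"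
  by (auto simp: is_submodule_def)

lemma sm_uminus: "sm W \<Longrightarrow> x \<in> W \<Longrightarrow> - x \<in> W"
  using sm_mult[of W "-1" x] uminus_A one_A by simp

lemma sm_diff: "sm W \<Longrightarrow> x \<in> W \<Longrightarrow> y \<in> W \<Longrightarrow> x - y \<in> W"
  using sm_add[of W x "-y"] sm_uminus by simp

lemma sm_mult2: "sm W \<Longrightarrow> a \<in> A \<Longrightarrow> x \<in> W \<Longrightarrow> x * a \<in> W"
  using sm_mult by (simp add: mult.commute)

lemma sm_diff_swap: "sm W \<Longrightarrow> x - y \<in> W \<Longrightarrow> y - x \<in> W"
  using sm_uminus[of W "x - y"] by simp

lemma sm_sum: "sm W \<Longrightarrow> (\<And>i. i \<in> S \<Longrightarrow> h i \<in> W) \<Longrightarrow> sum h S \<in> W"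
  by (induction S rule: infinite_finite_induct) (auto simp: sm_zero sm_add)

lemma sm_scale: "sm W \<Longrightarrow> sm (y *o W)"
  unfolding is_submodule_def elt_set_times_def
  by (auto simp flip: distrib_left)

lemma sm_plus: assumes "sm V" "sm W" shows "sm (V + W)"
  unfolding is_submodule_def
proof (intro conjI ballI)
  show "0 \<in> V + W" using set_plus_intro[OF sm_zero[OF assms(1)] sm_zero[OF assms(2)]] by simp
next
  fix x y assume "x \<in> V + W" "y \<in> V + W"
  then obtain a b c d where "x = a + b" "y = c + d" "a \<in> V" "b \<in> W" "c \<in> V" "d \<in> W"
    by (auto elim!: set_plus_elim)
  then have "x + y = (a + c) + (b + d)" "a + c \<in> V" "b + d \<in> W" using assms by (auto intro: sm_add)
  then show "x + y \<in> V + W" by (metis set_plus_intro)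
next
  fix a x assume "a \<in> A" "x \<in> V + W"
  then obtain c d where "x = c + d" "c \<in> V" "d \<in> W"
    by (auto elim!: set_plus_elim)
  then have "a * x = a * c + a * d" "a * c \<in> V" "a * d \<in> W"
    using assms \<open>a \<in> A\<close> by (auto intro: sm_mult simp: distrib_left)
  then show "a * x \<in> V + W" by (metis set_plus_intro)
qed

text \<open>Statements about a product module are proved by placing the product inside a colon
  module like this one: only products of generators then have to be tested, and finite sums never
  appear.\<close>

lemma sm_colon: "sm V \<Longrightarrow> sm {x. \<forall>w\<in>W. x * w \<in> V}"
  by (auto simp: is_submodule_def distrib_right mult.assoc)

lemma sm_iv: "sm (iv W)"
  unfolding ideal_inv_def by (rule sm_colon[OF sm_A])

lemma plus_upper1: "sm W \<Longrightarrow> V \<subseteq> V + W"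
  using set_zero_plus2[of W V] sm_zero by (auto simp: add.commute)

lemma plus_upper2: "sm V \<Longrightarrow> W \<subseteq> V + W"
  using set_zero_plus2[of V W] sm_zero by auto

lemma plus_least: "sm X \<Longrightarrow> V \<subseteq> X \<Longrightarrow> W \<subseteq> X \<Longrightarrow> V + W \<subseteq> X"
  by (auto elim!: set_plus_elim intro!: sm_add)

lemma mp_sm: "sm (I \<cdot> J)"
  unfolding mod_prod_def by (rule hull_in) (auto simp: is_submodule_def)

lemma mp_memI: "a \<in> I \<Longrightarrow> w \<in> J \<Longrightarrow> a * w \<in> I \<cdot> J"
  unfolding mod_prod_def by (rule hull_inc) auto

lemma mp_least: "sm M \<Longrightarrow> (\<And>a w. a \<in> I \<Longrightarrow> w \<in> J \<Longrightarrow> a * w \<in> M) \<Longrightarrow> I \<cdot> J \<subseteq> M"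
  unfolding mod_prod_def by (rule hull_minimal) auto

lemma mp_comm: "I \<cdot> J = J \<cdot> I"
  by (rule subset_antisym; rule mp_least[OF mp_sm]) (metis mp_memI mult.commute)+

lemma mp_mono: "I \<subseteq> I' \<Longrightarrow> J \<subseteq> J' \<Longrightarrow> I \<cdot> J \<subseteq> I' \<cdot> J'"
  by (rule mp_least[OF mp_sm]) (auto intro: mp_memI)

lemma mp_assoc_le: "I \<cdot> J \<cdot> K \<subseteq> I \<cdot> (J \<cdot> K)"
proof (rule mp_least[OF mp_sm])
  have "I \<cdot> J \<subseteq> {x. \<forall>k\<in>K. x * k \<in> I \<cdot> (J \<cdot> K)}"
    by (rule mp_least[OF sm_colon[OF mp_sm]]) (auto simp: mult.assoc intro: mp_memI)
  then show "a * w \<in> I \<cdot> (J \<cdot> K)" if "a \<in> I \<cdot> J" "w \<in> K" for a w using that by blast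
qed

lemma mp_assoc: "I \<cdot> J \<cdot> K = I \<cdot> (J \<cdot> K)"
  by (metis mp_assoc_le mp_comm subset_antisym)

lemma mp_left_comm: "I \<cdot> (J \<cdot> K) = J \<cdot> (I \<cdot> K)"
  by (metis mp_assoc mp_comm)

lemmas mp_ac = mp_assoc mp_comm mp_left_comm

lemma mp_one: "sm W \<Longrightarrow> A \<cdot> W = W"
proof (rule subset_antisym)
  assume W: "sm W"
  show "A \<cdot> W \<subseteq> W" by (rule mp_least[OF W]) (rule sm_mult[OF W])
  show "W \<subseteq> A \<cdot> W" using mp_memI[OF one_A, of _ W] by auto
qed

lemma mp_one2: "sm W \<Longrightarrow> W \<cdot> A = W"
  by (metis mp_one mp_comm)

lemma mp_scale: "(y *o I) \<cdot> J = y *o (I \<cdot> J)"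
proof (rule subset_antisym)
  show "(y *o I) \<cdot> J \<subseteq> y *o (I \<cdot> J)"
    by (rule mp_least[OF sm_scale[OF mp_sm]]) (auto simp: elt_set_times_def mult.assoc intro: mp_memI)
  have "I \<cdot> J \<subseteq> {x. \<forall>w\<in>{y}. x * w \<in> (y *o I) \<cdot> J}"
  proof (rule mp_least[OF sm_colon[OF mp_sm]])
    fix a w assume "a \<in> I" "w \<in> J"
    then have "(y * a) * w \<in> (y *o I) \<cdot> J" by (intro mp_memI) auto
    then show "a * w \<in> {x. \<forall>w\<in>{y}. x * w \<in> (y *o I) \<cdot> J}" by (simp add: ac_simps)
  qed
  then show "y *o (I \<cdot> J) \<subseteq> (y *o I) \<cdot> J" by (auto simp: elt_set_times_def mult.commute)
qed

lemma mp_scale2: "I \<cdot> (y *o J) = y *o (I \<cdot> J)"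
  using mp_scale mp_comm by metis

lemma mp_principal: "sm W \<Longrightarrow> (y *o A) \<cdot> W = y *o W"
  by (simp add: mp_scale mp_one)

lemma mp_sub: "sm W \<Longrightarrow> I \<subseteq> A \<Longrightarrow> I \<cdot> W \<subseteq> W"
  using mp_mono[of I A W W] mp_one by auto

section \<open>Invertible modules\<close>

definition invble where "invble W \<longleftrightarrow> sm W \<and> W \<cdot> iv W = A"

lemma invble_sm: "invble W \<Longrightarrow> sm W" and invble_mp: "invble W \<Longrightarrow> W \<cdot> iv W = A"
  and invble_mp2: "invble W \<Longrightarrow> iv W \<cdot> W = A"
  by (auto simp: invble_def mp_comm)

text \<open>If W V = A, then iv W = iv W W V is contained in V. The argument takes place in K
  itself, so it also serves modules \<open>k *o I\<close> with k any nonzero element of K.\<close>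

lemma inv_unique: assumes "sm V" "W \<cdot> V = A" shows "iv W = V"
proof (rule subset_antisym)
  show "V \<subseteq> iv W" using mp_memI[of _ W _ V] assms(2) by (auto simp: ideal_inv_def) (metis mult.commute)
  have "iv W \<cdot> W \<subseteq> A" by (rule mp_least[OF sm_A]) (auto simp: ideal_inv_def)
  then have "iv W \<cdot> W \<cdot> V \<subseteq> A \<cdot> V" by (rule mp_mono) simp
  then show "iv W \<subseteq> V" using assms by (simp add: mp_assoc mp_one mp_one2 sm_iv)
qed

lemma invbleI: "sm W \<Longrightarrow> sm V \<Longrightarrow> W \<cdot> V = A \<Longrightarrow> invble W"
  using inv_unique by (auto simp: invble_def)

lemma invble_A: "invble A" by (rule invbleI[OF sm_A sm_A mp_one[OF sm_A]])
lemma iv_A: "iv A = A" by (rule inv_unique[OF sm_A mp_one[OF sm_A]])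

lemma invble_iv: "invble W \<Longrightarrow> invble (iv W)"
  using invbleI[OF sm_iv invble_sm invble_mp2] .

lemma iv_iv: "invble W \<Longrightarrow> iv (iv W) = W"
  using inv_unique[OF invble_sm invble_mp2] .

lemma mp_mp_iv: "invble V \<Longrightarrow> invble W \<Longrightarrow> V \<cdot> W \<cdot> (iv V \<cdot> iv W) = A"
  by (metis invble_mp mp_assoc mp_left_comm mp_one sm_iv mp_comm)

lemma invble_mul: "invble V \<Longrightarrow> invble W \<Longrightarrow> invble (V \<cdot> W)"
  using invbleI[OF mp_sm mp_sm mp_mp_iv] .

lemma iv_mul: "invble V \<Longrightarrow> invble W \<Longrightarrow> iv (V \<cdot> W) = iv V \<cdot> iv W"
  using inv_unique[OF mp_sm mp_mp_iv] .

lemma cancel_iv1: "invble W \<Longrightarrow> sm V \<Longrightarrow> W \<cdot> (iv W \<cdot> V) = V"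
  by (metis invble_mp mp_assoc mp_one)

lemma cancel_iv2: "invble W \<Longrightarrow> sm V \<Longrightarrow> iv W \<cdot> (W \<cdot> V) = V"
  by (metis invble_mp2 mp_assoc mp_one)

lemma mp_eq_cancel: "invble W \<Longrightarrow> sm X \<Longrightarrow> sm Y \<Longrightarrow> W \<cdot> X = W \<cdot> Y \<longleftrightarrow> X = Y"
  by (metis cancel_iv2)

text \<open>If x W lies in V, then x A = iv W (x W) lies in iv W V. Division by an invertible module
  thereby becomes a test on elements, the form in which the lattices \<open>iv I \<cdot> f\<close>
  are handled later.\<close>

lemma mem_iv_mp: assumes "invble W" "sm V" shows "x \<in> iv W \<cdot> V \<longleftrightarrow> (\<forall>w\<in>W. x * w \<in> V)"
proof
  assume x: "x \<in> iv W \<cdot> V"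
  have "iv W \<cdot> V \<subseteq> {x. \<forall>w\<in>W. x * w \<in> V}"
  proof (rule mp_least[OF sm_colon[OF assms(2)]], clarify)
    fix a v w assume "a \<in> iv W" "v \<in> V" "w \<in> W"
    then have "a * w * v \<in> V" by (intro sm_mult[OF assms(2)]) (auto simp: ideal_inv_def)
    then show "a * v * w \<in> V" by (simp add: ac_simps)
  qed
  with x show "\<forall>w\<in>W. x * w \<in> V" by blast
next
  assume x: "\<forall>w\<in>W. x * w \<in> V"
  have "x *o W \<subseteq> V" using x by (auto simp: elt_set_times_def)
  then have "iv W \<cdot> (x *o W) \<subseteq> iv W \<cdot> V" by (rule mp_mono[OF subset_refl])
  then have "x *o A \<subseteq> iv W \<cdot> V" by (simp add: mp_scale2 invble_mp2 assms)
  then show "x \<in> iv W \<cdot> V" using scale_memI[OF one_A, of x] by auto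
qed

lemma mem_mp_iff: assumes "invble W" "sm V" shows "x \<in> W \<cdot> V \<longleftrightarrow> (\<forall>w\<in>iv W. x * w \<in> V)"
  using mem_iv_mp[OF invble_iv[OF assms(1)] assms(2)] iv_iv[OF assms(1)] by simp

lemma invble_scale: "k \<noteq> 0 \<Longrightarrow> invble W \<Longrightarrow> invble (k *o W)"
  and iv_scale: "k \<noteq> 0 \<Longrightarrow> invble W \<Longrightarrow> iv (k *o W) = inverse k *o iv W"
proof -
  assume k: "k \<noteq> 0" and W: "invble W"
  have *: "(k *o W) \<cdot> (inverse k *o iv W) = A"
    using k W by (simp add: mp_scale mp_scale2 invble_mp set_times_rearrange2)
  show "invble (k *o W)" using invbleI[OF sm_scale sm_scale *] invble_sm[OF W] sm_iv by auto
  show "iv (k *o W) = inverse k *o iv W" using inv_unique[OF sm_scale *] sm_iv by auto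
qed

lemma invble_nonzero: "invble W \<Longrightarrow> \<exists>w\<in>W. w \<noteq> 0"
proof (rule ccontr)
  assume W: "invble W" and "\<not> (\<exists>w\<in>W. w \<noteq> 0)"
  then have "W \<cdot> iv W \<subseteq> {0}" by (intro mp_least) (auto simp: is_submodule_def)
  then show False using one_A by (auto simp: invble_mp[OF W])
qed

lemma iv_antimono: "V \<subseteq> W \<Longrightarrow> iv W \<subseteq> iv V" by (auto simp: ideal_inv_def)

section \<open>Integral ideals and comaximality\<close>

lemma integral_iff: "integral_ideal A I \<longleftrightarrow> sm I \<and> I \<noteq> {0} \<and> I \<subseteq> A"
  unfolding integral_ideal_def fractional_ideal_def using bexI[of "\<lambda>d. \<forall>x\<in>I. d * x \<in> A" 1 "A - {0}"] one_A
  by auto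

lemma integral_nonzero: "integral_ideal A I \<Longrightarrow> \<exists>a\<in>I. a \<noteq> 0"
  using sm_zero[of I] by (auto simp: integral_iff)

lemma integral_sm: "integral_ideal A I \<Longrightarrow> sm I" and integral_sub: "integral_ideal A I \<Longrightarrow> I \<subseteq> A"
  by (auto simp: integral_iff)

lemma integral_A: "integral_ideal A A"
  using sm_A one_A by (auto simp: integral_iff)

lemma integral_super: "integral_ideal A I \<Longrightarrow> I \<subseteq> J \<Longrightarrow> sm J \<Longrightarrow> J \<subseteq> A \<Longrightarrow> integral_ideal A J"
  using integral_nonzero[of I] unfolding integral_iff[of J] by blast

lemma integral_mul: assumes "integral_ideal A I" "integral_ideal A J"
  shows "integral_ideal A (I \<cdot> J)"
proof -
  obtain a b where "a \<in> I" "b \<in> J" "a \<noteq> 0" "b \<noteq> 0" using integral_nonzero assms by metis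
  then have "a * b \<in> I \<cdot> J" "a * b \<noteq> 0" by (auto intro: mp_memI)
  moreover have "I \<cdot> J \<subseteq> A" using mp_sub[OF sm_A integral_sub[OF assms(1)]] mp_mono[of I I J A]
      integral_sub[OF assms(2)] by auto
  ultimately show ?thesis using mp_sm by (auto simp: integral_iff)
qed

lemma integral_plus: "integral_ideal A I \<Longrightarrow> integral_ideal A J \<Longrightarrow> integral_ideal A (I + J)"
  using integral_super[of I "I + J"] plus_upper1 sm_plus plus_least[OF sm_A] by (auto simp: integral_iff)

lemma integral_principal: "a \<in> A \<Longrightarrow> a \<noteq> 0 \<Longrightarrow> integral_ideal A (a *o A)"
  using sm_scale[OF sm_A] scale_memI[OF one_A, of a] by (auto simp: integral_iff elt_set_times_def mult_A)

lemma integral_one: "integral_ideal A I \<Longrightarrow> 1 \<in> I \<Longrightarrow> I = A"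
  using sm_mult[of I _ 1] by (auto simp: integral_iff)

lemma mp_int_sub: "integral_ideal A I \<Longrightarrow> sm W \<Longrightarrow> I \<cdot> W \<subseteq> W"
  using mp_sub by (auto simp: integral_iff)

text \<open>The element form of \<open>prime_to\<close>: it is visibly monotone in both arguments,
  so coprimality passes to larger ideals without side conditions.\<close>

definition comax :: "'k set \<Rightarrow> 'k set \<Rightarrow> bool" where "comax I J \<longleftrightarrow> (\<exists>x\<in>I. \<exists>y\<in>J. x + y = 1)"

lemma prime_to_iff: assumes "integral_ideal A I" "integral_ideal A J"
  shows "prime_to A I J \<longleftrightarrow> comax I J"
proof
  assume "prime_to A I J"
  then have "1 \<in> {x + y |x y. x \<in> I \<and> y \<in> J}" using one_A by (simp add: prime_to_def)
  then show "comax I J" unfolding comax_def by force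
next
  assume "comax I J"
  then have "1 \<in> I + J" unfolding comax_def by (metis set_plus_intro)
  then have "I + J = A" using integral_one integral_plus assms by auto
  then show "prime_to A I J" by (auto simp: prime_to_def set_plus_def)
qed

lemma com_sym: "comax I J \<longleftrightarrow> comax J I" proof -
  have "comax J I" if I: "comax I J" for I J
  proof -
    obtain x y where "x \<in> I" "y \<in> J" "x + y = 1" using I by (auto simp: comax_def)
    moreover from this have "y + x = 1" by (metis add.commute)
    ultimately show ?thesis unfolding comax_def by blast
  qed
  then show ?thesis by blast
qed

lemma com_mono: "comax I J \<Longrightarrow> I \<subseteq> I' \<Longrightarrow> J \<subseteq> J' \<Longrightarrow> comax I' J'" unfolding comax_def by blast

lemma com_mul: assumes "comax I f" "comax J f" "sm f" "I \<subseteq> A" "f \<subseteq> A" shows "comax (I \<cdot> J) f"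
proof -
  obtain i x j y where *: "i \<in> I" "x \<in> f" "i + x = 1" "j \<in> J" "y \<in> f" "j + y = 1"
    using assms unfolding comax_def by metis
  have "i * j + (x * (j + y) + i * y) = (i + x) * (j + y)" by (simp add: algebra_simps)
  then have "i * j + (x + i * y) = 1" using * by simp
  moreover have "x + i * y \<in> f" "i * j \<in> I \<cdot> J"
    using * assms by (auto intro!: sm_add sm_mult mp_memI)
  ultimately show ?thesis unfolding comax_def by blast
qed

text \<open>With 1 = i + j, every x in the intersection equals i x + x j.\<close>

lemma com_inter: assumes "comax I J" "sm I" "sm J" "I \<subseteq> A" "J \<subseteq> A" shows "I \<inter> J = I \<cdot> J"
proof (rule subset_antisym)
  obtain i j where *: "i \<in> I" "j \<in> J" "i + j = 1" using assms unfolding comax_def by metis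
  show "I \<inter> J \<subseteq> I \<cdot> J"
  proof
    fix x assume x: "x \<in> I \<inter> J"
    have "x = i * x + x * j" using *(3) by (metis distrib_left mult.commute mult.right_neutral)
    moreover have "i * x \<in> I \<cdot> J" "x * j \<in> I \<cdot> J" using x * by (auto intro: mp_memI)
    ultimately show "x \<in> I \<cdot> J" using sm_add[OF mp_sm] by metis
  qed
  show "I \<cdot> J \<subseteq> I \<inter> J" using mp_sub[of J I] mp_sub[of I J] assms mp_comm by auto
qed

lemma com_A: "sm I \<Longrightarrow> comax A I"
  unfolding comax_def using one_A sm_zero by (intro bexI[of _ 1] bexI[of _ 0]) auto

end

section \<open>Integrally closed rings with finite quotients\<close>

text \<open>These two axioms isolate what the ideal theory takes from the topology: for a discrete
  cocompact subring finiteness of A / a A is a compactness statement, and the rest is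
  algebra.\<close>

locale dedekind = subring_of_field A for A :: "'k::field set" +
  assumes int_closed: "is_integrally_closed A"
    and fin_quot: "a \<in> A \<Longrightarrow> a \<noteq> 0 \<Longrightarrow> \<exists>C. finite C \<and> (\<forall>x\<in>A. \<exists>c\<in>C. x - c \<in> a *o A)"
begin

abbreviation "ideal \<equiv> integral_ideal A"
abbreviation "maxi \<equiv> maximal_ideal A"

text \<open>Such a J contains a A, so it is a union of cosets of a A and is determined by which of
  the finitely many representatives in C it contains.\<close>

lemma finite_above: assumes "a \<in> A" "a \<noteq> 0" shows "finite {J. sm J \<and> a \<in> J \<and> J \<subseteq> A}"
proof -
  obtain C where C: "finite C" "\<forall>x\<in>A. \<exists>c\<in>C. x - c \<in> a *o A" using fin_quot assms by blast
  have key: "x \<in> J \<longleftrightarrow> x \<in> A \<and> (\<exists>c\<in>C \<inter> J. x - c \<in> a *o A)" if J: "sm J" "a \<in> J" "J \<subseteq> A" for x J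
  proof -
    have sub: "a *o A \<subseteq> J" using sm_mult2[OF J(1) _ J(2)] by (auto simp: elt_set_times_def)
    show ?thesis
    proof
      assume x: "x \<in> J"
      then obtain c where c: "c \<in> C" "x - c \<in> a *o A" using C(2) J(3) by blast
      then have "x - (x - c) \<in> J" using sub x J(1) by (meson sm_diff subsetD)
      then have "c \<in> J" by simp
      then show "x \<in> A \<and> (\<exists>c\<in>C \<inter> J. x - c \<in> a *o A)" using c x J(3) by auto
    next
      assume "x \<in> A \<and> (\<exists>c\<in>C \<inter> J. x - c \<in> a *o A)"
      then obtain c where "c \<in> J" "x - c \<in> J" using sub by blast
      then have "c + (x - c) \<in> J" using J(1) by (intro sm_add)
      then show "x \<in> J" by simp
    qed
  qed
  have "inj_on (\<lambda>J. C \<inter> J) {J. sm J \<and> a \<in> J \<and> J \<subseteq> A}"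
  proof (rule inj_onI)
    fix J J' assume "J \<in> {J. sm J \<and> a \<in> J \<and> J \<subseteq> A}" "J' \<in> {J. sm J \<and> a \<in> J \<and> J \<subseteq> A}" "C \<inter> J = C \<inter> J'"
    then have "x \<in> J \<longleftrightarrow> x \<in> J'" for x using key[of J x] key[of J' x] by simp
    then show "J = J'" by blast
  qed
  moreover have "finite ((\<lambda>J. C \<inter> J) ` {J. sm J \<and> a \<in> J \<and> J \<subseteq> A})"
    by (rule finite_subset[of _ "Pow C"]) (use C in auto)
  ultimately show ?thesis using finite_imageD by blast
qed

lemma finite_super: assumes "ideal I" shows "finite {J. ideal J \<and> I \<subseteq> J}"
proof -
  obtain a where a: "a \<in> I" "a \<noteq> 0" using integral_nonzero[OF assms] by blast
  have "finite {J. sm J \<and> a \<in> J \<and> J \<subseteq> A}" using finite_above a integral_sub[OF assms] by auto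
  then show ?thesis by (rule rev_finite_subset) (use a in \<open>auto simp: integral_iff\<close>)
qed

text \<open>Induction from larger ideals to smaller ones. Finiteness of the set of ideals above I
  takes the place of the ascending chain condition.\<close>

lemma ideal_induct [consumes 1, case_names step]:
  assumes "ideal I" and step: "\<And>I. ideal I \<Longrightarrow> (\<And>J. ideal J \<Longrightarrow> I \<subset> J \<Longrightarrow> P J) \<Longrightarrow> P I"
  shows "P I"
  using assms(1)
proof (induction "card {J. ideal J \<and> I \<subseteq> J}" arbitrary: I rule: less_induct)
  case less
  show ?case
  proof (rule step[OF less.prems])
    fix J assume J: "ideal J" "I \<subset> J"
    have "card {K. ideal K \<and> J \<subseteq> K} < card {J. ideal J \<and> I \<subseteq> J}"
      by (rule psubset_card_mono[OF finite_super[OF less.prems]]) (use J less.prems in auto)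
    then show "P J" using less.hyps J by blast
  qed
qed

section \<open>Maximal ideals\<close>

lemma maxi_ideal: "maxi p \<Longrightarrow> ideal p" and maxi_ne: "maxi p \<Longrightarrow> p \<noteq> A"
  and maxi_max: "maxi p \<Longrightarrow> ideal J \<Longrightarrow> p \<subseteq> J \<Longrightarrow> J = p \<or> J = A"
  by (auto simp: maximal_ideal_def)

lemma ex_maxi: "ideal I \<Longrightarrow> I \<noteq> A \<Longrightarrow> \<exists>p. maxi p \<and> I \<subseteq> p"
proof (induction I rule: ideal_induct)
  case (step I)
  show ?case
  proof (cases "maxi I")
    case False
    then obtain J where J: "ideal J" "I \<subset> J" "J \<noteq> A"
      using step by (auto simp: maximal_ideal_def)
    then show ?thesis using step.IH[OF J(1,2,3)] by blast
  qed auto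
qed

lemma maxi_one: "maxi p \<Longrightarrow> 1 \<notin> p"
  using maxi_ideal maxi_ne integral_one by blast

lemma max_com: assumes "maxi p" "ideal J" "\<not> J \<subseteq> p" shows "comax J p"
proof -
  have "ideal (J + p)" using assms maxi_ideal integral_plus by blast
  moreover have "p \<subseteq> J + p" "J \<subseteq> J + p"
    using assms maxi_ideal integral_sm plus_upper1 plus_upper2 by blast+
  ultimately have "J + p = A" using maxi_max[OF assms(1)] assms(3) by blast
  then have "1 \<in> J + p" using one_A by simp
  then show ?thesis unfolding comax_def by (metis set_plus_elim)
qed

lemma not_com_maxi: assumes "ideal I" "ideal J" "\<not> comax I J" shows "\<exists>p. maxi p \<and> I \<subseteq> p \<and> J \<subseteq> p"
proof -
  have "I + J \<noteq> A"
  proof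
    assume "I + J = A"
    then have "1 \<in> I + J" using one_A by simp
    then show False using assms(3) unfolding comax_def by (metis set_plus_elim)
  qed
  then obtain p where "maxi p" "I + J \<subseteq> p" using ex_maxi integral_plus assms by blast
  moreover have "I \<subseteq> I + J" "J \<subseteq> I + J"
    using assms integral_sm plus_upper1 plus_upper2 by blast+
  ultimately show ?thesis by blast
qed

lemma com_not_sub: "comax I J \<Longrightarrow> maxi p \<Longrightarrow> I \<subseteq> p \<Longrightarrow> \<not> J \<subseteq> p"
proof
  assume "comax I J" and p: "maxi p" and "I \<subseteq> p" "J \<subseteq> p"
  then obtain x y where "x \<in> p" "y \<in> p" "x + y = 1" unfolding comax_def by blast
  then show False using maxi_one[OF p] sm_add[of p x y] integral_sm[OF maxi_ideal[OF p]] by auto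
qed

lemma max_prime: assumes "maxi p" "ideal I" "ideal J" "I \<cdot> J \<subseteq> p" shows "I \<subseteq> p \<or> J \<subseteq> p"
proof (rule ccontr)
  assume "\<not> (I \<subseteq> p \<or> J \<subseteq> p)"
  then have "comax I p" "comax J p" using max_com assms by blast+
  then have "comax (I \<cdot> J) p"
    by (intro com_mul integral_sm integral_sub maxi_ideal assms) auto
  then show False using com_not_sub assms com_sym by blast
qed

lemma max_prime_elem: assumes "maxi p" "x \<in> A" "y \<in> A" "x * y \<in> p" shows "x \<in> p \<or> y \<in> p"
proof (rule ccontr)
  assume n: "\<not> (x \<in> p \<or> y \<in> p)"
  have p: "sm p" using assms maxi_ideal integral_sm by blast
  have "x \<noteq> 0" using n sm_zero[OF p] by auto
  then have "comax (x *o A) p"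
    using max_com[OF assms(1) integral_principal[OF assms(2)]] n scale_memI[OF one_A, of x] by auto
  then obtain a q where "a \<in> A" "q \<in> p" "x * a + q = 1" by (auto simp: comax_def elt_set_times_def)
  then have "a * (x * y) + y * q = y" by (metis distrib_left mult.commute mult.left_commute mult.right_neutral)
  moreover have "a * (x * y) + y * q \<in> p"
    by (intro sm_add[OF p] sm_mult[OF p] \<open>a \<in> A\<close> \<open>q \<in> p\<close> assms)
  ultimately show False using n by simp
qed

text \<open>A finite integral domain is a field. Modulo a nonzero element of q the powers of x
  repeat, so \<open>x ^ m * (1 - x ^ (n - m))\<close> lies in q; since q is prime and x is outside
  it, \<open>1 - x ^ (n - m)\<close> lies in q, and J contains 1.\<close>

lemma prime_maxi: assumes q: "ideal q" "q \<noteq> A" and pr: "\<And>x y. x \<in> A \<Longrightarrow> y \<in> A \<Longrightarrow> x * y \<in> q \<Longrightarrow> x \<in> q \<or> y \<in> q"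
  shows "maxi q"
  unfolding maximal_ideal_def
proof (intro conjI allI impI q)
  fix J assume J: "ideal J" "q \<subseteq> J"
  show "J = q \<or> J = A"
  proof (rule ccontr)
    assume "\<not> (J = q \<or> J = A)"
    then obtain x where x: "x \<in> J" "x \<notin> q" "J \<noteq> A" using J by blast
    have xA: "x \<in> A" using x J integral_sub by blast
    have xn: "x ^ n \<in> A" for n by (induction n) (auto simp: one_A mult_A xA)
    have xnq: "x ^ n \<notin> q" for n
      by (induction n) (use q integral_one pr[OF xA xn] x in auto)
    obtain a where a: "a \<in> q" "a \<noteq> 0" using integral_nonzero[OF q(1)] by blast
    have aA: "a \<in> A" using a q integral_sub by blast
    obtain C where C: "finite C" "\<forall>x\<in>A. \<exists>c\<in>C. x - c \<in> a *o A" using fin_quot[OF aA a(2)] by blast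
    then have "\<forall>n. \<exists>c. c \<in> C \<and> x ^ n - c \<in> a *o A" using xn by blast
    then obtain c where c: "\<And>n. c n \<in> C \<and> x ^ n - c n \<in> a *o A" by metis
    have "\<not> inj c"
    proof
      assume "inj c"
      moreover have "finite (range c)" using finite_subset[OF _ C(1), of "range c"] c by blast
      ultimately show False using finite_imageD infinite_UNIV_nat by blast
    qed
    then obtain m n where mn: "m < n" "c m = c n" by (metis injI linorder_neqE_nat)
    have "(x ^ m - c m) - (x ^ n - c n) \<in> a *o A"
      using c sm_diff[OF sm_scale[OF sm_A]] by blast
    then have "x ^ m - x ^ n \<in> a *o A" using mn by simp
    moreover have "a *o A \<subseteq> q" using a q sm_mult2[OF integral_sm[OF q(1)]] by (auto simp: elt_set_times_def)
    moreover have "x ^ m - x ^ n = x ^ m * (1 - x ^ (n - m))"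
      using mn by (simp add: right_diff_distrib power_add[symmetric])
    ultimately have "x ^ m * (1 - x ^ (n - m)) \<in> q" by auto
    then have "1 - x ^ (n - m) \<in> J" using pr[OF xn, of "1 - x ^ (n - m)" m] xnq xn one_A diff_A J by blast
    moreover have "x ^ (n - m) \<in> J"
    proof -
      have "x ^ (n - m) = x ^ (n - m - 1) * x" using mn by (simp add: power_eq_if)
      then show ?thesis using sm_mult[OF integral_sm[OF J(1)] xn x(1)] by simp
    qed
    ultimately have "(1 - x ^ (n - m)) + x ^ (n - m) \<in> J" using integral_sm[OF J(1)] sm_add by blast
    then show False using integral_one[OF J(1)] x by simp
  qed
qed

text \<open>If \<open>x J \<subseteq> J\<close>, the modules \<open>A + A x + \<dots> + A x^n\<close> all lie in \<open>d\<inverse> A\<close> for a nonzero \<open>d \<in> J\<close>;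
  finiteness of \<open>A / d A\<close> makes two of them equal, which is an integral equation for \<open>x\<close>.\<close>

lemma stable_ideal_imp_mem: assumes J: "ideal J" and x: "\<And>j. j \<in> J \<Longrightarrow> x * j \<in> J" shows "x \<in> A"
proof -
  obtain d where d: "d \<in> J" "d \<noteq> 0" using integral_nonzero[OF J] by blast
  have dA: "d \<in> A" using d J integral_sub by blast
  define M where "M n = {poly P x | P. (\<forall>i. coeff P i \<in> A) \<and> degree P \<le> n}" for n
  have xd: "x ^ i * d \<in> J" for i
    by (induction i) (use d x in \<open>auto simp: mult.assoc\<close>)
  have Md: "y * d \<in> A" if "y \<in> M n" for y n
  proof -
    obtain P where P: "y = poly P x" "\<forall>i. coeff P i \<in> A" using \<open>y \<in> M n\<close> by (auto simp: M_def)
    have "y * d = (\<Sum>i\<le>degree P. coeff P i * (x ^ i * d))"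
      by (simp add: P(1) poly_altdef sum_distrib_right mult.assoc)
    also have "\<dots> \<in> J" using P(2) by (intro sm_sum[OF integral_sm[OF J]] sm_mult[OF integral_sm[OF J] _ xd]) auto
    finally show ?thesis using J integral_sub by blast
  qed
  have sM: "sm (M n)" for n
    unfolding is_submodule_def
  proof (intro conjI ballI)
    show "0 \<in> M n" unfolding M_def using zero_A by (auto intro!: exI[of _ 0])
    show "u + v \<in> M n" if uv: "u \<in> M n" "v \<in> M n" for u v
    proof -
      obtain P Q where "u = poly P x" "v = poly Q x" "\<forall>i. coeff P i \<in> A" "\<forall>i. coeff Q i \<in> A"
        "degree P \<le> n" "degree Q \<le> n" using uv unfolding M_def by blast
      then show ?thesis unfolding M_def
        by (auto intro!: exI[of _ "P + Q"] add_A degree_add_le)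
    qed
    show "a * v \<in> M n" if av: "a \<in> A" "v \<in> M n" for a v
    proof -
      obtain Q where "v = poly Q x" "\<forall>i. coeff Q i \<in> A" "degree Q \<le> n" using av unfolding M_def by blast
      moreover have "degree (smult a Q) \<le> degree Q" by (rule degree_smult_le)
      ultimately show ?thesis unfolding M_def using av
        by (auto intro!: exI[of _ "smult a Q"] mult_A)
    qed
  qed
  have one: "1 \<in> M n" for n
    unfolding M_def using zero_A one_A by (auto intro!: exI[of _ 1] simp: coeff_1)
  have "range (\<lambda>n. d *o M n) \<subseteq> {K. sm K \<and> d \<in> K \<and> K \<subseteq> A}"
  proof clarify
    fix n
    have "d \<in> d *o M n" using scale_memI[OF one, of d n] by simp
    moreover have "d *o M n \<subseteq> A" using Md by (auto simp: elt_set_times_def mult.commute)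
    ultimately show "sm (d *o M n) \<and> d \<in> d *o M n \<and> d *o M n \<subseteq> A" using sm_scale[OF sM] by blast
  qed
  then have "finite (range (\<lambda>n. d *o M n))" using finite_above[OF dA d(2)] finite_subset by blast
  then have "\<not> inj (\<lambda>n. d *o M n)" using finite_imageD infinite_UNIV_nat by blast
  then obtain m n where mn: "m < n" "d *o M m = d *o M n" by (metis (mono_tags, lifting) injI linorder_neqE_nat)
  then have "M m = M n" using scale_cancel[OF d(2)] by blast
  moreover have "x ^ n \<in> M n"
    unfolding M_def using zero_A one_A by (auto intro!: exI[of _ "monom 1 n"] simp: poly_monom degree_monom_eq)
  ultimately obtain P where P: "x ^ n = poly P x" "\<forall>i. coeff P i \<in> A" "degree P \<le> m"
    unfolding M_def by blast
  let ?Q = "monom 1 n - P"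
  have deg: "degree ?Q = n"
    using P(3) mn(1) by (subst diff_conv_add_uminus, subst degree_add_eq_left) (auto simp: degree_monom_eq)
  have "lead_coeff ?Q = 1" unfolding deg using P(3) mn(1) by (simp add: coeff_eq_0)
  moreover have "\<forall>i. coeff ?Q i \<in> A" using P(2) zero_A one_A by (auto intro!: diff_A uminus_A)
  \<comment> \<open>Integral closedness concerns quotients of elements of A, hence x is written as
    \<open>(x * d) / d\<close>.\<close>
  moreover have "poly ?Q ((x * d) / d) = 0" using d(2) P(1) by (simp add: poly_monom)
  moreover have "x * d \<in> A" using x[OF d(1)] J integral_sub by blast
  ultimately have "(x * d) / d \<in> A"
    using int_closed dA d(2) unfolding is_integrally_closed_def by blast
  then show ?thesis using d(2) by simp
qed

section \<open>Invertibility of nonzero ideals\<close>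

lemma mp_iv_sub: "I \<cdot> iv I \<subseteq> A"
  by (rule mp_least[OF sm_A]) (auto simp: ideal_inv_def mult.commute)

lemma sub_iv: "I \<subseteq> A \<Longrightarrow> A \<subseteq> iv I"
  unfolding ideal_inv_def by (auto intro: mult_A)

lemma sub_mp_iv: "sm I \<Longrightarrow> J \<subseteq> A \<Longrightarrow> I \<subseteq> I \<cdot> iv J"
  using mp_mono[OF subset_refl sub_iv, of J I] by (simp add: mp_one2)

lemma mem_mp_A: "invble W \<Longrightarrow> x \<in> W \<longleftrightarrow> (\<forall>w\<in>iv W. x * w \<in> A)"
  using mem_mp_iff[OF _ sm_A, of W x] by (simp add: mp_one2 invble_sm)

text \<open>An associated prime q of A / I is invertible: q iv q is q or A, and the value q would
  put iv q inside A by integral closedness, which invertibility of I forbids. Splitting off q gives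
  I = I1 q with I1 larger. As p is prime it contains q, hence equals it, or it contains I1, and the
  induction applies.\<close>

lemma max_invble:
  "ideal I \<Longrightarrow> invble I \<Longrightarrow> maxi p \<Longrightarrow> I \<subseteq> p \<Longrightarrow> invble p"
proof (induction I rule: ideal_induct)
  case (step I)
  note I = step.hyps
  have IA: "I \<subseteq> A" "sm I" using I by (auto simp: integral_iff)
  have "I \<noteq> A" using step.prems maxi_ideal[of p] maxi_ne[of p] by (auto simp: integral_iff)
  \<comment> \<open>\<open>D b\<close> is the colon ideal (I : b). A maximal one, for b outside I,
    is prime: if x y lies in \<open>D b\<close> and y does not, then \<open>D (y * b)\<close>
    contains \<open>D b\<close>, hence equals it, and it contains x.\<close>
  define D where "D b = {x\<in>A. x * b \<in> I}" for b
  have D: "ideal (D b)" "I \<subseteq> D b" if "b \<in> A" for b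
  proof -
    have sI: "I \<subseteq> D b" using sm_mult2[OF IA(2) that] IA by (auto simp: D_def)
    have "sm (D b)" unfolding D_def using IA(2) sm_zero[OF IA(2)]
      by (auto simp: is_submodule_def zero_A add_A mult_A distrib_right mult.assoc)
    then show "ideal (D b)" using integral_super[OF I sI] by (auto simp: D_def)
    show "I \<subseteq> D b" by (rule sI)
  qed
  have fin: "finite (D ` (A - I))"
    by (rule finite_subset[OF _ finite_super[OF I]]) (use D in auto)
  have "D ` (A - I) \<noteq> {}" using \<open>I \<noteq> A\<close> IA by auto
  from finite_has_maximal[OF fin this]
  obtain b where b: "b \<in> A" "b \<notin> I" and bmax: "\<And>c. c \<in> A \<Longrightarrow> c \<notin> I \<Longrightarrow> D b \<subseteq> D c \<Longrightarrow> D b = D c"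
    by auto
  let ?q = "D b"
  have q: "ideal ?q" "I \<subseteq> ?q" using D b by auto
  have "1 \<notin> ?q" using b by (simp add: D_def)
  then have qne: "?q \<noteq> A" using one_A by blast
  have mq: "maxi ?q"
  proof (rule prime_maxi[OF q(1) qne])
    fix x y assume xy: "x \<in> A" "y \<in> A" "x * y \<in> ?q"
    show "x \<in> ?q \<or> y \<in> ?q"
    proof (rule ccontr)
      assume n: "\<not> (x \<in> ?q \<or> y \<in> ?q)"
      have yb: "y * b \<in> A" "y * b \<notin> I" using n xy b by (auto simp: D_def mult_A)
      have "D b \<subseteq> D (y * b)" using sm_mult[OF IA(2) xy(2)] by (auto simp: D_def mult.left_commute[of _ y b])
      then have "D b = D (y * b)" using bmax yb by blast
      moreover have "x \<in> D (y * b)" using xy by (auto simp: D_def mult.assoc)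
      ultimately show False using n by simp
    qed
  qed
  have qA: "?q \<subseteq> A" "sm ?q" using q by (auto simp: integral_iff)
  \<comment> \<open>If iv q were inside A, then b iv I, which lies in iv q, would be inside A as
    well; for invertible I this says that b lies in I.\<close>
  have niv: "\<not> iv ?q \<subseteq> A"
  proof
    assume a: "iv ?q \<subseteq> A"
    have "b * v \<in> iv ?q" if "v \<in> iv I" for v
      unfolding ideal_inv_def
    proof clarify
      fix x assume "x \<in> ?q"
      then have "v * (x * b) \<in> A" using that by (auto simp: D_def ideal_inv_def)
      then show "b * v * x \<in> A" by (simp add: ac_simps)
    qed
    then have "b \<in> I" using mem_mp_A[OF step.prems(1), of b] a by blast
    then show False using b by blast
  qed
  have invq: "invble ?q"
  proof -
    have sub: "?q \<subseteq> ?q \<cdot> iv ?q" using sub_mp_iv qA by blast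
    have id: "ideal (?q \<cdot> iv ?q)" using integral_super[OF q(1) sub mp_sm mp_iv_sub] .
    have "?q \<cdot> iv ?q \<noteq> ?q"
    proof
      assume "?q \<cdot> iv ?q = ?q"
      then have "x * j \<in> ?q" if "x \<in> iv ?q" "j \<in> ?q" for x j
        using mp_memI[OF that(2,1)] by (simp add: mult.commute)
      then have "iv ?q \<subseteq> A" using stable_ideal_imp_mem[OF q(1)] by blast
      then show False using niv by blast
    qed
    then have "?q \<cdot> iv ?q = A" using maxi_max[OF mq id sub] by blast
    then show ?thesis using qA by (auto simp: invble_def)
  qed
  define I1 where "I1 = I \<cdot> iv ?q"
  have I1: "I \<subseteq> I1" unfolding I1_def using sub_mp_iv[OF IA(2) qA(1)] .
  have "I1 \<subseteq> A" unfolding I1_def using mp_mono[OF q(2) subset_refl] mp_iv_sub by blast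
  then have id1: "ideal I1" using integral_super[OF I I1] mp_sm by (simp add: I1_def)
  have "I1 \<noteq> I"
  proof
    assume "I1 = I"
    then have "I \<cdot> iv ?q = I \<cdot> A" by (simp add: I1_def mp_one2 IA)
    then have "iv ?q = A" using mp_eq_cancel[OF step.prems(1) sm_iv sm_A] by blast
    then show False using niv by simp
  qed
  then have lt: "I \<subset> I1" using I1 by blast
  have inv1: "invble I1" unfolding I1_def using invble_mul step.prems(1) invble_iv[OF invq] by blast
  have "I1 \<cdot> ?q = I" unfolding I1_def by (simp add: mp_assoc invble_mp2[OF invq] mp_one2 IA)
  then have "I1 \<subseteq> p \<or> ?q \<subseteq> p" using max_prime[OF step.prems(2) id1 q(1)] step.prems(3) by simp
  then show ?case
  proof
    assume "I1 \<subseteq> p" then show ?thesis using step.IH[OF id1 lt inv1 step.prems(2)] by blast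
  next
    assume "?q \<subseteq> p"
    then have "p = ?q" using maxi_max[OF mq maxi_ideal] maxi_ne step.prems by blast
    then show ?thesis using invq by simp
  qed
qed

text \<open>Multiplication by iv p for a maximal p above I enlarges I strictly, so the induction
  applies to the quotient. The invertible ideal inside p that \<open>max_invble\<close> requires is
  a principal ideal generated by an element of I.\<close>

theorem ideal_invble: "ideal I \<Longrightarrow> invble I"
proof (induction I rule: ideal_induct)
  case (step I)
  have IA: "I \<subseteq> A" "sm I" using step.hyps by (auto simp: integral_iff)
  show ?case
  proof (cases "I = A")
    case False
    then obtain p where p: "maxi p" "I \<subseteq> p" using ex_maxi step.hyps by blast
    obtain a where a: "a \<in> I" "a \<noteq> 0" using integral_nonzero[OF step.hyps] by blast
    have "a *o A \<subseteq> p" using a p sm_mult2[OF integral_sm[OF maxi_ideal[OF p(1)]]] by (auto simp: elt_set_times_def)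
    then have ip: "invble p"
      using max_invble[OF integral_principal invble_scale[OF _ invble_A] p(1)] a IA by blast
    have pA: "p \<subseteq> A" using p maxi_ideal integral_sub by blast
    let ?J = "I \<cdot> iv p"
    have sub: "I \<subseteq> ?J" using sub_mp_iv[OF IA(2) pA] .
    have "?J \<subseteq> A" using mp_mono[OF p(2) subset_refl] mp_iv_sub by blast
    then have id: "ideal ?J" using integral_super[OF step.hyps sub mp_sm] by blast
    have "?J \<noteq> I"
    proof
      assume J: "?J = I"
      have "x * j \<in> I" if "x \<in> iv p" "j \<in> I" for x j
        using mp_memI[OF that(2,1)] J by (simp add: mult.commute)
      then have "iv p \<subseteq> A" using stable_ideal_imp_mem[OF step.hyps] by blast
      then have "p \<cdot> iv p \<subseteq> p" using mp_mono[of p p "iv p" A] mp_one2[of p] invble_sm[OF ip] by auto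
      then show False using invble_mp[OF ip] maxi_one[OF p(1)] one_A by auto
    qed
    then have "invble ?J" using step.IH[OF id] sub by blast
    moreover have "?J \<cdot> p = I" by (simp add: mp_assoc invble_mp2[OF ip] mp_one2 IA)
    ultimately show ?thesis using invble_mul[OF _ ip] by metis
  qed (simp add: invble_A)
qed

subsection \<open>Ideal arithmetic\<close>

text \<open>In the topological setting these are exactly the lattices, see \<open>lattice_iff\<close>.\<close>

definition glat :: "'k set \<Rightarrow> bool" where
  "glat W \<longleftrightarrow> (\<exists>k I. k \<noteq> 0 \<and> ideal I \<and> W = k *o I)"

lemma ideal_glat: "ideal I \<Longrightarrow> glat I"
  unfolding glat_def by (rule exI[of _ 1]) auto

lemma glat_invble: "glat W \<Longrightarrow> invble W"
  unfolding glat_def using ideal_invble invble_scale by blast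

lemma glat_sm: "glat W \<Longrightarrow> sm W" using glat_invble invble_sm by blast

lemma glat_scale: "glat W \<Longrightarrow> k \<noteq> 0 \<Longrightarrow> glat (k *o W)"
  unfolding glat_def by (metis mult_eq_0_iff set_times_rearrange2)

lemma glat_mul: "glat V \<Longrightarrow> glat W \<Longrightarrow> glat (V \<cdot> W)"
  unfolding glat_def
proof clarify
  fix k l :: 'k and I J assume "k \<noteq> 0" "ideal I" "l \<noteq> 0" "ideal J"
  then show "\<exists>m M. m \<noteq> 0 \<and> ideal M \<and> (k *o I) \<cdot> (l *o J) = m *o M"
    using integral_mul[of I J]
    by (intro exI[of _ "k * l"] exI[of _ "I \<cdot> J"]) (simp add: mp_scale mp_scale2 set_times_rearrange2 mult.commute)
qed

lemma ideal_subset_glat: assumes "glat W" "W \<subseteq> A" shows "ideal W"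
proof -
  obtain w where "w \<in> W" "w \<noteq> 0" using invble_nonzero glat_invble assms by blast
  then show ?thesis using glat_sm assms by (auto simp: integral_iff)
qed

lemma invble_sub_ideal: assumes "invble W" "W \<subseteq> A" shows "ideal W"
  using invble_nonzero[OF assms(1)] assms invble_sm by (auto simp: integral_iff)

lemma glat_iv: assumes "glat W" shows "glat (iv W)"
proof -
  obtain k I where k: "k \<noteq> 0" "ideal I" "W = k *o I" using assms glat_def by blast
  obtain a where a: "a \<in> I" "a \<noteq> 0" using integral_nonzero k by blast
  have "a *o iv I \<subseteq> A" using a by (auto simp: elt_set_times_def ideal_inv_def mult.commute)
  then have "ideal (a *o iv I)" using invble_sub_ideal invble_scale invble_iv ideal_invble a k by blast
  then have "glat (inverse k *o (inverse a *o (a *o iv I)))"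
    using a k by (intro glat_scale ideal_glat) auto
  moreover have "inverse k *o (inverse a *o (a *o iv I)) = iv W"
    using iv_scale[OF k(1) ideal_invble[OF k(2)]] a k(3) by (simp add: set_times_rearrange2)
  ultimately show ?thesis by simp
qed

lemma glat_super: assumes "ideal I" "I \<subseteq> W" "sm W" "c \<noteq> 0" "c *o W \<subseteq> A" shows "glat W"
proof -
  obtain a where a: "a \<in> I" "a \<noteq> 0" using integral_nonzero assms by blast
  then have "c * a \<in> c *o W" "c * a \<noteq> 0" using assms by auto
  then have "ideal (c *o W)" using assms sm_scale by (auto simp: integral_iff)
  then have "glat (inverse c *o (c *o W))" using assms by (intro glat_scale ideal_glat) auto
  then show ?thesis using assms by (simp add: set_times_rearrange2)
qed

text \<open>To contain is to divide: the cofactor is \<open>iv g \<cdot> f\<close>, which lies in A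
  exactly because f lies in g.\<close>

lemma dvd_iff: assumes "ideal g" "ideal f" shows "ideal_dvd A g f \<longleftrightarrow> f \<subseteq> g"
proof
  assume "ideal_dvd A g f"
  then obtain h where "ideal h" "f = g \<cdot> h" unfolding ideal_dvd_def by blast
  then show "f \<subseteq> g" using mp_int_sub[of h g] assms integral_sm mp_comm by auto
next
  assume "f \<subseteq> g"
  have g: "invble g" using ideal_invble assms by blast
  have "iv g \<cdot> f \<subseteq> A" using mp_mono[OF subset_refl \<open>f \<subseteq> g\<close>, of "iv g"] invble_mp2[OF g] by simp
  then have "ideal (iv g \<cdot> f)"
    using ideal_subset_glat glat_mul[OF glat_iv[OF ideal_glat] ideal_glat] assms by blast
  moreover have "f = g \<cdot> (iv g \<cdot> f)" using cancel_iv1[OF g integral_sm[OF assms(2)]] by simp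
  ultimately show "ideal_dvd A g f" unfolding ideal_dvd_def by blast
qed

lemma ideal_quot: assumes "ideal g" "ideal f" "f \<subseteq> g" shows "ideal (f \<cdot> iv g)"
proof -
  have "f \<cdot> iv g \<subseteq> A" using mp_mono[OF assms(3) subset_refl] mp_iv_sub by blast
  then show ?thesis using ideal_subset_glat glat_mul[OF ideal_glat glat_iv[OF ideal_glat]] assms by blast
qed

section \<open>Approximation at finitely many primes\<close>

lemma maxi_proper_mul: assumes "maxi p" "glat M" shows "p \<cdot> M \<noteq> M"
proof
  assume "p \<cdot> M = M"
  then have "M \<cdot> p = M \<cdot> A" using mp_comm mp_one2 glat_sm assms by metis
  then show False using mp_eq_cancel[OF glat_invble[OF assms(2)]] integral_sm[OF maxi_ideal] sm_A maxi_ne assms by blast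
qed

lemma mem_max_mul: assumes "maxi p" "glat M"
  shows "x \<in> p \<cdot> M \<longleftrightarrow> (\<forall>w\<in>iv M. x * w \<in> p)"
  using mem_mp_iff[OF glat_invble[OF assms(2)] integral_sm[OF maxi_ideal[OF assms(1)]]] mp_comm by metis

lemma prime_mul_notin: assumes "maxi p" "glat M" "e \<in> A" "e \<notin> p" "c \<in> M" "c \<notin> p \<cdot> M"
  shows "e * c \<notin> p \<cdot> M"
proof -
  obtain w where w: "w \<in> iv M" "c * w \<notin> p" using mem_max_mul assms by blast
  then have "c * w \<in> A" using assms by (auto simp: ideal_inv_def mult.commute)
  then have "e * (c * w) \<notin> p" using max_prime_elem assms w by blast
  then show ?thesis using mem_max_mul[OF assms(1,2)] w by (auto simp: mult.assoc)
qed

text \<open>Each further q contributes a factor in q outside p, available because distinct maximal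
  ideals do not contain one another; the product stays outside the prime p.\<close>

lemma prime_avoidance: assumes "finite S" "\<forall>q\<in>S. maxi q \<and> q \<noteq> p" "maxi p" "ideal f" "\<not> f \<subseteq> p"
  shows "\<exists>e\<in>f. e \<notin> p \<and> (\<forall>q\<in>S. e \<in> q)"
  using assms(1,2)
proof (induction S)
  case (insert q S)
  then obtain e where e: "e \<in> f" "e \<notin> p" "\<forall>q\<in>S. e \<in> q" by auto
  have "\<not> q \<subseteq> p" using insert.prems maxi_max[of q p] maxi_ideal[OF assms(3)] maxi_ne assms(3) by auto
  then obtain c where c: "c \<in> q" "c \<notin> p" by blast
  have A: "c \<in> A" "e \<in> A" using c e insert.prems maxi_ideal assms(4) integral_sub by blast+
  have "e * c \<in> f" using sm_mult2[OF integral_sm[OF assms(4)]] A e by blast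
  moreover have "e * c \<notin> p" using max_prime_elem[OF assms(3)] A c e by blast
  moreover have "e * c \<in> r" if "r \<in> insert q S" for r
  proof -
    have "maxi r" using that insert.prems by blast
    then have "sm r" using maxi_ideal integral_sm by blast
    then show ?thesis using that c(1) e(3) sm_mult[OF _ A(2), of r c] sm_mult2[OF _ A(1), of r e] by blast
  qed
  ultimately show ?case by blast
qed (use assms in auto)

text \<open>The primes are treated one at a time. If b falls into p M, a term e c is added with e in
  f and in all primes treated before, but not in p, and c in M outside p M: this repairs p, keeps
  the earlier primes and the congruence modulo f M.\<close>

lemma ex_coprime:
  assumes "finite S" "glat M" "ideal f" "b0 \<in> M" "\<forall>p\<in>S. maxi p \<and> \<not> f \<subseteq> p"
  shows "\<exists>b. b - b0 \<in> f \<cdot> M \<and> b \<in> M \<and> (\<forall>p\<in>S. b \<notin> p \<cdot> M)"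
  using assms(1,5)
proof (induction S)
  case empty
  then show ?case using assms by (intro exI[of _ b0]) (simp add: sm_zero mp_sm)
next
  case (insert p S)
  then obtain b where b: "b - b0 \<in> f \<cdot> M" "b \<in> M" "\<forall>p\<in>S. b \<notin> p \<cdot> M" by auto
  show ?case
  proof (cases "b \<in> p \<cdot> M")
    case False
    then show ?thesis using b by blast
  next
    case True
    have p: "maxi p" "\<not> f \<subseteq> p" using insert.prems by auto
    have "\<forall>q\<in>S. maxi q \<and> q \<noteq> p" using insert by auto
    then obtain e where e: "e \<in> f" "e \<notin> p" "\<forall>q\<in>S. e \<in> q" using prime_avoidance[OF insert.hyps(1) _ p(1) assms(3) p(2)] by blast
    have eA: "e \<in> A" using e assms integral_sub by blast
    have M: "sm M" using assms glat_sm by blast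
    have "p \<cdot> M \<subseteq> M" using mp_int_sub[OF maxi_ideal[OF p(1)] M] .
    then obtain c where c: "c \<in> M" "c \<notin> p \<cdot> M" using maxi_proper_mul[OF p(1) assms(2)] by blast
    let ?b = "b + e * c"
    have "(b - b0) + e * c \<in> f \<cdot> M" using sm_add[OF mp_sm b(1) mp_memI] e c by blast
    moreover have "(b - b0) + e * c = ?b - b0" by simp
    ultimately have 1: "?b - b0 \<in> f \<cdot> M" by metis
    have 2: "?b \<in> M" by (intro sm_add[OF M] sm_mult[OF M] b eA c)
    have 3: "?b \<notin> q \<cdot> M" if "q \<in> insert p S" for q
    proof (cases "q = p")
      case True
      have "e * c \<notin> p \<cdot> M" using prime_mul_notin p assms eA e c by blast
      then show ?thesis using \<open>b \<in> p \<cdot> M\<close> sm_diff[OF mp_sm, of ?b p M b] True by auto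
    next
      case False
      then have "e * c \<in> q \<cdot> M" "b \<notin> q \<cdot> M" using that e c b by (auto intro: mp_memI)
      then show ?thesis using sm_diff[OF mp_sm, of ?b q M "e * c"] by auto
    qed
    show ?thesis using 1 2 3 by blast
  qed
qed

lemma finite_maxi_above: "ideal f \<Longrightarrow> finite {p. maxi p \<and> f \<subseteq> p}"
  by (rule finite_subset[OF _ finite_super]) (auto simp: maxi_ideal)

section \<open>Prime power parts of an ideal\<close>

primrec ppow :: "'k set \<Rightarrow> nat \<Rightarrow> 'k set" where
  "ppow p 0 = A" | "ppow p (Suc n) = p \<cdot> ppow p n"

lemma ppow_ideal: "ideal p \<Longrightarrow> ideal (ppow p n)"
  by (induction n) (auto simp: integral_A integral_mul)

lemma ppow_maxi: assumes "maxi p" "maxi q" "ppow p n \<subseteq> q" shows "q = p"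
  using assms(3)
proof (induction n)
  case 0
  then show ?case using maxi_ideal[OF assms(2)] maxi_ne[OF assms(2)] integral_sub by auto
next
  case (Suc n)
  then have "p \<subseteq> q \<or> ppow p n \<subseteq> q"
    using max_prime[OF assms(2) maxi_ideal[OF assms(1)] ppow_ideal[OF maxi_ideal[OF assms(1)]]] by simp
  then show ?case
    using Suc.IH maxi_max[OF assms(1) maxi_ideal[OF assms(2)]] maxi_ne[OF assms(2)] by blast
qed

lemma ppart: assumes "maxi p" shows "ideal f \<Longrightarrow> \<exists>n f'. ideal f' \<and> f = ppow p n \<cdot> f' \<and> \<not> f' \<subseteq> p"
proof (induction f rule: ideal_induct)
  case (step f)
  have p: "ideal p" "invble p" using assms maxi_ideal ideal_invble by blast+
  have f: "sm f" using step.hyps integral_sm by blast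
  show ?case
  proof (cases "f \<subseteq> p")
    case False
    have "f = ppow p 0 \<cdot> f" using mp_one[OF f] by simp
    then show ?thesis using False step.hyps by blast
  next
    case True
    have q: "ideal (f \<cdot> iv p)" using ideal_quot p step.hyps True by blast
    have eq: "p \<cdot> (f \<cdot> iv p) = f" using cancel_iv1[OF p(2) f] by (simp add: mp_comm)
    have "f \<subseteq> f \<cdot> iv p" using sub_mp_iv f p integral_sub by blast
    moreover have "f \<noteq> f \<cdot> iv p" using maxi_proper_mul[OF assms ideal_glat[OF q]] eq by metis
    ultimately obtain n f' where "ideal f'" "f \<cdot> iv p = ppow p n \<cdot> f'" "\<not> f' \<subseteq> p" using step.IH[OF q] by blast
    moreover from this have "f = ppow p (Suc n) \<cdot> f'" using eq by (simp add: mp_assoc)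
    ultimately show ?thesis by blast
  qed
qed

lemma ppow_com: assumes "maxi p" "ideal f'" "\<not> f' \<subseteq> p" shows "comax (ppow p n) f'"
proof (rule ccontr)
  assume "\<not> comax (ppow p n) f'"
  then obtain q where "maxi q" "ppow p n \<subseteq> q" "f' \<subseteq> q"
    using not_com_maxi ppow_ideal[OF maxi_ideal] assms by blast
  then show False using ppow_maxi assms by blast
qed

end

section \<open>Discrete cocompact subrings\<close>

lemma open_mult_preimage: "open U \<Longrightarrow> open {x. x * c \<in> U}" for c :: "'k::topological_field"
proof -
  assume "open U"
  moreover have "continuous_on UNIV (\<lambda>x. x * c)" by (intro continuous_intros)
  ultimately have "open ((\<lambda>x. x * c) -` U)" by (rule open_vimage)
  then show ?thesis by (simp add: vimage_def)
qed

lemma open_plus_preimage: "open U \<Longrightarrow> open {x. x - c \<in> U}" for c :: "'k::topological_field"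
proof -
  assume "open U"
  moreover have "continuous_on UNIV (\<lambda>x. x - c)" unfolding continuous_on_def by (intro ballI tendsto_intros)
  ultimately have "open ((\<lambda>x. x - c) -` U)" by (rule open_vimage)
  then show ?thesis by (simp add: vimage_def)
qed

lemma compact_scale: "compact C \<Longrightarrow> compact (c *o C)" for c :: "'k::topological_field"
proof -
  assume "compact C"
  then have "compact ((\<lambda>x. c * x) ` C)" by (intro compact_continuous_image continuous_intros) auto
  moreover have "(\<lambda>x. c * x) ` C = c *o C" by (auto simp: elt_set_times_def)
  ultimately show ?thesis by simp
qed

lemma compact_translate: "compact C \<Longrightarrow> compact ((\<lambda>x. c + x) ` C)" for c :: "'k::topological_field"
  by (intro compact_continuous_image) (auto simp: continuous_on_def intro!: tendsto_intros)

lemma compact_closed: "compact (C :: 'k::topological_field set) \<Longrightarrow> closed C"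
  by (rule compact_imp_closed)

lemma compact_product: assumes "compact C" "compact (D :: 'k::topological_field set)"
  shows "compact {x * y | x y. x \<in> C \<and> y \<in> D}"
proof -
  have "continuous_on (C \<times> D) (\<lambda>p. fst p * snd p)" by (intro continuous_intros)
  then have "compact ((\<lambda>p. fst p * snd p) ` (C \<times> D))"
    using assms by (intro compact_continuous_image compact_Times) auto
  moreover have "(\<lambda>p. fst p * snd p) ` (C \<times> D) = {x * y | x y. x \<in> C \<and> y \<in> D}" by force
  ultimately show ?thesis by simp
qed

text \<open>A tube argument: continuity of multiplication at each (0, c) gives a product
  neighbourhood mapped into U, and finitely many of the second factors cover C.\<close>

lemma eventually_mult_compact:
  fixes U :: "'k::topological_field set"
  assumes "compact C" "open U" "0 \<in> U"
  shows "eventually (\<lambda>z. \<forall>c\<in>C. z * c \<in> U) (nhds 0)"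
proof -
  have ex: "\<exists>S T. open S \<and> 0 \<in> S \<and> open T \<and> c \<in> T \<and> (\<forall>x\<in>S. \<forall>y\<in>T. x * y \<in> U)" for c
  proof -
    have "LIM x (nhds 0 \<times>\<^sub>F nhds c). fst x * snd x :> nhds (0 * c)" by (rule tendsto_mult_Pair)
    moreover have "eventually (\<lambda>x. x \<in> U) (nhds (0 * c))" using assms by (auto simp: eventually_nhds)
    ultimately have "eventually (\<lambda>p. fst p * snd p \<in> U) (nhds 0 \<times>\<^sub>F nhds c)"
      by (auto simp: filterlim_iff)
    then show ?thesis unfolding eventually_prod_filter eventually_nhds by (metis fst_conv snd_conv)
  qed
  \<comment> \<open>The choice is made in two stages, \<open>T c\<close> after \<open>S c\<close>,
    so that both neighbourhoods belong to the same instance of \<open>ex\<close>.\<close>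
  define S T where "S c = (SOME S. \<exists>T. open S \<and> 0 \<in> S \<and> open T \<and> c \<in> T \<and> (\<forall>x\<in>S. \<forall>y\<in>T. x * y \<in> U))"
    and "T c = (SOME T. open (S c) \<and> 0 \<in> S c \<and> open T \<and> c \<in> T \<and> (\<forall>x\<in>S c. \<forall>y\<in>T. x * y \<in> U))" for c
  have "\<exists>T. open (S c) \<and> 0 \<in> S c \<and> open T \<and> c \<in> T \<and> (\<forall>x\<in>S c. \<forall>y\<in>T. x * y \<in> U)" for c
    unfolding S_def by (rule someI_ex[OF ex])
  then have ST: "open (S c) \<and> 0 \<in> S c \<and> open (T c) \<and> c \<in> T c \<and> (\<forall>x\<in>S c. \<forall>y\<in>T c. x * y \<in> U)" for c
    unfolding T_def by (rule someI_ex)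
  obtain F where F: "F \<subseteq> C" "finite F" "C \<subseteq> (\<Union>c\<in>F. T c)"
    using compactE_image[OF assms(1), of C T] ST by blast
  have "open (\<Inter>c\<in>F. S c)" "0 \<in> (\<Inter>c\<in>F. S c)" using F(2) ST by auto
  moreover have "\<forall>z\<in>(\<Inter>c\<in>F. S c). \<forall>c\<in>C. z * c \<in> U"
  proof (intro ballI)
    fix z c assume z: "z \<in> (\<Inter>c\<in>F. S c)" and "c \<in> C"
    then obtain d where "d \<in> F" "c \<in> T d" using F(3) by blast
    then show "z * c \<in> U" using ST[of d] z by blast
  qed
  ultimately show ?thesis unfolding eventually_nhds by blast
qed

lemma small_difference: fixes U :: "'k::topological_field set"
  assumes "open U" "0 \<in> U"
  shows "\<exists>V. open V \<and> 0 \<in> V \<and> (\<forall>x\<in>V. \<forall>y\<in>V. x - y \<in> U)"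
proof -
  have "((\<lambda>p. fst p - snd p) \<longlongrightarrow> 0 - 0) (nhds (0::'k, 0::'k))"
    using tendsto_fst[OF filterlim_ident, of "(0,0)"] tendsto_snd[OF filterlim_ident, of "(0,0)"]
    by (intro tendsto_diff) auto
  moreover have "eventually (\<lambda>x. x \<in> U) (nhds (0 - 0))" using assms by (auto simp: eventually_nhds)
  ultimately have "eventually (\<lambda>p. fst p - snd p \<in> U) (nhds (0::'k) \<times>\<^sub>F nhds 0)"
    unfolding nhds_prod filterlim_iff by blast
  then obtain S T where "open S" "0 \<in> S" "open T" "0 \<in> T" "\<forall>x\<in>S. \<forall>y\<in>T. x - y \<in> U"
    unfolding eventually_prod_filter eventually_nhds by (metis fst_conv snd_conv)
  then show ?thesis by (intro exI[of _ "S \<inter> T"]) auto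
qed

lemma small_quotient: fixes U :: "'k::topological_field set"
  assumes "open U" "1 \<in> U" "c \<noteq> 0"
  shows "\<exists>V. open V \<and> c \<in> V \<and> (\<forall>x\<in>V. \<forall>y\<in>V. x * inverse y \<in> U)"
proof -
  have "(inverse \<longlongrightarrow> inverse c) (nhds c)" using assms(3) by (rule tendsto_inverse_nhds)
  then have "((\<lambda>p. inverse (snd p)) \<longlongrightarrow> inverse c) (nhds (c, c))"
    by (rule filterlim_compose) (use tendsto_snd[OF filterlim_ident, of "(c,c)"] in simp)
  moreover have "(fst \<longlongrightarrow> c) (nhds (c, c))" using tendsto_fst[OF filterlim_ident, of "(c,c)"] by simp
  ultimately have "((\<lambda>p. fst p * inverse (snd p)) \<longlongrightarrow> c * inverse c) (nhds (c, c))"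
    by (intro tendsto_mult)
  moreover have "eventually (\<lambda>x. x \<in> U) (nhds (c * inverse c))" using assms by (auto simp: eventually_nhds)
  ultimately have "eventually (\<lambda>p. fst p * inverse (snd p) \<in> U) (nhds c \<times>\<^sub>F nhds c)"
    unfolding nhds_prod filterlim_iff by blast
  then obtain S T where "open S" "c \<in> S" "open T" "c \<in> T" "\<forall>x\<in>S. \<forall>y\<in>T. x * inverse y \<in> U"
    unfolding eventually_prod_filter eventually_nhds by (metis fst_conv snd_conv)
  then show ?thesis by (intro exI[of _ "S \<inter> T"]) auto
qed

text \<open>No metric is given, so cluster points take the place of limits of subsequences.\<close>

lemma compact_cluster: fixes x :: "nat \<Rightarrow> 'a::topological_space"
  assumes "compact C" "infinite {n. x n \<in> C}"
  shows "\<exists>c\<in>C. \<forall>V. open V \<longrightarrow> c \<in> V \<longrightarrow> infinite {n. x n \<in> V}"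
proof (rule ccontr)
  assume "\<not> ?thesis"
  then have "\<forall>c\<in>C. \<exists>V. open V \<and> c \<in> V \<and> finite {n. x n \<in> V}" by blast
  then obtain V where V: "\<And>c. c \<in> C \<Longrightarrow> open (V c) \<and> c \<in> V c \<and> finite {n. x n \<in> V c}" by metis
  obtain F where F: "F \<subseteq> C" "finite F" "C \<subseteq> (\<Union>c\<in>F. V c)"
    using compactE_image[OF assms(1), of C V] V by blast
  have "finite (\<Union>c\<in>F. {n. x n \<in> V c})" using F V by auto
  moreover have "{n. x n \<in> C} \<subseteq> (\<Union>c\<in>F. {n. x n \<in> V c})" using F(3) by blast
  ultimately show False using assms(2) finite_subset by blast
qed

text \<open>\<open>is_cocompact\<close> asks for some topology that makes the coset map a quotient
  map. The quotient topology is built as witness, and it is compact as the image of C.\<close>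

lemma is_cocompactI:
  fixes W :: "'k::topological_field set"
  assumes "compact C" "\<And>x. \<exists>c\<in>C. x +o W = c +o W"
  shows "is_cocompact W"
proof -
  let ?p = "\<lambda>x. x +o W"
  define L where "L U \<longleftrightarrow> U \<subseteq> range ?p \<and> open (?p -` U)" for U
  have ist: "istopology L" unfolding istopology_def
  proof (intro conjI allI impI)
    fix S T assume "L S" "L T"
    then show "L (S \<inter> T)" by (auto simp: L_def)
  next
    fix K assume "\<forall>S\<in>K. L S"
    then show "L (\<Union>K)" by (auto simp: L_def vimage_Union)
  qed
  have op: "openin (topology L) = L" using topology_inverse'[OF ist] .
  have "?p -` range ?p = UNIV" by auto
  then have "L (range ?p)" by (simp add: L_def)
  then have ts: "topspace (topology L) = range ?p"
    unfolding topspace_def op by (auto simp: L_def)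
  have q: "quotient_map euclidean (topology L) ?p"
    unfolding quotient_map_def ts op by (auto simp: L_def vimage_def)
  have "compactin (topology L) (?p ` C)"
    by (rule image_compactin[of euclidean]) (use assms q quotient_imp_continuous_map in auto)
  moreover have "?p ` C = range ?p" using assms(2) by auto
  ultimately have "compact_space (topology L)" by (simp add: compact_space_def ts)
  then show ?thesis unfolding is_cocompact_def using q by blast
qed

locale arith =
  fixes A :: "'k::topological_field set" and sg :: "'k \<Rightarrow> 'k"
  assumes bd: "basic_data A sg"
begin

lemma subring': "is_subring A" using bd by (auto simp: basic_data_def)

sublocale subring_of_field A by unfold_locales (rule subring')

lemma compact_nbhd: "\<exists>U B. open U \<and> compact B \<and> (0::'k) \<in> U \<and> U \<subseteq> B"
  using bd unfolding basic_data_def locally_compact_space_def by auto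

lemma not_open_zero: "\<not> open {0::'k}"
proof
  assume o: "open {0::'k}"
  have "x isolated_in UNIV" for x :: 'k
  proof -
    have "open {y. y - x \<in> {0}}" by (rule open_plus_preimage[OF o])
    moreover have "{y. y - x \<in> {0}} = {x}" by auto
    ultimately show ?thesis unfolding isolated_in_def by auto
  qed
  then show False using bd by (auto simp: basic_data_def discrete_def)
qed

lemma ex_small: "eventually P (nhds (0::'k)) \<Longrightarrow> \<exists>z. z \<noteq> 0 \<and> P z"
proof -
  assume "eventually P (nhds (0::'k))"
  then obtain U where "open U" "0 \<in> U" "\<forall>z\<in>U. P z" by (auto simp: eventually_nhds)
  moreover have "U \<noteq> {0}" using not_open_zero \<open>open U\<close> by blast
  ultimately show ?thesis by blast
qed

text \<open>If K were compact, some nonzero z would be so small that z K avoids 1, but z times its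
  inverse is 1.\<close>

lemma not_compact: "\<not> compact (UNIV :: 'k set)"
proof
  assume c: "compact (UNIV :: 'k set)"
  have "open (- {1::'k})" by (intro open_Compl) simp
  then obtain z :: 'k where "z \<noteq> 0" "\<forall>c\<in>UNIV. z * c \<in> - {1}"
    using ex_small[OF eventually_mult_compact[OF c, of "- {1}"]] by auto
  then show False using right_inverse by blast
qed

lemma discrete_nbhd: assumes "discrete W" "0 \<in> W" shows "\<exists>U. open U \<and> U \<inter> W = {0::'k}"
  using assms by (auto simp: discrete_def isolated_in_def)

text \<open>A neighbourhood V with all differences in U has translates that meet W in at most one
  point, and finitely many translates cover C.\<close>

lemma discrete_compact_finite: assumes "sm W" "discrete W" "compact C" shows "finite (W \<inter> C)"
proof -
  obtain U where U: "open U" "U \<inter> W = {0}" using discrete_nbhd sm_zero assms by blast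
  then obtain V where V: "open V" "0 \<in> V" "\<forall>x\<in>V. \<forall>y\<in>V. x - y \<in> U" using small_difference[of U] by blast
  obtain F where F: "F \<subseteq> C" "finite F" "C \<subseteq> (\<Union>c\<in>F. {x. x - c \<in> V})"
  proof (rule compactE_image[OF assms(3), of C "\<lambda>c. {x. x - c \<in> V}"])
    show "C \<subseteq> (\<Union>c\<in>C. {x. x - c \<in> V})" using V(2) by force
  qed (use open_plus_preimage[OF V(1)] in auto)
  have "finite (W \<inter> {x. x - c \<in> V})" for c
  proof -
    have "x = y" if "x \<in> W" "x - c \<in> V" "y \<in> W" "y - c \<in> V" for x y
    proof -
      have "(x - c) - (y - c) \<in> U" "x - y \<in> W" using V(3) that sm_diff assms(1) by blast+
      then have "x - y \<in> U \<inter> W" by simp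
      then show ?thesis using U by auto
    qed
    then have "\<exists>a. W \<inter> {x. x - c \<in> V} \<subseteq> {a}" by blast
    then show ?thesis using finite_subset by blast
  qed
  then have "finite (\<Union>c\<in>F. W \<inter> {x. x - c \<in> V})" using F(2) by (intro finite_UN_I)
  then show ?thesis by (rule rev_finite_subset) (use F(3) in blast)
qed

lemma coset_eq_iff: "sm W \<Longrightarrow> x +o W = y +o W \<longleftrightarrow> x - y \<in> W"
proof
  assume W: "sm W" and "x +o W = y +o W"
  then have "x \<in> y +o W" using sm_zero[OF W] by (metis add.right_neutral set_plus_intro2)
  then show "x - y \<in> W" by (simp add: coset_mem_iff)
next
  assume W: "sm W" "x - y \<in> W"
  have "z - x \<in> W \<longleftrightarrow> z - y \<in> W" for z
    using sm_add[OF W(1) _ W(2), of "z - x"] sm_diff[OF W(1) _ W(2), of "z - y"] by auto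
  then show "x +o W = y +o W" by (auto simp: coset_mem_iff)
qed

text \<open>Translates of U have open images in the quotient, so finitely many images suffice. The
  corresponding translates of the compact set B then form a compact set of representatives; this is
  where local compactness enters.\<close>

lemma cocompact_cover: assumes "sm W" "is_cocompact W" shows "\<exists>C. compact C \<and> (\<forall>x. \<exists>c\<in>C. x - c \<in> W)"
proof -
  let ?p = "\<lambda>x. x +o W"
  obtain T where T: "quotient_map euclidean T ?p" "compact_space T" using assms unfolding is_cocompact_def by blast
  have ts: "topspace T = range ?p" using T(1) by (auto simp: quotient_map_def)
  have op: "openin T U \<longleftrightarrow> open {x. ?p x \<in> U}" if "U \<subseteq> range ?p" for U
    using T(1) that ts by (auto simp: quotient_map_def)
  obtain U B where U: "open U" "compact B" "(0::'k) \<in> U" "U \<subseteq> B" using compact_nbhd by blast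
  define N where "N x = ?p ` {y. y - x \<in> U}" for x
  have oN: "openin T (N x)" for x
  proof -
    have "{y. ?p y \<in> N x} = (\<Union>w\<in>W. {y. y - (x + w) \<in> U})"
    proof (intro Set.set_eqI iffI)
      fix y assume "y \<in> {y. ?p y \<in> N x}"
      then obtain z where "z - x \<in> U" "?p y = ?p z" by (auto simp: N_def)
      then have "y - z \<in> W" "y - (x + (y - z)) \<in> U" using coset_eq_iff[OF assms(1)] by auto
      then show "y \<in> (\<Union>w\<in>W. {y. y - (x + w) \<in> U})" by blast
    next
      fix y assume "y \<in> (\<Union>w\<in>W. {y. y - (x + w) \<in> U})"
      then obtain w where w: "w \<in> W" "y - (x + w) \<in> U" by blast
      then have "?p y = ?p (y - w)" "(y - w) - x \<in> U" using coset_eq_iff[OF assms(1)] by (auto simp: algebra_simps)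
      then show "y \<in> {y. ?p y \<in> N x}" by (auto simp: N_def)
    qed
    then have "open {y. ?p y \<in> N x}" using open_plus_preimage[OF U(1)] by auto
    then show ?thesis by (subst op) (auto simp: N_def)
  qed
  have "topspace T \<subseteq> \<Union>(range N)" unfolding ts N_def using U(3) by fastforce
  then obtain F where F: "finite F" "F \<subseteq> range N" "topspace T \<subseteq> \<Union>F"
    using T(2) oN unfolding compact_space_alt by (metis (no_types, lifting) rangeE)
  then obtain X where X: "finite X" "F = N ` X" by (meson finite_subset_image)
  define C where "C = (\<Union>x\<in>X. (\<lambda>y. x + y) ` B)"
  have "compact C" unfolding C_def using X compact_translate[OF U(2)] by (intro compact_UN) auto
  moreover have "\<exists>c\<in>C. y - c \<in> W" for y
  proof -
    have "?p y \<in> \<Union>(N ` X)" using F(3) ts X(2) by blast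
    then obtain x z where "x \<in> X" "z - x \<in> U" "?p y = ?p z" by (auto simp: N_def)
    then have "z \<in> C" "y - z \<in> W" using coset_eq_iff[OF assms(1)] U(4)
      by (auto simp: C_def intro!: bexI[of _ x] image_eqI[of _ _ "z - x"])
    then show ?thesis by blast
  qed
  ultimately show ?thesis by blast
qed

lemma discrete_A: "discrete A" and cocompact_A: "is_cocompact A" and intcl: "is_integrally_closed A"
  and sign: "is_sign sg" and finite_roots: "finite (roots_of_unity :: 'k set)"
  using bd by (auto simp: basic_data_def)

definition "Cf = (SOME C. compact C \<and> (\<forall>x. \<exists>c\<in>C. x - c \<in> A))"

lemma Cf: "compact Cf" "\<exists>c\<in>Cf. x - c \<in> A"
  using someI_ex[OF cocompact_cover[OF sm_A cocompact_A]] unfolding Cf_def by auto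

text \<open>Otherwise K would be a finite union of translates of the compact set
  \<open>Cf\<close>.\<close>

lemma infinite_A: "infinite A"
proof
  assume "finite A"
  then have "compact {c + a | c a. c \<in> Cf \<and> a \<in> A}"
  proof -
    assume "finite A"
    then have "compact (\<Union>a\<in>A. (\<lambda>x. a + x) ` Cf)" using compact_translate[OF Cf(1)] by (intro compact_UN) auto
    moreover have "(\<Union>a\<in>A. (\<lambda>x. a + x) ` Cf) = {c + a | c a. c \<in> Cf \<and> a \<in> A}" by (force simp: add.commute)
    ultimately show ?thesis by simp
  qed
  moreover have "{c + a | c a. c \<in> Cf \<and> a \<in> A} = UNIV"
  proof (intro Set.set_eqI iffI UNIV_I)
    fix x :: 'k
    obtain c where "c \<in> Cf" "x - c \<in> A" using Cf(2) by blast
    moreover have "x = c + (x - c)" by simp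
    ultimately show "x \<in> {c + a | c a. c \<in> Cf \<and> a \<in> A}" by blast
  qed
  ultimately show False using not_compact by simp
qed

lemma scaled_cover: "\<exists>c\<in>Cf. x - a * c \<in> a *o A" if "a \<noteq> 0"
proof -
  obtain c where c: "c \<in> Cf" "x / a - c \<in> A" using Cf(2) by blast
  have "a * (x / a - c) = x - a * c" using that by (simp add: algebra_simps)
  then have "x - a * c \<in> a *o A" using c(2) scale_memI by metis
  then show ?thesis using c(1) by blast
qed

text \<open>Every residue class modulo a A is represented by a point of A in the compact set
  \<open>a *o Cf\<close>, and a discrete subgroup has only finitely many points there.\<close>

lemma fin_quot': assumes "a \<in> A" "a \<noteq> 0" shows "\<exists>C. finite C \<and> (\<forall>x\<in>A. \<exists>c\<in>C. x - c \<in> a *o A)"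
proof (intro exI conjI ballI)
  show "finite (A \<inter> a *o Cf)" by (rule discrete_compact_finite[OF sm_A discrete_A compact_scale[OF Cf(1)]])
  fix x assume x: "x \<in> A"
  obtain c where c: "c \<in> Cf" "x - a * c \<in> a *o A" using scaled_cover assms by blast
  have "a *o A \<subseteq> A" using assms by (auto simp: elt_set_times_def mult_A)
  then have "x - (x - a * c) \<in> A" using diff_A[OF x] c by blast
  then show "\<exists>c\<in>A \<inter> a *o Cf. x - c \<in> a *o A" using c by (intro bexI[of _ "a * c"]) auto
qed

sublocale dedekind A
  by unfold_locales (use subring' intcl fin_quot' in auto)

end

section \<open>A contraction in place of an absolute value\<close>

context arith
begin

text \<open>B plays the part of a closed ball and s that of an element of absolute value below 1.
  The condition that 1 is outside \<open>s *o B\<close> keeps all positive powers of s away from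
  1.\<close>

lemma contraction:
  "\<exists>s B U. s \<noteq> 0 \<and> compact B \<and> open U \<and> (0::'k) \<in> U \<and> U \<subseteq> B \<and> 1 \<in> B \<and> s *o B \<subseteq> U \<and> 1 \<notin> s *o B"
proof -
  obtain U B0 where U: "open U" "compact B0" "(0::'k) \<in> U" "U \<subseteq> B0" using compact_nbhd by blast
  \<comment> \<open>Adjoining 1 to the ball puts all powers of s into it.\<close>
  define B where "B = insert 1 B0"
  have B: "compact B" "U \<subseteq> B" "1 \<in> B" using U by (auto simp: B_def)
  have "open (U \<inter> - {1})" using U by (intro open_Int open_Compl) auto
  then have "eventually (\<lambda>z. \<forall>c\<in>B. z * c \<in> U \<inter> - {1}) (nhds 0)"
    using eventually_mult_compact[OF B(1), of "U \<inter> - {1}"] U by auto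
  then obtain s where s: "s \<noteq> 0" "\<forall>c\<in>B. s * c \<in> U \<inter> - {1}" using ex_small by blast
  then have "s *o B \<subseteq> U" "1 \<notin> s *o B" by (auto simp: elt_set_times_def)
  then show ?thesis using s U B by blast
qed

definition "ctr = (SOME (s, B, U). s \<noteq> 0 \<and> compact B \<and> open U \<and> (0::'k) \<in> U \<and> U \<subseteq> B \<and> 1 \<in> B \<and> s *o B \<subseteq> U \<and> 1 \<notin> s *o B)"
definition "cs = fst ctr"
definition "cB = fst (snd ctr)"
definition "cU = snd (snd ctr)"

lemma ctr: "cs \<noteq> 0" "compact cB" "open cU" "0 \<in> cU" "cU \<subseteq> cB" "1 \<in> cB" "cs *o cB \<subseteq> cU" "1 \<notin> cs *o cB"
proof -
  have "\<exists>t. case t of (s, B, U) \<Rightarrow> s \<noteq> 0 \<and> compact B \<and> open U \<and> (0::'k) \<in> U \<and> U \<subseteq> B \<and> 1 \<in> B \<and> s *o B \<subseteq> U \<and> 1 \<notin> s *o B"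
    using contraction by simp
  from someI_ex[OF this] show "cs \<noteq> 0" "compact cB" "open cU" "0 \<in> cU" "cU \<subseteq> cB" "1 \<in> cB" "cs *o cB \<subseteq> cU" "1 \<notin> cs *o cB"
    unfolding ctr_def[symmetric] cs_def cB_def cU_def by (auto simp: case_prod_beta)
qed

lemma cs_step: "x \<in> cB \<Longrightarrow> cs * x \<in> cB" using ctr by auto

lemma cs_pow: "x \<in> cB \<Longrightarrow> cs ^ n * x \<in> cB"
  by (induction n) (auto simp: cs_step mult.assoc)

lemma cs_pow1: "cs ^ Suc n \<in> cs *o cB"
  using cs_pow[OF ctr(6), of n] by auto

text \<open>Otherwise the powers have a cluster point c different from 0. Two powers close to c have
  a quotient close to 1; but this quotient is a positive power of \<open>cs\<close>, and those lie
  in the closed set \<open>cs *o cB\<close>, which misses 1.\<close>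

lemma cs_pow_small: assumes "open U" "0 \<in> U" shows "\<exists>n0. \<forall>n\<ge>n0. cs ^ n \<in> U"
proof (rule ccontr)
  assume n: "\<not> ?thesis"
  have inf: "infinite {n. cs ^ n \<in> cB \<inter> - U}"
    unfolding infinite_nat_iff_unbounded_le
  proof
    fix m
    obtain n where "n \<ge> m" "cs ^ n \<notin> U" using n by blast
    then show "\<exists>n\<ge>m. n \<in> {n. cs ^ n \<in> cB \<inter> - U}" using cs_pow[OF ctr(6), of n] by auto
  qed
  have "compact (cB \<inter> - U)" using ctr(2) assms by (intro compact_Int_closed) auto
  from compact_cluster[OF this inf]
  obtain c where c: "c \<in> cB \<inter> - U" "\<And>V. open V \<Longrightarrow> c \<in> V \<Longrightarrow> infinite {n. cs ^ n \<in> V}" by blast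
  have "open (- (cs *o cB))" using compact_closed[OF compact_scale[OF ctr(2)]] by blast
  moreover have "c \<noteq> 0" using c assms by auto
  ultimately obtain V where V: "open V" "c \<in> V" "\<forall>x\<in>V. \<forall>y\<in>V. x * inverse y \<in> - (cs *o cB)"
    using small_quotient[of "- (cs *o cB)" c] ctr(8) by auto
  have "infinite {n. cs ^ n \<in> V}" using c V by blast
  then obtain m where m: "cs ^ m \<in> V" using infinite_imp_nonempty by blast
  obtain n where n: "n > m" "cs ^ n \<in> V" using \<open>infinite {n. cs ^ n \<in> V}\<close> unfolding infinite_nat_iff_unbounded by blast
  have "n = Suc (n - m - 1) + m" using n by simp
  then have "cs ^ n = cs ^ Suc (n - m - 1) * cs ^ m" by (metis power_add)
  then have "cs ^ n * inverse (cs ^ m) = cs ^ Suc (n - m - 1)" using ctr(1) by simp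
  then show False using V(3) n(2) m cs_pow1 by (metis ComplD)
qed

lemma cs_pow_compact: assumes "compact C" "open U" "0 \<in> U" shows "\<exists>n0. \<forall>n\<ge>n0. \<forall>c\<in>C. cs ^ n * c \<in> U"
proof -
  obtain S where S: "open S" "0 \<in> S" "\<forall>z\<in>S. \<forall>c\<in>C. z * c \<in> U"
    using eventually_mult_compact[OF assms] by (auto simp: eventually_nhds)
  then show ?thesis using cs_pow_small[OF S(1,2)] by blast
qed

lemma cs_absorb: "\<exists>n. cs ^ n * x \<in> cB"
  using cs_pow_compact[of "{x}" cU] ctr by auto

text \<open>The sets \<open>inverse (cs ^ n) *o cB\<close> exhaust K and each contains finitely many
  elements of A. Countability is what later yields a cofinal sequence of ideals for
  \<open>GG_surj\<close>.\<close>

lemma countable_A: "countable A"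
proof -
  have "A \<subseteq> (\<Union>n. A \<inter> inverse (cs ^ n) *o cB)"
  proof
    fix x assume "x \<in> A"
    obtain n where "cs ^ n * x \<in> cB" using cs_absorb by blast
    then have "inverse (cs ^ n) * (cs ^ n * x) \<in> inverse (cs ^ n) *o cB" by blast
    moreover have "inverse (cs ^ n) * (cs ^ n * x) = x" using ctr(1) by (simp flip: mult.assoc)
    ultimately have "x \<in> inverse (cs ^ n) *o cB" by metis
    then show "x \<in> (\<Union>n. A \<inter> inverse (cs ^ n) *o cB)" using \<open>x \<in> A\<close> by blast
  qed
  
  moreover have "countable (\<Union>n. A \<inter> inverse (cs ^ n) *o cB)"
    using discrete_compact_finite[OF sm_A discrete_A compact_scale[OF ctr(2)]]
    by (intro countable_UN) (auto intro: countable_finite)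
  ultimately show ?thesis using countable_subset by blast
qed

section \<open>Lattices are the scaled ideals\<close>

lemma discrete_from_nbhd: assumes "sm W" "open U" "U \<inter> W = {0}" shows "discrete W"
  unfolding discrete_def isolated_in_def
proof (intro ballI conjI)
  fix x assume x: "x \<in> W"
  have "{y. y - x \<in> U} \<inter> W = {x}"
  proof -
    have "y = x" if "y - x \<in> U" "y \<in> W" for y
    proof -
      have "y - x \<in> U \<inter> W" using that sm_diff[OF assms(1) _ x] by blast
      then show ?thesis using assms by auto
    qed
    moreover have "0 \<in> U" using assms by blast
    ultimately show ?thesis using x by auto
  qed
  then show "\<exists>T. open T \<and> T \<inter> W = {x}" using open_plus_preimage[OF assms(2)] by blast
qed

lemma glat_lattice: assumes "glat W" shows "is_lattice A W"
  unfolding is_lattice_def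
proof (intro conjI)
  obtain k I where k: "k \<noteq> 0" "ideal I" "W = k *o I" using assms glat_def by blast
  show W: "sm W" using glat_sm assms by blast
  obtain U where U: "open U" "U \<inter> A = {0}" using discrete_nbhd[OF discrete_A zero_A] by blast
  have "{x. x * inverse k \<in> U} \<inter> W = {0}"
  proof -
    have "x = 0" if "x * inverse k \<in> U" "x \<in> W" for x
    proof -
      have "x * inverse k \<in> A" using that k mem_scale_iff[OF k(1)] integral_sub[OF k(2)] by (auto simp: divide_inverse)
      then have "x * inverse k = 0" using U that by blast
      then show ?thesis using k by simp
    qed
    then show ?thesis using U sm_zero[OF W] by auto
  qed
  then show "discrete W" using discrete_from_nbhd[OF W open_mult_preimage[OF U(1)]] by blast
  obtain a where a: "a \<in> I" "a \<noteq> 0" using integral_nonzero k by blast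
  have sub: "(k * a) *o A \<subseteq> W"
  proof -
    have "a *o A \<subseteq> I" using sm_mult2[OF integral_sm[OF k(2)] _ a(1)] by (auto simp: elt_set_times_def)
    then have "k *o (a *o A) \<subseteq> k *o I" by (rule set_times_mono)
    then show ?thesis using k by (simp add: set_times_rearrange2)
  qed
  show "is_cocompact W"
  proof (rule is_cocompactI[OF compact_scale[OF Cf(1), of "k * a"]])
    fix x
    obtain c where "c \<in> Cf" "x - (k * a) * c \<in> (k * a) *o A" using scaled_cover[of "k * a"] k a by auto
    then show "\<exists>c\<in>(k * a) *o Cf. x +o W = c +o W"
      using coset_eq_iff[OF W] sub by (intro bexI[of _ "(k * a) * c"]) auto
  qed
qed

text \<open>After scaling, the lattice V contains 1, hence A, and V / A is represented by the finite
  set V \<inter> Cf. For x in V the infinitely many multiples a x meet finitely many classes modulo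
  A, so a difference of two multipliers is a denominator of x. A common denominator of the
  representatives then carries V into A.\<close>

lemma lattice_glat: assumes "is_lattice A W" shows "glat W"
proof -
  have W: "sm W" "discrete W" "is_cocompact W" using assms by (auto simp: is_lattice_def)
  obtain C where C: "compact C" "\<And>x. \<exists>c\<in>C. x - c \<in> W" using cocompact_cover W by blast
  have "W \<noteq> {0}"
  proof
    assume "W = {0}"
    then have "UNIV \<subseteq> C" using C(2) by auto
    then have "C = UNIV" by blast
    then show False using C not_compact by simp
  qed
  then obtain w where w: "w \<in> W" "w \<noteq> 0" using sm_zero W by blast
  define V where "V = inverse w *o W"
  have V: "sm V" unfolding V_def by (rule sm_scale[OF W(1)])
  have "inverse w * w \<in> V" unfolding V_def using w(1) by blast
  then have one: "1 \<in> V" using w by simp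
  have AV: "A \<subseteq> V" using sm_mult[OF V _ one] by auto
  have "V \<inter> Cf \<subseteq> (\<lambda>x. inverse w * x) ` (W \<inter> w *o Cf)"
  proof
    fix x assume x: "x \<in> V \<inter> Cf"
    have "w * x \<in> W" using x w mem_scale_iff[of "inverse w" x W] by (auto simp: V_def divide_inverse mult.commute)
    then have "w * x \<in> W \<inter> w *o Cf" using x by blast
    moreover have "x = inverse w * (w * x)" using w by simp
    ultimately show "x \<in> (\<lambda>x. inverse w * x) ` (W \<inter> w *o Cf)" by blast
  qed
  then have fin: "finite (V \<inter> Cf)"
    using discrete_compact_finite[OF W(1,2) compact_scale[OF Cf(1)], of w] finite_surj by blast
  have rep: "\<exists>c\<in>V \<inter> Cf. x - c \<in> A" if "x \<in> V" for x
  proof -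
    obtain c where c: "c \<in> Cf" "x - c \<in> A" using Cf(2) by blast
    then have "x - (x - c) \<in> V" using sm_diff[OF V that] AV by blast
    then show ?thesis using c by auto
  qed
  have den: "\<exists>d\<in>A. d \<noteq> 0 \<and> d * x \<in> A" if x: "x \<in> V" for x
  proof -
    have "\<forall>a. \<exists>c. a \<in> A \<longrightarrow> c \<in> V \<inter> Cf \<and> a * x - c \<in> A" using rep sm_mult[OF V _ x] by blast
    then obtain c where c: "\<And>a. a \<in> A \<Longrightarrow> c a \<in> V \<inter> Cf \<and> a * x - c a \<in> A" by metis
    have "\<not> inj_on c A"
    proof
      assume "inj_on c A"
      moreover have "finite (c ` A)" using finite_subset[OF _ fin] c by blast
      ultimately show False using finite_imageD infinite_A by blast
    qed
    then obtain a b where ab: "a \<in> A" "b \<in> A" "a \<noteq> b" "c a = c b" by (auto simp: inj_on_def)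
    have "(a * x - c a) - (b * x - c b) \<in> A" using c ab diff_A by blast
    then have "(a - b) * x \<in> A" using ab by (simp add: algebra_simps)
    then show ?thesis using ab diff_A by (intro bexI[of _ "a - b"]) auto
  qed
  have "\<exists>d\<in>A. d \<noteq> 0 \<and> (\<forall>x\<in>F. d * x \<in> A)" if "finite F" "F \<subseteq> V" for F
    using that
  proof (induction F)
    case empty then show ?case using one_A by (intro bexI[of _ 1]) auto
  next
    case (insert y F)
    then obtain d where d: "d \<in> A" "d \<noteq> 0" "\<forall>x\<in>F. d * x \<in> A" by auto
    obtain e where e: "e \<in> A" "e \<noteq> 0" "e * y \<in> A" using den insert.prems by blast
    have "d * e * x \<in> A" if "x \<in> insert y F" for x
    proof (cases "x = y")
      case True then show ?thesis using mult_A[OF d(1) e(3)] by (simp add: mult.assoc)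
    next
      case False
      then have "e * (d * x) \<in> A" using that d(3) mult_A[OF e(1)] by blast
      then show ?thesis by (simp add: ac_simps)
    qed
    then show ?case using d e mult_A by (intro bexI[of _ "d * e"]) auto
  qed
  then obtain d where d: "d \<in> A" "d \<noteq> 0" "\<forall>x\<in>V \<inter> Cf. d * x \<in> A" using fin by blast
  have "d *o V \<subseteq> A"
  proof
    fix z assume "z \<in> d *o V"
    then obtain x where x: "x \<in> V" "z = d * x" by (auto simp: elt_set_times_def)
    obtain c where c: "c \<in> V \<inter> Cf" "x - c \<in> A" using rep x by blast
    have "d * c + d * (x - c) \<in> A" using d(3) c(1) mult_A[OF d(1) c(2)] by (intro add_A) auto
    moreover have "z = d * c + d * (x - c)" using x by (simp add: algebra_simps)
    ultimately show "z \<in> A" by metis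
  qed
  then have "glat V" using glat_super[OF integral_A AV V d(2)] by blast
  then have "glat (w *o V)" using glat_scale w by blast
  then show ?thesis using w by (simp add: V_def set_times_rearrange2)
qed

lemma lattice_iff: "is_lattice A W \<longleftrightarrow> glat W"
  using lattice_glat glat_lattice by blast

text \<open>Minkowski's argument: among the sets \<open>s^n B\<close> shrinking to \<open>0\<close>, take the smallest one meeting \<open>I\<close> nontrivially,
  say in \<open>a\<close>. As \<open>I\<close> is separated at the next smaller scale, the index of \<open>a A\<close> in \<open>I\<close> is bounded
  independently of \<open>I\<close>.\<close>

lemma small_element: "\<exists>m. \<forall>I. ideal I \<longrightarrow> (\<exists>a\<in>I. a \<noteq> 0 \<and>
    (\<forall>X\<subseteq>I. finite X \<longrightarrow> card X > m \<longrightarrow> (\<exists>x\<in>X. \<exists>y\<in>X. x \<noteq> y \<and> x - y \<in> a *o A)))"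
proof -
  define E where "E = {x * y | x y. x \<in> cB \<and> y \<in> Cf}"
  have E: "compact E" unfolding E_def by (rule compact_product[OF ctr(2) Cf(1)])
  have oc: "open {x. x * inverse cs \<in> cU}" by (rule open_mult_preimage[OF ctr(3)])
  then obtain V where V: "open V" "0 \<in> V" "\<forall>x\<in>V. \<forall>y\<in>V. x - y \<in> {x. x * inverse cs \<in> cU}"
    using small_difference[OF oc] ctr(4) by auto
  \<comment> \<open>The number of these translates is the announced bound; it is fixed before I is
    introduced.\<close>
  obtain F where F: "F \<subseteq> E" "finite F" "E \<subseteq> (\<Union>c\<in>F. {x. x - c \<in> V})"
  proof (rule compactE_image[OF E, of E "\<lambda>c. {x. x - c \<in> V}"])
    show "E \<subseteq> (\<Union>c\<in>E. {x. x - c \<in> V})" using V(2) by force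
  qed (use open_plus_preimage[OF V(1)] in auto)
  obtain U where U: "open U" "U \<inter> A = {0}" using discrete_nbhd[OF discrete_A zero_A] by blast
  obtain n0 where n0: "\<forall>c\<in>cB. cs ^ n0 * c \<in> U" using cs_pow_compact[OF ctr(2) U(1)] U(2) by blast
  show ?thesis
  proof (intro exI allI impI)
    fix I assume I: "ideal I"
    have IA: "I \<subseteq> A" "sm I" using I by (auto simp: integral_iff)
    \<comment> \<open>\<open>Q k x\<close> says that x is a nonzero element of I in cs^(n0 - k) cB,
      written without negative powers. The exponent n0 is so large that nothing satisfies it for k =
      0.\<close>
    define Q where "Q k x \<longleftrightarrow> x \<in> I \<and> x \<noteq> 0 \<and> cs ^ k * x \<in> cs ^ n0 *o cB" for k x
    define P where "P k \<longleftrightarrow> (\<exists>x. Q k x)" for k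
    have P0: "\<not> P 0"
    proof
      assume "P 0"
      then obtain x where "x \<in> I" "x \<noteq> 0" "x \<in> cs ^ n0 *o cB" by (auto simp: P_def Q_def)
      moreover from this have "x \<in> U" using n0 by (auto simp: elt_set_times_def)
      ultimately show False using U IA by blast
    qed
    obtain z where z: "z \<in> I" "z \<noteq> 0" using integral_nonzero I by blast
    obtain j where "cs ^ j * z \<in> cB" using cs_absorb by blast
    then have "cs ^ n0 * (cs ^ j * z) \<in> cs ^ n0 *o cB" by blast
    then have "P (n0 + j)" using z by (auto simp: P_def Q_def power_add mult.assoc)
    then have Pk: "P (LEAST k. P k)" by (rule LeastI)
    define k where "k = (LEAST k. P k) - 1"
    have "(LEAST k. P k) \<noteq> 0" using Pk P0 by metis
    then have k: "Suc k = (LEAST k. P k)" by (simp add: k_def)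
    then have nPk: "\<not> P k" using not_less_Least[of k P] by simp
    obtain a where a: "a \<in> I" "a \<noteq> 0" "cs ^ Suc k * a \<in> cs ^ n0 *o cB" using Pk k by (auto simp: P_def Q_def)
    show "\<exists>a\<in>I. a \<noteq> 0 \<and> (\<forall>X\<subseteq>I. finite X \<longrightarrow> card X > card F \<longrightarrow> (\<exists>x\<in>X. \<exists>y\<in>X. x \<noteq> y \<and> x - y \<in> a *o A))"
    proof (rule bexI[OF _ a(1)], rule conjI[OF a(2)], intro allI impI)
      fix X assume X: "X \<subseteq> I" "finite X" "card F < card X"
      have "\<exists>y f. y \<in> I \<and> x - y \<in> a *o A \<and> f \<in> F \<and> cs ^ Suc k * y * inverse (cs ^ n0) - f \<in> V" if x: "x \<in> X" for x
      proof -
        obtain c where c: "c \<in> Cf" "x - a * c \<in> a *o A" using scaled_cover a by blast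
        have "a *o A \<subseteq> I" using sm_mult2[OF IA(2) _ a(1)] by (auto simp: elt_set_times_def)
        then have "x - (x - a * c) \<in> I" using sm_diff[OF IA(2)] x X c by blast
        then have y: "a * c \<in> I" by simp
        obtain b where b: "b \<in> cB" "cs ^ Suc k * a = cs ^ n0 * b" using a(3) by (auto simp: elt_set_times_def)
        have "cs ^ Suc k * (a * c) = (cs ^ n0 * b) * c" using b(2) by (metis mult.assoc)
        then have "cs ^ Suc k * (a * c) * inverse (cs ^ n0) = cs ^ n0 * b * c * inverse (cs ^ n0)" by (simp only:)
        also have "\<dots> = b * c" using ctr(1) by (simp add: field_simps)
        finally have "cs ^ Suc k * (a * c) * inverse (cs ^ n0) = b * c" .
        moreover have "b * c \<in> E" using b c by (auto simp: E_def)
        then obtain f where "f \<in> F" "b * c - f \<in> V" using F(3) by blast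
        ultimately show ?thesis using y c by metis
      qed
      then obtain y f where yf: "\<And>x. x \<in> X \<Longrightarrow> y x \<in> I \<and> x - y x \<in> a *o A \<and> f x \<in> F \<and>
          cs ^ Suc k * y x * inverse (cs ^ n0) - f x \<in> V" by metis
      have "f ` X \<subseteq> F" using yf by blast
      then have "\<not> inj_on f X" using card_inj_on_le[of f X F] F(2) X(3) by auto
      then obtain x x' where xx: "x \<in> X" "x' \<in> X" "x \<noteq> x'" "f x = f x'" by (auto simp: inj_on_def)
      let ?d = "y x - y x'"
      have "(cs ^ Suc k * y x * inverse (cs ^ n0) - f x) - (cs ^ Suc k * y x' * inverse (cs ^ n0) - f x') \<in> {x. x * inverse cs \<in> cU}"
        using V(3) yf[OF xx(1)] yf[OF xx(2)] by blast
      \<comment> \<open>Differences of V lie in \<open>cs\<close> times \<open>cU\<close>.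
        Cancelling one factor \<open>cs\<close> places \<open>?d\<close> at the next smaller scale,
        where I has no nonzero element by minimality of \<open>Suc k\<close>.\<close>
      moreover have "((cs ^ Suc k * y x * inverse (cs ^ n0) - f x) - (cs ^ Suc k * y x' * inverse (cs ^ n0) - f x')) * inverse cs = cs ^ k * ?d * inverse (cs ^ n0)"
      proof -
        have "(cs ^ Suc k * y x * inverse (cs ^ n0) - f x) - (cs ^ Suc k * y x' * inverse (cs ^ n0) - f x')
            = cs * (cs ^ k * ?d * inverse (cs ^ n0))"
          using xx(4) by (simp add: algebra_simps)
        then show ?thesis using ctr(1) by simp
      qed
      ultimately have "cs ^ k * ?d * inverse (cs ^ n0) \<in> cB" using ctr(5) by auto
      then have "cs ^ n0 * (cs ^ k * ?d * inverse (cs ^ n0)) \<in> cs ^ n0 *o cB" by blast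
      moreover have "cs ^ n0 * (cs ^ k * ?d * inverse (cs ^ n0)) = cs ^ k * ?d" using ctr(1) by simp
      ultimately have "cs ^ k * ?d \<in> cs ^ n0 *o cB" by metis
      moreover have "?d \<in> I" using yf xx sm_diff[OF IA(2)] by blast
      ultimately have "?d = 0" using nPk by (auto simp: P_def Q_def)
      then have "x - x' = (x - y x) - (x' - y x')" by simp
      also have "\<dots> \<in> a *o A" using yf xx sm_diff[OF sm_scale[OF sm_A]] by blast
      finally show "\<exists>x\<in>X. \<exists>y\<in>X. x \<noteq> y \<and> x - y \<in> a *o A" using xx by blast
    qed
  qed
qed

text \<open>For m + 1 elements t of A and x in I, two of the products t x are congruent modulo a A;
  hence the product D of all differences satisfies D x \<in> a A. So (D / a) I lies between D A and
  A, and only finitely many modules do.\<close>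

theorem finite_classes: "\<exists>R. finite R \<and> (\<forall>W. glat W \<longrightarrow> (\<exists>J\<in>R. \<exists>k. k \<noteq> 0 \<and> glat J \<and> W = k *o J))"
proof -
  obtain m where m: "\<And>I. ideal I \<Longrightarrow> \<exists>a\<in>I. a \<noteq> 0 \<and>
    (\<forall>X\<subseteq>I. finite X \<longrightarrow> card X > m \<longrightarrow> (\<exists>x\<in>X. \<exists>y\<in>X. x \<noteq> y \<and> x - y \<in> a *o A))"
    using small_element by metis
  obtain T where T: "T \<subseteq> A" "card T = Suc m" "finite T"
    using infinite_arbitrarily_large[OF infinite_A] by metis
  define D where "D = (\<Prod>p\<in>{p\<in>T \<times> T. fst p \<noteq> snd p}. fst p - snd p)"
  have prodA: "prod h Y \<in> A" if "\<And>y. y \<in> Y \<Longrightarrow> h y \<in> A" for h and Y :: "('k \<times> 'k) set"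
    using that by (induction Y rule: infinite_finite_induct) (auto simp: one_A mult_A)
  have finT: "finite {p\<in>T \<times> T. fst p \<noteq> snd p}" using T by simp
  have D: "D \<in> A" "D \<noteq> 0"
    using T finT unfolding D_def by (auto intro!: prodA diff_A simp: prod_zero_iff)
  have Dd: "\<exists>e\<in>A. D = e * (s - t)" if "s \<in> T" "t \<in> T" "s \<noteq> t" for s t
  proof
    have "(s, t) \<in> {p\<in>T \<times> T. fst p \<noteq> snd p}" using that by simp
    from prod.remove[OF finT this, of "\<lambda>p. fst p - snd p"]
    show "D = (\<Prod>p\<in>{p\<in>T \<times> T. fst p \<noteq> snd p} - {(s, t)}. fst p - snd p) * (s - t)"
      by (simp add: D_def mult.commute)
    show "(\<Prod>p\<in>{p\<in>T \<times> T. fst p \<noteq> snd p} - {(s, t)}. fst p - snd p) \<in> A"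
      using T by (auto intro!: prodA diff_A)
  qed
  let ?R = "{J. sm J \<and> D \<in> J \<and> J \<subseteq> A}"
  have "\<exists>J\<in>?R. \<exists>k. k \<noteq> 0 \<and> glat J \<and> W = k *o J" if W: "glat W" for W
  proof -
    obtain l I where l: "l \<noteq> 0" "ideal I" "W = l *o I" using W glat_def by blast
    have I: "sm I" using l integral_sm by blast
    obtain a where a: "a \<in> I" "a \<noteq> 0" "\<And>X. X \<subseteq> I \<Longrightarrow> finite X \<Longrightarrow> card X > m \<Longrightarrow> \<exists>x\<in>X. \<exists>y\<in>X. x \<noteq> y \<and> x - y \<in> a *o A"
      using m[OF l(2)] by blast
    have Dx: "D * x \<in> a *o A" if x: "x \<in> I" for x
    proof (cases "x = 0")
      case True then show ?thesis using sm_zero[OF sm_scale[OF sm_A]] by simp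
    next
      case False
      have "inj_on (\<lambda>t. t * x) T" using False by (auto simp: inj_on_def)
      then have "card ((\<lambda>t. t * x) ` T) = Suc m" using T card_image by metis
      moreover have "(\<lambda>t. t * x) ` T \<subseteq> I" using sm_mult[OF I _ x] T by blast
      ultimately obtain s t where st: "s \<in> T" "t \<in> T" "s * x \<noteq> t * x" "s * x - t * x \<in> a *o A"
        using a(3)[of "(\<lambda>t. t * x) ` T"] T(3) by auto
      then obtain e where "e \<in> A" "D = e * (s - t)" using Dd by metis
      moreover from this have "D * x = e * (s * x - t * x)" by (simp only: left_diff_distrib mult.assoc)
      ultimately show ?thesis using sm_mult[OF sm_scale[OF sm_A]] st(4) by metis
    qed
    define J where "J = (D * inverse a) *o I"
    have "sm J" unfolding J_def by (rule sm_scale[OF I])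
    moreover have "D \<in> J"
    proof -
      have "(D * inverse a) * a \<in> J" unfolding J_def using a(1) by blast
      moreover have "(D * inverse a) * a = D" using a(2) by simp
      ultimately show ?thesis by metis
    qed
    moreover have "J \<subseteq> A"
    proof
      fix y assume "y \<in> J"
      then obtain x where "x \<in> I" "y = D * inverse a * x" by (auto simp: J_def elt_set_times_def)
      moreover obtain b where "b \<in> A" "D * x = a * b" using Dx[OF \<open>x \<in> I\<close>] by (auto simp: elt_set_times_def)
      ultimately have "y = inverse a * (a * b)" by (simp add: ac_simps)
      then have "y = b" using a(2) by (simp flip: mult.assoc)
      then show "y \<in> A" using \<open>b \<in> A\<close> by simp
    qed
    moreover have "l * a * inverse D * (D * inverse a) = l" using a(2) D(2) by (simp add: field_simps)
    then have "W = (l * a * inverse D) *o J" using l(3) unfolding J_def set_times_rearrange2 by (simp only:)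
    moreover have "glat J" unfolding J_def using a D l by (intro glat_scale ideal_glat) auto
    ultimately show ?thesis using a D l by (intro bexI[of _ J] exI[of _ "l * a * inverse D"]) auto
  qed
  then show ?thesis using finite_above[OF D] by blast
qed

section \<open>Signs, units and positive elements\<close>

lemma sg_mult: "x \<noteq> 0 \<Longrightarrow> y \<noteq> 0 \<Longrightarrow> sg (x * y) = sg x * sg y"
  and sg_root: "x \<noteq> 0 \<Longrightarrow> sg x \<in> roots_of_unity"
  and sg_id: "z \<in> roots_of_unity \<Longrightarrow> sg z = z"
  using sign by (auto simp: is_sign_def)

lemma root_nonzero: "z \<in> roots_of_unity \<Longrightarrow> (z::'k) \<noteq> 0"
  by (auto simp: roots_of_unity_def) (metis zero_power zero_neq_one)

lemma one_root: "(1::'k) \<in> roots_of_unity" by (auto simp: roots_of_unity_def)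

lemma inverse_root: "z \<in> roots_of_unity \<Longrightarrow> inverse (z::'k) \<in> roots_of_unity"
  by (auto simp: roots_of_unity_def power_inverse)

abbreviation "pos \<equiv> is_positive sg"

lemma pos_nonzero: "pos x \<Longrightarrow> x \<noteq> 0" by (simp add: is_positive_def)
lemma pos_one: "pos 1" using sg_id[OF one_root] by (simp add: is_positive_def)
lemma pos_mult: "pos x \<Longrightarrow> pos y \<Longrightarrow> pos (x * y)" by (simp add: is_positive_def sg_mult)
lemma pos_inverse: "pos x \<Longrightarrow> pos (inverse x)"
  using sg_mult[of x "inverse x"] sg_id[OF one_root] by (simp add: is_positive_def)
lemma pos_divide: "pos x \<Longrightarrow> pos y \<Longrightarrow> pos (x / y)"
  by (simp add: divide_inverse pos_mult pos_inverse)

lemma pos_sg: "x \<noteq> 0 \<Longrightarrow> pos (x * inverse (sg x))"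
  using sg_mult[of x "inverse (sg x)"] sg_id[OF inverse_root[OF sg_root]] root_nonzero[OF sg_root]
  by (simp add: is_positive_def)

text \<open>For a unit v take the least k with cs^k v in \<open>cB\<close>; this first entry lies in
  a compact set E away from 0. If k were large, v^-1 = cs^k (cs^k v)^-1 would be a nonzero element
  of A close to 0. So k is bounded, and all units lie in one compact set.\<close>

lemma units_finite: "finite {v. v \<noteq> 0 \<and> v *o A = A}"
proof -
  have oc: "open {x. x * inverse cs \<in> cU}" by (rule open_mult_preimage[OF ctr(3)])
  \<comment> \<open>The shell \<open>cB\<close> minus \<open>cs\<close> times \<open>cU\<close>: a
    point of it cannot be divided by \<open>cs\<close> and land in \<open>cU\<close>.\<close>
  define E where "E = cB \<inter> - {x. x * inverse cs \<in> cU}"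
  have E: "compact E" unfolding E_def using ctr(2) oc by (intro compact_Int_closed) auto
  have E0: "0 \<notin> E" using ctr(4) by (auto simp: E_def)
  have "continuous_on E (inverse :: 'k \<Rightarrow> 'k)"
    unfolding continuous_on_def
  proof
    fix x assume "x \<in> E"
    then have "(inverse \<longlongrightarrow> inverse x) (nhds x)" using E0 by (intro tendsto_inverse_nhds) auto
    then show "(inverse \<longlongrightarrow> inverse x) (at x within E)"
      by (rule filterlim_mono) (auto simp: at_within_def)
  qed
  then have E': "compact (inverse ` E)" using E compact_continuous_image by blast
  obtain U where U: "open U" "U \<inter> A = {0}" using discrete_nbhd[OF discrete_A zero_A] by blast
  obtain k0 where k0: "\<forall>n\<ge>k0. \<forall>c\<in>inverse ` E. cs ^ n * c \<in> U" using cs_pow_compact[OF E' U(1)] U(2) by blast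
  have "{v. v \<noteq> 0 \<and> v *o A = A} \<subseteq> A \<inter> inverse (cs ^ k0) *o cB"
  proof (rule subsetI, elim CollectE conjE)
    fix v assume v: "v \<noteq> 0" "v *o A = A"
    have "v * 1 \<in> v *o A" using one_A by blast
    then have vA: "v \<in> A" using v by simp
    have ivA: "inverse v \<in> A"
      using scale_flip[OF v] scale_memI[OF one_A, of "inverse v"] by simp
    let ?k = "LEAST k. cs ^ k * v \<in> cB"
    have kB: "cs ^ ?k * v \<in> cB" by (rule LeastI_ex[OF cs_absorb])
    have "?k \<le> k0"
    proof (rule ccontr)
      assume n: "\<not> ?k \<le> k0"
      then obtain j where j: "?k = Suc j" by (metis not0_implies_Suc le0)
      then have "cs ^ j * v \<notin> cB" using not_less_Least[of j "\<lambda>k. cs ^ k * v \<in> cB"] by auto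
      moreover have "cs ^ ?k * v * inverse cs = cs ^ j * v" unfolding j using ctr(1) by (simp add: field_simps)
      ultimately have "cs ^ ?k * v * inverse cs \<notin> cU" using ctr(5) by (metis subsetD)
      then have "cs ^ ?k * v \<in> E" using kB unfolding E_def by auto
      moreover have "\<forall>c\<in>inverse ` E. cs ^ ?k * c \<in> U" using k0 n by (meson nle_le)
      ultimately have "cs ^ ?k * inverse (cs ^ ?k * v) \<in> U" by blast
      moreover have "cs ^ ?k * inverse (cs ^ ?k * v) = inverse v" using ctr(1) v by simp
      ultimately have "inverse v \<in> U \<inter> A" using ivA by (metis IntI)
      then show False using U v by simp
    qed
    then have "cs ^ (k0 - ?k) * (cs ^ ?k * v) \<in> cB" using cs_pow[OF kB] by blast
    then have "cs ^ k0 * v \<in> cB" using \<open>?k \<le> k0\<close> by (simp add: mult.assoc[symmetric] power_add[symmetric])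
    then have "inverse (cs ^ k0) * (cs ^ k0 * v) \<in> inverse (cs ^ k0) *o cB" by blast
    moreover have "inverse (cs ^ k0) * (cs ^ k0 * v) = v" using ctr(1) by (simp flip: mult.assoc)
    ultimately have "v \<in> inverse (cs ^ k0) *o cB" by metis
    then show "v \<in> A \<inter> inverse (cs ^ k0) *o cB" using vA by simp
  qed
  then show ?thesis
    using discrete_compact_finite[OF sm_A discrete_A compact_scale[OF ctr(2)]] finite_subset by blast
qed

text \<open>The powers of v are units, so they repeat and v is a root of unity, on which
  \<open>sg\<close> is the identity. Hence a lattice has no positive automorphism other than
  1.\<close>

theorem pos_unit: assumes "pos v" "v *o A = A" shows "v = 1"
proof -
  have v0: "v \<noteq> 0" using assms pos_nonzero by blast
  have "v ^ n *o A = A" for n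
  proof (induction n)
    case (Suc n)
    have "v ^ Suc n *o A = v *o (v ^ n *o A)" by (simp add: set_times_rearrange2)
    then show ?case using Suc assms by simp
  qed simp
  then have "finite (range (\<lambda>n::nat. v ^ n))" using v0 by (intro finite_subset[OF _ units_finite]) auto
  then have "\<not> inj (\<lambda>n::nat. v ^ n)" using finite_imageD infinite_UNIV_nat by blast
  then obtain m n :: nat where "m < n" "v ^ m = v ^ n" by (metis (mono_tags, lifting) injI linorder_neqE_nat)
  then have "v ^ (n - m) = 1" using v0 by (simp add: power_diff)
  then have "v \<in> roots_of_unity" unfolding roots_of_unity_def using \<open>m < n\<close> by (auto intro!: exI[of _ "n - m"])
  then show ?thesis using sg_id assms by (simp add: is_positive_def)
qed

text \<open>\<open>sg\<close> is continuous with finitely many values, so the positive elements form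
  an open set around 1. For a small positive y the set 1 + y C is positive, hence so is y^-1 + C,
  and C meets every coset of W.\<close>

theorem ex_pos: assumes "glat W" shows "\<exists>w\<in>W. pos (x + w)"
proof -
  have L: "sm W" "is_cocompact W" using glat_lattice[OF assms] by (auto simp: is_lattice_def)
  obtain C where C: "compact C" "\<And>x. \<exists>c\<in>C. x - c \<in> W" using cocompact_cover L by blast
  let ?V = "- (roots_of_unity - {1::'k})"
  have "open ?V" using finite_roots by (intro open_Compl finite_imp_closed) auto
  moreover have "continuous_on (- {0}) sg" using sign by (simp add: is_sign_def)
  moreover have "open (- {0::'k})" by (intro open_Compl) simp
  ultimately have "open (sg -` ?V \<inter> - {0})" using continuous_on_open_vimage by blast
  moreover have "sg -` ?V \<inter> - {0} = {y. pos y}" using sg_root by (auto simp: is_positive_def)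
  ultimately have oN: "open {y. pos y}" by simp
  have "open {z. z - (-1) \<in> {y. pos y}}" by (rule open_plus_preimage[OF oN])
  then have oM: "open {z. pos (1 + z)}" by (simp add: add.commute)
  \<comment> \<open>All rotations of C are included because the small z obtained from the topology
    becomes positive only after division by \<open>sg z\<close>.\<close>
  have "compact (\<Union>z\<in>roots_of_unity. z *o C)" using finite_roots compact_scale[OF C(1)] by (intro compact_UN) auto
  from ex_small[OF eventually_mult_compact[OF this oM]]
  obtain z where z: "z \<noteq> 0" "\<forall>c\<in>(\<Union>z\<in>roots_of_unity. z *o C). pos (1 + z * c)" using pos_one by auto
  define y where "y = z * inverse (sg z)"
  have y: "pos y" unfolding y_def by (rule pos_sg[OF z(1)])
  have yC: "pos (1 + y * c)" if "c \<in> C" for c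
  proof -
    have "inverse (sg z) * c \<in> (\<Union>z\<in>roots_of_unity. z *o C)"
      using inverse_root[OF sg_root[OF z(1)]] that by blast
    then have "pos (1 + z * (inverse (sg z) * c))" using z(2) by blast
    then show ?thesis by (simp add: y_def mult.assoc)
  qed
  obtain c where c: "c \<in> C" "(x - inverse y) - c \<in> W" using C(2) by blast
  have "x + - ((x - inverse y) - c) = inverse y * (1 + y * c)"
    using pos_nonzero[OF y] by (simp add: algebra_simps)
  then have "pos (x + - ((x - inverse y) - c))" using pos_mult[OF pos_inverse[OF y] yC[OF c(1)]] by simp
  then show ?thesis using sm_uminus[OF L(1) c(2)] by blast
qed

subsection \<open>Homothety classes and ray classes\<close>

definition cl :: "'k \<Rightarrow> 'k set \<Rightarrow> 'k set set" where "cl x W = hclass A sg (x +o W)"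

text \<open>Homothety of presentations (x, W). The set-level relation quantifies over all
  presentations; by \<open>homothetic_iff\<close> any one of them decides it.\<close>

definition hom_eq :: "'k \<Rightarrow> 'k set \<Rightarrow> 'k \<Rightarrow> 'k set \<Rightarrow> bool" where
  "hom_eq x W x' W' \<longleftrightarrow> (\<exists>y. pos y \<and> y *o W = W' \<and> y * x - x' \<in> W')"

lemma coset_inj: assumes "sm W" "sm W'" "x +o W = x' +o W'" shows "W = W'" "x - x' \<in> W'"
proof -
  have "x \<in> x' +o W'" using assms sm_zero[OF assms(1)] by (metis add.right_neutral set_plus_intro2)
  then show d: "x - x' \<in> W'" by (simp add: coset_mem_iff)
  then have "x +o W' = x' +o W'" using coset_eq_iff[OF assms(2)] by simp
  then have "x +o W = x +o W'" using assms(3) by simp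
  then have "z + x - x \<in> W \<longleftrightarrow> z + x - x \<in> W'" for z using coset_mem_iff by metis
  then show "W = W'" by auto
qed

lemma homothetic_iff: assumes "glat W" "glat W'"
  shows "homothetic A sg (x +o W) (x' +o W') \<longleftrightarrow> hom_eq x W x' W'"
proof
  assume "homothetic A sg (x +o W) (x' +o W')"
  then obtain x1 W1 x2 W2 y where h: "glat W1" "glat W2" "x +o W = x1 +o W1" "x' +o W' = x2 +o W2"
    "pos y" "y *o W1 = W2" "y * x1 - x2 \<in> W2" unfolding homothetic_def lattice_iff by blast
  have e1: "W = W1" "x - x1 \<in> W1" using coset_inj[OF glat_sm[OF assms(1)] glat_sm[OF h(1)] h(3)] by auto
  have e2: "W' = W2" "x' - x2 \<in> W2" using coset_inj[OF glat_sm[OF assms(2)] glat_sm[OF h(2)] h(4)] by auto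
  have s: "sm W2" using h glat_sm by blast
  have "y * (x - x1) \<in> W2" using e1(2) h(6) by blast
  then have "(y * (x - x1) + (y * x1 - x2)) - (x' - x2) \<in> W2"
    by (intro sm_diff[OF s] sm_add[OF s] h(7) e2(2))
  moreover have "(y * (x - x1) + (y * x1 - x2)) - (x' - x2) = y * x - x'" by (simp add: algebra_simps)
  ultimately have "y * x - x' \<in> W2" by metis
  then show "hom_eq x W x' W'" unfolding hom_eq_def using h e1 e2 by blast
next
  assume "hom_eq x W x' W'"
  then show "homothetic A sg (x +o W) (x' +o W')"
    unfolding homothetic_def hom_eq_def lattice_iff using assms by blast
qed

lemma hom_eq_refl: "glat W \<Longrightarrow> x - x' \<in> W \<Longrightarrow> hom_eq x W x' W"
  unfolding hom_eq_def using pos_one by (intro exI[of _ 1]) auto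

lemma hom_eq_sym: assumes "glat W" "hom_eq x W x' W'" shows "hom_eq x' W' x W"
proof -
  obtain y where y: "pos y" "y *o W = W'" "y * x - x' \<in> W'" using assms hom_eq_def by blast
  have y0: "y \<noteq> 0" using y pos_nonzero by blast
  have f: "inverse y *o W' = W" using scale_flip[OF y0 y(2)] .
  have "inverse y * (y * x - x') \<in> inverse y *o W'" using y(3) by blast
  then have "inverse y * (y * x - x') \<in> W" by (simp only: f)
  moreover have "inverse y * (y * x - x') = x - inverse y * x'"
    using y0 by (simp add: algebra_simps)
  ultimately have "x - inverse y * x' \<in> W" by metis
  then have "inverse y * x' - x \<in> W" using sm_diff_swap glat_sm assms by blast
  then show ?thesis unfolding hom_eq_def using pos_inverse[OF y(1)] f by blast
qed

lemma hom_eq_trans: assumes "glat W''" "hom_eq x W x' W'" "hom_eq x' W' x'' W''" shows "hom_eq x W x'' W''"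
proof -
  obtain y where y: "pos y" "y *o W = W'" "y * x - x' \<in> W'" using assms hom_eq_def by blast
  obtain z where z: "pos z" "z *o W' = W''" "z * x' - x'' \<in> W''" using assms hom_eq_def by blast
  have "z * (y * x - x') \<in> W''" using y(3) z(2) by blast
  then have "z * (y * x - x') + (z * x' - x'') \<in> W''" using sm_add[OF glat_sm[OF assms(1)]] z(3) by blast
  moreover have "z * (y * x - x') + (z * x' - x'') = z * y * x - x''" by (simp add: algebra_simps)
  ultimately have "z * y * x - x'' \<in> W''" by metis
  moreover have "(z * y) *o W = W''" using y z by (simp add: set_times_rearrange2[symmetric])
  ultimately show ?thesis unfolding hom_eq_def using pos_mult y z by blast
qed

lemma cl_eq: assumes "glat W" "glat W'" shows "cl x W = cl x' W' \<longleftrightarrow> hom_eq x W x' W'"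
proof
  assume "cl x W = cl x' W'"
  moreover have "hom_eq x' W' x' W'" using assms hom_eq_refl sm_zero[OF glat_sm] by simp
  then have "x' +o W' \<in> cl x' W'" unfolding cl_def hclass_def using homothetic_iff assms by simp
  ultimately show "hom_eq x W x' W'" unfolding cl_def hclass_def using homothetic_iff[OF assms] by auto
next
  have sub: "cl x' W' \<subseteq> cl x W" if h: "hom_eq x W x' W'" "glat W" "glat W'" for x W x' W'
  proof
    fix X assume X: "X \<in> cl x' W'"
    then have "homothetic A sg (x' +o W') X" by (simp add: cl_def hclass_def)
    then obtain x2 W2 where X2: "glat W2" "X = x2 +o W2" unfolding homothetic_def lattice_iff by blast
    then have "hom_eq x' W' x2 W2" using X h homothetic_iff by (simp add: cl_def hclass_def)
    then have "hom_eq x W x2 W2" using hom_eq_trans X2 h by blast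
    then show "X \<in> cl x W" using X2 h homothetic_iff by (simp add: cl_def hclass_def)
  qed
  assume h: "hom_eq x W x' W'"
  show "cl x W = cl x' W'" using sub[OF h assms] sub[OF hom_eq_sym[OF assms(1) h] assms(2,1)] by blast
qed

lemma cl_scale: assumes "pos y" "glat W" shows "cl x W = cl (y * x) (y *o W)"
proof -
  have g: "glat (y *o W)" using assms glat_scale pos_nonzero by blast
  show ?thesis
    unfolding cl_eq[OF assms(2) g] hom_eq_def using assms sm_zero[OF glat_sm[OF g]]
    by (intro exI[of _ y]) auto
qed

lemma cl_shift: assumes "x - x' \<in> W" "glat W" shows "cl x W = cl x' W"
  using cl_eq[OF assms(2,2)] hom_eq_refl[OF assms(2,1)] by blast

section \<open>Orders of torsion translates\<close>

abbreviation "ordr \<equiv> order_of A"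

lemma ordr_sub: "ordr x W \<subseteq> A" by (auto simp: order_of_def)
lemma ordr_mem: "a \<in> ordr x W \<longleftrightarrow> a \<in> A \<and> a * x \<in> W" by (simp add: order_of_def)

lemma ordr_sm: "sm W \<Longrightarrow> sm (ordr x W)"
  unfolding is_submodule_def[of A "ordr x W"]
  by (auto simp: ordr_mem zero_A add_A mult_A sm_zero distrib_right mult.assoc intro: sm_add sm_mult)

lemma ordr_ideal: "sm W \<Longrightarrow> ideal f \<Longrightarrow> f \<subseteq> ordr x W \<Longrightarrow> ideal (ordr x W)"
  using integral_super ordr_sm ordr_sub by blast

lemma torsion_iff: "ideal f \<Longrightarrow> torsion_by f x W \<longleftrightarrow> f \<subseteq> ordr x W"
  using integral_sub[of f] unfolding torsion_by_def order_of_def by (auto simp: mult.commute)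

lemma hom_eq_ordr: assumes "glat W'" "hom_eq x W x' W'" shows "ordr x W = ordr x' W'"
proof -
  obtain y where y: "pos y" "y *o W = W'" "y * x - x' \<in> W'" using assms hom_eq_def by blast
  have W': "sm W'" using assms glat_sm by blast
  have "a * x \<in> W \<longleftrightarrow> a * x' \<in> W'" if "a \<in> A" for a
  proof -
    have "a * x \<in> W \<longleftrightarrow> a * (y * x) \<in> W'"
      using mem_scale_iff[OF pos_nonzero[OF y(1)], of "a * (y * x)" W] y(2) pos_nonzero[OF y(1)] by (simp add: ac_simps)
    moreover have "a * (y * x - x') \<in> W'" using sm_mult W' that y by blast
    then have "a * (y * x) - a * x' \<in> W'" by (simp add: algebra_simps)
    then have "a * (y * x) \<in> W' \<longleftrightarrow> a * x' \<in> W'"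
      using sm_add[OF W', of "a * (y * x) - a * x'" "a * x'"] sm_diff[OF W', of "a * (y * x)" "a * (y * x) - a * x'"] by auto
    ultimately show ?thesis by blast
  qed
  then show ?thesis by (auto simp: order_of_def)
qed

text \<open>The order of a homothety class, well defined on the classes of lattice translates by
  \<open>hom_eq_ordr\<close>.\<close>

definition "cord \<xi> = (THE ord. \<exists>x W. glat W \<and> \<xi> = cl x W \<and> ord = ordr x W)"

lemma cord_cl: "glat W \<Longrightarrow> cord (cl x W) = ordr x W"
  unfolding cord_def
proof (rule the_equality)
  assume W: "glat W"
  then show "\<exists>xa Wa. glat Wa \<and> cl x W = cl xa Wa \<and> ordr x W = ordr xa Wa" by blast
  fix ord assume "\<exists>xa Wa. glat Wa \<and> cl x W = cl xa Wa \<and> ord = ordr xa Wa"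
  then show "ord = ordr x W" using W cl_eq hom_eq_ordr by metis
qed

abbreviation "Xit \<equiv> Xi_tors A sg"

lemma Xit_iff: assumes "ideal f" shows "\<xi> \<in> Xit f \<longleftrightarrow> (\<exists>x W. glat W \<and> \<xi> = cl x W \<and> f \<subseteq> ordr x W)"
  unfolding Xi_tors_def lattice_iff cl_def using torsion_iff[OF assms] by auto

lemma cl_Xit: "ideal f \<Longrightarrow> glat W \<Longrightarrow> cl x W \<in> Xit f \<longleftrightarrow> f \<subseteq> ordr x W"
  using Xit_iff cord_cl by metis

lemma Xi_iff: "\<xi> \<in> Xi A sg \<longleftrightarrow> (\<exists>x W. glat W \<and> \<xi> = cl x W \<and> ideal (ordr x W))"
proof
  assume "\<xi> \<in> Xi A sg"
  then obtain f where "ideal f" "\<xi> \<in> Xit f" by (auto simp: Xi_def)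
  then show "\<exists>x W. glat W \<and> \<xi> = cl x W \<and> ideal (ordr x W)" using Xit_iff ordr_ideal glat_sm by metis
next
  assume "\<exists>x W. glat W \<and> \<xi> = cl x W \<and> ideal (ordr x W)"
  then show "\<xi> \<in> Xi A sg" unfolding Xi_def using Xit_iff by blast
qed

lemma Xit_Xi: "ideal f \<Longrightarrow> \<xi> \<in> Xit f \<Longrightarrow> \<xi> \<in> Xi A sg" unfolding Xi_def by blast

lemma Xi_Xit: "ideal f \<Longrightarrow> \<xi> \<in> Xi A sg \<Longrightarrow> f \<subseteq> cord \<xi> \<Longrightarrow> \<xi> \<in> Xit f"
  using Xi_iff Xit_iff cord_cl by metis

lemma Xit_cord: "ideal f \<Longrightarrow> \<xi> \<in> Xit f \<Longrightarrow> f \<subseteq> cord \<xi>"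
  using Xit_iff cord_cl by metis

lemma cord_ideal: "\<xi> \<in> Xi A sg \<Longrightarrow> ideal (cord \<xi>)"
  using Xi_iff cord_cl by metis

lemma Xit_mono: "ideal f \<Longrightarrow> ideal g \<Longrightarrow> f \<subseteq> g \<Longrightarrow> Xit g \<subseteq> Xit f"
proof
  fix \<xi> assume fg: "ideal f" "ideal g" "f \<subseteq> g" and "\<xi> \<in> Xit g"
  then obtain x W where "glat W" "\<xi> = cl x W" "g \<subseteq> ordr x W" using Xit_iff[OF fg(2)] by blast
  then show "\<xi> \<in> Xit f" using cl_Xit fg by auto
qed

text \<open>With 1 = i + t, i in J and t in the order, a x = (a x) i + a (t x). So enlarging W by
  the inverse of an ideal prime to the order creates no new annihilators.\<close>

lemma ordr_iv: assumes "glat W" "ideal J" "comax J (ordr x W)" shows "ordr x (iv J \<cdot> W) = ordr x W"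
proof -
  have W: "sm W" using glat_sm assms by blast
  have mem: "a * x \<in> iv J \<cdot> W \<longleftrightarrow> (\<forall>j\<in>J. a * x * j \<in> W)" for a
    using mem_iv_mp[OF ideal_invble[OF assms(2)] W] .
  obtain i t where it: "i \<in> J" "t \<in> A" "t * x \<in> W" "i + t = 1" using assms by (auto simp: comax_def ordr_mem)
  show ?thesis
  proof (rule Set.set_eqI)
    fix a
    have "a * x \<in> W" if "a \<in> A" "\<forall>j\<in>J. a * x * j \<in> W"
    proof -
      have "a * x = a * x * i + a * (t * x)" using it(4) by (metis distrib_left mult.assoc mult.commute mult.right_neutral)
      moreover have "a * x * i + a * (t * x) \<in> W" using that it sm_mult W sm_add by blast
      ultimately show ?thesis by metis
    qed
    moreover have "\<forall>j\<in>J. a * x * j \<in> W" if "a * x \<in> W" using sm_mult2[OF W _ that] integral_sub[OF assms(2)] by blast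
    ultimately show "a \<in> ordr x (iv J \<cdot> W) \<longleftrightarrow> a \<in> ordr x W" unfolding ordr_mem mem by blast
  qed
qed

lemma ordr_one_ideal: "ideal f \<Longrightarrow> ordr 1 f = f"
  using integral_sub by (auto simp: order_of_def)

lemma ordr_one: "ideal f \<Longrightarrow> ideal I \<Longrightarrow> comax I f \<Longrightarrow> ordr 1 (iv I \<cdot> f) = f"
  using ordr_iv[OF ideal_glat, of f I 1] ordr_one_ideal by simp

text \<open>The pair \<open>a, b\<close> in the definition of ray equivalence enters only through \<open>y = b / a\<close>, see \<open>ray_equiv_iff\<close>.\<close>

definition req :: "'k set \<Rightarrow> 'k set \<Rightarrow> 'k set \<Rightarrow> bool" where
  "req f I J \<longleftrightarrow> (\<exists>y. pos y \<and> y *o J = I \<and> (\<forall>j\<in>J. (y - 1) * j \<in> f))"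

lemma glat_iv_mul: "ideal I \<Longrightarrow> glat W \<Longrightarrow> glat (iv I \<cdot> W)"
  using glat_mul[OF glat_iv[OF ideal_glat]] .

text \<open>A positive y carries 1 + I^-1 f to 1 + J^-1 f exactly when y J = I and y - 1 lies in
  J^-1 f, that is, (y - 1) J lies in f. So ray classes modulo f label the classes of order f without
  repetition.\<close>

lemma cl_one_eq: assumes "ideal f" "ideal I" "ideal J"
  shows "cl 1 (iv I \<cdot> f) = cl 1 (iv J \<cdot> f) \<longleftrightarrow> req f I J"
proof -
  have f: "invble f" "sm f" and I: "invble I" "sm I" and J: "invble J" "sm J"
    using assms ideal_invble integral_sm by blast+
  have *: "y *o (iv I \<cdot> f) = iv J \<cdot> f \<longleftrightarrow> y *o J = I" if "y \<noteq> 0" for y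
  proof -
    have "y *o (iv I \<cdot> f) = iv J \<cdot> f \<longleftrightarrow> f \<cdot> (y *o iv I) = f \<cdot> iv J"
      by (simp add: mp_scale2 mp_comm)
    also have "\<dots> \<longleftrightarrow> y *o iv I = iv J" using mp_eq_cancel[OF f(1) sm_scale[OF sm_iv] sm_iv] .
    also have "\<dots> \<longleftrightarrow> inverse y *o I = J"
    proof
      assume "y *o iv I = iv J"
      then have "iv (y *o iv I) = J" using iv_iv J by simp
      then show "inverse y *o I = J" using iv_scale[OF that invble_iv[OF I(1)]] iv_iv I by simp
    next
      assume "inverse y *o I = J"
      then have "iv J = inverse (inverse y) *o iv I" using iv_scale[of "inverse y" I] that I by auto
      then show "y *o iv I = iv J" by simp
    qed
    also have "\<dots> \<longleftrightarrow> y *o J = I" using scale_flip[of y J I] scale_flip[of "inverse y" I J] that by auto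
    finally show ?thesis .
  qed
  have "cl 1 (iv I \<cdot> f) = cl 1 (iv J \<cdot> f) \<longleftrightarrow> hom_eq 1 (iv I \<cdot> f) 1 (iv J \<cdot> f)"
    using assms ideal_glat by (intro cl_eq glat_iv_mul) auto
  also have "\<dots> \<longleftrightarrow> req f I J"
    unfolding hom_eq_def req_def mem_iv_mp[OF J(1) f(2)] using * pos_nonzero by auto
  finally show ?thesis .
qed

text \<open>A positive representative x + w can be scaled to 1, so the class is [1 + V] with f
  inside V, and I = f V^-1 is the required ideal. A prime p containing both I and f would put f p^-1
  into V, making the order larger than f.\<close>

lemma cl_one_surj: assumes "glat W" "ordr x W = f" "ideal f"
  shows "\<exists>I. ideal I \<and> comax I f \<and> cl x W = cl 1 (iv I \<cdot> f)"
proof -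
  obtain w where w: "w \<in> W" "pos (x + w)" using ex_pos assms by blast
  define y where "y = inverse (x + w)"
  have y: "pos y" "y \<noteq> 0" "y * (x + w) = 1" using w pos_inverse pos_nonzero by (auto simp: y_def)
  define V where "V = y *o W"
  have V: "glat V" unfolding V_def using glat_scale assms y by blast
  have "y * x - 1 = - (y * w)" using y(3) by (simp add: algebra_simps)
  moreover have "y * w \<in> V" using w V_def by blast
  ultimately have "y * x - 1 \<in> V" using sm_uminus[OF glat_sm[OF V]] by simp
  then have c: "cl x W = cl 1 V" using cl_scale[OF y(1) assms(1)] cl_shift[OF _ V] V_def by metis
  then have o: "ordr 1 V = f" using assms cord_cl V by metis
  then have fV: "f \<subseteq> V" by (auto simp: order_of_def)
  have f: "invble f" "sm f" using assms ideal_invble integral_sm by blast+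
  have iV: "invble V" "sm V" using glat_invble glat_sm V by blast+
  define I where "I = f \<cdot> iv V"
  have gI: "glat I" unfolding I_def using glat_mul ideal_glat glat_iv assms V by blast
  have "I \<subseteq> A" unfolding I_def using mp_mono[OF fV subset_refl] mp_iv_sub by blast
  then have I: "ideal I" using ideal_subset_glat gI by blast
  have "iv I = iv f \<cdot> V" unfolding I_def using iv_mul[OF f(1) invble_iv[OF iV(1)]] iv_iv[OF iV(1)] by simp
  then have eq: "iv I \<cdot> f = V"
    using cancel_iv1[OF f(1) iV(2)] by (simp add: mp_ac)
  have "comax I f"
  proof (rule ccontr)
    assume "\<not> comax I f"
    then obtain p where p: "maxi p" "I \<subseteq> p" "f \<subseteq> p" using not_com_maxi I assms by blast
    have pi: "ideal p" "invble p" using p maxi_ideal ideal_invble by blast+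
    have q: "ideal (f \<cdot> iv p)" "ideal (I \<cdot> iv p)" using ideal_quot pi assms I p by blast+
    have "f \<cdot> iv p = (I \<cdot> iv p) \<cdot> V"
      unfolding I_def using invble_mp2[OF iV(1)] mp_one2[OF f(2)] by (metis mp_assoc mp_comm)
    then have "f \<cdot> iv p \<subseteq> V" using mp_int_sub[OF q(2) iV(2)] by simp
    then have "f \<cdot> iv p \<subseteq> f" using o integral_sub[OF q(1)] by (auto simp: order_of_def)
    moreover have "f \<subseteq> f \<cdot> iv p" using sub_mp_iv f pi integral_sub by blast
    moreover have "p \<cdot> (f \<cdot> iv p) = f" using cancel_iv1[OF pi(2) f(2)] by (simp add: mp_comm)
    ultimately show False using maxi_proper_mul[OF p(1) ideal_glat[OF assms(3)]] by simp
  qed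
  then show ?thesis using I c eq by auto
qed

lemma finite_cosets: assumes "glat V" "glat M" "V \<subseteq> M" shows "\<exists>C. finite C \<and> (\<forall>x\<in>M. \<exists>c\<in>C. x - c \<in> V)"
proof -
  obtain l I where l: "l \<noteq> 0" "ideal I" "M = l *o I" using assms glat_def by blast
  obtain v where v: "v \<in> V" "v \<noteq> 0" using invble_nonzero glat_invble assms by blast
  have MA: "x / l \<in> A" if "x \<in> M" for x
    using that l mem_scale_iff[OF l(1)] integral_sub[OF l(2)] by auto
  have "v / l \<in> A" "v / l \<noteq> 0" using MA v assms l by auto
  then obtain C where C: "finite C" "\<forall>x\<in>A. \<exists>c\<in>C. x - c \<in> (v / l) *o A" using fin_quot by blast
  have "\<exists>c\<in>(\<lambda>c. l * c) ` C. x - c \<in> V" if xM: "x \<in> M" for x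
  proof -
    obtain c where c: "c \<in> C" "x / l - c \<in> (v / l) *o A" using bspec[OF C(2) MA[OF xM]] by blast
    then obtain a where a: "a \<in> A" "x / l - c = (v / l) * a" unfolding elt_set_times_def by blast
    note ca = c(1) a
    then have "l * (x / l - c) = l * ((v / l) * a)" by simp
    then have "x - l * c = v * a" using l(1) by (simp add: algebra_simps)
    moreover have "v * a \<in> V" using ca(2) sm_mult2[OF glat_sm[OF assms(1)] _ v(1)] by blast
    ultimately show ?thesis using ca(1) by (intro bexI[of _ "l * c"]) auto
  qed
  then show ?thesis using C by blast
qed

theorem finite_Xit: assumes f: "ideal f" shows "finite (Xit f)"
proof -
  obtain R where R: "finite R" "\<And>W. glat W \<Longrightarrow> \<exists>J\<in>R. \<exists>k. k \<noteq> 0 \<and> glat J \<and> W = k *o J"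
    using finite_classes by blast
  \<comment> \<open>A scaling factor k is its sign times a positive element, so up to positive
    scaling the representatives must be multiplied by roots of unity.\<close>
  define R' where "R' = {W. glat W \<and> W \<in> (\<Union>z\<in>roots_of_unity. (\<lambda>J. z *o J) ` R)}"
  have fin: "finite R'"
    by (rule finite_subset[of _ "\<Union>z\<in>roots_of_unity. (\<lambda>J. z *o J) ` R"]) (use R finite_roots in \<open>auto simp: R'_def\<close>)
  have "\<exists>C. finite C \<and> (\<forall>x. f \<subseteq> ordr x W \<longrightarrow> (\<exists>c\<in>C. x - c \<in> W))" if "W \<in> R'" for W
  proof -
    have W: "glat W" "sm W" using that R'_def glat_sm by blast+
    have "W \<subseteq> iv f \<cdot> W" using sub_mp_iv[OF W(2) integral_sub[OF f]] by (simp add: mp_comm)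
    then obtain C where "finite C" "\<forall>x\<in>iv f \<cdot> W. \<exists>c\<in>C. x - c \<in> W"
      using finite_cosets[OF W(1) glat_iv_mul[OF f W(1)]] by blast
    moreover have "x \<in> iv f \<cdot> W" if "f \<subseteq> ordr x W" for x
      using that mem_iv_mp[OF ideal_invble[OF f] W(2)] by (auto simp: order_of_def mult.commute)
    ultimately show ?thesis by blast
  qed
  then obtain C where C: "\<And>W. W \<in> R' \<Longrightarrow> finite (C W) \<and> (\<forall>x. f \<subseteq> ordr x W \<longrightarrow> (\<exists>c\<in>C W. x - c \<in> W))" by metis
  have "Xit f \<subseteq> (\<Union>W\<in>R'. (\<lambda>c. cl c W) ` C W)"
  proof
    fix \<xi> assume "\<xi> \<in> Xit f"
    then obtain x W where W: "glat W" "\<xi> = cl x W" "f \<subseteq> ordr x W" using Xit_iff f by blast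
    obtain J k where k: "J \<in> R" "k \<noteq> 0" "glat J" "W = k *o J" using R W by blast
    define y where "y = inverse (k * inverse (sg k))"
    have y: "pos y" unfolding y_def by (rule pos_inverse[OF pos_sg[OF k(2)]])
    have "y * k = sg k" using k by (simp add: y_def)
    then have yW: "y *o W = sg k *o J" using k by (simp add: set_times_rearrange2)
    have g: "glat (y *o W)" using glat_scale W y pos_nonzero by blast
    then have R': "y *o W \<in> R'" unfolding R'_def using yW sg_root[OF k(2)] k by auto
    have c: "\<xi> = cl (y * x) (y *o W)" using W cl_scale[OF y W(1)] by simp
    then have "f \<subseteq> ordr (y * x) (y *o W)" using W g cord_cl by metis
    then obtain c where "c \<in> C (y *o W)" "y * x - c \<in> y *o W" using C R' by blast
    then have "\<xi> = cl c (y *o W)" "c \<in> C (y *o W)" using c cl_shift g by auto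
    then show "\<xi> \<in> (\<Union>W\<in>R'. (\<lambda>c. cl c W) ` C W)" using R' by blast
  qed
  then show ?thesis using finite_subset fin C by (metis (no_types, lifting) finite_UN_I finite_imageI)
qed

section \<open>Ray classes\<close>

lemma req_refl: "ideal f \<Longrightarrow> req f I I"
  unfolding req_def using pos_one sm_zero[OF integral_sm] by (intro exI[of _ 1]) auto

lemma req_sym: assumes "ideal f" "req f I J" shows "req f J I"
proof -
  obtain y where y: "pos y" "y *o J = I" "\<forall>j\<in>J. (y - 1) * j \<in> f" using assms req_def by blast
  have y0: "y \<noteq> 0" using y pos_nonzero by blast
  have "(inverse y - 1) * i \<in> f" if "i \<in> I" for i
  proof -
    have "i \<in> y *o J" using that y(2) by simp
    then obtain j where j: "j \<in> J" "i = y * j" unfolding elt_set_times_def by blast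
    have "(inverse y - 1) * i = - ((y - 1) * j)" using y0 j by (simp add: algebra_simps)
    then show ?thesis using sm_uminus[OF integral_sm[OF assms(1)]] y(3) j by simp
  qed
  then show ?thesis unfolding req_def using pos_inverse[OF y(1)] scale_flip[OF y0 y(2)] by blast
qed

lemma req_trans: assumes "ideal f" "req f I J" "req f J K" shows "req f I K"
proof -
  obtain y where y: "pos y" "y *o J = I" "\<forall>j\<in>J. (y - 1) * j \<in> f" using assms req_def by blast
  obtain z where z: "pos z" "z *o K = J" "\<forall>j\<in>K. (z - 1) * j \<in> f" using assms req_def by blast
  have "(y * z - 1) * k \<in> f" if "k \<in> K" for k
  proof -
    have "z * k \<in> J" using z(2) that by blast
    then have "(y - 1) * (z * k) + (z - 1) * k \<in> f" using sm_add[OF integral_sm[OF assms(1)]] y(3) z(3) that by blast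
    then show ?thesis by (simp add: algebra_simps)
  qed
  moreover have "(y * z) *o K = I" using y z by (simp add: set_times_rearrange2[symmetric])
  ultimately show ?thesis unfolding req_def using pos_mult y z by blast
qed

lemma req_mul: assumes "ideal f" "req f I J" "ideal M" shows "req f (I \<cdot> M) (J \<cdot> M)"
proof -
  obtain y where y: "pos y" "y *o J = I" "\<forall>j\<in>J. (y - 1) * j \<in> f" using assms req_def by blast
  have "J \<cdot> M \<subseteq> {x. \<forall>w\<in>{y - 1}. x * w \<in> f}"
  proof (rule mp_least[OF sm_colon[OF integral_sm[OF assms(1)]]], clarify)
    fix a w w' assume "a \<in> J" "w \<in> M"
    then have "(y - 1) * a * w \<in> f" using y(3) sm_mult2[OF integral_sm[OF assms(1)]] integral_sub[OF assms(3)] by blast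
    then show "a * w * (y - 1) \<in> f" by (simp add: ac_simps)
  qed
  then have "\<forall>j\<in>J \<cdot> M. (y - 1) * j \<in> f" by (auto simp: mult.commute)
  then show ?thesis unfolding req_def using y mp_scale by metis
qed

lemma req_mul2: "ideal f \<Longrightarrow> req f I J \<Longrightarrow> ideal M \<Longrightarrow> req f (M \<cdot> I) (M \<cdot> J)"
  using req_mul mp_comm by metis

lemma req_mono: "req f I J \<Longrightarrow> f \<subseteq> g \<Longrightarrow> req g I J"
  unfolding req_def by blast

lemma ex_nonzero_cong: assumes "ideal f" "ideal J" "comax J f" shows "\<exists>j\<in>J. j \<noteq> 0 \<and> j - 1 \<in> f"
proof -
  obtain j t where j: "j \<in> J" "t \<in> f" "j + t = 1" using assms comax_def by blast
  show ?thesis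
  proof (cases "j = 0")
    case False
    have "j - 1 = - t" using j by (simp add: algebra_simps)
    then show ?thesis using False j sm_uminus[OF integral_sm[OF assms(1)]] by auto
  next
    \<comment> \<open>If j = 0, then 1 lies in f, so f = A and any nonzero element of J satisfies
      the congruence.\<close>
    case True
    then have "f = A" using j integral_one assms by auto
    obtain i where "i \<in> J" "i \<noteq> 0" using integral_nonzero assms by blast
    then show ?thesis using \<open>f = A\<close> integral_sub[OF assms(2)] one_A diff_A by blast
  qed
qed

lemma com_elem: "ideal f \<Longrightarrow> a \<in> J \<Longrightarrow> a - 1 \<in> f \<Longrightarrow> comax J f"
  unfolding comax_def using sm_diff_swap[OF integral_sm, of f a 1]
  by (intro bexI[of _ a] bexI[of _ "1 - a"]) auto

text \<open>Given a and b, put y = b / a: then (y - 1) J lies in A and a (y - 1) J in f, and a can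
  be cancelled because it is prime to f. Conversely, a nonzero j in J congruent to 1 modulo f gives
  the pair a = j, b = y j.\<close>

lemma ray_equiv_iff: assumes f: "ideal f"
  shows "ray_equiv A sg f I J \<longleftrightarrow> ideal I \<and> ideal J \<and> comax I f \<and> comax J f \<and> req f I J"
proof
  assume r: "ray_equiv A sg f I J"
  then obtain a b where ab: "ideal I" "ideal J" "prime_to A I f" "prime_to A J f" "a \<in> A" "a \<noteq> 0" "b \<in> A" "b \<noteq> 0"
    "prime_to A (a *o A) f" "pos (b / a)" "a - b \<in> f" "a *o I = b *o J" unfolding ray_equiv_def by blast
  have sf: "sm f" using f integral_sm by blast
  have "comax (a *o A) f" using ab prime_to_iff integral_principal f by blast
  then obtain c t where ct: "c \<in> A" "t \<in> f" "a * c + t = 1" by (auto simp: comax_def elt_set_times_def)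
  have I: "(b / a) *o J = I"
  proof -
    have "inverse a *o (b *o J) = I" using scale_flip[OF ab(6,12)] .
    then show ?thesis by (simp add: set_times_rearrange2 divide_inverse mult.commute)
  qed
  have "(b / a - 1) * j \<in> f" if j: "j \<in> J" for j
  proof -
    let ?d = "(b / a - 1) * j"
    have "(b / a) * j \<in> I" using I j by blast
    then have "(b / a) * j - j \<in> A" using ab(1,2) integral_sub j diff_A by blast
    then have dA: "?d \<in> A" by (simp add: algebra_simps)
    have "a * ?d = (b - a) * j" using ab(6) by (simp add: field_simps)
    moreover have "(b - a) * j \<in> f" using sm_mult2[OF sf] sm_diff_swap[OF sf ab(11)] j integral_sub ab by blast
    ultimately have af: "a * ?d \<in> f" by (simp only:)
    have "c * (a * d) + t * d \<in> f" if "a * d \<in> f" "d \<in> A" for d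
      using sm_add[OF sf sm_mult[OF sf ct(1) that(1)] sm_mult2[OF sf that(2) ct(2)]] .
    moreover have "c * (a * d) + t * d = d" for d
    proof -
      have "c * (a * d) + t * d = (a * c + t) * d" by (simp add: algebra_simps)
      then show ?thesis using ct(3) by simp
    qed
    ultimately show ?thesis using af dA by metis
  qed
  then have "req f I J" unfolding req_def using I ab by blast
  then show "ideal I \<and> ideal J \<and> comax I f \<and> comax J f \<and> req f I J"
    using ab prime_to_iff f by blast
next
  assume r: "ideal I \<and> ideal J \<and> comax I f \<and> comax J f \<and> req f I J"
  then obtain y where y: "pos y" "y *o J = I" "\<forall>j\<in>J. (y - 1) * j \<in> f" using req_def by blast
  have sf: "sm f" using f integral_sm by blast
  obtain j where j: "j \<in> J" "j \<noteq> 0" "j - 1 \<in> f" using ex_nonzero_cong f r by blast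
  have jA: "j \<in> A" using j r integral_sub by blast
  have "y * j \<in> I" using y(2) j(1) by blast
  then have yj: "y * j \<in> A" "y * j \<noteq> 0" using r integral_sub[of I] pos_nonzero[OF y(1)] j(2) by auto
  have d: "(y - 1) * j \<in> f" using y j by blast
  then have "(y - 1) * j + (j - 1) \<in> f" using sm_add sf j by blast
  then have yj1: "y * j - 1 \<in> f" by (simp add: algebra_simps)
  have p1: "prime_to A (j *o A) f"
    using prime_to_iff[OF integral_principal[OF jA j(2)] f] com_elem[OF f _ j(3)] scale_memI[OF one_A, of j] by simp
  have p2: "prime_to A ((y * j) *o A) f"
    using prime_to_iff[OF integral_principal[OF yj] f] com_elem[OF f _ yj1] scale_memI[OF one_A, of "y * j"] by simp
  have p3: "is_positive sg (y * j / j)" using y j by simp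
  have "- ((y - 1) * j) \<in> f" using sm_uminus[OF sf d] .
  then have p4: "j - y * j \<in> f" by (simp add: algebra_simps)
  have p5: "j *o I = (y * j) *o J" using y(2) by (metis mult.commute set_times_rearrange2)
  show "ray_equiv A sg f I J"
  proof -
    have q: "ideal I" "ideal J" using r by simp_all
    have q': "prime_to A I f" "prime_to A J f"
      using prime_to_iff[OF q(1) f] prime_to_iff[OF q(2) f] r by simp_all
    have m: "j \<in> A - {0}" "y * j \<in> A - {0}" using jA j yj by simp_all
    show ?thesis unfolding ray_equiv_def
      by (intro conjI q q', rule bexI[OF _ m(1)], rule bexI[OF _ m(2)], intro conjI p1 p2 p3 p4 p5)
  qed
qed

abbreviation "rc \<equiv> ray_class A sg"
abbreviation "H \<equiv> ray_group A sg"

lemma rc_mem: "ideal f \<Longrightarrow> J \<in> rc f I \<longleftrightarrow> ideal I \<and> ideal J \<and> comax I f \<and> comax J f \<and> req f I J"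
  unfolding ray_class_def using ray_equiv_iff by simp

lemma rc_eq: assumes "ideal f" "ideal I" "ideal J" "comax I f" "comax J f"
  shows "rc f I = rc f J \<longleftrightarrow> req f I J"
proof
  assume "rc f I = rc f J"
  moreover have "J \<in> rc f J" using rc_mem req_refl assms by blast
  ultimately show "req f I J" using rc_mem assms by blast
next
  assume "req f I J"
  then have "req f I K \<longleftrightarrow> req f J K" for K
    using req_sym[OF assms(1)] req_trans[OF assms(1)] by blast
  then show "rc f I = rc f J" using rc_mem[OF assms(1)] assms by (intro Set.set_eqI) auto
qed

lemma H_carrier: "ideal f \<Longrightarrow> \<gamma> \<in> carrier (H f) \<longleftrightarrow> (\<exists>I. ideal I \<and> comax I f \<and> \<gamma> = rc f I)"
  unfolding ray_group_def using prime_to_iff by auto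

lemma H_one: "\<one>\<^bsub>H f\<^esub> = rc f A" by (simp add: ray_group_def)

lemma com_mul_ideal: "ideal I \<Longrightarrow> ideal J \<Longrightarrow> ideal f \<Longrightarrow> comax I f \<Longrightarrow> comax J f \<Longrightarrow> comax (I \<cdot> J) f"
  by (intro com_mul integral_sm integral_sub) auto

lemma req_mul_both: assumes "ideal f" "req f I I'" "req f J J'" "ideal J" "ideal I'"
  shows "req f (I \<cdot> J) (I' \<cdot> J')"
  using req_trans[OF assms(1) req_mul[OF assms(1,2,4)] req_mul2[OF assms(1,3,5)]] .

lemma H_mult: assumes "ideal f" "ideal I" "ideal J" "comax I f" "comax J f"
  shows "rc f I \<otimes>\<^bsub>H f\<^esub> rc f J = rc f (I \<cdot> J)"
proof -
  have "rc f (I' \<cdot> J') = rc f (I \<cdot> J)" if "I' \<in> rc f I" "J' \<in> rc f J" for I' J'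
  proof -
    have *: "ideal I'" "ideal J'" "comax I' f" "comax J' f" "req f I' I" "req f J' J"
      using that rc_mem assms req_sym by blast+
    show ?thesis using rc_eq[of f "I' \<cdot> J'" "I \<cdot> J"] req_mul_both integral_mul com_mul_ideal assms * by blast
  qed
  moreover have "I \<in> rc f I" "J \<in> rc f J" using rc_mem req_refl assms by blast+
  ultimately have "(\<Union>I'\<in>rc f I. \<Union>J'\<in>rc f J. rc f (I' \<cdot> J')) = rc f (I \<cdot> J)" by blast
  then show ?thesis by (simp add: ray_group_def)
qed

lemma com_Af: "ideal f \<Longrightarrow> comax A f" using com_A integral_sm by blast

text \<open>For \<open>b \<in> I\<close> positive, \<open>b \<equiv> 1\<close> mod \<open>f\<close>, the ideal \<open>b I\<inverse>\<close> represents the inverse class.\<close>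

lemma inverse_class: assumes "ideal f" "ideal g" "ideal I" "comax I f"
  shows "\<exists>J. ideal J \<and> comax J f \<and> comax J g \<and> req f (I \<cdot> J) A"
proof -
  have sf: "sm f" and sI: "sm I" "I \<subseteq> A" "invble I" and sg: "sm g" "g \<subseteq> A" and fA: "f \<subseteq> A"
    using assms integral_sm integral_sub ideal_invble by blast+
  obtain b0 where b0: "b0 \<in> I" "b0 - 1 \<in> f" using ex_nonzero_cong assms by blast
  \<comment> \<open>Primes dividing both f and g are settled by coprimality to f; these are the
    remaining primes dividing g.\<close>
  define S where "S = {p. maxi p \<and> g \<subseteq> p \<and> \<not> f \<subseteq> p}"
  have S: "finite S" by (rule finite_subset[OF _ finite_maxi_above[OF assms(2)]]) (auto simp: S_def)
  obtain b where b: "b - b0 \<in> f \<cdot> I" "b \<in> I" "\<forall>p\<in>S. b \<notin> p \<cdot> I"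
    using ex_coprime[OF S ideal_glat[OF assms(3)] assms(1) b0(1)] by (auto simp: S_def)
  have "glat (f \<cdot> g \<cdot> I)" using glat_mul ideal_glat assms by blast
  \<comment> \<open>A correction in f g I makes b positive and preserves the congruence modulo f and
    the behaviour at the primes in S.\<close>
  then obtain n where n: "n \<in> f \<cdot> g \<cdot> I" "pos (b + n)" using ex_pos by blast
  have "f \<cdot> g \<cdot> I \<subseteq> f \<cdot> g" using mp_sub[OF mp_sm sI(2)] mp_comm by metis
  also have "f \<cdot> g \<subseteq> f" using mp_sub[OF sf sg(2)] mp_comm by metis
  finally have nf: "n \<in> f" using n by blast
  have "f \<cdot> g \<cdot> I \<subseteq> g \<cdot> I" using mp_mono[OF mp_sub[OF sg(1) fA] subset_refl] .
  then have ng: "n \<in> g \<cdot> I" using n by blast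
  have nI: "n \<in> I" using ng mp_sub[OF sI(1) sg(2)] by blast
  define c where "c = b + n"
  have cI: "c \<in> I" unfolding c_def using sm_add sI b nI by blast
  have "f \<cdot> I \<subseteq> f" using mp_sub[OF sf sI(2)] mp_comm by metis
  then have "(b - b0) + (b0 - 1) + n \<in> f" using sm_add[OF sf] b b0 nf by blast
  moreover have "(b - b0) + (b0 - 1) + n = c - 1" by (simp add: c_def)
  ultimately have c1: "c - 1 \<in> f" by metis
  have c0: "c \<noteq> 0" unfolding c_def by (rule pos_nonzero[OF n(2)])
  have cp: "c \<notin> p \<cdot> I" if "p \<in> S" for p
  proof
    assume "c \<in> p \<cdot> I"
    moreover have "n \<in> p \<cdot> I" using ng mp_mono[of g p I I] that by (auto simp: S_def)
    ultimately have "c - n \<in> p \<cdot> I" using sm_diff mp_sm by blast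
    then show False using b(3) that by (simp add: c_def)
  qed
  define J where "J = c *o iv I"
  have IJ: "I \<cdot> J = c *o A" unfolding J_def by (simp add: mp_scale2 invble_mp sI)
  have gJ: "glat J" unfolding J_def using glat_scale glat_iv ideal_glat assms c0 by blast
  have "J \<subseteq> A" unfolding J_def using cI by (auto simp: elt_set_times_def ideal_inv_def mult.commute)
  then have J: "ideal J" using ideal_subset_glat gJ by blast
  have "1 \<in> iv I" using sI(2) by (auto simp: ideal_inv_def)
  then have "c \<in> J" unfolding J_def using scale_memI[of 1 "iv I" c] by simp
  then have Jf: "comax J f" using com_elem assms c1 by blast
  have Jg: "comax J g"
  proof (rule ccontr)
    assume "\<not> comax J g"
    then obtain p where p: "maxi p" "J \<subseteq> p" "g \<subseteq> p" using not_com_maxi J assms by blast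
    then have "p \<in> S" using com_not_sub Jf S_def by blast
    moreover have "c \<in> I \<cdot> J" unfolding IJ using scale_memI[OF one_A, of c] by simp
    then have "c \<in> p \<cdot> I" using mp_mono[OF subset_refl p(2), of I] mp_comm by blast
    ultimately show False using cp by blast
  qed
  have "req f (I \<cdot> J) A" unfolding req_def IJ
    using n(2) sm_mult2[OF sf _ c1] by (intro exI[of _ c]) (auto simp: c_def)
  then show ?thesis using J Jf Jg by blast
qed

text \<open>\<open>inverse_class\<close> can make its result prime to g. Inverting twice returns to
  the class of I with a representative of that kind.\<close>

lemma coprime_rep: assumes "ideal f" "ideal g" "ideal I" "comax I f"
  shows "\<exists>J. ideal J \<and> comax J f \<and> comax J g \<and> req f I J"
proof -
  obtain J1 where J1: "ideal J1" "comax J1 f" "req f (I \<cdot> J1) A" using inverse_class[OF assms] by blast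
  obtain J where J: "ideal J" "comax J f" "comax J g" "req f (J1 \<cdot> J) A"
    using inverse_class[OF assms(1,2) J1(1,2)] by blast
  have 1: "req f (I \<cdot> (J1 \<cdot> J)) J"
    using req_mul[OF assms(1) J1(3) J(1)] by (simp only: mp_assoc mp_one[OF integral_sm[OF J(1)]])
  have 2: "req f (I \<cdot> (J1 \<cdot> J)) I"
    using req_mul2[OF assms(1) J(4) assms(3)] by (simp only: mp_one2[OF integral_sm[OF assms(3)]])
  have "req f I J" using req_trans[OF assms(1) req_sym[OF assms(1) 2] 1] .
  then show ?thesis using J by blast
qed

theorem H_comm_group: assumes f: "ideal f" shows "comm_group (H f)"
proof (rule comm_groupI)
  fix x y assume "x \<in> carrier (H f)" "y \<in> carrier (H f)"
  then obtain I J where IJ: "ideal I" "comax I f" "x = rc f I" "ideal J" "comax J f" "y = rc f J"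
    unfolding H_carrier[OF f] by blast
  have "ideal (I \<cdot> J)" "comax (I \<cdot> J) f" using IJ f integral_mul com_mul_ideal by auto
  then show "x \<otimes>\<^bsub>H f\<^esub> y \<in> carrier (H f)" using H_mult[OF f] IJ H_carrier[OF f] by auto
  show "x \<otimes>\<^bsub>H f\<^esub> y = y \<otimes>\<^bsub>H f\<^esub> x" using IJ f mp_comm[of I J] by (simp add: H_mult)
  fix z assume "z \<in> carrier (H f)"
  then obtain K where K: "ideal K" "comax K f" "z = rc f K" unfolding H_carrier[OF f] by blast
  show "x \<otimes>\<^bsub>H f\<^esub> y \<otimes>\<^bsub>H f\<^esub> z = x \<otimes>\<^bsub>H f\<^esub> (y \<otimes>\<^bsub>H f\<^esub> z)"
    using IJ K f by (simp add: H_mult integral_mul com_mul_ideal mp_assoc)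
next
  show "\<one>\<^bsub>H f\<^esub> \<in> carrier (H f)" using H_one H_carrier f integral_A com_Af by metis
next
  fix x assume "x \<in> carrier (H f)"
  then obtain I where I: "ideal I" "comax I f" "x = rc f I" unfolding H_carrier[OF f] by blast
  show "\<one>\<^bsub>H f\<^esub> \<otimes>\<^bsub>H f\<^esub> x = x"
    using I f by (simp add: H_one H_mult integral_A com_Af mp_one integral_sm)
  obtain J where J: "ideal J" "comax J f" "req f (I \<cdot> J) A" using inverse_class[OF f f I(1,2)] by blast
  have "rc f J \<otimes>\<^bsub>H f\<^esub> x = rc f (I \<cdot> J)" using I J f mp_comm[of I J] by (simp add: H_mult)
  also have "\<dots> = rc f A" using rc_eq[OF f integral_mul integral_A com_mul_ideal com_Af] I J f by blast
  finally show "\<exists>y\<in>carrier (H f). y \<otimes>\<^bsub>H f\<^esub> x = \<one>\<^bsub>H f\<^esub>" using J H_carrier f H_one by metis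
qed

text \<open>The map sending the class of I to [1 + I^-1 f] embeds the group into the finite set
  \<open>Xit f\<close>.\<close>

lemma H_finite: assumes f: "ideal f" shows "finite (carrier (H f))"
proof -
  define h where "h \<gamma> = (SOME \<xi>. \<exists>I. ideal I \<and> comax I f \<and> \<gamma> = rc f I \<and> \<xi> = cl 1 (iv I \<cdot> f))" for \<gamma>
  have h: "\<exists>I. ideal I \<and> comax I f \<and> \<gamma> = rc f I \<and> h \<gamma> = cl 1 (iv I \<cdot> f)" if "\<gamma> \<in> carrier (H f)" for \<gamma>
    unfolding h_def by (rule someI_ex) (use that H_carrier f in blast)
  have "inj_on h (carrier (H f))"
  proof (rule inj_onI)
    fix x y assume xy: "x \<in> carrier (H f)" "y \<in> carrier (H f)" "h x = h y"
    obtain I J where "ideal I" "comax I f" "x = rc f I" "h x = cl 1 (iv I \<cdot> f)"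
      "ideal J" "comax J f" "y = rc f J" "h y = cl 1 (iv J \<cdot> f)" using h xy by metis
    then show "x = y" using xy(3) cl_one_eq rc_eq f by metis
  qed
  moreover have "h ` carrier (H f) \<subseteq> Xit f"
  proof
    fix \<xi> assume "\<xi> \<in> h ` carrier (H f)"
    then obtain I where "ideal I" "comax I f" "\<xi> = cl 1 (iv I \<cdot> f)" using h by blast
    then show "\<xi> \<in> Xit f" using cl_Xit[OF f] ordr_one f glat_iv_mul ideal_glat by blast
  qed
  ultimately show ?thesis using finite_Xit[OF f] finite_subset finite_imageD by blast
qed

subsection \<open>The limit group and its action\<close>

abbreviation "GG \<equiv> ray_lim A sg"

lemma GG_carrier: "\<sigma> \<in> carrier GG \<longleftrightarrow> \<sigma> \<in> (\<Pi>\<^sub>E f\<in>{f. ideal f}. carrier (H f)) \<and>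
   (\<forall>f g. ideal f \<longrightarrow> ideal g \<longrightarrow> g \<subseteq> f \<longrightarrow> (\<forall>I\<in>\<sigma> g. \<sigma> f = rc f I))"
  unfolding ray_lim_def Let_def using dvd_iff by auto

lemma GG_H: "\<sigma> \<in> carrier GG \<Longrightarrow> ideal f \<Longrightarrow> \<sigma> f \<in> carrier (H f)"
  unfolding GG_carrier by auto

lemma GG_compat: "\<sigma> \<in> carrier GG \<Longrightarrow> ideal f \<Longrightarrow> ideal g \<Longrightarrow> g \<subseteq> f \<Longrightarrow> I \<in> \<sigma> g \<Longrightarrow> \<sigma> f = rc f I"
  unfolding GG_carrier by blast

lemma rc_self: "ideal f \<Longrightarrow> ideal I \<Longrightarrow> comax I f \<Longrightarrow> I \<in> rc f I"
  using rc_mem req_refl by simp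

lemma GG_rep: assumes "\<sigma> \<in> carrier GG" "ideal f"
  shows "\<exists>I. ideal I \<and> comax I f \<and> \<sigma> f = rc f I \<and> I \<in> \<sigma> f"
proof -
  obtain I where "ideal I" "comax I f" "\<sigma> f = rc f I" using GG_H[OF assms] unfolding H_carrier[OF assms(2)] by blast
  then show ?thesis using rc_self[OF assms(2)] by auto
qed

lemma GG_mem: assumes "\<sigma> \<in> carrier GG" "ideal f" "I \<in> \<sigma> f" shows "ideal I" "comax I f" "\<sigma> f = rc f I"
proof -
  obtain J where J: "ideal J" "comax J f" "\<sigma> f = rc f J" using GG_rep[OF assms(1,2)] by blast
  then show "ideal I" "comax I f" using assms(3) rc_mem[OF assms(2)] by auto
  show "\<sigma> f = rc f I" using GG_compat[OF assms(1,2,2) subset_refl assms(3)] .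
qed

lemma GG_mult: "ideal f \<Longrightarrow> (\<sigma> \<otimes>\<^bsub>GG\<^esub> \<tau>) f = \<sigma> f \<otimes>\<^bsub>H f\<^esub> \<tau> f"
  by (simp add: ray_lim_def Let_def product_group_def)

lemma rc_down: assumes "ideal f" "ideal g" "g \<subseteq> f" "ideal I" "comax I g" "J \<in> rc g I" shows "rc f J = rc f I"
proof -
  have J: "ideal J" "comax J g" "req g I J" using assms(6) rc_mem[OF assms(2)] by auto
  have "comax I f" "comax J f" using com_mono[OF assms(5) subset_refl assms(3)] com_mono[OF J(2) subset_refl assms(3)] by auto
  then show ?thesis using rc_eq[OF assms(1,4) J(1)] req_mono[OF J(3) assms(3)] by simp
qed

lemma GG_mult_closed: assumes s: "\<sigma> \<in> carrier GG" and t: "\<tau> \<in> carrier GG" shows "\<sigma> \<otimes>\<^bsub>GG\<^esub> \<tau> \<in> carrier GG"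
  unfolding GG_carrier
proof (intro conjI allI impI ballI)
  show "\<sigma> \<otimes>\<^bsub>GG\<^esub> \<tau> \<in> (\<Pi>\<^sub>E f\<in>{f. ideal f}. carrier (H f))"
  proof (rule PiE_I)
    fix f assume "f \<in> {f. ideal f}"
    then have f: "ideal f" by simp
    interpret comm_group "H f" by (rule H_comm_group[OF f])
    show "(\<sigma> \<otimes>\<^bsub>GG\<^esub> \<tau>) f \<in> carrier (H f)" unfolding GG_mult[OF f] using GG_H[OF s f] GG_H[OF t f] by simp
  next
    fix f assume "f \<notin> {f. ideal f}"
    then show "(\<sigma> \<otimes>\<^bsub>GG\<^esub> \<tau>) f = undefined" by (simp add: ray_lim_def Let_def product_group_def)
  qed
next
  fix f g K assume f: "ideal f" and g: "ideal g" and gf: "g \<subseteq> f" and K: "K \<in> (\<sigma> \<otimes>\<^bsub>GG\<^esub> \<tau>) g"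
  obtain I where I: "ideal I" "comax I g" "\<sigma> g = rc g I" "I \<in> \<sigma> g" using GG_rep[OF s g] by blast
  obtain J where J: "ideal J" "comax J g" "\<tau> g = rc g J" "J \<in> \<tau> g" using GG_rep[OF t g] by blast
  have IJ: "ideal (I \<cdot> J)" "comax (I \<cdot> J) g" using integral_mul[OF I(1) J(1)] com_mul_ideal[OF I(1) J(1) g I(2) J(2)] by auto
  have "K \<in> rc g (I \<cdot> J)" using K H_mult[OF g I(1) J(1) I(2) J(2)] unfolding GG_mult[OF g] I(3) J(3) by simp
  then have "rc f K = rc f (I \<cdot> J)" using rc_down[OF f g gf IJ] by blast
  moreover have "comax I f" "comax J f" using com_mono[OF I(2) subset_refl gf] com_mono[OF J(2) subset_refl gf] by auto
  then have "rc f (I \<cdot> J) = rc f I \<otimes>\<^bsub>H f\<^esub> rc f J" using H_mult[OF f I(1) J(1)] by simp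
  moreover have "\<sigma> f = rc f I" "\<tau> f = rc f J" using GG_compat[OF s f g gf I(4)] GG_compat[OF t f g gf J(4)] by auto
  ultimately show "(\<sigma> \<otimes>\<^bsub>GG\<^esub> \<tau>) f = rc f K" unfolding GG_mult[OF f] by simp
qed

text \<open>As \<open>A\<close> is countable, the ideals \<open>f a\<^sub>0 \<dots> a\<^sub>n A\<close> for an enumeration of \<open>A - {0}\<close> are cofinal; a compatible
  system is built along this chain.\<close>

theorem GG_surj: assumes f: "ideal f" and \<gamma>: "\<gamma> \<in> carrier (H f)" shows "\<exists>\<sigma>\<in>carrier GG. \<sigma> f = \<gamma>"
proof -
  have inf: "infinite (A - {0})" using infinite_A by simp
  define a where "a = from_nat_into (A - {0})"
  have a: "range a = A - {0}" unfolding a_def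
    using infinite_imp_nonempty[OF inf] countable_A by (intro range_from_nat_into) auto
  define F where "F = rec_nat f (\<lambda>n F. a n *o F)"
  have F0: "F 0 = f" and FS: "F (Suc n) = a n *o F n" for n by (simp_all add: F_def)
  have an: "a n \<in> A" "a n \<noteq> 0" for n using a by blast+
  have F: "ideal (F n)" for n
  proof (induction n)
    case 0 then show ?case using f F0 by simp
  next
    case (Suc n)
    have "(a n *o A) \<cdot> F n = F (Suc n)" using mp_principal[OF integral_sm[OF Suc]] FS by simp
    then show ?case using integral_mul[OF integral_principal[OF an] Suc] by metis
  qed
  have Fdec: "F (Suc n) \<subseteq> F n" for n
    unfolding FS using sm_mult[OF integral_sm[OF F] an(1)] by (auto simp: elt_set_times_def)
  have Fmono: "F m \<subseteq> F n" if "n \<le> m" for m n using that Fdec by (rule lift_Suc_antimono_le[rotated])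
  have cof: "\<exists>n. F n \<subseteq> h" if "ideal h" for h
  proof -
    obtain b where b: "b \<in> h" "b \<noteq> 0" using integral_nonzero[OF \<open>ideal h\<close>] by blast
    then have "b \<in> range a" unfolding a using integral_sub[OF \<open>ideal h\<close>] by blast
    then obtain n where n: "b = a n" by blast
    have "F (Suc n) \<subseteq> h" unfolding FS using sm_mult2[OF integral_sm[OF \<open>ideal h\<close>] _ b(1)] integral_sub[OF F] n
      by (auto simp: elt_set_times_def)
    then show ?thesis by blast
  qed
  obtain I0 where I0: "ideal I0" "comax I0 f" "\<gamma> = rc f I0" using \<gamma> unfolding H_carrier[OF f] by blast
  have "\<exists>I. \<forall>n. (ideal (I n) \<and> comax (I n) (F n) \<and> (n = 0 \<longrightarrow> I n = I0)) \<and> req (F n) (I n) (I (Suc n))"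
  proof (rule dependent_nat_choice)
    show "\<exists>x. ideal x \<and> comax x (F 0) \<and> (0 = 0 \<longrightarrow> x = I0)" using I0 F0 by auto
    fix x n assume "ideal x \<and> comax x (F n) \<and> (n = 0 \<longrightarrow> x = I0)"
    then show "\<exists>y. (ideal y \<and> comax y (F (Suc n)) \<and> (Suc n = 0 \<longrightarrow> y = I0)) \<and> req (F n) x y"
      using coprime_rep[OF F F, of x n "Suc n"] by auto
  qed
  then obtain I where I: "\<And>n. ideal (I n)" "\<And>n. comax (I n) (F n)" "I 0 = I0" "\<And>n. req (F n) (I n) (I (Suc n))" by blast
  have rq: "req (F n) (I n) (I (n + k))" for n k
  proof (induction k)
    case 0 then show ?case using req_refl[OF F] by simp
  next
    case (Suc k)
    have "req (F n) (I (n + k)) (I (Suc (n + k)))" using req_mono[OF I(4) Fmono] by simp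
    then show ?case using req_trans[OF F Suc] by simp
  qed
  \<comment> \<open>Every n with \<open>F n\<close> inside h gives the same class, since later
    members of the chain are equivalent to \<open>I n\<close> modulo \<open>F n\<close>; the least n
    is merely a definite choice.\<close>
  define \<sigma> where "\<sigma> h = (if ideal h then rc h (I (LEAST n. F n \<subseteq> h)) else undefined)" for h
  have sig: "\<sigma> h = rc h (I n)" "comax (I n) h" if h: "ideal h" "F n \<subseteq> h" for h n
  proof -
    let ?m = "LEAST n. F n \<subseteq> h"
    have m: "F ?m \<subseteq> h" "?m \<le> n" using LeastI[of "\<lambda>n. F n \<subseteq> h", OF h(2)] Least_le[of "\<lambda>n. F n \<subseteq> h", OF h(2)] by auto
    show c: "comax (I n) h" using com_mono[OF I(2) subset_refl h(2)] .
    have "comax (I ?m) h" using com_mono[OF I(2) subset_refl m(1)] .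
    moreover have "req h (I ?m) (I n)" using req_mono[OF rq m(1), of "n - ?m"] m(2) by simp
    ultimately show "\<sigma> h = rc h (I n)" using rc_eq[OF h(1) I(1) I(1)] c h by (simp add: \<sigma>_def)
  qed
  have "\<sigma> \<in> carrier GG"
    unfolding GG_carrier
  proof (intro conjI allI impI ballI)
    show "\<sigma> \<in> (\<Pi>\<^sub>E f\<in>{f. ideal f}. carrier (H f))"
    proof (rule PiE_I)
      fix h assume "h \<in> {f. ideal f}"
      then have h: "ideal h" by simp
      then obtain n where "F n \<subseteq> h" using cof by blast
      then show "\<sigma> h \<in> carrier (H h)" unfolding H_carrier[OF h] using sig[OF h] I(1) by blast
    qed (simp add: \<sigma>_def)
  next
    fix h g K assume h: "ideal h" and g: "ideal g" and gh: "g \<subseteq> h" and K: "K \<in> \<sigma> g"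
    obtain n where n: "F n \<subseteq> g" using cof g by blast
    have nh: "F n \<subseteq> h" using n gh by blast
    have "K \<in> rc g (I n)" using K sig(1)[OF g n] by simp
    then show "\<sigma> h = rc h K" using rc_down[OF h g gh I(1) sig(2)[OF g n]] sig(1)[OF h nh] by simp
  qed
  moreover have "\<sigma> f = \<gamma>" using sig(1)[OF f, of 0] F0 I(3) I0 by simp
  ultimately show ?thesis by blast
qed

lemma req_iv: assumes "ideal I" "ideal J" "pos y" "y *o J = I" shows "y *o iv I = iv J"
proof -
  have y: "y \<noteq> 0" using pos_nonzero[OF assms(3)] .
  have "iv I = inverse y *o iv J" using iv_scale[OF y ideal_invble[OF assms(2)]] assms(4) by simp
  then show ?thesis using y by (simp add: set_times_rearrange2)
qed

text \<open>The result depends neither on the presentation of the class nor on the ideal within its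
  ray class: if z J = I with (z - 1) J inside the order, then (z - 1) x J lies in W. This makes both
  the group action and, with I = J, the maps \<open>Ymap\<close> well defined.\<close>

lemma cl_iv_cong: assumes W: "glat W" and W': "glat W'" and eq: "cl x W = cl x' W'"
  and I: "ideal I" and J: "ideal J" and r: "req (ordr x W) I J"
  shows "cl x (iv I \<cdot> W) = cl x' (iv J \<cdot> W')"
proof -
  have gs: "glat (iv I \<cdot> W)" "glat (iv I \<cdot> W')" "glat (iv J \<cdot> W')"
    using glat_iv_mul I J W W' by auto
  have sub: "V \<subseteq> iv K \<cdot> V" if "ideal K" "sm V" for K V
    using sub_mp_iv[OF that(2) integral_sub[OF that(1)]] by (simp add: mp_comm)
  obtain y where y: "pos y" "y *o W = W'" "y * x - x' \<in> W'" using eq cl_eq[OF W W'] hom_eq_def by blast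
  have "y *o (iv I \<cdot> W) = iv I \<cdot> W'" using y(2) mp_scale2 by metis
  moreover have "y * x - x' \<in> iv I \<cdot> W'" using y(3) sub[OF I glat_sm[OF W']] by blast
  ultimately have "hom_eq x (iv I \<cdot> W) x' (iv I \<cdot> W')" unfolding hom_eq_def using y(1) by blast
  then have 1: "cl x (iv I \<cdot> W) = cl x' (iv I \<cdot> W')" using cl_eq[OF gs(1,2)] by simp
  have oo: "ordr x W = ordr x' W'" using eq cord_cl[OF W] cord_cl[OF W'] by metis
  obtain z where z: "pos z" "z *o J = I" "\<forall>j\<in>J. (z - 1) * j \<in> ordr x' W'" using r oo unfolding req_def by auto
  have "z *o (iv I \<cdot> W') = iv J \<cdot> W'" using req_iv[OF I J z(1,2)] mp_scale by metis
  moreover have "z * x' - x' \<in> iv J \<cdot> W'"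
    unfolding mem_iv_mp[OF ideal_invble[OF J] glat_sm[OF W']]
  proof
    fix j assume "j \<in> J"
    then have "(z - 1) * j * x' \<in> W'" using z(3) ordr_mem by blast
    then show "(z * x' - x') * j \<in> W'" by (simp add: algebra_simps)
  qed
  ultimately have "hom_eq x' (iv I \<cdot> W') x' (iv J \<cdot> W')" unfolding hom_eq_def using z(1) by blast
  then show ?thesis using 1 cl_eq[OF gs(2,3)] by simp
qed

lemma act_cl: assumes s: "\<sigma> \<in> carrier GG" and W: "glat W" and ord: "ideal (ordr x W)" and I: "I \<in> \<sigma> (ordr x W)"
  shows "act A sg \<sigma> (cl x W) = cl x (iv I \<cdot> W)"
  unfolding act_def lattice_iff cl_def[symmetric]
proof (rule the_equality)
  show "\<exists>xa Wa Ia. glat Wa \<and> cl x W = cl xa Wa \<and> Ia \<in> \<sigma> (ordr xa Wa) \<and> cl x (iv I \<cdot> W) = cl xa (iv Ia \<cdot> Wa)"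
    using W I by blast
  fix \<eta> assume "\<exists>xa Wa Ia. glat Wa \<and> cl x W = cl xa Wa \<and> Ia \<in> \<sigma> (ordr xa Wa) \<and> \<eta> = cl xa (iv Ia \<cdot> Wa)"
  then obtain x' W' J where h: "glat W'" "cl x W = cl x' W'" "J \<in> \<sigma> (ordr x' W')" "\<eta> = cl x' (iv J \<cdot> W')" by blast
  have oo: "ordr x' W' = ordr x W" using h(2) cord_cl[OF W] cord_cl[OF h(1)] by metis
  have J: "J \<in> \<sigma> (ordr x W)" using h(3) oo by simp
  have "rc (ordr x W) I = rc (ordr x W) J" using GG_mem(3)[OF s ord I] GG_mem(3)[OF s ord J] by simp
  then have "req (ordr x W) I J" using rc_eq[OF ord] GG_mem[OF s ord I] GG_mem[OF s ord J] by simp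
  then show "\<eta> = cl x (iv I \<cdot> W)"
    using cl_iv_cong[OF W h(1,2) GG_mem(1)[OF s ord I] GG_mem(1)[OF s ord J]] h(4) by simp
qed

text \<open>The definition of the action evaluates \<sigma> at the exact order. Compatibility of the
  system allows any ideal f inside the order instead, so that one level serves all of
  \<open>Xit f\<close>.\<close>

lemma act_level: assumes s: "\<sigma> \<in> carrier GG" and f: "ideal f" and W: "glat W" and ord: "f \<subseteq> ordr x W"
  and I: "ideal I" "comax I f" "\<sigma> f = rc f I"
  shows "act A sg \<sigma> (cl x W) = cl x (iv I \<cdot> W)"
proof -
  have o: "ideal (ordr x W)" using ordr_ideal[OF glat_sm[OF W] f ord] .
  have "I \<in> \<sigma> f" using I rc_self[OF f] by simp
  then have "\<sigma> (ordr x W) = rc (ordr x W) I" using GG_compat[OF s o f ord] by blast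
  moreover have "comax I (ordr x W)" using com_mono[OF I(2) subset_refl ord] .
  ultimately have "I \<in> \<sigma> (ordr x W)" using rc_self[OF o I(1)] by simp
  then show ?thesis using act_cl[OF s W o] by blast
qed

definition lift :: "'k set \<Rightarrow> 'k set set \<Rightarrow> 'k set \<Rightarrow> 'k set set" where
  "lift f \<gamma> = (SOME \<sigma>. \<sigma> \<in> carrier GG \<and> \<sigma> f = \<gamma>)"

lemma lift: assumes "ideal f" "\<gamma> \<in> carrier (H f)" shows "lift f \<gamma> \<in> carrier GG" "lift f \<gamma> f = \<gamma>"
proof -
  have "\<exists>\<sigma>. \<sigma> \<in> carrier GG \<and> \<sigma> f = \<gamma>" using GG_surj[OF assms] by blast
  from someI_ex[OF this] show "lift f \<gamma> \<in> carrier GG" "lift f \<gamma> f = \<gamma>" unfolding lift_def by auto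
qed

text \<open>On \<open>f\<close>-torsion classes the action of the limit group factors through level \<open>f\<close>, see \<open>act_ga\<close>.\<close>

definition ga :: "'k set \<Rightarrow> 'k set set \<Rightarrow> 'k set set \<Rightarrow> 'k set set" where
  "ga f \<gamma> \<xi> = act A sg (lift f \<gamma>) \<xi>"

lemma rc_H: "ideal f \<Longrightarrow> ideal I \<Longrightarrow> comax I f \<Longrightarrow> rc f I \<in> carrier (H f)"
  unfolding H_carrier by blast

lemma ga_cl: assumes f: "ideal f" and W: "glat W" and ord: "f \<subseteq> ordr x W" and I: "ideal I" "comax I f"
  shows "ga f (rc f I) (cl x W) = cl x (iv I \<cdot> W)"
  unfolding ga_def
  using act_level[OF lift(1)[OF f rc_H[OF f I]] f W ord I] lift(2)[OF f rc_H[OF f I]] by simp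

lemma act_ga: assumes s: "\<sigma> \<in> carrier GG" and f: "ideal f" and xi: "\<xi> \<in> Xit f"
  shows "act A sg \<sigma> \<xi> = ga f (\<sigma> f) \<xi>"
proof -
  obtain x W where W: "glat W" "\<xi> = cl x W" "f \<subseteq> ordr x W" using xi unfolding Xit_iff[OF f] by blast
  obtain I where I: "ideal I" "comax I f" "\<sigma> f = rc f I" using GG_rep[OF s f] by blast
  show ?thesis unfolding W(2) I(3) using act_level[OF s f W(1,3) I] ga_cl[OF f W(1,3) I(1,2)] by simp
qed

lemma ga_cord: assumes f: "ideal f" and xi: "\<xi> \<in> Xit f" and g: "\<gamma> \<in> carrier (H f)"
  shows "ga f \<gamma> \<xi> \<in> Xit f" "cord (ga f \<gamma> \<xi>) = cord \<xi>"
proof -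
  obtain x W where W: "glat W" "\<xi> = cl x W" "f \<subseteq> ordr x W" using xi unfolding Xit_iff[OF f] by blast
  obtain I where I: "ideal I" "comax I f" "\<gamma> = rc f I" using g unfolding H_carrier[OF f] by blast
  have gI: "glat (iv I \<cdot> W)" using glat_iv_mul[OF I(1) W(1)] .
  have o: "ordr x (iv I \<cdot> W) = ordr x W" using ordr_iv[OF W(1) I(1) com_mono[OF I(2) subset_refl W(3)]] .
  have e: "ga f \<gamma> \<xi> = cl x (iv I \<cdot> W)" unfolding W(2) I(3) using ga_cl[OF f W(1,3) I(1,2)] .
  show "ga f \<gamma> \<xi> \<in> Xit f" unfolding e using cl_Xit[OF f gI] o W(3) by simp
  show "cord (ga f \<gamma> \<xi>) = cord \<xi>" unfolding e unfolding W(2) using cord_cl[OF gI] cord_cl[OF W(1)] o by simp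
qed

lemma ga_mult: assumes f: "ideal f" and xi: "\<xi> \<in> Xit f" and g: "\<gamma> \<in> carrier (H f)" and d: "\<delta> \<in> carrier (H f)"
  shows "ga f (\<gamma> \<otimes>\<^bsub>H f\<^esub> \<delta>) \<xi> = ga f \<gamma> (ga f \<delta> \<xi>)"
proof -
  obtain x W where W: "glat W" "\<xi> = cl x W" "f \<subseteq> ordr x W" using xi unfolding Xit_iff[OF f] by blast
  obtain I where I: "ideal I" "comax I f" "\<gamma> = rc f I" using g unfolding H_carrier[OF f] by blast
  obtain J where J: "ideal J" "comax J f" "\<delta> = rc f J" using d unfolding H_carrier[OF f] by blast
  have gJ: "glat (iv J \<cdot> W)" using glat_iv_mul[OF J(1) W(1)] .
  have o: "ordr x (iv J \<cdot> W) = ordr x W" using ordr_iv[OF W(1) J(1) com_mono[OF J(2) subset_refl W(3)]] .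
  have "ga f \<gamma> (ga f \<delta> \<xi>) = cl x (iv I \<cdot> (iv J \<cdot> W))"
    unfolding W(2) I(3) J(3) ga_cl[OF f W(1,3) J(1,2)] using ga_cl[OF f gJ _ I(1,2), of x] o W(3) by simp
  moreover have "ga f (\<gamma> \<otimes>\<^bsub>H f\<^esub> \<delta>) \<xi> = cl x (iv (I \<cdot> J) \<cdot> W)"
    unfolding W(2) I(3) J(3) H_mult[OF f I(1) J(1) I(2) J(2)]
    using ga_cl[OF f W(1,3) integral_mul[OF I(1) J(1)] com_mul_ideal[OF I(1) J(1) f I(2) J(2)]] .
  ultimately show ?thesis using iv_mul[OF ideal_invble[OF I(1)] ideal_invble[OF J(1)]] by (simp add: mp_assoc)
qed

lemma ga_one: assumes f: "ideal f" and xi: "\<xi> \<in> Xit f" shows "ga f \<one>\<^bsub>H f\<^esub> \<xi> = \<xi>"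
proof -
  obtain x W where W: "glat W" "\<xi> = cl x W" "f \<subseteq> ordr x W" using xi unfolding Xit_iff[OF f] by blast
  show ?thesis unfolding W(2) H_one ga_cl[OF f W(1,3) integral_A com_Af[OF f]]
    by (simp add: iv_A mp_one glat_sm[OF W(1)])
qed

definition pr :: "'k set \<Rightarrow> 'k set set \<Rightarrow> 'k set set" where "pr g \<gamma> = rc g (SOME I. I \<in> \<gamma>)"

lemma pr_rc: assumes "ideal f" "ideal g" "f \<subseteq> g" "ideal I" "comax I f" shows "pr g (rc f I) = rc g I"
proof -
  have "(SOME J. J \<in> rc f I) \<in> rc f I" by (rule someI[of "\<lambda>J. J \<in> rc f I", OF rc_self[OF assms(1,4,5)]])
  then show ?thesis unfolding pr_def by (rule rc_down[OF assms(2,1,3,4,5)])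
qed

lemma pr_hom: assumes f: "ideal f" and g: "ideal g" and fg: "f \<subseteq> g" shows "pr g \<in> hom (H f) (H g)"
proof (rule homI)
  fix x assume "x \<in> carrier (H f)"
  then obtain I where I: "ideal I" "comax I f" "x = rc f I" unfolding H_carrier[OF f] by blast
  show "pr g x \<in> carrier (H g)" unfolding I(3) pr_rc[OF f g fg I(1,2)] using rc_H[OF g I(1) com_mono[OF I(2) subset_refl fg]] .
next
  fix x y assume "x \<in> carrier (H f)" "y \<in> carrier (H f)"
  then obtain I J where I: "ideal I" "comax I f" "x = rc f I" and J: "ideal J" "comax J f" "y = rc f J" unfolding H_carrier[OF f] by blast
  have c: "comax I g" "comax J g" using com_mono[OF I(2) subset_refl fg] com_mono[OF J(2) subset_refl fg] by auto
  show "pr g (x \<otimes>\<^bsub>H f\<^esub> y) = pr g x \<otimes>\<^bsub>H g\<^esub> pr g y"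
    unfolding I(3) J(3) H_mult[OF f I(1) J(1) I(2) J(2)] pr_rc[OF f g fg I(1,2)] pr_rc[OF f g fg J(1,2)]
      H_mult[OF g I(1) J(1) c] by (rule pr_rc[OF f g fg integral_mul[OF I(1) J(1)] com_mul_ideal[OF I(1) J(1) f I(2) J(2)]])
qed

text \<open>A class modulo g comes from level f as soon as it has a representative prime to f, which
  \<open>coprime_rep\<close> supplies.\<close>

lemma pr_surj: assumes f: "ideal f" and g: "ideal g" and fg: "f \<subseteq> g" shows "pr g ` carrier (H f) = carrier (H g)"
proof
  show "pr g ` carrier (H f) \<subseteq> carrier (H g)" using hom_carrier[OF pr_hom[OF assms]] .
  show "carrier (H g) \<subseteq> pr g ` carrier (H f)"
  proof
    fix \<gamma> assume "\<gamma> \<in> carrier (H g)"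
    then obtain I where I: "ideal I" "comax I g" "\<gamma> = rc g I" unfolding H_carrier[OF g] by blast
    obtain J where J: "ideal J" "comax J g" "comax J f" "req g I J" using coprime_rep[OF g f I(1,2)] by blast
    have "\<gamma> = rc g J" using rc_eq[OF g I(1) J(1) I(2) J(2)] J(4) I(3) by simp
    then have "\<gamma> = pr g (rc f J)" using pr_rc[OF f g fg J(1,3)] by simp
    then show "\<gamma> \<in> pr g ` carrier (H f)" using rc_H[OF f J(1,3)] by blast
  qed
qed

lemma ga_pr: assumes f: "ideal f" and g: "ideal g" and fg: "f \<subseteq> g" and xi: "\<xi> \<in> Xit g" and c: "\<gamma> \<in> carrier (H f)"
  shows "ga f \<gamma> \<xi> = ga g (pr g \<gamma>) \<xi>"
proof -
  obtain x W where W: "glat W" "\<xi> = cl x W" "g \<subseteq> ordr x W" using xi unfolding Xit_iff[OF g] by blast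
  obtain I where I: "ideal I" "comax I f" "\<gamma> = rc f I" using c unfolding H_carrier[OF f] by blast
  have "f \<subseteq> ordr x W" using fg W(3) by blast
  then show ?thesis unfolding W(2) I(3) pr_rc[OF f g fg I(1,2)]
    using ga_cl[OF f W(1) _ I(1,2)] ga_cl[OF g W(1,3) I(1) com_mono[OF I(2) subset_refl fg]] by simp
qed

lemma GG_pr: assumes s: "\<sigma> \<in> carrier GG" and f: "ideal f" and g: "ideal g" and fg: "f \<subseteq> g" shows "\<sigma> g = pr g (\<sigma> f)"
proof -
  obtain I where I: "ideal I" "comax I f" "\<sigma> f = rc f I" "I \<in> \<sigma> f" using GG_rep[OF s f] by blast
  show ?thesis unfolding I(3) pr_rc[OF f g fg I(1,2)] using GG_compat[OF s g f fg I(4)] .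
qed

lemma one_Xit: assumes f: "ideal f" and g: "ideal g" and fg: "f \<subseteq> g" shows "cl 1 g \<in> Xit f"
  using cl_Xit[OF f ideal_glat[OF g]] ordr_one_ideal[OF g] fg by simp

lemma cord_one: "ideal g \<Longrightarrow> cord (cl 1 g) = g"
  using cord_cl[OF ideal_glat] ordr_one_ideal by simp

lemma ga_one_cl: assumes f: "ideal f" and I: "ideal I" "comax I f" shows "ga f (rc f I) (cl 1 f) = cl 1 (iv I \<cdot> f)"
  using ga_cl[OF f ideal_glat[OF f] _ I] ordr_one_ideal[OF f] by simp

lemma Xi_orbit: assumes xi: "\<xi> \<in> Xi A sg"
  shows "\<exists>I. ideal I \<and> comax I (cord \<xi>) \<and> \<xi> = cl 1 (iv I \<cdot> cord \<xi>)"
proof -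
  obtain x W where W: "glat W" "\<xi> = cl x W" "ideal (ordr x W)" using xi unfolding Xi_iff by blast
  have "cord \<xi> = ordr x W" using W cord_cl by simp
  then show ?thesis using cl_one_surj[OF W(1) refl W(3)] W(2) by auto
qed

lemma Xi_orbit_ga: assumes xi: "\<xi> \<in> Xi A sg"
  shows "\<exists>\<gamma>\<in>carrier (H (cord \<xi>)). \<xi> = ga (cord \<xi>) \<gamma> (cl 1 (cord \<xi>))"
proof -
  have c: "ideal (cord \<xi>)" by (rule cord_ideal[OF xi])
  obtain I where I: "ideal I" "comax I (cord \<xi>)" "\<xi> = cl 1 (iv I \<cdot> cord \<xi>)" using Xi_orbit[OF xi] by blast
  then show ?thesis using ga_one_cl[OF c I(1,2)] rc_H[OF c I(1,2)] by metis
qed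

lemma ga_inj: assumes f: "ideal f" and c: "\<gamma> \<in> carrier (H f)" "\<delta> \<in> carrier (H f)" and e: "ga f \<gamma> (cl 1 f) = ga f \<delta> (cl 1 f)"
  shows "\<gamma> = \<delta>"
proof -
  obtain I where I: "ideal I" "comax I f" "\<gamma> = rc f I" using c(1) unfolding H_carrier[OF f] by blast
  obtain J where J: "ideal J" "comax J f" "\<delta> = rc f J" using c(2) unfolding H_carrier[OF f] by blast
  have "cl 1 (iv I \<cdot> f) = cl 1 (iv J \<cdot> f)"
    using e ga_one_cl[OF f I(1,2)] ga_one_cl[OF f J(1,2)] unfolding I(3) J(3) by simp
  then have "req f I J" using cl_one_eq[OF f I(1) J(1)] by simp
  then show ?thesis unfolding I(3) J(3) using rc_eq[OF f I(1) J(1) I(2) J(2)] by simp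
qed

section \<open>The maps Y_p and their fibres\<close>

abbreviation "YY \<equiv> Ymap A sg"

lemma YY_cl: assumes W: "glat W" and f: "ideal f" shows "YY f (cl x W) = cl x (iv f \<cdot> W)"
  unfolding Ymap_def lattice_iff cl_def[symmetric]
proof (rule the_equality)
  show "\<exists>xa Wa. glat Wa \<and> cl x W = cl xa Wa \<and> cl x (iv f \<cdot> W) = cl xa (iv f \<cdot> Wa)" using W by blast
  fix \<eta> assume "\<exists>xa Wa. glat Wa \<and> cl x W = cl xa Wa \<and> \<eta> = cl xa (iv f \<cdot> Wa)"
  then obtain x' W' where h: "glat W'" "cl x W = cl x' W'" "\<eta> = cl x' (iv f \<cdot> W')" by blast
  have "req (ordr x W) f f" unfolding req_def using pos_one sm_zero[OF ordr_sm[OF glat_sm[OF W]]] by (intro exI[of _ 1]) auto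
  then show "\<eta> = cl x (iv f \<cdot> W)" using cl_iv_cong[OF W h(1,2) f f] h(3) by simp
qed

lemma ordr_super: "W \<subseteq> V \<Longrightarrow> ordr x W \<subseteq> ordr x V" by (auto simp: order_of_def)

lemma sub_iv_mp: "ideal K \<Longrightarrow> sm V \<Longrightarrow> V \<subseteq> iv K \<cdot> V"
  using sub_mp_iv[OF _ integral_sub, of V K] by (simp add: mp_comm)

lemma YY_Xi: assumes f: "ideal f" and xi: "\<xi> \<in> Xi A sg" shows "YY f \<xi> \<in> Xi A sg" "cord \<xi> \<subseteq> cord (YY f \<xi>)"
proof -
  obtain x W where W: "glat W" "\<xi> = cl x W" "ideal (ordr x W)" using xi unfolding Xi_iff by blast
  have g: "glat (iv f \<cdot> W)" using glat_iv_mul[OF f W(1)] .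
  have sub: "ordr x W \<subseteq> ordr x (iv f \<cdot> W)" by (rule ordr_super[OF sub_iv_mp[OF f glat_sm[OF W(1)]]])
  show "YY f \<xi> \<in> Xi A sg" unfolding W(2) YY_cl[OF W(1) f] Xi_iff
    using g ordr_ideal[OF glat_sm[OF g] W(3) sub] by blast
  show "cord \<xi> \<subseteq> cord (YY f \<xi>)" unfolding W(2) YY_cl[OF W(1) f] cord_cl[OF W(1)] cord_cl[OF g] by (rule sub)
qed

lemma YY_ga: assumes p: "ideal p" and f: "ideal f" and xi: "\<xi> \<in> Xit f" and c: "\<gamma> \<in> carrier (H f)"
  shows "YY p (ga f \<gamma> \<xi>) = ga f \<gamma> (YY p \<xi>)"
proof -
  obtain x W where W: "glat W" "\<xi> = cl x W" "f \<subseteq> ordr x W" using xi unfolding Xit_iff[OF f] by blast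
  obtain I where I: "ideal I" "comax I f" "\<gamma> = rc f I" using c unfolding H_carrier[OF f] by blast
  have g: "glat (iv p \<cdot> W)" "glat (iv I \<cdot> W)" using glat_iv_mul p I(1) W(1) by auto
  have s: "f \<subseteq> ordr x (iv p \<cdot> W)" using W(3) ordr_super[OF sub_iv_mp[OF p glat_sm[OF W(1)]]] by blast
  show ?thesis unfolding W(2) I(3) ga_cl[OF f W(1,3) I(1,2)] YY_cl[OF W(1) p] YY_cl[OF g(2) p] ga_cl[OF f g(1) s I(1,2)]
    by (simp add: mp_left_comm)
qed

text \<open>In the normal form [1 + I^-1 o] with o the order, the factor p^-1 is absorbed into o if
  p divides o, and into I^-1 otherwise.\<close>

lemma cord_YY: assumes p: "maxi p" and eta: "\<eta> \<in> Xi A sg"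
  shows "cord \<eta> \<subseteq> p \<Longrightarrow> cord \<eta> = p \<cdot> cord (YY p \<eta>)" "\<not> cord \<eta> \<subseteq> p \<Longrightarrow> cord (YY p \<eta>) = cord \<eta>"
proof -
  let ?o = "cord \<eta>"
  have o: "ideal ?o" by (rule cord_ideal[OF eta])
  have pi: "ideal p" "invble p" using maxi_ideal[OF p] ideal_invble[OF maxi_ideal[OF p]] by auto
  obtain I where I: "ideal I" "comax I ?o" "\<eta> = cl 1 (iv I \<cdot> ?o)" using Xi_orbit[OF eta] by blast
  have g: "glat (iv I \<cdot> ?o)" using glat_iv_mul[OF I(1) ideal_glat[OF o]] .
  have Y: "YY p \<eta> = cl 1 (iv p \<cdot> (iv I \<cdot> ?o))" using YY_cl[OF g pi(1)] I(3) by metis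
  have cY: "cord (YY p \<eta>) = ordr 1 (iv p \<cdot> (iv I \<cdot> ?o))" unfolding Y using cord_cl[OF glat_iv_mul[OF pi(1) g]] .
  show "?o = p \<cdot> cord (YY p \<eta>)" if op: "?o \<subseteq> p"
  proof -
    have o1: "ideal (?o \<cdot> iv p)" by (rule ideal_quot[OF pi(1) o op])
    have e: "iv p \<cdot> (iv I \<cdot> ?o) = iv I \<cdot> (?o \<cdot> iv p)" by (simp add: mp_ac)
    have "comax I (?o \<cdot> iv p)" using com_mono[OF I(2) subset_refl sub_mp_iv[OF integral_sm[OF o] integral_sub[OF pi(1)]]] .
    then have "cord (YY p \<eta>) = ?o \<cdot> iv p" unfolding cY e using ordr_one[OF o1 I(1)] by simp
    then show ?thesis using cancel_iv1[OF pi(2) integral_sm[OF o]] by (simp add: mp_comm)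
  qed
  show "cord (YY p \<eta>) = ?o" if op: "\<not> ?o \<subseteq> p"
  proof -
    have "comax p ?o" using max_com[OF p o op] com_sym by blast
    then have c: "comax (p \<cdot> I) ?o" using com_mul_ideal[OF pi(1) I(1) o _ I(2)] by blast
    have e: "iv p \<cdot> (iv I \<cdot> ?o) = iv (p \<cdot> I) \<cdot> ?o" using iv_mul[OF pi(2) ideal_invble[OF I(1)]] by (simp add: mp_assoc)
    show ?thesis unfolding cY e using ordr_one[OF o integral_mul[OF pi(1) I(1)] c] .
  qed
qed

definition "ker h g = {\<kappa> \<in> carrier (H h). pr g \<kappa> = \<one>\<^bsub>H g\<^esub>}"
definition "fib p \<xi> = {\<eta> \<in> Xi A sg. YY p \<eta> = \<xi>}"

text \<open>By \<open>cord_YY\<close> a preimage has order p g, or order g with p prime to g. The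
  first kind forms a torsor under the kernel of H(p g) \<rightarrow> H(g). The second is a single
  class, obtained from the inverse Frobenius at p; it is the source of the Euler factor.\<close>

lemma fib_one: assumes p: "maxi p" and g: "ideal g"
  shows "fib p (cl 1 g) = (\<lambda>\<kappa>. ga (p \<cdot> g) \<kappa> (cl 1 (p \<cdot> g))) ` ker (p \<cdot> g) g \<union>
     (if g \<subseteq> p then {} else {ga g (inv\<^bsub>H g\<^esub> (rc g p)) (cl 1 g)})" (is "_ = ?K \<union> ?S")
proof -
  let ?h = "p \<cdot> g"
  have pi: "ideal p" "invble p" using maxi_ideal[OF p] ideal_invble[OF maxi_ideal[OF p]] by auto
  have h: "ideal ?h" by (rule integral_mul[OF pi(1) g])
  have hg: "?h \<subseteq> g" using mp_int_sub[OF pi(1) integral_sm[OF g]] .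
  interpret Hg: comm_group "H g" by (rule H_comm_group[OF g])
  have eq1: "cl 1 (iv I \<cdot> g) = cl 1 g \<longleftrightarrow> rc g I = \<one>\<^bsub>H g\<^esub>" if I: "ideal I" "comax I g" for I
    using cl_one_eq[OF g I(1) integral_A] rc_eq[OF g I(1) integral_A I(2) com_Af[OF g]]
    by (simp add: iv_A mp_one integral_sm[OF g] H_one)
  have YK: "YY p (cl 1 (iv I \<cdot> ?h)) = cl 1 (iv I \<cdot> g)" if I: "ideal I" for I
  proof -
    have "iv p \<cdot> (iv I \<cdot> ?h) = iv I \<cdot> (iv p \<cdot> (p \<cdot> g))" by (simp add: mp_left_comm)
    then show ?thesis using YY_cl[OF glat_iv_mul[OF I ideal_glat[OF h]] pi(1)] cancel_iv2[OF pi(2) integral_sm[OF g]] by simp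
  qed
  have YS: "YY p (cl 1 (iv I \<cdot> g)) = cl 1 (iv (p \<cdot> I) \<cdot> g)" if I: "ideal I" for I
    using YY_cl[OF glat_iv_mul[OF I ideal_glat[OF g]] pi(1)] iv_mul[OF pi(2) ideal_invble[OF I]] by (simp add: mp_assoc)
  show ?thesis
  proof
    show "fib p (cl 1 g) \<subseteq> ?K \<union> ?S"
    proof
      fix \<eta> assume "\<eta> \<in> fib p (cl 1 g)"
      then have e: "\<eta> \<in> Xi A sg" "YY p \<eta> = cl 1 g" by (auto simp: fib_def)
      have cg: "cord (YY p \<eta>) = g" unfolding e(2) by (rule cord_one[OF g])
      obtain I where I: "ideal I" "comax I (cord \<eta>)" "\<eta> = cl 1 (iv I \<cdot> cord \<eta>)" using Xi_orbit[OF e(1)] by blast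
      show "\<eta> \<in> ?K \<union> ?S"
      proof (cases "cord \<eta> \<subseteq> p")
        case True
        then have c: "cord \<eta> = ?h" using cord_YY(1)[OF p e(1)] cg by simp
        have Ih: "comax I ?h" "\<eta> = cl 1 (iv I \<cdot> ?h)" using I c by auto
        have "cl 1 (iv I \<cdot> g) = cl 1 g" using YK[OF I(1)] Ih e(2) by simp
        then have "rc g I = \<one>\<^bsub>H g\<^esub>" using eq1[OF I(1) com_mono[OF Ih(1) subset_refl hg]] by simp
        then have "rc ?h I \<in> ker ?h g" unfolding ker_def using pr_rc[OF h g hg I(1) Ih(1)] rc_H[OF h I(1) Ih(1)] by simp
        moreover have "\<eta> = ga ?h (rc ?h I) (cl 1 ?h)" using ga_one_cl[OF h I(1) Ih(1)] Ih(2) by simp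
        ultimately show ?thesis by blast
      next
        case False
        then have c: "cord \<eta> = g" using cord_YY(2)[OF p e(1)] cg by simp
        have gp: "\<not> g \<subseteq> p" using False c by simp
        have Ig: "comax I g" "\<eta> = cl 1 (iv I \<cdot> g)" using I c by auto
        have cp: "comax p g" using max_com[OF p g gp] com_sym by blast
        have "cl 1 (iv (p \<cdot> I) \<cdot> g) = cl 1 g" using YS[OF I(1)] Ig e(2) by simp
        then have "rc g (p \<cdot> I) = \<one>\<^bsub>H g\<^esub>" using eq1[OF integral_mul[OF pi(1) I(1)] com_mul_ideal[OF pi(1) I(1) g cp Ig(1)]] by simp
        then have "rc g I \<otimes>\<^bsub>H g\<^esub> rc g p = \<one>\<^bsub>H g\<^esub>" using H_mult[OF g I(1) pi(1) Ig(1) cp] by (simp add: mp_comm)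
        then have "inv\<^bsub>H g\<^esub> (rc g p) = rc g I" using Hg.inv_equality rc_H[OF g I(1) Ig(1)] rc_H[OF g pi(1) cp] by blast
        then show ?thesis using gp ga_one_cl[OF g I(1) Ig(1)] Ig(2) by simp
      qed
    qed
    have "?K \<subseteq> fib p (cl 1 g)"
    proof
      fix \<eta> assume "\<eta> \<in> ?K"
      then obtain \<kappa> where k: "\<kappa> \<in> carrier (H ?h)" "pr g \<kappa> = \<one>\<^bsub>H g\<^esub>" "\<eta> = ga ?h \<kappa> (cl 1 ?h)" by (auto simp: ker_def)
      obtain I where I: "ideal I" "comax I ?h" "\<kappa> = rc ?h I" using k(1) unfolding H_carrier[OF h] by blast
      have e: "\<eta> = cl 1 (iv I \<cdot> ?h)" unfolding k(3) I(3) by (rule ga_one_cl[OF h I(1,2)])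
      have "rc g I = \<one>\<^bsub>H g\<^esub>" using k(2) pr_rc[OF h g hg I(1,2)] I(3) by simp
      then have "YY p \<eta> = cl 1 g" unfolding e YK[OF I(1)] using eq1[OF I(1) com_mono[OF I(2) subset_refl hg]] by simp
      moreover have "\<eta> \<in> Xi A sg" using ga_cord(1)[OF h one_Xit[OF h h subset_refl] k(1)] Xit_Xi[OF h] k(3) by simp
      ultimately show "\<eta> \<in> fib p (cl 1 g)" by (simp add: fib_def)
    qed
    moreover have "?S \<subseteq> fib p (cl 1 g)"
    proof (cases "g \<subseteq> p")
      case False
      have cp: "comax p g" using max_com[OF p g False] com_sym by blast
      have rp: "rc g p \<in> carrier (H g)" by (rule rc_H[OF g pi(1) cp])
      let ?i = "inv\<^bsub>H g\<^esub> (rc g p)"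
      have ic: "?i \<in> carrier (H g)" using rp by simp
      obtain I where I: "ideal I" "comax I g" "?i = rc g I" using ic unfolding H_carrier[OF g] by blast
      have e: "ga g ?i (cl 1 g) = cl 1 (iv I \<cdot> g)" unfolding I(3) by (rule ga_one_cl[OF g I(1,2)])
      have "rc g (p \<cdot> I) = rc g p \<otimes>\<^bsub>H g\<^esub> ?i" using H_mult[OF g pi(1) I(1) cp I(2)] I(3) by simp
      then have "rc g (p \<cdot> I) = \<one>\<^bsub>H g\<^esub>" using rp by simp
      then have "YY p (ga g ?i (cl 1 g)) = cl 1 g" unfolding e YS[OF I(1)]
        using eq1[OF integral_mul[OF pi(1) I(1)] com_mul_ideal[OF pi(1) I(1) g cp I(2)]] by simp
      moreover have "ga g ?i (cl 1 g) \<in> Xi A sg"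
        using ga_cord(1)[OF g one_Xit[OF g g subset_refl] ic] Xit_Xi[OF g] by simp
      ultimately show ?thesis using False by (simp add: fib_def)
    qed simp
    ultimately show "?K \<union> ?S \<subseteq> fib p (cl 1 g)" by blast
  qed
qed

text \<open>The order of a preimage is that of \<xi> or p times it, and p (f p^-1) = f. Hence the
  distribution relators involve only f-torsion classes.\<close>

lemma fib_Xit: assumes p: "maxi p" and f: "ideal f" and fp: "f \<subseteq> p" and xi: "\<xi> \<in> Xit (f \<cdot> iv p)"
  shows "fib p \<xi> \<subseteq> Xit f"
proof
  have pi: "ideal p" "invble p" using maxi_ideal[OF p] ideal_invble[OF maxi_ideal[OF p]] by auto
  have q: "ideal (f \<cdot> iv p)" by (rule ideal_quot[OF pi(1) f fp])
  have eq: "p \<cdot> (f \<cdot> iv p) = f" using cancel_iv1[OF pi(2) integral_sm[OF f]] by (simp add: mp_comm)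
  fix \<eta> assume "\<eta> \<in> fib p \<xi>"
  then have e: "\<eta> \<in> Xi A sg" "YY p \<eta> = \<xi>" by (auto simp: fib_def)
  have c: "f \<cdot> iv p \<subseteq> cord (YY p \<eta>)" using Xit_cord[OF q xi] e(2) by simp
  have "f \<subseteq> cord \<eta>"
  proof (cases "cord \<eta> \<subseteq> p")
    case True
    then have "cord \<eta> = p \<cdot> cord (YY p \<eta>)" using cord_YY(1)[OF p e(1)] by simp
    then show ?thesis using mp_mono[OF subset_refl c, of p] eq by simp
  next
    case False
    then have "cord (YY p \<eta>) = cord \<eta>" using cord_YY(2)[OF p e(1)] by simp
    then show ?thesis using c sub_mp_iv[OF integral_sm[OF f] integral_sub[OF pi(1)]] by blast
  qed
  then show "\<eta> \<in> Xit f" using Xi_Xit[OF f e(1)] by simp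
qed

end

section \<open>Characters and the distribution relation\<close>

lemma (in comm_group) sum_translate: assumes "k \<in> carrier G"
  shows "(\<Sum>g\<in>carrier G. F (g \<otimes> k)) = (\<Sum>g\<in>carrier G. F g)"
  by (rule sum.reindex_bij_witness[of _ "\<lambda>g. g \<otimes> inv k" "\<lambda>g. g \<otimes> k"]) (use assms in \<open>auto simp: m_assoc\<close>)

lemma cchar_mult: "\<psi> \<in> hom G complex_units \<Longrightarrow> x \<in> carrier G \<Longrightarrow> y \<in> carrier G \<Longrightarrow> \<psi> (x \<otimes>\<^bsub>G\<^esub> y) = \<psi> x * \<psi> y"
  and cchar_nonzero: "\<psi> \<in> hom G complex_units \<Longrightarrow> x \<in> carrier G \<Longrightarrow> \<psi> x \<noteq> 0"
  by (auto simp: hom_def complex_units_def)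

lemma (in group) cchar_one: "\<psi> \<in> hom G complex_units \<Longrightarrow> \<psi> \<one> = 1"
  using cchar_mult[of \<psi> G \<one> \<one>] cchar_nonzero[of \<psi> G \<one>] by simp

lemma (in group) cchar_inv: "\<psi> \<in> hom G complex_units \<Longrightarrow> x \<in> carrier G \<Longrightarrow> \<psi> (inv x) = inverse (\<psi> x)"
  using cchar_mult[of \<psi> G x "inv x"] cchar_one[of \<psi>] inverse_unique[of "\<psi> x" "\<psi> (inv x)"] by simp

lemma cchar_inverse: "\<psi> \<in> hom G complex_units \<Longrightarrow> (\<lambda>x. inverse (\<psi> x)) \<in> hom G complex_units"
  by (auto simp: hom_def complex_units_def)

lemma root_of_unity_sum_zero:
  assumes "0 < k" "k < n"
  shows "(\<Sum>j<n. cis (2 * pi * real j / real n) ^ k) = 0"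
proof -
  define x where "x = cis (2 * pi * real k / real n)"
  have inj: "inj_on (\<lambda>k. cis (2 * pi * real k / real n)) {..<n}"
    using Complex.bij_betw_roots_unity[of n] assms by (simp add: bij_betw_def)
  have x1: "x \<noteq> 1"
  proof
    assume "x = 1"
    then have "cis (2 * pi * real k / real n) = cis (2 * pi * real 0 / real n)" by (simp add: x_def)
    then have "k = 0" using inj_onD[OF inj, of k 0] assms by simp
    then show False using assms by simp
  qed
  have "x ^ n = cis (real n * (2 * pi * real k / real n))" by (simp only: x_def Complex.DeMoivre)
  also have "real n * (2 * pi * real k / real n) = 2 * pi * real k" using assms by simp
  also have "cis (2 * pi * real k) = 1" by (rule cis_multiple_2pi) simp
  finally have xn: "x ^ n = 1" .
  have "cis (2 * pi * real j / real n) ^ k = x ^ j" for j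
    by (simp add: x_def Complex.DeMoivre mult.commute mult.left_commute)
  then have "(\<Sum>j<n. cis (2 * pi * real j / real n) ^ k) = (\<Sum>j<n. x ^ j)" by simp
  also have "\<dots> = 0" using x1 xn by (simp add: geometric_sum)
  finally show ?thesis .
qed

text \<open>The functions with vanishing Fourier coefficients form a translation invariant space; if it is nonzero, it
  contains a common eigenvector of all translations, i.e. a multiple of a character.\<close>

theorem (in comm_group) fourier_zero:
  fixes D :: "'a \<Rightarrow> complex"
  assumes fin: "finite (carrier G)"
    and zero: "\<And>\<psi>. \<psi> \<in> hom G complex_units \<Longrightarrow> (\<Sum>g\<in>carrier G. D g * \<psi> g) = 0"
    and g: "g \<in> carrier G"
  shows "D g = 0"
proof (rule ccontr)
  assume nz: "D g \<noteq> 0"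
  define V where "V = {D. \<forall>\<psi>\<in>hom G complex_units. (\<Sum>g\<in>carrier G. D g * \<psi> g) = (0::complex)}"
  have ex: "\<exists>D'\<in>V. (\<exists>g\<in>carrier G. D' g \<noteq> 0) \<and> (\<forall>s\<in>S. \<exists>c. \<forall>g\<in>carrier G. D' (g \<otimes> s) = c * D' g)"
    if "finite S" "S \<subseteq> carrier G" for S
    using that
  proof (induction S)
    case empty
    have "D \<in> V" using zero by (simp add: V_def)
    then show ?case using nz g by blast
  next
    case (insert s S)
    then obtain D' where D': "D' \<in> V" "\<exists>g\<in>carrier G. D' g \<noteq> 0"
      "\<forall>s\<in>S. \<exists>c. \<forall>g\<in>carrier G. D' (g \<otimes> s) = c * D' g" by auto
    have s: "s \<in> carrier G" using insert by simp
    have "\<not> inj (\<lambda>n::nat. s [^] n)"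
      using finite_imageD[of "\<lambda>n::nat. s [^] n" UNIV] finite_subset[OF _ fin, of "range (\<lambda>n::nat. s [^] n)"] s by auto
    then obtain i j :: nat where ij: "i < j" "s [^] i = s [^] j"
      by (metis (mono_tags, lifting) injI linorder_neqE_nat)
    define n where "n = j - i"
    have n: "n > 0" using ij by (simp add: n_def)
    have "i + n = j" using ij(1) by (simp add: n_def)
    then have "s [^] i \<otimes> s [^] n = s [^] i" using ij(2) nat_pow_mult[OF s, of i n] by simp
    then have sn: "s [^] n = \<one>" using s by simp
    define \<zeta> where "\<zeta> j = cis (2 * pi * real j / real n)" for j
    have zn: "\<zeta> j ^ n = 1" for j
    proof -
      have "\<zeta> j ^ n = cis (real n * (2 * pi * real j / real n))" by (simp only: \<zeta>_def Complex.DeMoivre)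
      also have "real n * (2 * pi * real j / real n) = 2 * pi * real j" using n by simp
      also have "cis (2 * pi * real j) = 1" by (rule cis_multiple_2pi) simp
      finally show ?thesis .
    qed
    \<comment> \<open>Up to the factor n, \<open>E j\<close> is the projection of D' to the
      eigenspace of translation by s with eigenvalue inverse to \<open>\<zeta> j\<close>. The
      projections add up to n D', so one of them is nonzero.\<close>
    define E where "E j g = (\<Sum>k<n. \<zeta> j ^ k * D' (g \<otimes> s [^] k))" for j g
    have EV: "E j \<in> V" for j
      unfolding V_def
    proof (intro CollectI ballI)
      fix \<psi> assume chi: "\<psi> \<in> hom G complex_units"
      have t0: "(\<Sum>g\<in>carrier G. D' (g \<otimes> a) * \<psi> g) = 0" if a: "a \<in> carrier G" for a
      proof -
        have "(\<Sum>g\<in>carrier G. D' (g \<otimes> a) * \<psi> g) = inverse (\<psi> a) * (\<Sum>g\<in>carrier G. D' (g \<otimes> a) * \<psi> (g \<otimes> a))"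
          unfolding sum_distrib_left
          by (rule sum.cong) (use a cchar_nonzero[OF chi a] in \<open>auto simp: cchar_mult[OF chi]\<close>)
        also have "(\<Sum>g\<in>carrier G. D' (g \<otimes> a) * \<psi> (g \<otimes> a)) = (\<Sum>g\<in>carrier G. D' g * \<psi> g)"
          by (rule sum_translate[OF a])
        also have "\<dots> = 0" using D'(1) chi by (simp add: V_def)
        finally show ?thesis by simp
      qed
      have "(\<Sum>g\<in>carrier G. E j g * \<psi> g) = (\<Sum>k<n. \<zeta> j ^ k * (\<Sum>g\<in>carrier G. D' (g \<otimes> s [^] k) * \<psi> g))"
        unfolding E_def sum_distrib_right sum_distrib_left by (subst sum.swap) (simp add: mult.assoc)
      also have "\<dots> = 0" using t0 s by simp
      finally show "(\<Sum>g\<in>carrier G. E j g * \<psi> g) = 0" .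
    qed
    have Es: "\<zeta> j * E j (g \<otimes> s) = E j g" if gc: "g \<in> carrier G" for j g
    proof -
      have "\<zeta> j * E j (g \<otimes> s) = (\<Sum>k<n. \<zeta> j ^ Suc k * D' (g \<otimes> s [^] Suc k))"
        unfolding E_def sum_distrib_left
      proof (rule sum.cong[OF refl])
        fix k assume "k \<in> {..<n}"
        have "g \<otimes> s \<otimes> s [^] k = g \<otimes> s [^] Suc k" using gc s by (simp add: m_assoc nat_pow_comm nat_pow_Suc2[symmetric])
        then show "\<zeta> j * (\<zeta> j ^ k * D' (g \<otimes> s \<otimes> s [^] k)) = \<zeta> j ^ Suc k * D' (g \<otimes> s [^] Suc k)" by simp
      qed
      also have "\<dots> = (\<Sum>k<n. \<zeta> j ^ k * D' (g \<otimes> s [^] k))"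
      proof -
        let ?F = "\<lambda>k. \<zeta> j ^ k * D' (g \<otimes> s [^] k)"
        have "(\<Sum>k<n. ?F (Suc k)) + ?F 0 = (\<Sum>k<Suc n. ?F k)"
          by (simp add: sum.lessThan_Suc_shift del: sum.lessThan_Suc)
        also have "\<dots> = (\<Sum>k<n. ?F k) + ?F n" by simp
        also have "?F n = ?F 0" using zn sn by simp
        finally show ?thesis by simp
      qed
      finally show ?thesis by (simp add: E_def)
    qed
    have "(\<Sum>j<n. E j g) = of_nat n * D' g" if gc: "g \<in> carrier G" for g
    proof -
      have "(\<Sum>j<n. E j g) = (\<Sum>k<n. (\<Sum>j<n. \<zeta> j ^ k) * D' (g \<otimes> s [^] k))"
        unfolding E_def sum_distrib_right by (rule sum.swap)
      also have "\<dots> = (\<Sum>k<n. if k = 0 then of_nat n * D' g else 0)"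
        by (rule sum.cong) (use root_of_unity_sum_zero[of _ n] gc in \<open>auto simp: \<zeta>_def\<close>)
      also have "\<dots> = of_nat n * D' g" using n by simp
      finally show ?thesis .
    qed
    then obtain j g where j: "g \<in> carrier G" "E j g \<noteq> 0"
      using D'(2) n by (metis (no_types, lifting) mult_eq_0_iff of_nat_0_eq_iff neq0_conv sum.neutral)
    have z0: "\<zeta> j \<noteq> 0" by (simp add: \<zeta>_def)
    have "\<exists>c. \<forall>g\<in>carrier G. E j (g \<otimes> t) = c * E j g" if t: "t \<in> insert s S" for t
    proof (cases "t = s")
      case True
      have "E j (g \<otimes> s) = inverse (\<zeta> j) * E j g" if "g \<in> carrier G" for g
        using Es[OF that, of j] z0 by (simp add: field_simps)
      then show ?thesis using True by blast
    next
      case False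
      then obtain c where c: "\<forall>g\<in>carrier G. D' (g \<otimes> t) = c * D' g" using D'(3) t by auto
      have tc: "t \<in> carrier G" using t insert.prems by blast
      have "E j (g \<otimes> t) = c * E j g" if "g \<in> carrier G" for g
      proof -
        have "D' (g \<otimes> t \<otimes> s [^] k) = c * D' (g \<otimes> s [^] k)" for k :: nat
        proof -
          have "g \<otimes> t \<otimes> s [^] k = (g \<otimes> s [^] k) \<otimes> t" using that tc s by (simp add: m_ac)
          then show ?thesis using c that s by simp
        qed
        then show ?thesis by (simp add: E_def sum_distrib_left mult.left_commute)
      qed
      then show ?thesis by blast
    qed
    then show ?case using EV j by blast
  qed
  from ex[OF fin subset_refl]
  obtain D' g0 where D': "D' \<in> V" "g0 \<in> carrier G" "D' g0 \<noteq> 0"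
    and eig: "\<forall>s\<in>carrier G. \<exists>c. \<forall>g\<in>carrier G. D' (g \<otimes> s) = c * D' g" by blast
  then obtain c where c: "\<And>s g. s \<in> carrier G \<Longrightarrow> g \<in> carrier G \<Longrightarrow> D' (g \<otimes> s) = c s * D' g" by metis
  have cm: "c (s \<otimes> t) = c s * c t" if "s \<in> carrier G" "t \<in> carrier G" for s t
  proof -
    have "c (s \<otimes> t) * D' g0 = D' (g0 \<otimes> t \<otimes> s)" using c that D'(2) by (simp add: m_ac flip: c)
    also have "\<dots> = c s * c t * D' g0" using c that D'(2) by simp
    finally show ?thesis using D'(3) by simp
  qed
  have "c \<one> * D' g0 = D' g0" using c[of \<one> g0] D'(2) by simp
  then have c1: "c \<one> = 1" using D'(3) by simp
  have "c s \<noteq> 0" if "s \<in> carrier G" for s using cm[OF that inv_closed[OF that]] c1 that by auto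
  then have chom: "c \<in> hom G complex_units" using cm by (auto simp: hom_def complex_units_def)
  \<comment> \<open>D' is a multiple of the character c, so its coefficient at the inverse of c is
    |G| times D' at the identity.\<close>
  have "(\<Sum>g\<in>carrier G. D' g * inverse (c g)) = (\<Sum>g\<in>carrier G. D' \<one>)"
  proof (rule sum.cong[OF refl])
    fix g assume "g \<in> carrier G"
    then show "D' g * inverse (c g) = D' \<one>" using c[of g \<one>] cchar_nonzero[OF chom, of g] by simp
  qed
  moreover have "(\<Sum>g\<in>carrier G. D' g * inverse (c g)) = 0" using D'(1) cchar_inverse[OF chom] by (simp add: V_def)
  ultimately have "D' \<one> = 0" using fin by auto
  then have "D' g0 = 0" using c[of g0 \<one>] D'(2) by simp
  then show False using D'(3) by simp
qed

section \<open>Conductors and Haar integrals\<close>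

context arith
begin

text \<open>The descended character is evaluated on chosen lifts; the projection of the limit group
  to level f is surjective, and the condition makes the value independent of the lift.\<close>

lemma factors_iff: assumes ch: "ch \<in> hom GG complex_units" and f: "ideal f"
  shows "factors_through A sg ch f \<longleftrightarrow> (\<forall>\<sigma>\<in>carrier GG. \<forall>\<tau>\<in>carrier GG. \<sigma> f = \<tau> f \<longrightarrow> ch \<sigma> = ch \<tau>)"
proof
  assume "factors_through A sg ch f"
  then show "\<forall>\<sigma>\<in>carrier GG. \<forall>\<tau>\<in>carrier GG. \<sigma> f = \<tau> f \<longrightarrow> ch \<sigma> = ch \<tau>" unfolding factors_through_def by auto
next
  assume r: "\<forall>\<sigma>\<in>carrier GG. \<forall>\<tau>\<in>carrier GG. \<sigma> f = \<tau> f \<longrightarrow> ch \<sigma> = ch \<tau>"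
  interpret comm_group "H f" by (rule H_comm_group[OF f])
  have "(\<lambda>\<gamma>. ch (lift f \<gamma>)) \<in> hom (H f) complex_units"
  proof (rule homI)
    fix x assume x: "x \<in> carrier (H f)"
    show "ch (lift f x) \<in> carrier complex_units" using ch lift(1)[OF f x] by (auto simp: hom_def)
    fix y assume y: "y \<in> carrier (H f)"
    have xy: "x \<otimes>\<^bsub>H f\<^esub> y \<in> carrier (H f)" using x y by simp
    have "lift f (x \<otimes>\<^bsub>H f\<^esub> y) f = (lift f x \<otimes>\<^bsub>GG\<^esub> lift f y) f"
      unfolding GG_mult[OF f] lift(2)[OF f x] lift(2)[OF f y] by (rule lift(2)[OF f xy])
    then have "ch (lift f (x \<otimes>\<^bsub>H f\<^esub> y)) = ch (lift f x \<otimes>\<^bsub>GG\<^esub> lift f y)"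
      using r GG_mult_closed[OF lift(1)[OF f x] lift(1)[OF f y]] lift(1)[OF f xy] by blast
    then show "ch (lift f (x \<otimes>\<^bsub>H f\<^esub> y)) = ch (lift f x) \<otimes>\<^bsub>complex_units\<^esub> ch (lift f y)"
      using cchar_mult[OF ch lift(1)[OF f x] lift(1)[OF f y]] by (simp add: complex_units_def)
  qed
  moreover have "ch \<sigma> = ch (lift f (\<sigma> f))" if "\<sigma> \<in> carrier GG" for \<sigma>
    by (rule r[rule_format, OF that lift(1)[OF f GG_H[OF that f]] lift(2)[OF f GG_H[OF that f], symmetric]])
  ultimately show "factors_through A sg ch f" unfolding factors_through_def
    by (intro bexI[of _ "\<lambda>\<gamma>. ch (lift f \<gamma>)"] ballI)
qed

text \<open>An element trivial at level f + g is a product of one trivial at f and one trivial at g.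
  It is represented by \<open>y *o A\<close> with y - 1 = a + b, a in f and b in g; a positive z
  near 1 + a is congruent to 1 modulo f and to y modulo g, and the class of \<open>z *o A\<close>
  effects the splitting.\<close>

lemma factors_sum: assumes ch: "ch \<in> hom GG complex_units" and f: "ideal f" and g: "ideal g"
  and ff: "factors_through A sg ch f" and fg: "factors_through A sg ch g"
  shows "factors_through A sg ch (f + g)"
  unfolding factors_iff[OF ch integral_plus[OF f g]]
proof (intro ballI impI)
  let ?d = "f + g" and ?h = "f \<cdot> g"
  have d: "ideal ?d" by (rule integral_plus[OF f g])
  have h: "ideal ?h" by (rule integral_mul[OF f g])
  have sf: "sm f" and sg: "sm g" using f g integral_sm by auto
  have hf: "?h \<subseteq> f" using mp_int_sub[OF g sf] by (simp add: mp_comm)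
  have hg: "?h \<subseteq> g" using mp_int_sub[OF f sg] .
  have hd: "?h \<subseteq> ?d" using hf plus_upper1[OF sg] by blast
  fix \<sigma> \<tau> assume s: "\<sigma> \<in> carrier GG" and t: "\<tau> \<in> carrier GG" and st: "\<sigma> ?d = \<tau> ?d"
  interpret Hh: comm_group "H ?h" by (rule H_comm_group[OF h])
  interpret Hd: comm_group "H ?d" by (rule H_comm_group[OF d])
  have sh: "\<sigma> ?h \<in> carrier (H ?h)" "\<tau> ?h \<in> carrier (H ?h)" using GG_H s t h by auto
  define \<gamma> where "\<gamma> = inv\<^bsub>H ?h\<^esub> (\<tau> ?h) \<otimes>\<^bsub>H ?h\<^esub> \<sigma> ?h"
  have gc: "\<gamma> \<in> carrier (H ?h)" using sh by (simp add: \<gamma>_def)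
  have tg: "\<tau> ?h \<otimes>\<^bsub>H ?h\<^esub> \<gamma> = \<sigma> ?h" unfolding \<gamma>_def using sh by (simp add: Hh.m_assoc[symmetric])
  have pd: "\<tau> ?d = \<tau> ?d \<otimes>\<^bsub>H ?d\<^esub> pr ?d \<gamma>"
    using st tg GG_pr[OF s h d hd] GG_pr[OF t h d hd] hom_mult[OF pr_hom[OF h d hd] sh(2) gc] by simp
  have "\<tau> ?d \<in> carrier (H ?d)" "pr ?d \<gamma> \<in> carrier (H ?d)" using GG_H[OF t d] hom_in_carrier[OF pr_hom[OF h d hd] gc] by auto
  then have pd1: "pr ?d \<gamma> = \<one>\<^bsub>H ?d\<^esub>" using pd Hd.l_cancel_one' by blast
  obtain I where I: "ideal I" "comax I ?h" "\<gamma> = rc ?h I" using gc unfolding H_carrier[OF h] by blast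
  have Id: "comax I ?d" by (rule com_mono[OF I(2) subset_refl hd])
  have "rc ?d I = rc ?d A" using pd1 pr_rc[OF h d hd I(1,2)] I(3) H_one by simp
  then have "req ?d I A" using rc_eq[OF d I(1) integral_A Id com_Af[OF d]] by simp
  then obtain y where y: "pos y" "y *o A = I" "\<forall>j\<in>A. (y - 1) * j \<in> ?d" unfolding req_def by blast
  have "y - 1 \<in> ?d" using y(3) one_A by (metis mult.right_neutral)
  then obtain a b where ab: "a \<in> f" "b \<in> g" "y - 1 = a + b" by (auto elim: set_plus_elim)
  \<comment> \<open>The term n in f g makes 1 + a positive without changing its residues.\<close>
  obtain n where n: "n \<in> ?h" "pos (1 + a + n)" using ex_pos[OF ideal_glat[OF h]] by blast
  define z where "z = 1 + a + n"
  have "a + n \<in> f" using sm_add[OF sf ab(1)] n(1) hf by blast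
  then have zf: "z - 1 \<in> f" by (simp add: z_def add.assoc)
  have yA: "y \<in> A" using y(2) scale_memI[OF one_A, of y] integral_sub[OF I(1)] by auto
  have "n - b \<in> g" using sm_diff[OF sg _ ab(2)] n(1) hg by blast
  moreover have "n - b = z - y" using ab(3) by (simp add: z_def algebra_simps)
  ultimately have zg: "z - y \<in> g" by metis
  have "1 + (a + n) \<in> A" using add_A[OF one_A] \<open>a + n \<in> f\<close> integral_sub[OF f] by blast
  then have zA: "z \<in> A" "z \<noteq> 0" using pos_nonzero[OF n(2)] by (simp_all add: z_def add.assoc)
  let ?Z = "z *o A"
  have Z: "ideal ?Z" by (rule integral_principal[OF zA])
  have Zf: "comax ?Z f" using com_elem[OF f _ zf] scale_memI[OF one_A, of z] by simp
  have Ig: "comax I g" by (rule com_mono[OF I(2) subset_refl hg])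
  have Zg: "comax ?Z g"
  proof -
    obtain w k where w: "w \<in> A" "k \<in> g" "y * w + k = 1" using Ig y(2) by (auto simp: comax_def elt_set_times_def)
    have "z * w \<in> ?Z" using w(1) by blast
    moreover have "k - (z - y) * w \<in> g" using sm_diff[OF sg w(2) sm_mult2[OF sg w(1) zg]] .
    moreover have "z * w + (k - (z - y) * w) = 1" using w(3) by (simp add: algebra_simps)
    ultimately show ?thesis unfolding comax_def by blast
  qed
  have Zh: "comax ?Z ?h" using com_mul_ideal[OF f g Z] Zf Zg com_sym by metis
  have "req f ?Z A" unfolding req_def using n(2) sm_mult2[OF sf _ zf] by (intro exI[of _ z]) (auto simp: z_def)
  then have e1: "rc f ?Z = \<one>\<^bsub>H f\<^esub>" using rc_eq[OF f Z integral_A Zf com_Af[OF f]] H_one by simp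
  have "req g I ?Z"
    unfolding req_def
  proof (intro exI[of _ "y / z"] conjI ballI)
    show "pos (y / z)" using pos_divide y(1) n(2) by (simp add: z_def)
    show "(y / z) *o ?Z = I" using y(2) zA by (simp add: set_times_rearrange2)
    fix j assume "j \<in> ?Z"
    then obtain w where w: "w \<in> A" "j = z * w" by (auto simp: elt_set_times_def)
    have "(y / z - 1) * j = - ((z - y) * w)" using zA w by (simp add: field_simps)
    then show "(y / z - 1) * j \<in> g" using sm_uminus[OF sg sm_mult2[OF sg w(1) zg]] by simp
  qed
  then have e2: "rc g I = rc g ?Z" using rc_eq[OF g I(1) Z Ig Zg] by simp
  define \<alpha> where "\<alpha> = lift ?h \<gamma>"
  define \<beta> where "\<beta> = lift ?h (rc ?h ?Z)"
  have al: "\<alpha> \<in> carrier GG" "\<alpha> ?h = \<gamma>" unfolding \<alpha>_def using lift[OF h gc] by auto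
  have be: "\<beta> \<in> carrier GG" "\<beta> ?h = rc ?h ?Z" unfolding \<beta>_def using lift[OF h rc_H[OF h Z Zh]] by auto
  have bf: "\<beta> f = \<one>\<^bsub>H f\<^esub>" using GG_pr[OF be(1) h f hf] be(2) pr_rc[OF h f hf Z Zh] e1 by simp
  have bg: "\<beta> g = \<alpha> g"
    using GG_pr[OF be(1) h g hg] be(2) pr_rc[OF h g hg Z Zh] GG_pr[OF al(1) h g hg] al(2) I(3) pr_rc[OF h g hg I(1,2)] e2 by simp
  have c1: "\<tau> \<otimes>\<^bsub>GG\<^esub> \<alpha> \<in> carrier GG" "\<tau> \<otimes>\<^bsub>GG\<^esub> \<beta> \<in> carrier GG" using GG_mult_closed t al be by auto
  have "(\<tau> \<otimes>\<^bsub>GG\<^esub> \<alpha>) ?h = \<sigma> ?h" unfolding GG_mult[OF h] al(2) by (rule tg)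
  then have "(\<tau> \<otimes>\<^bsub>GG\<^esub> \<alpha>) f = \<sigma> f" using GG_pr[OF c1(1) h f hf] GG_pr[OF s h f hf] by simp
  then have "ch \<sigma> = ch (\<tau> \<otimes>\<^bsub>GG\<^esub> \<alpha>)" using ff[unfolded factors_iff[OF ch f]] s c1 by metis
  also have "(\<tau> \<otimes>\<^bsub>GG\<^esub> \<alpha>) g = (\<tau> \<otimes>\<^bsub>GG\<^esub> \<beta>) g" unfolding GG_mult[OF g] bg by simp
  then have "ch (\<tau> \<otimes>\<^bsub>GG\<^esub> \<alpha>) = ch (\<tau> \<otimes>\<^bsub>GG\<^esub> \<beta>)" using fg[unfolded factors_iff[OF ch g]] c1 by metis
  also have "(\<tau> \<otimes>\<^bsub>GG\<^esub> \<beta>) f = \<tau> f"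
  proof -
    interpret Hf: comm_group "H f" by (rule H_comm_group[OF f])
    show ?thesis unfolding GG_mult[OF f] bf using GG_H[OF t f] by simp
  qed
  then have "ch (\<tau> \<otimes>\<^bsub>GG\<^esub> \<beta>) = ch \<tau>" using ff[unfolded factors_iff[OF ch f]] t c1 by metis
  finally show "ch \<sigma> = ch \<tau>" .
qed

text \<open>Take the largest ideal c above f through which the character factors. By
  \<open>factors_sum\<close> it also factors through c + k for any other level k, so k lies in
  c.\<close>

theorem conductor_exists: assumes ch: "ch \<in> hom GG complex_units" and f: "ideal f" and ff: "factors_through A sg ch f"
  shows "\<exists>c. has_conductor A sg ch c \<and> f \<subseteq> c"
proof -
  let ?S = "{g. ideal g \<and> f \<subseteq> g \<and> factors_through A sg ch g}"
  have "finite ?S" by (rule finite_subset[OF _ finite_super[OF f]]) auto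
  moreover have "?S \<noteq> {}" using f ff by blast
  ultimately obtain c where c: "ideal c" "f \<subseteq> c" "factors_through A sg ch c"
    and max: "\<And>g. ideal g \<Longrightarrow> f \<subseteq> g \<Longrightarrow> factors_through A sg ch g \<Longrightarrow> c \<subseteq> g \<Longrightarrow> c = g"
    using finite_has_maximal[of ?S] by auto
  have "factors_through A sg ch k \<longleftrightarrow> ideal_dvd A c k" if k: "ideal k" for k
    unfolding dvd_iff[OF c(1) k]
  proof
    assume fk: "factors_through A sg ch k"
    have u: "c \<subseteq> c + k" "k \<subseteq> c + k" using plus_upper1[OF integral_sm[OF k]] plus_upper2[OF integral_sm[OF c(1)]] by auto
    have "c = c + k" using max[OF integral_plus[OF c(1) k] _ factors_sum[OF ch c(1) k c(3) fk] u(1)] u(1) c(2) by blast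
    then show "k \<subseteq> c" using u(2) by simp
  next
    assume kc: "k \<subseteq> c"
    show "factors_through A sg ch k"
      unfolding factors_iff[OF ch k]
    proof (intro ballI impI)
      fix \<sigma> \<tau> assume s: "\<sigma> \<in> carrier GG" "\<tau> \<in> carrier GG" "\<sigma> k = \<tau> k"
      then have "\<sigma> c = \<tau> c" using GG_pr[OF s(1) k c(1) kc] GG_pr[OF s(2) k c(1) kc] by simp
      then show "ch \<sigma> = ch \<tau>" using c(3)[unfolded factors_iff[OF ch c(1)]] s by blast
    qed
  qed
  then show ?thesis using c unfolding has_conductor_def by blast
qed

lemma fibre_open: assumes f: "ideal f" shows "openin (ray_top A sg) {\<tau> \<in> carrier GG. \<tau> f = \<gamma>}"
proof (cases "\<gamma> \<in> carrier (H f)")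
  case True
  let ?P = "product_topology (\<lambda>f. discrete_topology (carrier (H f))) {f. ideal f}"
  have "continuous_map ?P (discrete_topology (carrier (H f))) (\<lambda>x. x f)"
    using continuous_map_product_projection[of f "{f. ideal f}" "\<lambda>f. discrete_topology (carrier (H f))"] f by simp
  then have "openin ?P {x \<in> topspace ?P. x f \<in> {\<gamma>}}"
    by (rule openin_continuous_map_preimage) (use True in simp)
  moreover have "{\<tau> \<in> carrier GG. \<tau> f = \<gamma>} = {x \<in> topspace ?P. x f \<in> {\<gamma>}} \<inter> carrier GG"
  proof -
    have "x \<in> topspace ?P" if "x \<in> carrier GG" for x using that unfolding GG_carrier by simp
    then show ?thesis by blast
  qed
  ultimately show ?thesis unfolding ray_top_def openin_subtopology by blast
next
  case False
  then have "{\<tau> \<in> carrier GG. \<tau> f = \<gamma>} = {}" using GG_H f by blast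
  then show ?thesis by (simp only: openin_empty)
qed

lemma pullback_char: assumes f: "ideal f" and psi: "\<psi> \<in> hom (H f) complex_units"
  shows "is_character A sg (\<lambda>\<sigma>. \<psi> (\<sigma> f))" "(\<lambda>\<sigma>. \<psi> (\<sigma> f)) \<in> hom GG complex_units"
    "factors_through A sg (\<lambda>\<sigma>. \<psi> (\<sigma> f)) f"
proof -
  show h: "(\<lambda>\<sigma>. \<psi> (\<sigma> f)) \<in> hom GG complex_units"
    using psi GG_H[OF _ f] by (auto simp: hom_def GG_mult[OF f])
  show "factors_through A sg (\<lambda>\<sigma>. \<psi> (\<sigma> f)) f" unfolding factors_through_def using psi by blast
  show "is_character A sg (\<lambda>\<sigma>. \<psi> (\<sigma> f))"
    unfolding is_character_def
  proof (intro conjI ballI h)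
    fix \<sigma> assume "\<sigma> \<in> carrier GG"
    then show "\<exists>S. openin (ray_top A sg) S \<and> \<sigma> \<in> S \<and> (\<forall>\<tau>\<in>S. \<psi> (\<tau> f) = \<psi> (\<sigma> f))"
      using fibre_open[OF f, of "\<sigma> f"] by (intro exI[of _ "{\<tau> \<in> carrier GG. \<tau> f = \<sigma> f}"]) auto
  qed
qed

text \<open>The fibres of the projection to H f are carried into one another by translations, so
  each has measure 1 / |H f|.\<close>

lemma haar_integral: fixes F :: "'k set set \<Rightarrow> complex"
  assumes haar: "is_haar_prob A sg \<mu>" and f: "ideal f"
  shows "(\<integral>\<sigma>. F (\<sigma> f) \<partial>\<mu>) = 1 / of_nat (card (carrier (H f))) * (\<Sum>\<gamma>\<in>carrier (H f). F \<gamma>)"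
proof -
  have sp: "space \<mu> = carrier GG" and st: "sets \<mu> = sigma_sets (carrier GG) {S. openin (ray_top A sg) S}"
    and one: "emeasure \<mu> (space \<mu>) = 1"
    and inv: "\<And>\<sigma> S. \<sigma> \<in> carrier GG \<Longrightarrow> S \<in> sets \<mu> \<Longrightarrow> emeasure \<mu> ((\<lambda>\<tau>. \<sigma> \<otimes>\<^bsub>GG\<^esub> \<tau>) ` S) = emeasure \<mu> S"
    using haar by (auto simp: is_haar_prob_def)
  interpret Hf: comm_group "H f" by (rule H_comm_group[OF f])
  interpret finite_measure \<mu> by (rule finite_measureI) (simp add: one)
  define B where "B \<gamma> = {\<tau> \<in> carrier GG. \<tau> f = \<gamma>}" for \<gamma>
  have Bs: "B \<gamma> \<in> sets \<mu>" for \<gamma>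
    unfolding st B_def by (rule sigma_sets.Basic) (simp add: fibre_open[OF f])
  have le: "emeasure \<mu> (B \<gamma>) \<le> emeasure \<mu> (B \<delta>)" if c: "\<gamma> \<in> carrier (H f)" "\<delta> \<in> carrier (H f)" for \<gamma> \<delta>
  proof -
    let ?k = "\<delta> \<otimes>\<^bsub>H f\<^esub> inv\<^bsub>H f\<^esub> \<gamma>"
    have k: "?k \<in> carrier (H f)" using c by simp
    let ?s = "lift f ?k"
    have "(\<lambda>\<tau>. ?s \<otimes>\<^bsub>GG\<^esub> \<tau>) ` B \<gamma> \<subseteq> B \<delta>"
      using GG_mult_closed lift[OF f k] c by (auto simp: B_def GG_mult[OF f] Hf.m_assoc)
    then have "emeasure \<mu> ((\<lambda>\<tau>. ?s \<otimes>\<^bsub>GG\<^esub> \<tau>) ` B \<gamma>) \<le> emeasure \<mu> (B \<delta>)" by (rule emeasure_mono[OF _ Bs])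
    then show ?thesis using inv[OF lift(1)[OF f k] Bs] by simp
  qed
  have fin: "finite (carrier (H f))" by (rule H_finite[OF f])
  let ?n = "card (carrier (H f))"
  have n: "?n > 0" using fin Hf.one_closed card_gt_0_iff by blast
  have m: "measure \<mu> (B \<gamma>) = 1 / real ?n" if c: "\<gamma> \<in> carrier (H f)" for \<gamma>
  proof -
    have eq: "measure \<mu> (B \<delta>) = measure \<mu> (B \<gamma>)" if "\<delta> \<in> carrier (H f)" for \<delta>
      using le[OF c that] le[OF that c] by (simp add: measure_def)
    have "(\<Union>\<delta>\<in>carrier (H f). B \<delta>) = space \<mu>" unfolding sp B_def using GG_H[OF _ f] by auto
    moreover have "measure \<mu> (\<Union>\<delta>\<in>carrier (H f). B \<delta>) = (\<Sum>\<delta>\<in>carrier (H f). measure \<mu> (B \<delta>))"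
    proof (rule finite_measure_finite_Union[OF fin])
      show "B ` carrier (H f) \<subseteq> sets \<mu>" using Bs by blast
      show "disjoint_family_on B (carrier (H f))" by (auto simp: disjoint_family_on_def B_def)
    qed
    moreover have "measure \<mu> (space \<mu>) = 1" using one by (simp add: measure_def)
    ultimately have "1 = real ?n * measure \<mu> (B \<gamma>)" using eq by simp
    then show ?thesis using n by (simp add: field_simps)
  qed
  have "(\<integral>\<sigma>. F (\<sigma> f) \<partial>\<mu>) = (\<integral>\<sigma>. (\<Sum>\<gamma>\<in>carrier (H f). indicator (B \<gamma>) \<sigma> *\<^sub>R F \<gamma>) \<partial>\<mu>)"
  proof (rule Bochner_Integration.integral_cong[OF refl])
    fix \<sigma> assume s: "\<sigma> \<in> space \<mu>"
    then have "\<sigma> \<in> carrier GG" by (simp add: sp)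
    then have "(\<Sum>\<gamma>\<in>carrier (H f). indicator (B \<gamma>) \<sigma> *\<^sub>R F \<gamma>) = (\<Sum>\<gamma>\<in>carrier (H f). if \<gamma> = \<sigma> f then F \<gamma> else 0)"
      by (intro sum.cong) (auto simp: B_def indicator_def)
    then show "F (\<sigma> f) = (\<Sum>\<gamma>\<in>carrier (H f). indicator (B \<gamma>) \<sigma> *\<^sub>R F \<gamma>)"
      using fin GG_H[OF \<open>\<sigma> \<in> carrier GG\<close> f] by simp
  qed
  also have "\<dots> = (\<Sum>\<gamma>\<in>carrier (H f). (\<integral>\<sigma>. indicator (B \<gamma>) \<sigma> *\<^sub>R F \<gamma> \<partial>\<mu>))"
    using Bs by (intro Bochner_Integration.integral_sum) (simp add: emeasure_eq_measure)
  also have "\<dots> = (\<Sum>\<gamma>\<in>carrier (H f). measure \<mu> (B \<gamma>) *\<^sub>R F \<gamma>)"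
    using Bs by (intro sum.cong) (simp_all add: emeasure_eq_measure)
  also have "\<dots> = (\<Sum>\<gamma>\<in>carrier (H f). (1 / of_nat ?n) * F \<gamma>)"
    using m by (intro sum.cong) (simp_all add: scaleR_conv_of_real)
  finally show ?thesis by (simp add: sum_distrib_left)
qed

end

section \<open>Fourier coefficients of the universal homomorphism\<close>

locale universal_hom = arith A sg for A :: "'k::topological_field set" and sg :: "'k \<Rightarrow> 'k" +
  fixes \<mu> :: "('k set \<Rightarrow> 'k set set) measure" and u :: "('k set set \<Rightarrow>\<^sub>0 int) \<Rightarrow> rat"
  assumes haar: "is_haar_prob A sg \<mu>" and uni: "is_universal_hom A sg \<mu> u"
begin

definition v :: "'k set set \<Rightarrow> rat" where "v \<xi> = u (frag_of \<xi>)"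

text \<open>The Euler product prescribed for the coefficient. Conductor c and level g are separate
  arguments because one character has to be compared at the levels g and p g.\<close>

definition Pf :: "(('k set \<Rightarrow> 'k set set) \<Rightarrow> complex) \<Rightarrow> 'k set \<Rightarrow> 'k set \<Rightarrow> complex" where
  "Pf ch c g = (\<Prod>p\<in>{p. maxi p \<and> g \<subseteq> p}. 1 - char_at A sg ch c p)"

text \<open>The factor 1 / |G_f| in the prescribed integral cancels against the one from the Haar
  average.\<close>

lemma char_sum_eq: assumes f: "ideal f" and psi: "\<psi> \<in> hom (H f) complex_units"
  and c: "has_conductor A sg (\<lambda>\<sigma>. \<psi> (\<sigma> f)) c" and fc: "f \<subseteq> c"
  shows "(\<Sum>\<gamma>\<in>carrier (H f). of_rat (v (ga f \<gamma> (cl 1 f))) * \<psi> \<gamma>) = Pf (\<lambda>\<sigma>. \<psi> (\<sigma> f)) c f"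
proof -
  let ?ch = "\<lambda>\<sigma>. \<psi> (\<sigma> f)"
  let ?n = "card (carrier (H f))"
  interpret Hf: comm_group "H f" by (rule H_comm_group[OF f])
  have n: "?n > 0" using H_finite[OF f] Hf.one_closed card_gt_0_iff by blast
  have sp: "space \<mu> = carrier GG" using haar by (simp add: is_haar_prob_def)
  have ci: "ideal c" using c by (simp add: has_conductor_def)
  have "ideal_dvd A c f" using dvd_iff[OF ci f] fc by simp
  then have U: "(\<integral>\<gamma>. of_rat (u (frag_of (act A sg \<gamma> (hclass A sg (1 +o f))))) * ?ch \<gamma> \<partial>\<mu>) =
      1 / of_nat ?n * (\<Prod>p\<in>{p. maxi p \<and> ideal_dvd A p f}. 1 - char_at A sg ?ch c p)"
    using uni f pullback_char(1)[OF f psi] c unfolding is_universal_hom_def by blast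
  have "{p. maxi p \<and> ideal_dvd A p f} = {p. maxi p \<and> f \<subseteq> p}" using dvd_iff[OF maxi_ideal f] by blast
  then have R: "(\<Prod>p\<in>{p. maxi p \<and> ideal_dvd A p f}. 1 - char_at A sg ?ch c p) = Pf ?ch c f" by (simp add: Pf_def)
  have "(\<integral>\<gamma>. of_rat (u (frag_of (act A sg \<gamma> (hclass A sg (1 +o f))))) * ?ch \<gamma> \<partial>\<mu>)
      = (\<integral>\<sigma>. (\<lambda>\<gamma>. of_rat (v (ga f \<gamma> (cl 1 f))) * \<psi> \<gamma>) (\<sigma> f) \<partial>\<mu>)"
  proof (rule Bochner_Integration.integral_cong[OF refl])
    fix \<sigma> assume "\<sigma> \<in> space \<mu>"
    then show "of_rat (u (frag_of (act A sg \<sigma> (hclass A sg (1 +o f))))) * ?ch \<sigma> = of_rat (v (ga f (\<sigma> f) (cl 1 f))) * \<psi> (\<sigma> f)"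
      using act_ga[OF _ f one_Xit[OF f f subset_refl], of \<sigma>] by (simp add: sp v_def cl_def)
  qed
  also have "\<dots> = 1 / of_nat ?n * (\<Sum>\<gamma>\<in>carrier (H f). of_rat (v (ga f \<gamma> (cl 1 f))) * \<psi> \<gamma>)"
    by (rule haar_integral[OF haar f])
  finally show ?thesis using U R n by simp
qed

text \<open>\<open>char_at\<close> reads the value at level c. A lift of the class of p from level g
  projects to the class of p at level c, so a deeper level prime to p gives the same value.\<close>

lemma char_at_eq: assumes ch: "ch \<in> hom GG complex_units" and c: "has_conductor A sg ch c"
  and g: "ideal g" and gc: "g \<subseteq> c" and psi: "\<And>\<sigma>. \<sigma> \<in> carrier GG \<Longrightarrow> ch \<sigma> = \<psi> (\<sigma> g)"
  and p: "maxi p" and gp: "\<not> g \<subseteq> p"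
  shows "char_at A sg ch c p = \<psi> (rc g p)"
proof -
  have ci: "ideal c" using c by (simp add: has_conductor_def)
  have pi: "ideal p" by (rule maxi_ideal[OF p])
  have "ideal_dvd A c c" using dvd_iff[OF ci ci] by simp
  then have fc: "factors_through A sg ch c" using c ci by (simp add: has_conductor_def)
  have cp: "\<not> ideal_dvd A p c" using dvd_iff[OF pi ci] gc gp by blast
  have pg: "comax p g" using max_com[OF p g gp] com_sym by blast
  let ?s = "lift g (rc g p)"
  have s: "?s \<in> carrier GG" "?s g = rc g p" using lift[OF g rc_H[OF g pi pg]] by auto
  have sc: "?s c = rc c p" using GG_pr[OF s(1) g ci gc] s(2) pr_rc[OF g ci gc pi pg] by simp
  have "(THE w. \<exists>\<sigma>\<in>carrier GG. \<sigma> c = rc c p \<and> w = ch \<sigma>) = ch ?s"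
  proof (rule the_equality)
    show "\<exists>\<sigma>\<in>carrier GG. \<sigma> c = rc c p \<and> ch ?s = ch \<sigma>" using s(1) sc by blast
    fix w assume "\<exists>\<sigma>\<in>carrier GG. \<sigma> c = rc c p \<and> w = ch \<sigma>"
    then obtain \<sigma> where "\<sigma> \<in> carrier GG" "\<sigma> c = rc c p" "w = ch \<sigma>" by blast
    then show "w = ch ?s" using fc[unfolded factors_iff[OF ch ci]] s(1) sc by metis
  qed
  then show ?thesis using cp psi[OF s(1)] s(2) by (simp add: char_at_def)
qed

lemma ker_closed: assumes h: "ideal h" and g: "ideal g" and hg: "h \<subseteq> g"
  shows "ker h g \<subseteq> carrier (H h)" "finite (ker h g)" "\<one>\<^bsub>H h\<^esub> \<in> ker h g"
    "\<kappa> \<in> ker h g \<Longrightarrow> \<nu> \<in> ker h g \<Longrightarrow> \<kappa> \<otimes>\<^bsub>H h\<^esub> \<nu> \<in> ker h g" "\<kappa> \<in> ker h g \<Longrightarrow> inv\<^bsub>H h\<^esub> \<kappa> \<in> ker h g"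
proof -
  interpret Hh: comm_group "H h" by (rule H_comm_group[OF h])
  interpret Hg: comm_group "H g" by (rule H_comm_group[OF g])
  interpret P: group_hom "H h" "H g" "pr g"
    by (unfold_locales) (rule pr_hom[OF h g hg])
  show sub: "ker h g \<subseteq> carrier (H h)" by (auto simp: ker_def)
  show "finite (ker h g)" by (rule finite_subset[OF sub H_finite[OF h]])
  show "\<one>\<^bsub>H h\<^esub> \<in> ker h g" by (simp add: ker_def)
  show "\<kappa> \<otimes>\<^bsub>H h\<^esub> \<nu> \<in> ker h g" if "\<kappa> \<in> ker h g" "\<nu> \<in> ker h g" using that by (auto simp: ker_def)
  show "inv\<^bsub>H h\<^esub> \<kappa> \<in> ker h g" if "\<kappa> \<in> ker h g" using that by (auto simp: ker_def)
qed

text \<open>The fibres of \<open>pr g\<close> are cosets of the kernel, all of the same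
  size.\<close>

lemma sum_fibre: fixes F :: "'k set set \<Rightarrow> complex"
  assumes h: "ideal h" and g: "ideal g" and hg: "h \<subseteq> g"
  shows "(\<Sum>\<gamma>\<in>carrier (H h). F (pr g \<gamma>)) = of_nat (card (ker h g)) * (\<Sum>\<delta>\<in>carrier (H g). F \<delta>)"
proof -
  interpret Hh: comm_group "H h" by (rule H_comm_group[OF h])
  interpret Hg: comm_group "H g" by (rule H_comm_group[OF g])
  interpret P: group_hom "H h" "H g" "pr g"
    by (unfold_locales) (rule pr_hom[OF h g hg])
  have cf: "card {\<gamma> \<in> carrier (H h). pr g \<gamma> = \<delta>} = card (ker h g)" if d: "\<delta> \<in> carrier (H g)" for \<delta>
  proof -
    have "\<delta> \<in> pr g ` carrier (H h)" unfolding pr_surj[OF h g hg] by (rule d)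
    then obtain \<alpha> where a: "\<alpha> \<in> carrier (H h)" "pr g \<alpha> = \<delta>" by auto
    have "bij_betw (\<lambda>\<kappa>. \<kappa> \<otimes>\<^bsub>H h\<^esub> \<alpha>) (ker h g) {\<gamma> \<in> carrier (H h). pr g \<gamma> = \<delta>}"
    proof (rule bij_betw_byWitness[where f' = "\<lambda>\<gamma>. \<gamma> \<otimes>\<^bsub>H h\<^esub> inv\<^bsub>H h\<^esub> \<alpha>"])
      show "\<forall>\<kappa>\<in>ker h g. \<kappa> \<otimes>\<^bsub>H h\<^esub> \<alpha> \<otimes>\<^bsub>H h\<^esub> inv\<^bsub>H h\<^esub> \<alpha> = \<kappa>"
        using a(1) by (simp add: ker_def Hh.m_assoc)
      show "\<forall>\<gamma>\<in>{\<gamma> \<in> carrier (H h). pr g \<gamma> = \<delta>}. \<gamma> \<otimes>\<^bsub>H h\<^esub> inv\<^bsub>H h\<^esub> \<alpha> \<otimes>\<^bsub>H h\<^esub> \<alpha> = \<gamma>"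
        using a(1) by (simp add: Hh.m_assoc)
      show "(\<lambda>\<kappa>. \<kappa> \<otimes>\<^bsub>H h\<^esub> \<alpha>) ` ker h g \<subseteq> {\<gamma> \<in> carrier (H h). pr g \<gamma> = \<delta>}"
      proof clarify
        fix \<kappa> assume "\<kappa> \<in> ker h g"
        then show "\<kappa> \<otimes>\<^bsub>H h\<^esub> \<alpha> \<in> carrier (H h) \<and> pr g (\<kappa> \<otimes>\<^bsub>H h\<^esub> \<alpha>) = \<delta>"
          using P.hom_mult[of \<kappa> \<alpha>] a d by (simp add: ker_def)
      qed
      show "(\<lambda>\<gamma>. \<gamma> \<otimes>\<^bsub>H h\<^esub> inv\<^bsub>H h\<^esub> \<alpha>) ` {\<gamma> \<in> carrier (H h). pr g \<gamma> = \<delta>} \<subseteq> ker h g"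
      proof clarify
        fix \<gamma> assume c: "\<gamma> \<in> carrier (H h)" "\<delta> = pr g \<gamma>"
        then have "pr g (\<gamma> \<otimes>\<^bsub>H h\<^esub> inv\<^bsub>H h\<^esub> \<alpha>) = pr g \<gamma> \<otimes>\<^bsub>H g\<^esub> inv\<^bsub>H g\<^esub> (pr g \<alpha>)"
          using P.hom_mult[of \<gamma> "inv\<^bsub>H h\<^esub> \<alpha>"] a(1) by simp
        then show "\<gamma> \<otimes>\<^bsub>H h\<^esub> inv\<^bsub>H h\<^esub> \<alpha> \<in> ker h g" using a d c by (simp add: ker_def)
      qed
    qed
    then show ?thesis by (simp add: bij_betw_same_card)
  qed
  have "(\<Sum>\<gamma>\<in>carrier (H h). F (pr g \<gamma>)) = (\<Sum>\<delta>\<in>carrier (H g). \<Sum>\<gamma>\<in>{\<gamma> \<in> carrier (H h). pr g \<gamma> = \<delta>}. F (pr g \<gamma>))"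
    by (rule sum.group[symmetric, OF H_finite[OF h] H_finite[OF g]]) auto
  also have "\<dots> = (\<Sum>\<delta>\<in>carrier (H g). of_nat (card (ker h g)) * F \<delta>)"
    by (rule sum.cong[OF refl]) (simp add: cf)
  finally show ?thesis by (simp add: sum_distrib_left)
qed

lemma char_descend: assumes h: "ideal h" and g: "ideal g" and hg: "h \<subseteq> g"
  and psi: "\<psi> \<in> hom (H h) complex_units" and triv: "\<forall>\<kappa>\<in>ker h g. \<psi> \<kappa> = 1"
  shows "\<exists>\<phi>\<in>hom (H g) complex_units. \<forall>\<gamma>\<in>carrier (H h). \<psi> \<gamma> = \<phi> (pr g \<gamma>)"
proof -
  interpret Hh: comm_group "H h" by (rule H_comm_group[OF h])
  interpret Hg: comm_group "H g" by (rule H_comm_group[OF g])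
  interpret P: group_hom "H h" "H g" "pr g"
    by (unfold_locales) (rule pr_hom[OF h g hg])
  let ?ch = "\<lambda>\<sigma>. \<psi> (\<sigma> h)"
  note ch = pullback_char(2)[OF h psi]
  have "factors_through A sg ?ch g"
    unfolding factors_iff[OF ch g]
  proof (intro ballI impI)
    fix \<sigma> \<tau> assume s: "\<sigma> \<in> carrier GG" "\<tau> \<in> carrier GG" "\<sigma> g = \<tau> g"
    have c: "\<sigma> h \<in> carrier (H h)" "\<tau> h \<in> carrier (H h)" using GG_H s h by auto
    have "pr g (\<sigma> h) = pr g (\<tau> h)" using GG_pr[OF s(1) h g hg] GG_pr[OF s(2) h g hg] s(3) by simp
    then have "\<sigma> h \<otimes>\<^bsub>H h\<^esub> inv\<^bsub>H h\<^esub> \<tau> h \<in> ker h g" using c by (simp add: ker_def)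
    then have "\<psi> (\<sigma> h) * inverse (\<psi> (\<tau> h)) = 1"
      using triv cchar_mult[OF psi] Hh.cchar_inv[OF psi] c by (metis Hh.inv_closed)
    then show "\<psi> (\<sigma> h) = \<psi> (\<tau> h)" using cchar_nonzero[OF psi c(2)] by (simp add: field_simps)
  qed
  then obtain \<phi> where phi: "\<phi> \<in> hom (H g) complex_units" "\<forall>\<sigma>\<in>carrier GG. \<psi> (\<sigma> h) = \<phi> (\<sigma> g)"
    unfolding factors_through_def by blast
  have "\<psi> \<gamma> = \<phi> (pr g \<gamma>)" if c: "\<gamma> \<in> carrier (H h)" for \<gamma>
    using phi(2) lift[OF h c] GG_pr[OF lift(1)[OF h c] h g hg] by metis
  then show ?thesis using phi(1) by blast
qed

text \<open>Substituting \<gamma> \<kappa> for \<gamma>: translating a class multiplies its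
  coefficient by the inverse of the character value.\<close>

lemma sum_ga: assumes h: "ideal h" and k: "\<kappa> \<in> carrier (H h)" and xi: "\<xi> \<in> Xit h" and psi: "\<psi> \<in> hom (H h) complex_units"
  shows "(\<Sum>\<gamma>\<in>carrier (H h). of_rat (v (ga h \<gamma> (ga h \<kappa> \<xi>))) * \<psi> \<gamma>)
    = inverse (\<psi> \<kappa>) * (\<Sum>\<gamma>\<in>carrier (H h). of_rat (v (ga h \<gamma> \<xi>)) * \<psi> \<gamma>)"
proof -
  interpret Hh: comm_group "H h" by (rule H_comm_group[OF h])
  have "(\<Sum>\<gamma>\<in>carrier (H h). of_rat (v (ga h \<gamma> \<xi>)) * \<psi> \<gamma>) =
      (\<Sum>\<gamma>\<in>carrier (H h). of_rat (v (ga h (\<gamma> \<otimes>\<^bsub>H h\<^esub> \<kappa>) \<xi>)) * \<psi> (\<gamma> \<otimes>\<^bsub>H h\<^esub> \<kappa>))"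
    by (rule Hh.sum_translate[OF k, symmetric])
  also have "\<dots> = (\<Sum>\<gamma>\<in>carrier (H h). \<psi> \<kappa> * (of_rat (v (ga h \<gamma> (ga h \<kappa> \<xi>))) * \<psi> \<gamma>))"
    by (rule sum.cong[OF refl]) (simp add: ga_mult[OF h xi _ k] cchar_mult[OF psi _ k])
  finally show ?thesis using cchar_nonzero[OF psi k] by (simp add: sum_distrib_left[symmetric])
qed

text \<open>Both sides are functions on the ray class group modulo \<open>p g\<close> with the same Fourier coefficients.\<close>

lemma dist_rel_one: assumes p: "maxi p" and g: "ideal g" and c: "\<gamma> \<in> carrier (H (p \<cdot> g))"
  shows "v (ga (p \<cdot> g) \<gamma> (cl 1 g)) = (\<Sum>\<eta>\<in>fib p (cl 1 g). v (ga (p \<cdot> g) \<gamma> \<eta>))"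
proof -
  define h where "h = p \<cdot> g"
  have pi: "ideal p" by (rule maxi_ideal[OF p])
  have h: "ideal h" unfolding h_def by (rule integral_mul[OF pi g])
  have hg: "h \<subseteq> g" unfolding h_def using mp_int_sub[OF pi integral_sm[OF g]] .
  have hne: "h \<noteq> g" unfolding h_def using maxi_proper_mul[OF p ideal_glat[OF g]] .
  interpret Hh: comm_group "H h" by (rule H_comm_group[OF h])
  interpret Hg: comm_group "H g" by (rule H_comm_group[OF g])
  interpret P: group_hom "H h" "H g" "pr g"
    by (unfold_locales) (rule pr_hom[OF h g hg])
  note ker = ker_closed[OF h g hg]
  have xh: "cl 1 h \<in> Xit h" and xg: "cl 1 g \<in> Xit h" and xgg: "cl 1 g \<in> Xit g"
    using one_Xit h g hg by auto
  let ?i = "inv\<^bsub>H g\<^esub> (rc g p)"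
  have rp: "comax p g" "rc g p \<in> carrier (H g)" if "\<not> g \<subseteq> p"
    using max_com[OF p g that] com_sym rc_H[OF g pi] by blast+
  define \<tau> where "\<tau> = (SOME \<tau>. \<tau> \<in> carrier (H h) \<and> pr g \<tau> = ?i)"
  have tau: "\<tau> \<in> carrier (H h)" "pr g \<tau> = ?i" if "\<not> g \<subseteq> p"
  proof -
    have "?i \<in> pr g ` carrier (H h)" using pr_surj[OF h g hg] rp(2)[OF that] by simp
    then have "\<exists>\<tau>. \<tau> \<in> carrier (H h) \<and> pr g \<tau> = ?i" by (metis imageE)
    from someI_ex[OF this] show "\<tau> \<in> carrier (H h)" "pr g \<tau> = ?i" unfolding \<tau>_def by auto
  qed
  define K where "K = (\<lambda>\<kappa>. ga h \<kappa> (cl 1 h)) ` ker h g"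
  define S where "S = (if g \<subseteq> p then {} else {ga h \<tau> (cl 1 g)})"
  have fibe: "fib p (cl 1 g) = K \<union> S"
    unfolding fib_one[OF p g] K_def S_def h_def[symmetric] using ga_pr[OF h g hg xgg tau(1)] tau(2) by simp
  have injK: "inj_on (\<lambda>\<kappa>. ga h \<kappa> (cl 1 h)) (ker h g)"
    by (rule inj_onI) (use ker(1) ga_inj[OF h] in blast)
  have disj: "K \<inter> S = {}"
  proof -
    have "cord \<eta> = h" if "\<eta> \<in> K" for \<eta> using that ga_cord(2)[OF h xh] cord_one[OF h] ker(1) by (auto simp: K_def)
    moreover have "cord \<eta> = g" if "\<eta> \<in> S" for \<eta>
      using that ga_cord(2)[OF h xg] cord_one[OF g] tau(1) by (auto simp: S_def split: if_splits)
    ultimately show ?thesis using hne by blast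
  qed
  have fin: "finite K" "finite S" using ker(2) by (auto simp: K_def S_def)
  define a where "a x \<gamma> = (of_rat (v (ga h \<gamma> x)) :: complex)" for x \<gamma>
  define D where "D \<gamma> = a (cl 1 g) \<gamma> - (\<Sum>\<eta>\<in>fib p (cl 1 g). a \<eta> \<gamma>)" for \<gamma>
  have "D \<gamma> = 0"
  proof (rule Hh.fourier_zero[OF H_finite[OF h]])
    show "\<gamma> \<in> carrier (H h)" using c by (simp add: h_def)
    fix \<psi> assume psi: "\<psi> \<in> hom (H h) complex_units"
    define B where "B x = (\<Sum>\<gamma>\<in>carrier (H h). a x \<gamma> * \<psi> \<gamma>)" for x
    have BK: "B (ga h \<kappa> (cl 1 h)) = inverse (\<psi> \<kappa>) * B (cl 1 h)" if "\<kappa> \<in> carrier (H h)" for \<kappa>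
      unfolding B_def a_def by (rule sum_ga[OF h that xh psi])
    have BS: "B (ga h \<kappa> (cl 1 g)) = inverse (\<psi> \<kappa>) * B (cl 1 g)" if "\<kappa> \<in> carrier (H h)" for \<kappa>
      unfolding B_def a_def by (rule sum_ga[OF h that xg psi])
    define k where "k = (\<Sum>\<kappa>\<in>ker h g. inverse (\<psi> \<kappa>))"
    have sumS: "(\<Sum>\<eta>\<in>S. B \<eta>) = (if g \<subseteq> p then 0 else inverse (\<psi> \<tau>) * B (cl 1 g))"
      using BS tau(1) by (simp add: S_def)
    have sumK: "(\<Sum>\<eta>\<in>K. B \<eta>) = k * B (cl 1 h)"
      unfolding K_def sum.reindex[OF injK] k_def sum_distrib_right using BK ker(1) by (intro sum.cong) auto
    have "(\<Sum>\<gamma>\<in>carrier (H h). D \<gamma> * \<psi> \<gamma>) = B (cl 1 g) - (\<Sum>\<eta>\<in>fib p (cl 1 g). B \<eta>)"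
      unfolding D_def B_def left_diff_distrib sum_subtractf sum_distrib_right
      by (subst (2) sum.swap) simp
    also have "(\<Sum>\<eta>\<in>fib p (cl 1 g). B \<eta>) = (\<Sum>\<eta>\<in>K. B \<eta>) + (\<Sum>\<eta>\<in>S. B \<eta>)"
      unfolding fibe by (rule sum.union_disjoint[OF fin disj])
    finally have tot: "(\<Sum>\<gamma>\<in>carrier (H h). D \<gamma> * \<psi> \<gamma>) = B (cl 1 g) - k * B (cl 1 h) - (if g \<subseteq> p then 0 else inverse (\<psi> \<tau>) * B (cl 1 g))"
      unfolding sumS sumK by simp
    show "(\<Sum>\<gamma>\<in>carrier (H h). D \<gamma> * \<psi> \<gamma>) = 0"
    \<comment> \<open>A character nontrivial on the kernel annihilates every term:
      \<open>B (cl 1 g)\<close> because the kernel fixes \<open>cl 1 g\<close>, and \<open>k\<close>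
      as a nontrivial character sum. Otherwise it comes from level g, and Euler products are
      compared.\<close>
    proof (cases "\<forall>\<kappa>\<in>ker h g. \<psi> \<kappa> = 1")
      case False
      then obtain \<kappa> where k0: "\<kappa> \<in> ker h g" "\<psi> \<kappa> \<noteq> 1" by blast
      have kc: "\<kappa> \<in> carrier (H h)" "pr g \<kappa> = \<one>\<^bsub>H g\<^esub>" using k0(1) by (auto simp: ker_def)
      have "ga h \<kappa> (cl 1 g) = cl 1 g" using ga_pr[OF h g hg xgg kc(1)] kc(2) ga_one[OF g xgg] by simp
      then have "B (cl 1 g) = inverse (\<psi> \<kappa>) * B (cl 1 g)" using BS[OF kc(1)] by simp
      then have "\<psi> \<kappa> * B (cl 1 g) = B (cl 1 g)" using cchar_nonzero[OF psi kc(1)] by (simp add: field_simps)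
      then have Bg: "B (cl 1 g) = 0" using k0(2) by simp
      have "(\<Sum>\<nu>\<in>ker h g. inverse (\<psi> (\<nu> \<otimes>\<^bsub>H h\<^esub> \<kappa>))) = k"
        unfolding k_def
      proof (rule sum.reindex_bij_witness[of _ "\<lambda>\<nu>. \<nu> \<otimes>\<^bsub>H h\<^esub> inv\<^bsub>H h\<^esub> \<kappa>" "\<lambda>\<nu>. \<nu> \<otimes>\<^bsub>H h\<^esub> \<kappa>"])
        fix \<nu> assume l: "\<nu> \<in> ker h g"
        then have lc: "\<nu> \<in> carrier (H h)" using ker(1) by blast
        show "\<nu> \<otimes>\<^bsub>H h\<^esub> \<kappa> \<otimes>\<^bsub>H h\<^esub> inv\<^bsub>H h\<^esub> \<kappa> = \<nu>" "\<nu> \<otimes>\<^bsub>H h\<^esub> inv\<^bsub>H h\<^esub> \<kappa> \<otimes>\<^bsub>H h\<^esub> \<kappa> = \<nu>"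
          using lc kc by (simp_all add: Hh.m_assoc)
        show "\<nu> \<otimes>\<^bsub>H h\<^esub> \<kappa> \<in> ker h g" "\<nu> \<otimes>\<^bsub>H h\<^esub> inv\<^bsub>H h\<^esub> \<kappa> \<in> ker h g" using ker l k0(1) by auto
      qed simp
      moreover have "(\<Sum>\<nu>\<in>ker h g. inverse (\<psi> (\<nu> \<otimes>\<^bsub>H h\<^esub> \<kappa>))) = k * inverse (\<psi> \<kappa>)"
        unfolding k_def sum_distrib_right using ker(1) kc(1) by (intro sum.cong) (auto simp: cchar_mult[OF psi])
      ultimately have "k = k * inverse (\<psi> \<kappa>)" by simp
      then have "k * \<psi> \<kappa> = k" using cchar_nonzero[OF psi kc(1)] by (simp add: field_simps)
      then have "k = 0" using k0(2) by simp
      then show ?thesis using tot Bg by simp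
    next
      case True
      obtain \<phi> where phi: "\<phi> \<in> hom (H g) complex_units" "\<forall>\<gamma>\<in>carrier (H h). \<psi> \<gamma> = \<phi> (pr g \<gamma>)"
        using char_descend[OF h g hg psi True] by blast
      have kk: "k = of_nat (card (ker h g))" unfolding k_def using True by simp
      let ?ch = "\<lambda>\<sigma>. \<phi> (\<sigma> g)" and ?ch' = "\<lambda>\<sigma>. \<psi> (\<sigma> h)"
      \<comment> \<open>The two functions agree on the limit group only, so conductor and values at
        primes have to be transferred from one to the other.\<close>
      have chh: "?ch' \<sigma> = ?ch \<sigma>" if "\<sigma> \<in> carrier GG" for \<sigma>
        using phi(2) GG_H[OF that h] GG_pr[OF that h g hg] by simp
      note ch = pullback_char(2)[OF g phi(1)] and ch' = pullback_char(2)[OF h psi]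
      have fac: "factors_through A sg ?ch g" by (rule pullback_char(3)[OF g phi(1)])
      obtain d where d: "has_conductor A sg ?ch d" "g \<subseteq> d" using conductor_exists[OF ch g fac] by blast
      have ft: "factors_through A sg ?ch' f = factors_through A sg ?ch f" for f
        unfolding factors_through_def using chh by auto
      have d': "has_conductor A sg ?ch' d" using d(1) unfolding has_conductor_def ft .
      have hd: "h \<subseteq> d" using hg d(2) by blast
      have ca: "char_at A sg ?ch' d q = char_at A sg ?ch d q" for q
      proof -
        have "(\<lambda>w. \<exists>\<sigma>\<in>carrier GG. \<sigma> d = rc d q \<and> w = ?ch' \<sigma>) = (\<lambda>w. \<exists>\<sigma>\<in>carrier GG. \<sigma> d = rc d q \<and> w = ?ch \<sigma>)"
          using chh by (intro ext bex_cong) auto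
        then show ?thesis by (simp add: char_at_def)
      qed
      have Pff: "Pf ?ch' d f = Pf ?ch d f" for f unfolding Pf_def ca ..
      have Bh: "B (cl 1 h) = Pf ?ch d h"
        unfolding B_def a_def Pff[symmetric] by (rule char_sum_eq[OF h psi d' hd])
      have "B (cl 1 g) = (\<Sum>\<gamma>\<in>carrier (H h). of_rat (v (ga g (pr g \<gamma>) (cl 1 g))) * \<phi> (pr g \<gamma>))"
        unfolding B_def a_def using phi(2) ga_pr[OF h g hg xgg] by (intro sum.cong) auto
      also have "\<dots> = of_nat (card (ker h g)) * (\<Sum>\<delta>\<in>carrier (H g). of_rat (v (ga g \<delta> (cl 1 g))) * \<phi> \<delta>)"
        by (rule sum_fibre[OF h g hg])
      also have "\<dots> = k * Pf ?ch d g" unfolding kk char_sum_eq[OF g phi(1) d] ..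
      finally have Bg: "B (cl 1 g) = k * Pf ?ch d g" .
      have max: "h \<subseteq> q \<longleftrightarrow> q = p \<or> g \<subseteq> q" if q: "maxi q" for q
      proof
        assume "h \<subseteq> q"
        then have "p \<subseteq> q \<or> g \<subseteq> q" using max_prime[OF q pi g] by (simp add: h_def)
        then show "q = p \<or> g \<subseteq> q" using maxi_max[OF p maxi_ideal[OF q]] maxi_ne[OF q] by blast
      next
        assume "q = p \<or> g \<subseteq> q"
        moreover have "h \<subseteq> p" using mp_int_sub[OF g integral_sm[OF pi]] by (simp add: h_def mp_comm)
        ultimately show "h \<subseteq> q" using hg by blast
      qed
      show ?thesis
      proof (cases "g \<subseteq> p")
        case True
        then have "{q. maxi q \<and> h \<subseteq> q} = {q. maxi q \<and> g \<subseteq> q}" using max by auto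
        then have "Pf ?ch d h = Pf ?ch d g" by (simp add: Pf_def)
        then show ?thesis using tot Bg Bh True by simp
      next
        case False
        then have "{q. maxi q \<and> h \<subseteq> q} = insert p {q. maxi q \<and> g \<subseteq> q}" using max p by auto
        then have Ph: "Pf ?ch d h = (1 - char_at A sg ?ch d p) * Pf ?ch d g"
          using finite_maxi_above[OF g] False by (simp add: Pf_def)
        have cp: "char_at A sg ?ch d p = \<phi> (rc g p)" by (rule char_at_eq[OF ch d(1) g d(2) _ p False]) simp
        have "\<psi> \<tau> = inverse (\<phi> (rc g p))" using phi(2) tau[OF False] Hg.cchar_inv[OF phi(1) rp(2)[OF False]] by simp
        then have "inverse (\<psi> \<tau>) = char_at A sg ?ch d p" using cp by simp
        then show ?thesis using tot Bg Bh Ph False by (simp add: algebra_simps)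
      qed
    qed
  qed
  then have "of_rat (v (ga h \<gamma> (cl 1 g))) = (of_rat (\<Sum>\<eta>\<in>fib p (cl 1 g). v (ga h \<gamma> \<eta>)) :: complex)"
    by (simp add: D_def a_def of_rat_sum)
  then show ?thesis by (simp add: h_def)
qed

text \<open>Every class is a translate of some [1 + g], and Y_p commutes with the action, so
  translation by \<delta> maps the fibre over [1 + g] bijectively to the fibre over \<xi>. This
  reduces the claim to \<open>dist_rel_one\<close>.\<close>

theorem dist_rel: assumes p: "maxi p" and f: "ideal f" and fp: "f \<subseteq> p" and xi: "\<xi> \<in> Xit (f \<cdot> iv p)" and c: "\<gamma> \<in> carrier (H f)"
  shows "v (ga f \<gamma> \<xi>) = (\<Sum>\<eta>\<in>fib p \<xi>. v (ga f \<gamma> \<eta>))"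
proof -
  have pi: "ideal p" "invble p" using maxi_ideal[OF p] ideal_invble[OF maxi_ideal[OF p]] by auto
  have q: "ideal (f \<cdot> iv p)" by (rule ideal_quot[OF pi(1) f fp])
  have eq: "p \<cdot> (f \<cdot> iv p) = f" using cancel_iv1[OF pi(2) integral_sm[OF f]] by (simp add: mp_comm)
  have xX: "\<xi> \<in> Xi A sg" by (rule Xit_Xi[OF q xi])
  define g where "g = cord \<xi>"
  have g: "ideal g" unfolding g_def by (rule cord_ideal[OF xX])
  have qg: "f \<cdot> iv p \<subseteq> g" unfolding g_def by (rule Xit_cord[OF q xi])
  let ?h = "p \<cdot> g"
  have h: "ideal ?h" by (rule integral_mul[OF pi(1) g])
  have fh: "f \<subseteq> ?h" using mp_mono[OF subset_refl qg, of p] eq by simp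
  have hg: "?h \<subseteq> g" using mp_int_sub[OF pi(1) integral_sm[OF g]] .
  have fg: "f \<subseteq> g" using fh hg by blast
  interpret Hf: comm_group "H f" by (rule H_comm_group[OF f])
  obtain \<delta>0 where d0: "\<delta>0 \<in> carrier (H g)" "\<xi> = ga g \<delta>0 (cl 1 g)" using Xi_orbit_ga[OF xX] unfolding g_def[symmetric] by (elim bexE)
  have "\<delta>0 \<in> pr g ` carrier (H f)" unfolding pr_surj[OF f g fg] by (rule d0(1))
  then obtain \<delta> where d: "\<delta> \<in> carrier (H f)" "pr g \<delta> = \<delta>0" by auto
  have xg: "cl 1 g \<in> Xit f" "cl 1 g \<in> Xit g" "cl 1 g \<in> Xit ?h" using one_Xit f g h fg hg by auto
  have xi_eq: "\<xi> = ga f \<delta> (cl 1 g)" using ga_pr[OF f g fg xg(2) d(1)] d0(2) d(2) by simp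
  have "cl 1 g \<in> Xit (f \<cdot> iv p)" by (rule one_Xit[OF q g qg])
  then have fX: "fib p (cl 1 g) \<subseteq> Xit f" by (rule fib_Xit[OF p f fp])
  have hq: "?h \<cdot> iv p = g" using invble_mp[OF pi(2)] mp_one2[OF integral_sm[OF g]] by (metis mp_assoc mp_comm)
  have hp: "?h \<subseteq> p" using mp_int_sub[OF g integral_sm[OF pi(1)]] by (simp add: mp_comm)
  have fXh: "fib p (cl 1 g) \<subseteq> Xit ?h" using fib_Xit[OF p h hp] hq xg(2) by simp
  have inv_ga: "ga f (inv\<^bsub>H f\<^esub> \<delta>) (ga f \<delta> \<eta>) = \<eta>" "ga f \<delta> (ga f (inv\<^bsub>H f\<^esub> \<delta>) \<eta>) = \<eta>" if "\<eta> \<in> Xit f" for \<eta>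
    using ga_mult[OF f that, of "inv\<^bsub>H f\<^esub> \<delta>" \<delta>] ga_mult[OF f that d(1), of "inv\<^bsub>H f\<^esub> \<delta>"] ga_one[OF f that] d(1) by auto
  have bij: "bij_betw (ga f \<delta>) (fib p (cl 1 g)) (fib p \<xi>)"
  proof (rule bij_betw_byWitness[where f' = "ga f (inv\<^bsub>H f\<^esub> \<delta>)"])
    show "\<forall>a\<in>fib p (cl 1 g). ga f (inv\<^bsub>H f\<^esub> \<delta>) (ga f \<delta> a) = a" using inv_ga(1) fX by blast
    have xX2: "fib p \<xi> \<subseteq> Xit f" by (rule fib_Xit[OF p f fp xi])
    then show "\<forall>a\<in>fib p \<xi>. ga f \<delta> (ga f (inv\<^bsub>H f\<^esub> \<delta>) a) = a" using inv_ga(2) by blast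
    show "ga f \<delta> ` fib p (cl 1 g) \<subseteq> fib p \<xi>"
    proof clarify
      fix \<eta> assume e: "\<eta> \<in> fib p (cl 1 g)"
      then have x: "\<eta> \<in> Xit f" using fX by blast
      have "YY p (ga f \<delta> \<eta>) = \<xi>" using YY_ga[OF pi(1) f x d(1)] e xi_eq by (simp add: fib_def)
      then show "ga f \<delta> \<eta> \<in> fib p \<xi>" using Xit_Xi[OF f ga_cord(1)[OF f x d(1)]] by (simp add: fib_def)
    qed
    show "ga f (inv\<^bsub>H f\<^esub> \<delta>) ` fib p \<xi> \<subseteq> fib p (cl 1 g)"
    proof clarify
      fix \<eta> assume e: "\<eta> \<in> fib p \<xi>"
      then have x: "\<eta> \<in> Xit f" using xX2 by blast
      have dc: "inv\<^bsub>H f\<^esub> \<delta> \<in> carrier (H f)" using d(1) by simp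
      have "YY p (ga f (inv\<^bsub>H f\<^esub> \<delta>) \<eta>) = cl 1 g"
        using YY_ga[OF pi(1) f x dc] e xi_eq inv_ga(1)[OF xg(1)] by (simp add: fib_def)
      then show "ga f (inv\<^bsub>H f\<^esub> \<delta>) \<eta> \<in> fib p (cl 1 g)" using Xit_Xi[OF f ga_cord(1)[OF f x dc]] by (simp add: fib_def)
    qed
  qed
  let ?a = "\<gamma> \<otimes>\<^bsub>H f\<^esub> \<delta>"
  have ac: "?a \<in> carrier (H f)" using c d(1) by simp
  have pc: "pr ?h ?a \<in> carrier (H ?h)" using hom_in_carrier[OF pr_hom[OF f h fh] ac] .
  have lev: "ga f ?a \<eta> = ga ?h (pr ?h ?a) \<eta>" if "\<eta> \<in> Xit ?h" for \<eta> by (rule ga_pr[OF f h fh that ac])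
  have "v (ga f \<gamma> \<xi>) = v (ga ?h (pr ?h ?a) (cl 1 g))"
    unfolding xi_eq ga_mult[OF f xg(1) c d(1), symmetric] lev[OF xg(3)] ..
  also have "\<dots> = (\<Sum>\<eta>\<in>fib p (cl 1 g). v (ga ?h (pr ?h ?a) \<eta>))" by (rule dist_rel_one[OF p g pc])
  also have "\<dots> = (\<Sum>\<eta>\<in>fib p (cl 1 g). v (ga f \<gamma> (ga f \<delta> \<eta>)))"
    by (rule sum.cong[OF refl]) (use fXh fX lev ga_mult[OF f _ c d(1)] in \<open>metis subsetD\<close>)
  also have "\<dots> = (\<Sum>\<eta>\<in>fib p \<xi>. v (ga f \<gamma> \<eta>))" by (rule sum.reindex_bij_betw[OF bij])
  finally show ?thesis .
qed

end

section \<open>Kubert's generators\<close>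

locale level = arith A sg for A :: "'k::topological_field set" and sg :: "'k \<Rightarrow> 'k" +
  fixes f :: "'k set"
  assumes f: "integral_ideal A f"
begin

text \<open>\<open>f = PP p \<cdot> ff p\<close> is the decomposition of \<open>f\<close> into its \<open>p\<close>-part and its prime-to-\<open>p\<close> part.\<close>

definition "T = {p. maxi p \<and> f \<subseteq> p}"
definition "dec p = (SOME d. ideal (snd d) \<and> f = ppow p (fst d) \<cdot> snd d \<and> \<not> snd d \<subseteq> p)"
definition "PP p = ppow p (fst (dec p))"
definition "ff p = snd (dec p)"

lemma sf: "sm f" and fA: "f \<subseteq> A" using f integral_iff by auto

lemma finT: "finite T" unfolding T_def by (rule finite_maxi_above[OF f])

lemma T: "p \<in> T \<Longrightarrow> maxi p" "p \<in> T \<Longrightarrow> f \<subseteq> p" "p \<in> T \<Longrightarrow> ideal p" "p \<in> T \<Longrightarrow> sm p" "p \<in> T \<Longrightarrow> p \<subseteq> A"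
  using maxi_ideal integral_iff by (auto simp: T_def)

lemma dec: assumes p: "p \<in> T"
  shows "ideal (ff p)" "f = PP p \<cdot> ff p" "\<not> ff p \<subseteq> p" "ideal (PP p)" "\<exists>m. fst (dec p) = Suc m" "PP p \<subseteq> p" "comax (PP p) (ff p)"
proof -
  obtain n f' where "ideal f' \<and> f = ppow p n \<cdot> f' \<and> \<not> f' \<subseteq> p" using ppart[OF T(1)[OF p] f] by blast
  then have "\<exists>d. ideal (snd d) \<and> f = ppow p (fst d) \<cdot> snd d \<and> \<not> snd d \<subseteq> p" by (intro exI[of _ "(n, f')"]) simp
  from someI_ex[OF this] have d: "ideal (ff p)" "f = PP p \<cdot> ff p" "\<not> ff p \<subseteq> p"
    unfolding dec_def[symmetric] ff_def PP_def by auto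
  then show "ideal (ff p)" "f = PP p \<cdot> ff p" "\<not> ff p \<subseteq> p" by auto
  show iP: "ideal (PP p)" unfolding PP_def by (rule ppow_ideal[OF T(3)[OF p]])
  show ex: "\<exists>m. fst (dec p) = Suc m"
  proof (cases "fst (dec p)")
    case 0
    then have "f = ff p" using d(2) mp_one[OF integral_sm[OF d(1)]] by (simp add: PP_def)
    then show ?thesis using d(3) T(2)[OF p] by simp
  qed simp
  then obtain m where "fst (dec p) = Suc m" by blast
  then have "PP p = ppow p m \<cdot> p" unfolding PP_def using mp_comm by simp
  then show "PP p \<subseteq> p" using mp_int_sub[OF ppow_ideal[OF T(3)[OF p]] T(4)[OF p]] by simp
  show "comax (PP p) (ff p)" unfolding PP_def by (rule ppow_com[OF T(1)[OF p] d(1,3)])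
qed

lemma sPP: "p \<in> T \<Longrightarrow> sm (PP p)" and PPA: "p \<in> T \<Longrightarrow> PP p \<subseteq> A"
  and sff: "p \<in> T \<Longrightarrow> sm (ff p)" and ffA: "p \<in> T \<Longrightarrow> ff p \<subseteq> A"
  using dec integral_iff by auto

lemma f_sub_PP: "p \<in> T \<Longrightarrow> f \<subseteq> PP p"
  using dec(2) mp_int_sub[OF dec(1) sPP] mp_comm by metis

lemma PP_sub: "p \<in> T \<Longrightarrow> q \<in> T \<Longrightarrow> PP p \<subseteq> q \<Longrightarrow> q = p"
  unfolding PP_def using ppow_maxi[OF T(1) T(1)] by blast

lemma ff_sub_PP: assumes p: "p \<in> T" and q: "q \<in> T" and ne: "p \<noteq> q" shows "ff p \<subseteq> PP q"
proof
  fix y assume y: "y \<in> ff p"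
  have "\<not> PP q \<subseteq> p" using PP_sub[OF q p] ne by blast
  then have "comax (PP p) (PP q)" unfolding PP_def[of p] by (rule ppow_com[OF T(1)[OF p] dec(4)[OF q]])
  then obtain a b where ab: "a \<in> PP p" "b \<in> PP q" "a + b = 1" by (auto simp: comax_def)
  have "a * y \<in> f" using mp_memI[OF ab(1) y] dec(2)[OF p] by simp
  then have "a * y \<in> PP q" using f_sub_PP[OF q] by blast
  moreover have "y * b \<in> PP q" using sm_mult[OF sPP[OF q] _ ab(2)] y ffA[OF p] by blast
  ultimately have "a * y + y * b \<in> PP q" by (rule sm_add[OF sPP[OF q]])
  moreover have "a * y + y * b = (a + b) * y" by (simp add: algebra_simps)
  ultimately show "y \<in> PP q" using ab(3) by simp
qed

lemma PP_prime: assumes p: "p \<in> T" and a: "a \<in> A" "a \<notin> p" and x: "x \<in> A" "a * x \<in> PP p" shows "x \<in> PP p"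
proof -
  have a0: "a \<noteq> 0" using a(2) sm_zero[OF T(4)[OF p]] by auto
  have "\<not> a *o A \<subseteq> p" using a(2) scale_memI[OF one_A, of a] by auto
  then have "comax (PP p) (a *o A)" unfolding PP_def by (rule ppow_com[OF T(1)[OF p] integral_principal[OF a(1) a0]])
  then obtain c b where cb: "c \<in> PP p" "b \<in> A" "c + a * b = 1" by (auto simp: comax_def elt_set_times_def)
  have "x * c + b * (a * x) \<in> PP p"
    using sm_add[OF sPP[OF p] sm_mult[OF sPP[OF p] x(1) cb(1)] sm_mult[OF sPP[OF p] cb(2) x(2)]] .
  moreover have "x * c + b * (a * x) = (c + a * b) * x" by (simp add: algebra_simps)
  ultimately show ?thesis using cb(3) by simp
qed

text \<open>If x were outside f, its order modulo f would lie in some p of T; but x in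
  \<open>PP p\<close> forces that order to contain \<open>ff p\<close>, which is not inside
  p.\<close>

lemma mem_f_iff: assumes x: "x \<in> A" shows "x \<in> f \<longleftrightarrow> (\<forall>p\<in>T. x \<in> PP p)"
proof
  assume "x \<in> f" then show "\<forall>p\<in>T. x \<in> PP p" using f_sub_PP by blast
next
  assume h: "\<forall>p\<in>T. x \<in> PP p"
  have sub: "f \<subseteq> ordr x f" using sm_mult2[OF sf x] fA by (auto simp: ordr_mem)
  have o: "ideal (ordr x f)" by (rule ordr_ideal[OF sf f sub])
  show "x \<in> f"
  proof (rule ccontr)
    assume "x \<notin> f"
    then have "1 \<notin> ordr x f" by (simp add: ordr_mem)
    then have "ordr x f \<noteq> A" using one_A by blast
    then obtain p where p: "maxi p" "ordr x f \<subseteq> p" using ex_maxi[OF o] by blast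
    then have pT: "p \<in> T" using sub by (auto simp: T_def)
    have "ff p \<subseteq> ordr x f"
    proof
      fix a assume a: "a \<in> ff p"
      have "x * a \<in> f" using mp_memI[OF bspec[OF h pT] a] dec(2)[OF pT] by simp
      then show "a \<in> ordr x f" using a ffA[OF pT] by (auto simp: ordr_mem mult.commute)
    qed
    then show False using p dec(3)[OF pT] by blast
  qed
qed

lemma crt_mod_f: assumes b: "\<And>p. p \<in> T \<Longrightarrow> b p \<in> A" shows "\<exists>x\<in>A. \<forall>p\<in>T. x - b p \<in> PP p"
proof -
  have "\<forall>p\<in>T. \<exists>e. e \<in> ff p \<and> 1 - e \<in> PP p"
  proof
    fix p assume pT: "p \<in> T"
    obtain c e where "c \<in> PP p" "e \<in> ff p" "c + e = 1" using dec(7)[OF pT] unfolding comax_def by blast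
    moreover from this have "1 - e = c" by (simp add: algebra_simps)
    ultimately show "\<exists>e. e \<in> ff p \<and> 1 - e \<in> PP p" by metis
  qed
  then obtain e where e: "\<And>p. p \<in> T \<Longrightarrow> e p \<in> ff p \<and> 1 - e p \<in> PP p" by metis
  have be: "b p * e p \<in> ff p" if "p \<in> T" for p using sm_mult[OF sff[OF that] b[OF that]] e[OF that] by blast
  define x where "x = (\<Sum>p\<in>T. b p * e p)"
  have "x \<in> A" unfolding x_def using be ffA by (intro sm_sum[OF sm_A]) blast
  moreover have "x - b q \<in> PP q" if q: "q \<in> T" for q
  proof -
    have "x = b q * e q + (\<Sum>p\<in>T - {q}. b p * e p)" unfolding x_def by (rule sum.remove[OF finT q])
    then have "x - b q = (\<Sum>p\<in>T - {q}. b p * e p) - b q * (1 - e q)" by (simp add: algebra_simps)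
    moreover have "(\<Sum>p\<in>T - {q}. b p * e p) \<in> PP q"
      using be ff_sub_PP[OF _ q] by (intro sm_sum[OF sPP[OF q]]) blast
    moreover have "b q * (1 - e q) \<in> PP q" using sm_mult[OF sPP[OF q] b[OF q]] e[OF q] by blast
    ultimately show ?thesis using sm_diff[OF sPP[OF q]] by simp
  qed
  ultimately show ?thesis by blast
qed

text \<open>Up to positive scaling every lattice is \<open>LL I\<close> for exactly one \<open>I \<in> RR\<close>. Since \<open>1\<close> is the only positive unit,
  the classes in \<open>Xit f\<close> are then parametrised by \<open>I \<in> RR\<close> and a residue class in \<open>A\<close> modulo \<open>f\<close>.\<close>

definition "LL I = iv I \<cdot> f"

lemma LL: assumes I: "ideal I" "comax I f"
  shows "glat (LL I)" "sm (LL I)" "f \<subseteq> LL I" "\<And>x. x \<in> A \<Longrightarrow> ordr x (LL I) = ordr x f" "\<And>x. x \<in> A \<Longrightarrow> x \<in> LL I \<Longrightarrow> x \<in> f"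
proof -
  show g: "glat (LL I)" unfolding LL_def by (rule glat_iv_mul[OF I(1) ideal_glat[OF f]])
  show "sm (LL I)" by (rule glat_sm[OF g])
  show "f \<subseteq> LL I" unfolding LL_def by (rule sub_iv_mp[OF I(1) sf])
  show "ordr x (LL I) = ordr x f" if "x \<in> A" for x
    unfolding LL_def
  proof (rule ordr_iv[OF ideal_glat[OF f] I(1)])
    have "f \<subseteq> ordr x f" using sm_mult2[OF sf that] fA by (auto simp: ordr_mem)
    then show "comax I (ordr x f)" using com_mono[OF I(2) subset_refl] by blast
  qed
  show "x \<in> f" if "x \<in> A" "x \<in> LL I" for x
  proof -
    have "x \<in> ordr 1 (LL I)" using that by (simp add: ordr_mem)
    then show ?thesis unfolding LL_def using ordr_one[OF f I] by simp
  qed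
qed

section \<open>Coordinates at the primes dividing the level\<close>

lemma f_sub_ordr: "x \<in> A \<Longrightarrow> f \<subseteq> ordr x f"
  using sm_mult2[OF sf] fA by (auto simp: ordr_mem)

text \<open>p divides the order of x modulo f exactly when the coordinate of x at p is nonzero: a
  zero coordinate is annihilated by \<open>ff p\<close>, and a nonzero one only by elements of
  p.\<close>

lemma zero_iff: assumes p: "p \<in> T" and x: "x \<in> A" shows "ordr x f \<subseteq> p \<longleftrightarrow> x \<notin> PP p"
proof
  assume h: "ordr x f \<subseteq> p"
  show "x \<notin> PP p"
  proof
    assume xP: "x \<in> PP p"
    have "ff p \<subseteq> ordr x f"
    proof
      fix a assume a: "a \<in> ff p"
      have "x * a \<in> f" using mp_memI[OF xP a] dec(2)[OF p] by simp
      then show "a \<in> ordr x f" using a ffA[OF p] by (auto simp: ordr_mem mult.commute)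
    qed
    then show False using h dec(3)[OF p] by blast
  qed
next
  assume h: "x \<notin> PP p"
  show "ordr x f \<subseteq> p"
  proof
    fix a assume "a \<in> ordr x f"
    then have "a \<in> A" "a * x \<in> PP p" using f_sub_PP[OF p] by (auto simp: ordr_mem)
    then show "a \<in> p" using PP_prime[OF p _ _ x] h by blast
  qed
qed

lemma quot_mem: assumes p: "p \<in> T" and h: "\<And>a. a \<in> f \<cdot> iv p \<Longrightarrow> a * x \<in> f" shows "x \<in> p"
proof -
  have q: "ideal (f \<cdot> iv p)" by (rule ideal_quot[OF T(3)[OF p] f T(2)[OF p]])
  have "x \<in> iv (f \<cdot> iv p) \<cdot> f"
    unfolding mem_iv_mp[OF ideal_invble[OF q] sf] using h by (auto simp: mult.commute)
  moreover have "iv (f \<cdot> iv p) \<cdot> f = p"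
    using iv_mul[OF ideal_invble[OF f] invble_iv[OF ideal_invble[OF T(3)[OF p]]]] iv_iv[OF ideal_invble[OF T(3)[OF p]]]
      cancel_iv2[OF ideal_invble[OF f] T(4)[OF p]] by (metis mp_assoc mp_comm)
  ultimately show ?thesis by simp
qed

text \<open>x outside p means that the order of x modulo f keeps the full p-part of f. With
  \<open>zero_iff\<close> this turns \<open>unitary\<close> into the condition that every coordinate
  is zero or a unit.\<close>

lemma full_iff: assumes p: "p \<in> T" and x: "x \<in> A" shows "f \<cdot> iv p \<subseteq> ordr x f \<longleftrightarrow> x \<in> p"
proof
  assume h: "f \<cdot> iv p \<subseteq> ordr x f"
  show "x \<in> p" by (rule quot_mem[OF p]) (use h in \<open>auto simp: ordr_mem\<close>)
next
  assume xp: "x \<in> p"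
  show "f \<cdot> iv p \<subseteq> ordr x f"
  proof
    fix a assume a: "a \<in> f \<cdot> iv p"
    have "a * x \<in> (f \<cdot> iv p) \<cdot> p" by (rule mp_memI[OF a xp])
    also have "(f \<cdot> iv p) \<cdot> p = f" using invble_mp2[OF ideal_invble[OF T(3)[OF p]]] mp_one2[OF sf] by (simp add: mp_assoc)
    finally have "a * x \<in> f" .
    moreover have "a \<in> A" using a integral_sub[OF ideal_quot[OF T(3)[OF p] f T(2)[OF p]]] by blast
    ultimately show "a \<in> ordr x f" by (simp add: ordr_mem)
  qed
qed

text \<open>An element b of M = f^-1 W outside p M for all p dividing f has exact order f modulo W:
  a larger order would force b into k M for a proper ideal k = f (order)^-1. Then
  \<open>cl_one_surj\<close> applies to b + W.\<close>

lemma ex_rep: assumes W: "glat W" shows "\<exists>I. ideal I \<and> comax I f \<and> (\<exists>y. pos y \<and> y *o W = LL I)"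
proof -
  define M where "M = iv f \<cdot> W"
  have M: "glat M" unfolding M_def by (rule glat_iv_mul[OF f W])
  have fM: "f \<cdot> M = W" unfolding M_def by (rule cancel_iv1[OF ideal_invble[OF f] glat_sm[OF W]])
  have "\<forall>p\<in>T. maxi p \<and> \<not> A \<subseteq> p" using T maxi_one one_A by blast
  \<comment> \<open>Modulus A and starting value 0 ask just for an element of M outside every p
    M.\<close>
  from ex_coprime[OF finT M integral_A sm_zero[OF glat_sm[OF M]] this]
  obtain b where b: "b \<in> M" "\<forall>p\<in>T. b \<notin> p \<cdot> M" by blast
  have sub: "f \<subseteq> ordr b W"
  proof
    fix a assume a: "a \<in> f"
    then show "a \<in> ordr b W" using mp_memI[OF a b(1)] fM fA by (auto simp: ordr_mem)
  qed
  have o: "ideal (ordr b W)" by (rule ordr_ideal[OF glat_sm[OF W] f sub])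
  have "ordr b W = f"
  proof (rule ccontr)
    assume ne: "ordr b W \<noteq> f"
    let ?k = "f \<cdot> iv (ordr b W)"
    have k: "ideal ?k" by (rule ideal_quot[OF o f sub])
    have ke: "ordr b W \<cdot> ?k = f" using cancel_iv1[OF ideal_invble[OF o] sf] by (simp add: mp_comm)
    have "?k \<noteq> A" using ke ne mp_one2[OF integral_sm[OF o]] by auto
    then obtain p where p: "maxi p" "?k \<subseteq> p" using ex_maxi[OF k] by blast
    have "f \<subseteq> ?k" using sub_mp_iv[OF sf ordr_sub] .
    then have pT: "p \<in> T" using p by (auto simp: T_def)
    have "b \<in> iv (ordr b W) \<cdot> W"
      unfolding mem_iv_mp[OF ideal_invble[OF o] glat_sm[OF W]] by (auto simp: ordr_mem mult.commute)
    also have "iv (ordr b W) \<cdot> W = ?k \<cdot> M" unfolding fM[symmetric] by (simp add: mp_ac)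
    also have "\<dots> \<subseteq> p \<cdot> M" by (rule mp_mono[OF p(2) subset_refl])
    finally show False using b(2) pT by blast
  qed
  then obtain I where I: "ideal I" "comax I f" "cl b W = cl 1 (iv I \<cdot> f)" using cl_one_surj[OF W _ f] by blast
  then have "hom_eq b W 1 (LL I)" using cl_eq[OF W LL(1)[OF I(1,2)]] by (simp add: LL_def)
  then show ?thesis using I unfolding hom_eq_def by blast
qed

definition "rep W = (SOME I. ideal I \<and> comax I f \<and> (\<exists>y. pos y \<and> y *o W = LL I))"
definition "RR = rep ` {W. glat W}"

lemma rep: "glat W \<Longrightarrow> ideal (rep W) \<and> comax (rep W) f \<and> (\<exists>y. pos y \<and> y *o W = LL (rep W))"
  unfolding rep_def by (rule someI_ex[OF ex_rep])

lemma RR: "I \<in> RR \<Longrightarrow> ideal I" "I \<in> RR \<Longrightarrow> comax I f"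
  using rep by (auto simp: RR_def)

text \<open>The predicate from which \<open>rep\<close> chooses is invariant under positive scaling,
  so the same ideal is selected for all positive multiples of a lattice.\<close>

lemma rep_cong: assumes "pos z" "z *o W = V" shows "rep W = rep V"
proof -
  have "(\<exists>y. pos y \<and> y *o W = X) \<longleftrightarrow> (\<exists>y. pos y \<and> y *o V = X)" for X
  proof
    assume "\<exists>y. pos y \<and> y *o W = X"
    then obtain y where y: "pos y" "y *o W = X" by blast
    have "y * inverse z * z = y" using pos_nonzero[OF assms(1)] by simp
    then have "(y * inverse z) *o V = X" using assms(2) y(2) by (metis set_times_rearrange2)
    then show "\<exists>y. pos y \<and> y *o V = X" using pos_mult[OF y(1) pos_inverse[OF assms(1)]] by blast
  next
    assume "\<exists>y. pos y \<and> y *o V = X"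
    then obtain y where y: "pos y" "y *o V = X" by blast
    have "(y * z) *o W = X" using assms(2) y by (simp add: set_times_rearrange2[symmetric])
    then show "\<exists>y. pos y \<and> y *o W = X" using pos_mult[OF y(1) assms(1)] by blast
  qed
  then show ?thesis unfolding rep_def by simp
qed

lemma RR_unique: assumes I: "I \<in> RR" and J: "J \<in> RR" and y: "pos y" "y *o LL I = LL J" shows "I = J" "y = 1"
proof -
  obtain W V where W: "glat W" "I = rep W" and V: "glat V" "J = rep V" using I J by (auto simp: RR_def)
  obtain a b where ab: "pos a" "a *o W = LL I" "pos b" "b *o V = LL J" using rep W V by metis
  have "rep W = rep (LL I)" "rep V = rep (LL J)" "rep (LL I) = rep (LL J)" using rep_cong ab y by blast+
  then show e: "I = J" using W V by simp
  have L: "invble (LL I)" "sm (LL I)" using glat_invble LL(1,2)[OF RR[OF I]] by auto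
  have "LL I \<cdot> (y *o A) = LL I \<cdot> A" using y(2) e L(2) by (simp add: mp_scale2 mp_one2)
  then have "y *o A = A" using mp_eq_cancel[OF L(1) sm_scale[OF sm_A] sm_A] by simp
  then show "y = 1" using pos_unit y(1) by blast
qed

lemma cl_LL_eq: assumes I: "I \<in> RR" and J: "J \<in> RR" and e: "cl x (LL I) = cl x' (LL J)"
  shows "I = J" "x - x' \<in> LL I"
proof -
  have "hom_eq x (LL I) x' (LL J)" using e cl_eq[OF LL(1)[OF RR[OF I]] LL(1)[OF RR[OF J]]] by simp
  then obtain y where y: "pos y" "y *o LL I = LL J" "y * x - x' \<in> LL J" unfolding hom_eq_def by blast
  show "I = J" using RR_unique(1)[OF I J y(1,2)] .
  then show "x - x' \<in> LL I" using RR_unique(2)[OF I J y(1,2)] y(3) by simp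
qed

text \<open>On the normalised lattice I^-1 f the torsion point lies in I^-1. Multiplication by an i
  in I congruent to 1 modulo f moves it into A without changing the class.\<close>

lemma Xit_rep: assumes xi: "\<xi> \<in> Xit f" shows "\<exists>I\<in>RR. \<exists>x\<in>A. \<xi> = cl x (LL I)"
proof -
  obtain z W where W: "glat W" "\<xi> = cl z W" "f \<subseteq> ordr z W" using xi unfolding Xit_iff[OF f] by blast
  let ?I = "rep W"
  obtain y where y: "pos y" "y *o W = LL ?I" using rep[OF W(1)] by blast
  have I: "?I \<in> RR" using W by (simp add: RR_def)
  have Ii: "ideal ?I" "comax ?I f" using RR[OF I] by auto
  let ?t = "y * z"
  have e: "\<xi> = cl ?t (LL ?I)" using W(2) cl_scale[OF y(1) W(1)] y(2) by simp
  have "f \<subseteq> ordr ?t (LL ?I)" using Xit_cord[OF f xi] cord_cl[OF LL(1)[OF Ii]] e by simp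
  then have "?t \<in> iv f \<cdot> LL ?I"
    unfolding mem_iv_mp[OF ideal_invble[OF f] LL(2)[OF Ii]] by (auto simp: ordr_mem mult.commute)
  moreover have "iv f \<cdot> LL ?I = iv ?I"
    unfolding LL_def using cancel_iv2[OF ideal_invble[OF f] sm_iv] by (metis mp_comm)
  ultimately have t: "?t \<in> iv ?I" by simp
  obtain i w where iw: "i \<in> ?I" "w \<in> f" "i + w = 1" using Ii(2) by (auto simp: comax_def)
  have 1: "?t * i \<in> A" using t iw(1) by (auto simp: ideal_inv_def)
  have "?t * w \<in> LL ?I" unfolding LL_def by (rule mp_memI[OF t iw(2)])
  moreover have "?t * (i + w) = ?t" by (simp add: iw(3))
  then have "?t * w = ?t - ?t * i" unfolding distrib_left by (metis add_diff_cancel_left')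
  ultimately have "?t - ?t * i \<in> LL ?I" by metis
  then have "\<xi> = cl (?t * i) (LL ?I)" using e cl_shift[OF _ LL(1)[OF Ii]] by simp
  then show ?thesis using I 1 by blast
qed

definition "BB = {cl b (LL I) | b I. I \<in> RR \<and> b \<in> A \<and> (\<forall>p\<in>T. b \<in> PP p \<or> (b \<notin> p \<and> b - 1 \<notin> PP p))}"

lemma cl_LL_Xit: "I \<in> RR \<Longrightarrow> x \<in> A \<Longrightarrow> cl x (LL I) \<in> Xit f"
  using cl_Xit[OF f LL(1)[OF RR]] LL(4)[OF RR] f_sub_ordr by simp

lemma BB_Xit: "BB \<subseteq> Xit f"
  using cl_LL_Xit by (auto simp: BB_def)

text \<open>Replacing the coordinates \<open>0\<close> of \<open>b\<close> by \<open>1\<close> embeds \<open>BB\<close> into the classes of order exactly \<open>f\<close>.\<close>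

lemma card_BB: "finite BB" "card BB \<le> card (carrier (H f))"
proof -
  show fin: "finite BB" by (rule finite_subset[OF BB_Xit finite_Xit[OF f]])
  define Q where "Q \<beta> \<gamma> \<longleftrightarrow> (\<exists>I b x. I \<in> RR \<and> b \<in> A \<and> x \<in> A \<and> \<beta> = cl b (LL I) \<and> ga f \<gamma> (cl 1 f) = cl x (LL I) \<and>
    (\<forall>p\<in>T. (b \<in> PP p \<and> x - 1 \<in> PP p) \<or> (b \<notin> PP p \<and> b - 1 \<notin> PP p \<and> x - b \<in> PP p)))" for \<beta> \<gamma>
  have ex: "\<exists>\<gamma>\<in>carrier (H f). Q \<beta> \<gamma>" if be: "\<beta> \<in> BB" for \<beta>
  proof -
    obtain b I where b: "\<beta> = cl b (LL I)" "I \<in> RR" "b \<in> A" "\<forall>p\<in>T. b \<in> PP p \<or> (b \<notin> p \<and> b - 1 \<notin> PP p)"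
      using be unfolding BB_def by blast
    have "\<exists>x\<in>A. \<forall>p\<in>T. x - (if b \<in> PP p then 1 else b) \<in> PP p"
      by (rule crt_mod_f) (use b(3) one_A in auto)
    then obtain x where x: "x \<in> A" "\<forall>p\<in>T. x - (if b \<in> PP p then 1 else b) \<in> PP p" by blast
    have xp: "x \<notin> p" if p: "p \<in> T" for p
    proof
      assume "x \<in> p"
      moreover have "x - (if b \<in> PP p then 1 else b) \<in> p" using x(2) p dec(6)[OF p] by blast
      ultimately have "x - (x - (if b \<in> PP p then 1 else b)) \<in> p" by (rule sm_diff[OF T(4)[OF p]])
      then have "(if b \<in> PP p then 1 else b) \<in> p" by simp
      then show False using b(4) p maxi_one[OF T(1)[OF p]] by (auto split: if_splits)
    qed
    have "ordr x f = f"
    proof (rule subset_antisym[OF _ f_sub_ordr[OF x(1)]])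
      show "ordr x f \<subseteq> f"
      proof
        fix a assume "a \<in> ordr x f"
        then have a: "a \<in> A" "a * x \<in> f" by (auto simp: ordr_mem)
        have "a \<in> PP p" if p: "p \<in> T" for p
          using PP_prime[OF p x(1) xp[OF p] a(1)] a(2) f_sub_PP[OF p] by (auto simp: mult.commute)
        then show "a \<in> f" using mem_f_iff[OF a(1)] by blast
      qed
    qed
    then have "cord (cl x (LL I)) = f" using cord_cl[OF LL(1)[OF RR[OF b(2)]]] LL(4)[OF RR[OF b(2)] x(1)] by simp
    then obtain \<gamma> where "\<gamma> \<in> carrier (H f)" "cl x (LL I) = ga f \<gamma> (cl 1 f)"
      using Xi_orbit_ga[OF Xit_Xi[OF f cl_LL_Xit[OF b(2) x(1)]]] by auto
    moreover have "\<forall>p\<in>T. (b \<in> PP p \<and> x - 1 \<in> PP p) \<or> (b \<notin> PP p \<and> b - 1 \<notin> PP p \<and> x - b \<in> PP p)"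
    proof
      fix p assume p: "p \<in> T"
      show "(b \<in> PP p \<and> x - 1 \<in> PP p) \<or> (b \<notin> PP p \<and> b - 1 \<notin> PP p \<and> x - b \<in> PP p)"
        using bspec[OF b(4) p] bspec[OF x(2) p] by (cases "b \<in> PP p") auto
    qed
    ultimately have "Q \<beta> \<gamma>" unfolding Q_def using b x(1) by metis
    then show ?thesis using \<open>\<gamma> \<in> carrier (H f)\<close> by blast
  qed
  then obtain h where h: "\<And>\<beta>. \<beta> \<in> BB \<Longrightarrow> h \<beta> \<in> carrier (H f) \<and> Q \<beta> (h \<beta>)" by metis
  have "inj_on h BB"
  proof (rule inj_onI)
    fix \<beta> \<beta>' assume bb: "\<beta> \<in> BB" "\<beta>' \<in> BB" "h \<beta> = h \<beta>'"
    obtain I b x where 1: "I \<in> RR" "b \<in> A" "x \<in> A" "\<beta> = cl b (LL I)" "ga f (h \<beta>) (cl 1 f) = cl x (LL I)"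
      "\<forall>p\<in>T. (b \<in> PP p \<and> x - 1 \<in> PP p) \<or> (b \<notin> PP p \<and> b - 1 \<notin> PP p \<and> x - b \<in> PP p)"
      using h[OF bb(1)] unfolding Q_def by blast
    obtain I' b' x' where 2: "I' \<in> RR" "b' \<in> A" "x' \<in> A" "\<beta>' = cl b' (LL I')" "ga f (h \<beta>') (cl 1 f) = cl x' (LL I')"
      "\<forall>p\<in>T. (b' \<in> PP p \<and> x' - 1 \<in> PP p) \<or> (b' \<notin> PP p \<and> b' - 1 \<notin> PP p \<and> x' - b' \<in> PP p)"
      using h[OF bb(2)] unfolding Q_def by blast
    have "cl x (LL I) = cl x' (LL I')" using 1(5) 2(5) bb(3) by simp
    then have II: "I = I'" "x - x' \<in> LL I" using cl_LL_eq[OF 1(1) 2(1)] by auto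
    have xx: "x - x' \<in> f" using LL(5)[OF RR[OF 1(1)] diff_A[OF 1(3) 2(3)] II(2)] .
    \<comment> \<open>The coordinate 1 of x arises only from the coordinate 0 of b, since b itself
      avoids 1 there. Hence x determines b.\<close>
    have "b - b' \<in> PP p" if p: "p \<in> T" for p
    proof -
      note d = sm_diff[OF sPP[OF p]] and ad = sm_add[OF sPP[OF p]]
      have xxp: "x - x' \<in> PP p" using xx f_sub_PP[OF p] by blast
      have e1: "b' - 1 \<in> PP p" if "x - 1 \<in> PP p" "x' - b' \<in> PP p"
        using d[OF d[OF that(1) xxp] that(2)] by simp
      have e2: "b - 1 \<in> PP p" if "x' - 1 \<in> PP p" "x - b \<in> PP p"
        using d[OF ad[OF that(1) xxp] that(2)] by simp
      have e3: "b - b' \<in> PP p" if "x - b \<in> PP p" "x' - b' \<in> PP p"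
        using d[OF ad[OF xxp that(2)] that(1)] by simp
      show ?thesis using bspec[OF 1(6) p] bspec[OF 2(6) p] e1 e2 e3 d by blast
    qed
    then have "b - b' \<in> f" using mem_f_iff[OF diff_A[OF 1(2) 2(2)]] by blast
    then have "b - b' \<in> LL I" using LL(3)[OF RR[OF 1(1)]] by blast
    then show "\<beta> = \<beta>'" using cl_shift[OF _ LL(1)[OF RR[OF 1(1)]]] 1(4) 2(4) II(1) by simp
  qed
  moreover have "h ` BB \<subseteq> carrier (H f)" using h by blast
  ultimately show "card BB \<le> card (carrier (H f))" by (rule card_inj_on_le[OF _ _ H_finite[OF f]])
qed

text \<open>Reduction is carried out in an arbitrary subgroup containing the relators instead of in
  the quotient U(f). This lets it be applied twice: to relators plus combinations of
  \<open>BB\<close>, and to the annihilator of a function on the group.\<close>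

definition closed_rel :: "('k set set \<Rightarrow>\<^sub>0 int) set \<Rightarrow> bool" where
  "closed_rel M \<longleftrightarrow> 0 \<in> M \<and> (\<forall>x\<in>M. \<forall>y\<in>M. x - y \<in> M) \<and> dist_relators A sg f \<subseteq> M"

lemma dist_relators_eq: "dist_relators A sg f = {frag_of \<xi> - (\<Sum>\<eta>\<in>fib p \<xi>. frag_of \<eta>) | \<xi> p. p \<in> T \<and> \<xi> \<in> Xit (f \<cdot> iv p)}"
proof -
  have "maxi p \<and> ideal_dvd A p f \<longleftrightarrow> p \<in> T" for p using dvd_iff[OF maxi_ideal f] by (auto simp: T_def)
  then show ?thesis unfolding dist_relators_def fib_def[symmetric] by (metis (no_types, lifting))
qed

lemma closed_rel: assumes "closed_rel M"
  shows "0 \<in> M" "x \<in> M \<Longrightarrow> y \<in> M \<Longrightarrow> x - y \<in> M" "x \<in> M \<Longrightarrow> y \<in> M \<Longrightarrow> x + y \<in> M"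
    "p \<in> T \<Longrightarrow> \<xi> \<in> Xit (f \<cdot> iv p) \<Longrightarrow> frag_of \<xi> - (\<Sum>\<eta>\<in>fib p \<xi>. frag_of \<eta>) \<in> M"
proof -
  show z: "0 \<in> M" using assms by (simp add: closed_rel_def)
  have d: "x - y \<in> M" if "x \<in> M" "y \<in> M" for x y using assms that by (simp add: closed_rel_def)
  then show "x - y \<in> M" if "x \<in> M" "y \<in> M" using that by blast
  show "x + y \<in> M" if "x \<in> M" "y \<in> M" using d[OF that(1) d[OF z that(2)]] by simp
  show "frag_of \<xi> - (\<Sum>\<eta>\<in>fib p \<xi>. frag_of \<eta>) \<in> M" if "p \<in> T" "\<xi> \<in> Xit (f \<cdot> iv p)"
    using assms that unfolding closed_rel_def dist_relators_eq by blast
qed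

lemma closed_rel_sum: "closed_rel M \<Longrightarrow> (\<And>i. i \<in> S \<Longrightarrow> h i \<in> M) \<Longrightarrow> sum h S \<in> M"
  by (induction S rule: infinite_finite_induct) (auto intro: closed_rel)

text \<open>At each \<open>p\<close> dividing \<open>f\<close> the order of \<open>\<xi>\<close> is prime to \<open>p\<close> or has the same \<open>p\<close>-part as \<open>f\<close>.\<close>

definition "unitary \<xi> \<longleftrightarrow> (\<forall>p\<in>T. \<not> cord \<xi> \<subseteq> p \<or> \<not> f \<cdot> iv p \<subseteq> cord \<xi>)"

lemma fib_Xit_T: "p \<in> T \<Longrightarrow> \<xi> \<in> Xit (f \<cdot> iv p) \<Longrightarrow> fib p \<xi> \<subseteq> Xit f"
  using fib_Xit[OF T(1) f T(2)] .

text \<open>If \<xi> is not unitary at p, the relator at p applies to it and expresses it by classes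
  of order p times its own. The induction is on the number of ideals between f and the
  order.\<close>

lemma reduce_unitary: assumes M: "closed_rel M" and un: "\<And>\<xi>. \<xi> \<in> Xit f \<Longrightarrow> unitary \<xi> \<Longrightarrow> frag_of \<xi> \<in> M"
  shows "\<xi> \<in> Xit f \<Longrightarrow> frag_of \<xi> \<in> M"
proof (induction "card {J. ideal J \<and> f \<subseteq> J \<and> J \<subseteq> cord \<xi>}" arbitrary: \<xi> rule: less_induct)
  case less
  have o: "ideal (cord \<xi>)" "f \<subseteq> cord \<xi>" using cord_ideal[OF Xit_Xi[OF f less.prems]] Xit_cord[OF f less.prems] by auto
  show ?case
  proof (cases "unitary \<xi>")
    case True then show ?thesis using un less.prems by blast
  next
    case False
    then obtain p where p: "p \<in> T" "cord \<xi> \<subseteq> p" "f \<cdot> iv p \<subseteq> cord \<xi>" unfolding unitary_def by blast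
    have q: "ideal (f \<cdot> iv p)" by (rule ideal_quot[OF T(3)[OF p(1)] f T(2)[OF p(1)]])
    have xi: "\<xi> \<in> Xit (f \<cdot> iv p)" using Xi_Xit[OF q Xit_Xi[OF f less.prems] p(3)] .
    have "frag_of \<eta> \<in> M" if eta: "\<eta> \<in> fib p \<xi>" for \<eta>
    proof (rule less.hyps)
      have e: "\<eta> \<in> Xi A sg" "YY p \<eta> = \<xi>" using eta by (auto simp: fib_def)
      show eX: "\<eta> \<in> Xit f" using fib_Xit_T[OF p(1) xi] eta by blast
      \<comment> \<open>Since p already divides the order of \<xi>, the fibre contains no class of
        the same order as \<xi>.\<close>
      have "cord \<eta> \<subseteq> p" using cord_YY(2)[OF T(1)[OF p(1)] e(1)] e(2) p(2) by auto
      then have c: "cord \<eta> = p \<cdot> cord \<xi>" using cord_YY(1)[OF T(1)[OF p(1)] e(1)] e(2) by simp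
      have sub: "cord \<eta> \<subseteq> cord \<xi>" unfolding c by (rule mp_int_sub[OF T(3)[OF p(1)] integral_sm[OF o(1)]])
      have ne: "cord \<eta> \<noteq> cord \<xi>" unfolding c by (rule maxi_proper_mul[OF T(1)[OF p(1)] ideal_glat[OF o(1)]])
      show "card {J. ideal J \<and> f \<subseteq> J \<and> J \<subseteq> cord \<eta>} < card {J. ideal J \<and> f \<subseteq> J \<and> J \<subseteq> cord \<xi>}"
      proof (rule psubset_card_mono)
        show "finite {J. ideal J \<and> f \<subseteq> J \<and> J \<subseteq> cord \<xi>}" by (rule finite_subset[OF _ finite_super[OF f]]) auto
        have "cord \<xi> \<in> {J. ideal J \<and> f \<subseteq> J \<and> J \<subseteq> cord \<xi>}" using o by simp
        moreover have "cord \<xi> \<notin> {J. ideal J \<and> f \<subseteq> J \<and> J \<subseteq> cord \<eta>}" using sub ne by auto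
        moreover have "{J. ideal J \<and> f \<subseteq> J \<and> J \<subseteq> cord \<eta>} \<subseteq> {J. ideal J \<and> f \<subseteq> J \<and> J \<subseteq> cord \<xi>}" using sub by auto
        ultimately show "{J. ideal J \<and> f \<subseteq> J \<and> J \<subseteq> cord \<eta>} \<subset> {J. ideal J \<and> f \<subseteq> J \<and> J \<subseteq> cord \<xi>}" by blast
      qed
    qed
    then have "(\<Sum>\<eta>\<in>fib p \<xi>. frag_of \<eta>) \<in> M" by (rule closed_rel_sum[OF M])
    from closed_rel(3)[OF M closed_rel(4)[OF M p(1) xi] this] show ?thesis by simp
  qed
qed

lemma YY_A: "\<xi> \<in> Xi A sg \<Longrightarrow> YY A \<xi> = \<xi>"
proof -
  assume "\<xi> \<in> Xi A sg"
  then obtain x W where W: "glat W" "\<xi> = cl x W" unfolding Xi_iff by blast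
  show ?thesis unfolding W(2) YY_cl[OF W(1) integral_A] by (simp add: iv_A mp_one glat_sm[OF W(1)])
qed

lemma YY_mul: assumes p: "ideal p" and P: "ideal P" and xi: "\<xi> \<in> Xi A sg" shows "YY (p \<cdot> P) \<xi> = YY p (YY P \<xi>)"
proof -
  obtain x W where W: "glat W" "\<xi> = cl x W" using xi unfolding Xi_iff by blast
  show ?thesis
    unfolding W(2) YY_cl[OF W(1) integral_mul[OF p P]] YY_cl[OF W(1) P] YY_cl[OF glat_iv_mul[OF P W(1)] p]
    using iv_mul[OF ideal_invble[OF p] ideal_invble[OF P]] by (simp add: mp_assoc)
qed

text \<open>Telescoping: the map for \<open>p \<cdot> ppow p n\<close> is a composite, so its fibre
  is the disjoint union of fibres for \<open>ppow p n\<close> over the fibre of Y_p, and the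
  relators add up.\<close>

lemma iterated_rel: assumes M: "closed_rel M" and p: "p \<in> T"
  shows "f \<subseteq> ppow p n \<Longrightarrow> \<xi> \<in> Xit (f \<cdot> iv (ppow p n)) \<Longrightarrow>
    fib (ppow p n) \<xi> \<subseteq> Xit f \<and> frag_of \<xi> - (\<Sum>\<eta>\<in>fib (ppow p n) \<xi>. frag_of \<eta>) \<in> M"
proof (induction n arbitrary: \<xi>)
  case 0
  then have xi: "\<xi> \<in> Xit f" by (simp add: iv_A mp_one2 sf)
  then have "fib A \<xi> = {\<xi>}" using YY_A Xit_Xi[OF f xi] by (auto simp: fib_def)
  then show ?case using xi closed_rel(1)[OF M] by simp
next
  case (Suc n)
  let ?P = "ppow p n"
  have pi: "ideal p" "maxi p" using T p by auto
  have P: "ideal ?P" by (rule ppow_ideal[OF pi(1)])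
  have pP: "ideal (p \<cdot> ?P)" by (rule integral_mul[OF pi(1) P])
  have sub: "p \<cdot> ?P \<subseteq> ?P" "p \<cdot> ?P \<subseteq> p"
    using mp_int_sub[OF pi(1) integral_sm[OF P]] mp_int_sub[OF P integral_sm[OF pi(1)]] by (simp_all add: mp_comm)
  have fpP: "f \<subseteq> p \<cdot> ?P" using Suc.prems(1) by simp
  have fP: "f \<subseteq> ?P" using fpP sub by blast
  have iveq: "iv (p \<cdot> ?P) = iv p \<cdot> iv ?P" by (rule iv_mul[OF ideal_invble[OF pi(1)] ideal_invble[OF P]])
  have q: "ideal (f \<cdot> iv ?P)" by (rule ideal_quot[OF P f fP])
  have qp: "f \<cdot> iv ?P \<subseteq> p"
  proof -
    have "f \<cdot> iv ?P \<subseteq> (p \<cdot> ?P) \<cdot> iv ?P" by (rule mp_mono[OF fpP subset_refl])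
    also have "\<dots> = p" using invble_mp[OF ideal_invble[OF P]] mp_one2[OF integral_sm[OF pi(1)]] by (simp add: mp_assoc)
    finally show ?thesis .
  qed
  have eq: "f \<cdot> iv (p \<cdot> ?P) = (f \<cdot> iv ?P) \<cdot> iv p" unfolding iveq by (simp add: mp_ac)
  have xi: "\<xi> \<in> Xit ((f \<cdot> iv ?P) \<cdot> iv p)" using Suc.prems(2) eq by simp
  have fib1: "fib p \<xi> \<subseteq> Xit (f \<cdot> iv ?P)" by (rule fib_Xit[OF pi(2) q qp xi])
  have r: "ideal (f \<cdot> iv p)" by (rule ideal_quot[OF pi(1) f T(2)[OF p]])
  have r': "ideal (f \<cdot> iv (p \<cdot> ?P))" by (rule ideal_quot[OF pP f fpP])
  have "f \<cdot> iv p \<subseteq> f \<cdot> iv (p \<cdot> ?P)" by (rule mp_mono[OF subset_refl iv_antimono[OF sub(2)]])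
  then have xi': "\<xi> \<in> Xit (f \<cdot> iv p)" using Xit_mono[OF r r'] Suc.prems(2) by auto
  have IH: "fib ?P \<zeta> \<subseteq> Xit f \<and> frag_of \<zeta> - (\<Sum>\<eta>\<in>fib ?P \<zeta>. frag_of \<eta>) \<in> M" if "\<zeta> \<in> fib p \<xi>" for \<zeta>
    using Suc.IH[OF fP] fib1 that by blast
  have U: "fib (p \<cdot> ?P) \<xi> = (\<Union>\<zeta>\<in>fib p \<xi>. fib ?P \<zeta>)"
    using YY_mul[OF pi(1) P] YY_Xi(1)[OF P] by (auto simp: fib_def)
  have fin1: "finite (fib p \<xi>)" by (rule finite_subset[OF fib1 finite_Xit[OF q]])
  have fin2: "\<forall>\<zeta>\<in>fib p \<xi>. finite (fib ?P \<zeta>)" using IH finite_subset[OF _ finite_Xit[OF f]] by blast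
  have disj: "\<forall>\<zeta>\<in>fib p \<xi>. \<forall>\<zeta>'\<in>fib p \<xi>. \<zeta> \<noteq> \<zeta>' \<longrightarrow> fib ?P \<zeta> \<inter> fib ?P \<zeta>' = {}" by (auto simp: fib_def)
  have s: "(\<Sum>\<eta>\<in>fib (p \<cdot> ?P) \<xi>. frag_of \<eta>) = (\<Sum>\<zeta>\<in>fib p \<xi>. \<Sum>\<eta>\<in>fib ?P \<zeta>. frag_of \<eta>)"
    unfolding U by (rule sum.UNION_disjoint[OF fin1 fin2 disj])
  have "(\<Sum>\<zeta>\<in>fib p \<xi>. frag_of \<zeta> - (\<Sum>\<eta>\<in>fib ?P \<zeta>. frag_of \<eta>)) \<in> M"
    using IH by (intro closed_rel_sum[OF M]) blast
  then have "(\<Sum>\<zeta>\<in>fib p \<xi>. frag_of \<zeta>) - (\<Sum>\<eta>\<in>fib (p \<cdot> ?P) \<xi>. frag_of \<eta>) \<in> M"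
    unfolding s by (simp add: sum_subtractf)
  from closed_rel(3)[OF M closed_rel(4)[OF M p xi'] this]
  have "frag_of \<xi> - (\<Sum>\<eta>\<in>fib (p \<cdot> ?P) \<xi>. frag_of \<eta>) \<in> M" by simp
  moreover have "fib (p \<cdot> ?P) \<xi> \<subseteq> Xit f" unfolding U using IH by blast
  ultimately show ?case by simp
qed

text \<open>If P^-1 V is a positive multiple y^-1 of P^-1 W, cancelling P^-1 gives y V = W. So every
  preimage can be presented on the same lattice W, and only the residue modulo P^-1 W is
  prescribed.\<close>

lemma fib_cl: assumes W: "glat W" and P: "ideal P" and o: "ideal (ordr x (iv P \<cdot> W))"
  shows "fib P (cl x (iv P \<cdot> W)) = {cl x' W | x'. x' - x \<in> iv P \<cdot> W}"
proof
  have g: "glat (iv P \<cdot> W)" by (rule glat_iv_mul[OF P W])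
  show "fib P (cl x (iv P \<cdot> W)) \<subseteq> {cl x' W | x'. x' - x \<in> iv P \<cdot> W}"
  proof
    fix \<eta> assume "\<eta> \<in> fib P (cl x (iv P \<cdot> W))"
    then have e: "\<eta> \<in> Xi A sg" "YY P \<eta> = cl x (iv P \<cdot> W)" by (auto simp: fib_def)
    obtain z V where V: "glat V" "\<eta> = cl z V" using e(1) unfolding Xi_iff by blast
    have "cl z (iv P \<cdot> V) = cl x (iv P \<cdot> W)" using e(2) YY_cl[OF V(1) P] V(2) by simp
    then obtain y where y: "pos y" "y *o (iv P \<cdot> V) = iv P \<cdot> W" "y * z - x \<in> iv P \<cdot> W"
      unfolding cl_eq[OF glat_iv_mul[OF P V(1)] g] hom_eq_def by blast
    have "iv P \<cdot> (y *o V) = iv P \<cdot> W" using y(2) by (simp add: mp_scale2)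
    then have "y *o V = W"
      using mp_eq_cancel[OF invble_iv[OF ideal_invble[OF P]] sm_scale[OF glat_sm[OF V(1)]] glat_sm[OF W]] by simp
    then have "\<eta> = cl (y * z) W" using cl_scale[OF y(1) V(1)] V(2) by simp
    then show "\<eta> \<in> {cl x' W | x'. x' - x \<in> iv P \<cdot> W}" using y(3) by blast
  qed
  show "{cl x' W | x'. x' - x \<in> iv P \<cdot> W} \<subseteq> fib P (cl x (iv P \<cdot> W))"
  proof clarify
    fix x' assume x': "x' - x \<in> iv P \<cdot> W"
    have "YY P (cl x' W) = cl x (iv P \<cdot> W)" using YY_cl[OF W P] cl_shift[OF x' g] by simp
    moreover have "P \<cdot> ordr x (iv P \<cdot> W) \<subseteq> ordr x' W"
    proof (rule mp_least[OF ordr_sm[OF glat_sm[OF W]]])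
      fix a b assume a: "a \<in> P" and b: "b \<in> ordr x (iv P \<cdot> W)"
      have bA: "b \<in> A" using b ordr_sub by blast
      have "b * x + b * (x' - x) \<in> iv P \<cdot> W"
        using sm_add[OF glat_sm[OF g] _ sm_mult[OF glat_sm[OF g] bA x']] b by (simp add: ordr_mem)
      then have "b * x' \<in> iv P \<cdot> W" by (simp add: algebra_simps)
      then have "b * x' * a \<in> W" using a mem_iv_mp[OF ideal_invble[OF P] glat_sm[OF W]] by blast
      then show "a * b \<in> ordr x' W" using a bA integral_sub[OF P] by (auto simp: ordr_mem ac_simps intro: mult_A)
    qed
    then have "ideal (ordr x' W)" by (rule ordr_ideal[OF glat_sm[OF W] integral_mul[OF P o]])
    ultimately show "cl x' W \<in> fib P (cl x (iv P \<cdot> W))" using W unfolding fib_def Xi_iff by blast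
  qed
qed

lemma unitary_LL: assumes I: "I \<in> RR" and x: "x \<in> A"
  shows "unitary (cl x (LL I)) \<longleftrightarrow> (\<forall>p\<in>T. x \<in> PP p \<or> x \<notin> p)"
  unfolding unitary_def cord_cl[OF LL(1)[OF RR[OF I]]] LL(4)[OF RR[OF I] x]
  using zero_iff[OF _ x] full_iff[OF _ x] by blast

text \<open>Enlarging the lattice at p leaves the other coordinates alone: otherwise w z would lie
  in q for every w in p^m, and since z is outside q all of p^m would. The auxiliary classes in
  \<open>reduce_BB\<close> are unitary for this reason.\<close>

lemma not_full: assumes I: "I \<in> RR" and z: "z \<in> A" and p: "p \<in> T" and q: "q \<in> T" "q \<noteq> p" "z \<notin> q"
  shows "\<not> f \<cdot> iv q \<subseteq> ordr z (iv (ppow p m) \<cdot> LL I)"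
proof
  assume s: "f \<cdot> iv q \<subseteq> ordr z (iv (ppow p m) \<cdot> LL I)"
  have P: "ideal (ppow p m)" by (rule ppow_ideal[OF T(3)[OF p]])
  have fq: "ideal (f \<cdot> iv q)" by (rule ideal_quot[OF T(3)[OF q(1)] f T(2)[OF q(1)]])
  have "w \<in> q" if w: "w \<in> ppow p m" for w
  proof -
    have wA: "w \<in> A" using w integral_sub[OF P] by blast
    have "w * z \<in> q"
    proof (rule quot_mem[OF q(1)])
      fix a assume a: "a \<in> f \<cdot> iv q"
      then have aA: "a \<in> A" using integral_sub[OF fq] by blast
      have "a * z \<in> iv (ppow p m) \<cdot> LL I" using s a by (auto simp: ordr_mem)
      then have "a * z * w \<in> LL I" using w mem_iv_mp[OF ideal_invble[OF P] LL(2)[OF RR[OF I]]] by blast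
      then show "a * (w * z) \<in> f" using LL(5)[OF RR[OF I], of "a * z * w"] mult_A[OF mult_A[OF aA z] wA] by (simp add: ac_simps)
    qed
    then show ?thesis using max_prime_elem[OF T(1)[OF q(1)] wA z] q(3) by blast
  qed
  then have "ppow p m \<subseteq> q" by blast
  then show False using ppow_maxi[OF T(1)[OF p] T(1)[OF q(1)]] q(2) by blast
qed

text \<open>If the coordinate of \<open>x\<close> at \<open>p\<close> is \<open>1\<close>, comparing the iterated relations for \<open>PP p = ppow p (Suc m)\<close>
  and \<open>ppow p m\<close> replaces \<open>cl x (LL I)\<close> by classes whose
  \<open>p\<close>-coordinate is not \<open>1\<close> and by classes with fewer nonzero coordinates.\<close>

lemma reduce_BB: assumes M: "closed_rel M" and BM: "frag_of ` BB \<subseteq> M"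
  shows "I \<in> RR \<Longrightarrow> x \<in> A \<Longrightarrow> \<forall>p\<in>T. x \<in> PP p \<or> x \<notin> p \<Longrightarrow> frag_of (cl x (LL I)) \<in> M"
proof (induction "card {p\<in>T. x \<notin> PP p} * (card T + 1) + card {p\<in>T. x \<notin> PP p \<and> x - 1 \<in> PP p}"
    arbitrary: x I rule: less_induct)
  case less
  note I = less.prems(1) and xA = less.prems(2) and xun = less.prems(3)
  note IL = LL[OF RR[OF I]]
  \<comment> \<open>The induction measure is lexicographic: first the number of nonzero coordinates,
    then the number of coordinates equal to 1. The weight \<open>card T + 1\<close> exceeds every
    value of the second count.\<close>
  have cT: "card {p\<in>T. Q p} \<le> card T" for Q by (rule card_mono[OF finT]) auto
  have lower: "frag_of \<zeta> \<in> M" if z: "\<zeta> \<in> Xit f" "unitary \<zeta>" "{p\<in>T. cord \<zeta> \<subseteq> p} \<subset> {p\<in>T. x \<notin> PP p}" for \<zeta>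
  proof -
    obtain J y where J: "J \<in> RR" "y \<in> A" "\<zeta> = cl y (LL J)" using Xit_rep[OF z(1)] by blast
    have "{p\<in>T. y \<notin> PP p} = {p\<in>T. cord \<zeta> \<subseteq> p}"
      unfolding J(3) cord_cl[OF LL(1)[OF RR[OF J(1)]]] LL(4)[OF RR[OF J(1)] J(2)] using zero_iff[OF _ J(2)] by blast
    then have "card {p\<in>T. y \<notin> PP p} < card {p\<in>T. x \<notin> PP p}"
      using z(3) finT by (intro psubset_card_mono) auto
    then have "Suc (card {p\<in>T. y \<notin> PP p}) * (card T + 1) \<le> card {p\<in>T. x \<notin> PP p} * (card T + 1)"
      by (intro mult_le_mono1) simp
    then have "card {p\<in>T. y \<notin> PP p} * (card T + 1) + card {p\<in>T. y \<notin> PP p \<and> y - 1 \<in> PP p}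
        < card {p\<in>T. x \<notin> PP p} * (card T + 1) + card {p\<in>T. x \<notin> PP p \<and> x - 1 \<in> PP p}"
      using cT[of "\<lambda>p. y \<notin> PP p \<and> y - 1 \<in> PP p"] by simp
    then show ?thesis using less.hyps[OF _ J(1,2)] z(2) unitary_LL[OF J(1,2)] J(3) by simp
  qed
  show ?case
  proof (cases "\<exists>p\<in>T. x \<notin> PP p \<and> x - 1 \<in> PP p")
    case False
    have "cl x (LL I) \<in> BB" unfolding BB_def using I xA xun False by blast
    then show ?thesis using BM by blast
  next
    case True
    then obtain p where p: "p \<in> T" "x \<notin> PP p" "x - 1 \<in> PP p" by blast
    have xp: "x \<notin> p" using xun p by blast
    obtain m where m: "fst (dec p) = Suc m" using dec(5)[OF p(1)] by blast
    define P where "P = PP p"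
    define f' where "f' = ff p"
    define P1 where "P1 = ppow p m"
    have Pm: "P = ppow p (Suc m)" and PP1: "P = p \<cdot> P1" using m by (simp_all add: P_def PP_def P1_def)
    have P: "ideal P" "sm P" "P \<subseteq> A" using dec(4)[OF p(1)] integral_iff by (auto simp: P_def)
    have f': "ideal f'" "sm f'" "f' \<subseteq> A" "\<not> f' \<subseteq> p" using dec(1,3)[OF p(1)] integral_iff by (auto simp: f'_def)
    have P1: "ideal P1" unfolding P1_def by (rule ppow_ideal[OF T(3)[OF p(1)]])
    have fe: "f = P \<cdot> f'" using dec(2)[OF p(1)] by (simp add: P_def f'_def)
    have pf': "ideal (p \<cdot> f')" by (rule integral_mul[OF T(3)[OF p(1)] f'(1)])
    have fe1: "f = P1 \<cdot> (p \<cdot> f')" unfolding fe PP1 by (simp add: mp_ac)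
    have q1: "f \<cdot> iv P = f'" unfolding fe using cancel_iv2[OF ideal_invble[OF P(1)] f'(2)] by (metis mp_comm)
    have q2: "f \<cdot> iv P1 = p \<cdot> f'" unfolding fe1 using cancel_iv2[OF ideal_invble[OF P1] mp_sm] by (metis mp_comm)
    have fP: "f \<subseteq> P" "f \<subseteq> P1"
      unfolding fe using mp_int_sub[OF f'(1) P(2)] mp_int_sub[OF pf' integral_sm[OF P1]] fe1 fe by (simp_all add: mp_comm)
    let ?L = "LL I"
    let ?V = "iv P \<cdot> ?L" and ?V1 = "iv P1 \<cdot> ?L"
    have gV: "glat ?V" "glat ?V1" using glat_iv_mul P(1) P1 IL(1) by auto
    have Ve: "?V = iv I \<cdot> f'" unfolding LL_def q1[symmetric] by (simp add: mp_ac)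
    have V1e: "?V1 = iv I \<cdot> (p \<cdot> f')" unfolding LL_def q2[symmetric] by (simp add: mp_ac)
    have f'V: "f' \<subseteq> ?V" unfolding Ve by (rule sub_iv_mp[OF RR(1)[OF I] f'(2)])
    have pf'V1: "p \<cdot> f' \<subseteq> ?V1" unfolding V1e by (rule sub_iv_mp[OF RR(1)[OF I] mp_sm])
    have V1V: "?V1 \<subseteq> ?V" unfolding Ve V1e by (rule mp_mono[OF subset_refl mp_int_sub[OF T(3)[OF p(1)] f'(2)]])
    have LV: "?L \<subseteq> ?V" "?L \<subseteq> ?V1" using sub_iv_mp[OF P(1) IL(2)] sub_iv_mp[OF P1 IL(2)] by auto
    obtain a b where ab: "a \<in> P" "b \<in> f'" "a + b = 1" using dec(7)[OF p(1)] by (auto simp: comax_def P_def f'_def)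
    \<comment> \<open>As a is 0 modulo P and 1 modulo f', the element x0 has coordinate 0 at p and
      agrees with x at all other primes.\<close>
    define x0 where "x0 = x * a"
    have x0P: "x0 \<in> P" unfolding x0_def by (rule sm_mult[OF P(2) xA ab(1)])
    have x0A: "x0 \<in> A" using x0P P(3) by blast
    have "x = x * a + x * b" using ab(3) by (metis distrib_left mult.right_neutral)
    then have "x - x0 = x * b" unfolding x0_def by (metis add_diff_cancel_left')
    then have xx0: "x - x0 \<in> f'" using sm_mult[OF f'(2) xA ab(2)] by simp
    have f'q: "f' \<subseteq> PP q" if "q \<in> T" "q \<noteq> p" for q unfolding f'_def using ff_sub_PP[OF p(1) that(1)] that(2) by blast
    \<comment> \<open>The fibre over \<xi>2 consists of the classes that agree with x away from p,
      with every coordinate at p. The fibre over \<xi>3, formed with one factor p less, consists of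
      those among them whose coordinate lies in p. Both base classes have coordinate zero at
      p.\<close>
    define \<xi>2 where "\<xi>2 = cl x ?V"
    define \<xi>3 where "\<xi>3 = cl x0 ?V1"
    have o2: "f' \<subseteq> ordr x ?V"
    proof
      fix c assume c: "c \<in> f'"
      have "x * c \<in> f'" by (rule sm_mult[OF f'(2) xA c])
      then show "c \<in> ordr x ?V" using f'V c f'(3) by (auto simp: ordr_mem mult.commute)
    qed
    have o3: "f' \<subseteq> ordr x0 ?V1"
    proof
      fix c assume c: "c \<in> f'"
      have "x0 * c \<in> f" unfolding fe by (rule mp_memI[OF x0P c])
      then have "c * x0 \<in> ?V1" using IL(3) LV(2) by (auto simp: mult.commute)
      then show "c \<in> ordr x0 ?V1" using c f'(3) by (auto simp: ordr_mem)
    qed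
    have X2: "\<xi>2 \<in> Xit (f \<cdot> iv P)" unfolding \<xi>2_def q1 using cl_Xit[OF f'(1) gV(1)] o2 by simp
    have "p \<cdot> f' \<subseteq> ordr x0 ?V1" using o3 mp_int_sub[OF T(3)[OF p(1)] f'(2)] by blast
    then have X3: "\<xi>3 \<in> Xit (f \<cdot> iv P1)" unfolding \<xi>3_def q2 using cl_Xit[OF pf' gV(2)] by simp
    have i2: "ideal (ordr x ?V)" by (rule ordr_ideal[OF glat_sm[OF gV(1)] f'(1) o2])
    have i3: "ideal (ordr x0 ?V1)" by (rule ordr_ideal[OF glat_sm[OF gV(2)] f'(1) o3])
    have ff'0: "f \<subseteq> f'" unfolding fe by (rule mp_int_sub[OF P(1) f'(2)])
    have X2f: "\<xi>2 \<in> Xit f" unfolding \<xi>2_def using cl_Xit[OF f gV(1)] o2 ff'0 by auto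
    have X3f: "\<xi>3 \<in> Xit f" unfolding \<xi>3_def using cl_Xit[OF f gV(2)] o3 ff'0 by auto
    have c2: "cord \<xi>2 = ordr x ?V" and c3: "cord \<xi>3 = ordr x0 ?V1" unfolding \<xi>2_def \<xi>3_def using cord_cl gV by auto
    have x0q: "x0 \<in> PP q \<longleftrightarrow> x \<in> PP q" if q: "q \<in> T" "q \<noteq> p" for q
    proof -
      have d: "x - x0 \<in> PP q" using xx0 f'q[OF q] by blast
      show ?thesis using sm_diff[OF sPP[OF q(1)] _ d, of x] sm_add[OF sPP[OF q(1)] _ d, of x0] by auto
    qed
    have x0q': "x0 \<notin> q" if q: "q \<in> T" "q \<noteq> p" "x \<notin> q" for q
    proof
      assume "x0 \<in> q"
      moreover have "x - x0 \<in> q" using xx0 f'q[OF q(1,2)] dec(6)[OF q(1)] by blast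
      ultimately have "x0 + (x - x0) \<in> q" by (rule sm_add[OF T(4)[OF q(1)]])
      then show False using q(3) by simp
    qed
    have s2: "q \<noteq> p \<and> x \<notin> PP q" if q: "q \<in> T" "cord \<xi>2 \<subseteq> q" for q
    proof
      show "q \<noteq> p" using q(2) o2 f'(4) c2 by blast
      have "ordr x f \<subseteq> ordr x ?V" using ordr_super[OF LV(1), of x] IL(4)[OF xA] by simp
      then show "x \<notin> PP q" using zero_iff[OF q(1) xA] q(2) c2 by blast
    qed
    have s3: "q \<noteq> p \<and> x \<notin> PP q" if q: "q \<in> T" "cord \<xi>3 \<subseteq> q" for q
    proof
      show ne: "q \<noteq> p" using q(2) o3 f'(4) c3 by blast
      have "ordr x0 f \<subseteq> ordr x0 ?V1" using ordr_super[OF LV(2), of x0] IL(4)[OF x0A] by simp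
      then have "x0 \<notin> PP q" using zero_iff[OF q(1) x0A] q(2) c3 by blast
      then show "x \<notin> PP q" using x0q[OF q(1) ne] by blast
    qed
    have u2: "unitary \<xi>2"
      unfolding unitary_def
    proof (intro ballI)
      fix q assume q: "q \<in> T"
      show "\<not> cord \<xi>2 \<subseteq> q \<or> \<not> f \<cdot> iv q \<subseteq> cord \<xi>2"
      proof (cases "cord \<xi>2 \<subseteq> q")
        case True
        then have "q \<noteq> p" "x \<notin> q" using s2[OF q True] xun q by auto
        then show ?thesis unfolding c2 Pm using not_full[OF I xA p(1) q] by blast
      qed simp
    qed
    have u3: "unitary \<xi>3"
      unfolding unitary_def
    proof (intro ballI)
      fix q assume q: "q \<in> T"
      show "\<not> cord \<xi>3 \<subseteq> q \<or> \<not> f \<cdot> iv q \<subseteq> cord \<xi>3"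
      proof (cases "cord \<xi>3 \<subseteq> q")
        case True
        then have n: "q \<noteq> p" "x \<notin> q" using s3[OF q True] xun q by auto
        then show ?thesis unfolding c3 P1_def using not_full[OF I x0A p(1) q n(1) x0q'[OF q n]] by blast
      qed simp
    qed
    have pin: "p \<in> {p\<in>T. x \<notin> PP p}" using p by simp
    have M2: "frag_of \<xi>2 \<in> M" by (rule lower[OF X2f u2]) (use s2 pin in blast)
    have M3: "frag_of \<xi>3 \<in> M" by (rule lower[OF X3f u3]) (use s3 pin in blast)
    define F where "F = fib P \<xi>2"
    define F1 where "F1 = fib P1 \<xi>3"
    have Fe: "F = {cl x' ?L | x'. x' - x \<in> ?V}" unfolding F_def \<xi>2_def by (rule fib_cl[OF IL(1) P(1) i2])
    have F1e: "F1 = {cl x' ?L | x'. x' - x0 \<in> ?V1}" unfolding F1_def \<xi>3_def by (rule fib_cl[OF IL(1) P1 i3])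
    have r2: "F \<subseteq> Xit f" "frag_of \<xi>2 - (\<Sum>\<eta>\<in>F. frag_of \<eta>) \<in> M"
      using iterated_rel[OF M p(1), of "Suc m" \<xi>2] fP(1) X2 unfolding F_def Pm by auto
    have r3: "frag_of \<xi>3 - (\<Sum>\<eta>\<in>F1. frag_of \<eta>) \<in> M"
      using iterated_rel[OF M p(1), of m \<xi>3] fP(2) X3 unfolding F1_def P1_def by auto
    have F1F: "F1 \<subseteq> F"
    proof
      fix \<eta> assume "\<eta> \<in> F1"
      then obtain x' where x': "\<eta> = cl x' ?L" "x' - x0 \<in> ?V1" unfolding F1e by blast
      have "(x' - x0) - (x - x0) \<in> ?V" using sm_diff[OF glat_sm[OF gV(1)]] x'(2) V1V xx0 f'V by blast
      then have "x' - x \<in> ?V" by simp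
      then show "\<eta> \<in> F" unfolding Fe using x'(1) by blast
    qed
    define \<xi> where "\<xi> = cl x ?L"
    have xiF: "\<xi> \<in> F" unfolding Fe \<xi>_def using sm_zero[OF glat_sm[OF gV(1)]] by force
    have xiF1: "\<xi> \<notin> F1"
    proof
      assume "\<xi> \<in> F1"
      then obtain x' where x': "cl x ?L = cl x' ?L" "x' - x0 \<in> ?V1" unfolding F1e \<xi>_def by blast
      have "x - x' \<in> ?V1" using cl_LL_eq(2)[OF I I x'(1)] LV(2) by blast
      then have "(x - x') + (x' - x0) \<in> ?V1" using sm_add[OF glat_sm[OF gV(2)] _ x'(2)] by blast
      then have "x - x0 \<in> ordr 1 (iv I \<cdot> (p \<cdot> f'))" using V1e diff_A[OF xA x0A] by (simp add: ordr_mem)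
      moreover have "comax I (p \<cdot> f')"
        using com_mono[OF RR(2)[OF I] subset_refl] mp_int_sub[OF P1 integral_sm[OF pf']] fe1 by metis
      ultimately have "x - x0 \<in> p \<cdot> f'" using ordr_one[OF pf' RR(1)[OF I]] by simp
      then have "x - x0 \<in> p" using mp_int_sub[OF f'(1) T(4)[OF p(1)]] mp_comm by blast
      moreover have "x0 \<in> p" using x0P dec(6)[OF p(1)] by (auto simp: P_def)
      ultimately have "(x - x0) + x0 \<in> p" by (rule sm_add[OF T(4)[OF p(1)]])
      then show False using xp by simp
    qed
    \<comment> \<open>Such a class has a unit coordinate at p, being outside \<open>F1\<close>, and
      this unit is not 1, since the class differs from \<xi>. Its nonzero coordinates are those of
      x, with one fewer equal to 1.\<close>
    have rest: "frag_of \<eta> \<in> M" if eta: "\<eta> \<in> F - F1 - {\<xi>}" for \<eta>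
    proof -
      obtain x' where x': "\<eta> = cl x' ?L" "x' - x \<in> ?V" using eta unfolding Fe by blast
      define v where "v = x' - x"
      have v: "v \<in> iv I \<cdot> f'" using x'(2) Ve v_def by simp
      obtain i w where iw: "i \<in> I" "w \<in> f" "i + w = 1" using RR(2)[OF I] by (auto simp: comax_def)
      have vi: "v * i \<in> f'" using v iw(1) unfolding mem_iv_mp[OF ideal_invble[OF RR(1)[OF I]] f'(2)] by blast
      have "iv I \<cdot> f' \<subseteq> iv I" using mp_int_sub[OF f'(1) sm_iv] mp_comm by metis
      then have vw: "v * w \<in> ?L" unfolding LL_def using mp_memI[OF _ iw(2)] v by blast
      define z where "z = x + v * i"
      have zA: "z \<in> A" unfolding z_def using add_A[OF xA] vi f'(3) by blast
      have zx: "z - x \<in> f'" using vi by (simp add: z_def)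
      have "x' - z = v * (i + w) - v * i" using iw(3) by (simp add: z_def v_def)
      then have "x' - z = v * w" by (simp add: algebra_simps)
      then have ez: "\<eta> = cl z ?L" using x'(1) cl_shift[OF _ IL(1)] vw by simp
      have zp: "z \<notin> p"
      proof
        assume zp: "z \<in> p"
        have "x0 \<in> p" using x0P dec(6)[OF p(1)] by (auto simp: P_def)
        then have "z - x0 \<in> p" by (rule sm_diff[OF T(4)[OF p(1)] zp])
        moreover have "(z - x) + (x - x0) \<in> f'" by (rule sm_add[OF f'(2) zx xx0])
        then have "z - x0 \<in> f'" by simp
        ultimately have "z - x0 \<in> p \<inter> f'" by blast
        moreover have "comax p f'" using max_com[OF T(1)[OF p(1)] f'(1,4)] com_sym by blast
        then have "p \<inter> f' = p \<cdot> f'" by (rule com_inter[OF _ T(4)[OF p(1)] f'(2) T(5)[OF p(1)] f'(3)])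
        ultimately have "z - x0 \<in> ?V1" using pf'V1 by blast
        then have "\<eta> \<in> F1" unfolding F1e using ez by blast
        then show False using eta by blast
      qed
      have z1: "z - 1 \<notin> P"
      proof
        assume "z - 1 \<in> P"
        moreover have "x - 1 \<in> P" using p(3) by (simp add: P_def)
        ultimately have "(z - 1) - (x - 1) \<in> P" by (rule sm_diff[OF P(2)])
        then have "z - x \<in> P \<inter> f'" using zx by simp
        moreover have "P \<inter> f' = P \<cdot> f'"
          using com_inter[OF _ P(2) f'(2) P(3) f'(3)] dec(7)[OF p(1)] by (simp add: P_def f'_def)
        ultimately have "z - x \<in> ?L" using fe IL(3) by blast
        then have "\<eta> = \<xi>" unfolding ez \<xi>_def by (rule cl_shift[OF _ IL(1)])
        then show False using eta by blast
      qed
      have zq: "(z \<in> PP q \<longleftrightarrow> x \<in> PP q) \<and> (z - 1 \<in> PP q \<longleftrightarrow> x - 1 \<in> PP q) \<and> (z \<in> q \<longleftrightarrow> x \<in> q)" if q: "q \<in> T" "q \<noteq> p" for q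
      proof -
        have d: "z - x \<in> PP q" using zx f'q[OF q] by blast
        then have d': "z - x \<in> q" using dec(6)[OF q(1)] by blast
        note a = sm_add[OF sPP[OF q(1)] _ d] and s = sm_diff[OF sPP[OF q(1)] _ d]
        have "z \<in> PP q \<longleftrightarrow> x \<in> PP q" using a[of x] s[of z] by auto
        moreover have "z - 1 \<in> PP q \<longleftrightarrow> x - 1 \<in> PP q" using a[of "x - 1"] s[of "z - 1"] by auto
        moreover have "z \<in> q \<longleftrightarrow> x \<in> q" using sm_add[OF T(4)[OF q(1)] _ d', of x] sm_diff[OF T(4)[OF q(1)] _ d', of z] by auto
        ultimately show ?thesis by blast
      qed
      have zP: "z \<notin> PP p" using zp dec(6)[OF p(1)] by blast
      have e1: "{q\<in>T. z \<notin> PP q} = {q\<in>T. x \<notin> PP q}" using zq zP p(2) by blast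
      have "{q\<in>T. z \<notin> PP q \<and> z - 1 \<in> PP q} \<subseteq> {q\<in>T. x \<notin> PP q \<and> x - 1 \<in> PP q} - {p}"
        using zq z1 unfolding P_def by blast
      then have "{q\<in>T. z \<notin> PP q \<and> z - 1 \<in> PP q} \<subset> {q\<in>T. x \<notin> PP q \<and> x - 1 \<in> PP q}" using p by blast
      then have "card {q\<in>T. z \<notin> PP q \<and> z - 1 \<in> PP q} < card {q\<in>T. x \<notin> PP q \<and> x - 1 \<in> PP q}"
        using finT by (intro psubset_card_mono) auto
      moreover have "\<forall>q\<in>T. z \<in> PP q \<or> z \<notin> q" using zq zp xun by blast
      ultimately show ?thesis unfolding ez using less.hyps[OF _ I zA] e1 by simp
    qed
    have finF: "finite F" by (rule finite_subset[OF r2(1) finite_Xit[OF f]])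
    have "(\<Sum>\<eta>\<in>F. frag_of \<eta>) = (\<Sum>\<eta>\<in>F - F1. frag_of \<eta>) + (\<Sum>\<eta>\<in>F1. frag_of \<eta>)"
      by (rule sum.subset_diff[OF F1F finF])
    also have "(\<Sum>\<eta>\<in>F - F1. frag_of \<eta>) = frag_of \<xi> + (\<Sum>\<eta>\<in>F - F1 - {\<xi>}. frag_of \<eta>)"
      using finF xiF xiF1 by (intro sum.remove) auto
    \<comment> \<open>\<xi> is the sum over F minus the sum over F1 minus the rest, with the two
      fibre sums replaced by \<xi>2 and \<xi>3 modulo relators.\<close>
    finally have tot: "frag_of \<xi> = (frag_of \<xi>2 - (frag_of \<xi>2 - (\<Sum>\<eta>\<in>F. frag_of \<eta>)))
        - (frag_of \<xi>3 - (frag_of \<xi>3 - (\<Sum>\<eta>\<in>F1. frag_of \<eta>))) - (\<Sum>\<eta>\<in>F - F1 - {\<xi>}. frag_of \<eta>)" by simp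
    have "(\<Sum>\<eta>\<in>F - F1 - {\<xi>}. frag_of \<eta>) \<in> M" by (rule closed_rel_sum[OF M rest])
    then have "frag_of \<xi> \<in> M" by (subst tot) (intro closed_rel(2)[OF M] M2 M3 r2(2) r3)
    then show ?thesis by (simp add: \<xi>_def)
  qed
qed

theorem BB_generates: assumes M: "closed_rel M" and BM: "frag_of ` BB \<subseteq> M" and xi: "\<xi> \<in> Xit f" shows "frag_of \<xi> \<in> M"
proof (rule reduce_unitary[OF M _ xi])
  fix \<zeta> assume z: "\<zeta> \<in> Xit f" "unitary \<zeta>"
  obtain J y where J: "J \<in> RR" "y \<in> A" "\<zeta> = cl y (LL J)" using Xit_rep[OF z(1)] by blast
  show "frag_of \<zeta> \<in> M" unfolding J(3) by (rule reduce_BB[OF M BM J(1,2)]) (use z(2) unitary_LL[OF J(1,2)] J(3) in simp)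
qed

end

section \<open>The isomorphism\<close>

text \<open>Gaussian elimination: the equation b is used to remove the unknown h0, whose value is
  restored at the end.\<close>

lemma underdetermined:
  fixes m :: "'b \<Rightarrow> 'h \<Rightarrow> 'a::field"
  assumes "finite B"
  shows "finite C \<Longrightarrow> card B < card C \<Longrightarrow> \<exists>l. (\<exists>h\<in>C. l h \<noteq> 0) \<and> (\<forall>b\<in>B. (\<Sum>h\<in>C. l h * m b h) = 0)"
  using assms
proof (induction B arbitrary: C m)
  case empty
  then have "C \<noteq> {}" by auto
  then show ?case by (intro exI[of _ "\<lambda>_. 1"]) auto
next
  case (insert b B)
  show ?case
  proof (cases "\<forall>h\<in>C. m b h = 0")
    case True
    obtain l where "\<exists>h\<in>C. l h \<noteq> 0" "\<forall>b\<in>B. (\<Sum>h\<in>C. l h * m b h) = 0"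
      using insert.IH[of C m] insert.prems insert.hyps by auto
    then show ?thesis using True by (intro exI[of _ l]) simp
  next
    case False
    then obtain h0 where h0: "h0 \<in> C" "m b h0 \<noteq> 0" by blast
    define C' where "C' = C - {h0}"
    have C': "finite C'" "card B < card C'" "h0 \<notin> C'" "C = insert h0 C'"
      using insert.prems insert.hyps h0(1) by (auto simp: C'_def card_Diff_singleton)
    define m' where "m' b' h = m b' h - m b' h0 * m b h / m b h0" for b' h
    obtain l where l: "\<exists>h\<in>C'. l h \<noteq> 0" "\<forall>b'\<in>B. (\<Sum>h\<in>C'. l h * m' b' h) = 0"
      using insert.IH[OF C'(1,2), of m'] by blast
    define s where "s = (\<Sum>h\<in>C'. l h * m b h)"
    define l' where "l' h = (if h = h0 then - s / m b h0 else l h)" for h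
    have sum: "(\<Sum>h\<in>C. l' h * m b' h) = - s / m b h0 * m b' h0 + (\<Sum>h\<in>C'. l h * m b' h)" for b'
    proof -
      have "(\<Sum>h\<in>C'. l' h * m b' h) = (\<Sum>h\<in>C'. l h * m b' h)"
        by (rule sum.cong) (use C'(3) in \<open>auto simp: l'_def\<close>)
      then show ?thesis unfolding C'(4) using C'(1,3) by (simp add: l'_def)
    qed
    have "(\<Sum>h\<in>C. l' h * m b' h) = 0" if b': "b' \<in> insert b B" for b'
    proof (cases "b' = b")
      case True
      then show ?thesis unfolding sum using h0(2) by (simp add: s_def)
    next
      case False
      then have "(\<Sum>h\<in>C'. l h * m' b' h) = 0" using l(2) b' by auto
      moreover have "(\<Sum>h\<in>C'. l h * m' b' h) = (\<Sum>h\<in>C'. l h * m b' h) - s * (m b' h0 / m b h0)"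
        unfolding m'_def s_def right_diff_distrib sum_subtractf sum_distrib_right
        by (simp add: mult.commute mult.left_commute)
      ultimately show ?thesis unfolding sum by (simp add: field_simps)
    qed
    moreover have "\<exists>h\<in>C. l' h \<noteq> 0" using l(1) C'(3,4) by (auto simp: l'_def)
    ultimately show ?thesis by blast
  qed
qed

text \<open>A relation with nonzero coefficient at b0 makes equation b0 a consequence of the others.
  There are then fewer equations than unknowns, even if B and C have equal size.\<close>

lemma dependent_kernel:
  fixes m :: "'b \<Rightarrow> 'h \<Rightarrow> 'a::field"
  assumes B: "finite B" and C: "finite C" and card: "card B \<le> card C"
    and b0: "b0 \<in> B" "c b0 \<noteq> 0" and dep: "\<And>h. h \<in> C \<Longrightarrow> (\<Sum>b\<in>B. c b * m b h) = 0"
  shows "\<exists>l. (\<exists>h\<in>C. l h \<noteq> 0) \<and> (\<forall>b\<in>B. (\<Sum>h\<in>C. l h * m b h) = 0)"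
proof -
  have "card (B - {b0}) < card C" using psubset_card_mono[OF B, of "B - {b0}"] card b0(1) by fastforce
  then obtain l where l: "\<exists>h\<in>C. l h \<noteq> 0" "\<forall>b\<in>B - {b0}. (\<Sum>h\<in>C. l h * m b h) = 0"
    using underdetermined[of "B - {b0}" C m] B C by auto
  have "0 = (\<Sum>h\<in>C. l h * (\<Sum>b\<in>B. c b * m b h))" using dep by simp
  also have "\<dots> = (\<Sum>b\<in>B. c b * (\<Sum>h\<in>C. l h * m b h))"
    unfolding sum_distrib_left by (subst sum.swap) (simp add: mult.left_commute)
  also have "\<dots> = c b0 * (\<Sum>h\<in>C. l h * m b0 h) + (\<Sum>b\<in>B - {b0}. c b * (\<Sum>h\<in>C. l h * m b h))"
    by (rule sum.remove[OF B b0(1)])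
  also have "\<dots> = c b0 * (\<Sum>h\<in>C. l h * m b0 h)" using l(2) by simp
  finally have "(\<Sum>h\<in>C. l h * m b0 h) = 0" using b0(2) by simp
  then show ?thesis using l by (intro exI[of _ l]) blast
qed

lemma (in group) lookup_gring_mult:
  assumes fin: "finite (carrier G)" and r: "Poly_Mapping.keys r \<subseteq> carrier G" and y: "Poly_Mapping.keys y \<subseteq> carrier G"
  shows "Poly_Mapping.lookup (gring_mult G r y) d =
    (if d \<in> carrier G then \<Sum>g\<in>carrier G. Poly_Mapping.lookup r g * Poly_Mapping.lookup y (inv g \<otimes> d) else 0)"
proof -
  let ?r = "Poly_Mapping.lookup r" and ?y = "Poly_Mapping.lookup y"
  have r0: "?r g = 0" if "g \<notin> Poly_Mapping.keys r" for g using that by (simp add: in_keys_iff)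
  have y0: "?y g = 0" if "g \<notin> Poly_Mapping.keys y" for g using that by (simp add: in_keys_iff)
  have "gring_mult G r y = (\<Sum>g\<in>Poly_Mapping.keys r. \<Sum>e\<in>carrier G. Poly_Mapping.single (g \<otimes> e) (?r g * ?y e))"
    unfolding gring_mult_def
    by (intro sum.cong refl sum.mono_neutral_left fin y ballI) (simp add: y0)
  also have "\<dots> = (\<Sum>g\<in>carrier G. \<Sum>e\<in>carrier G. Poly_Mapping.single (g \<otimes> e) (?r g * ?y e))"
    by (intro sum.mono_neutral_left fin r ballI) (simp add: r0)
  finally have e: "Poly_Mapping.lookup (gring_mult G r y) d =
      (\<Sum>g\<in>carrier G. \<Sum>e\<in>carrier G. if g \<otimes> e = d then ?r g * ?y e else 0)"
    by (simp add: lookup_sum lookup_single when_def)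
  show ?thesis
  proof (cases "d \<in> carrier G")
    case True
    have "(\<Sum>e\<in>carrier G. if g \<otimes> e = d then ?r g * ?y e else 0) = ?r g * ?y (inv g \<otimes> d)" if g: "g \<in> carrier G" for g
    proof -
      have "g \<otimes> e = d \<longleftrightarrow> e = inv g \<otimes> d" if "e \<in> carrier G" for e
        using that g True by (metis inv_closed inv_solve_left m_assoc l_inv l_one r_inv)
      then have "(\<Sum>e\<in>carrier G. if g \<otimes> e = d then ?r g * ?y e else 0)
          = (\<Sum>e\<in>carrier G. if e = inv g \<otimes> d then ?r g * ?y e else 0)" by (intro sum.cong) auto
      then show ?thesis using fin g True by simp
    qed
    then show ?thesis unfolding e using True by simp
  next
    case False
    have "(if g \<otimes> e' = d then ?r g * ?y e' else 0) = 0" if "g \<in> carrier G" "e' \<in> carrier G" for g e'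
      using that False m_closed by auto
    then show ?thesis unfolding e using False by simp
  qed
qed

lemma (in group) keys_gring_mult:
  assumes "finite (carrier G)" "Poly_Mapping.keys r \<subseteq> carrier G" "Poly_Mapping.keys y \<subseteq> carrier G"
  shows "Poly_Mapping.keys (gring_mult G r y) \<subseteq> carrier G"
  by (auto simp: in_keys_iff lookup_gring_mult[OF assms] split: if_splits)

lemmas frag_on_induct [consumes 1, case_names zero diff base] = free_Abelian_group_induct

section \<open>The map from classes to the group ring\<close>

locale anderson = universal_hom A sg \<mu> u + level A sg f
  for A :: "'k::topological_field set" and sg :: "'k \<Rightarrow> 'k"
    and \<mu> :: "('k set \<Rightarrow> 'k set set) measure" and u :: "('k set set \<Rightarrow>\<^sub>0 int) \<Rightarrow> rat" and f :: "'k set"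
begin

abbreviation "lk \<equiv> Poly_Mapping.lookup"
abbreviation "C \<equiv> carrier (H f)"
abbreviation "FF \<equiv> free_Abelian_group (Xit f)"

sublocale Hf: comm_group "H f" by (rule H_comm_group[OF f])

lemma finC: "finite C" by (rule H_finite[OF f])
lemma finX: "finite (Xit f)" by (rule finite_Xit[OF f])

text \<open>The linear extension of the values of u on translates by \<gamma>. Summation over the
  whole finite set \<open>Xit f\<close> rather than over the support makes linearity
  immediate.\<close>

definition w :: "'k set set \<Rightarrow> ('k set set \<Rightarrow>\<^sub>0 int) \<Rightarrow> rat" where
  "w \<gamma> x = (\<Sum>\<xi>\<in>Xit f. of_int (lk x \<xi>) * v (ga f \<gamma> \<xi>))"

lemma w_add: "w \<gamma> (x + y) = w \<gamma> x + w \<gamma> y" and w_diff: "w \<gamma> (x - y) = w \<gamma> x - w \<gamma> y"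
  and w_zero: "w \<gamma> 0 = 0" and w_cmul: "w \<gamma> (frag_cmul k x) = of_int k * w \<gamma> x"
  by (simp_all add: w_def lookup_add lookup_minus distrib_right left_diff_distrib sum.distrib sum_subtractf
      sum_distrib_left mult.assoc)

lemma w_sum: "w \<gamma> (sum h S) = (\<Sum>i\<in>S. w \<gamma> (h i))"
  by (induction S rule: infinite_finite_induct) (auto simp: w_add w_zero)

lemma w_frag: "\<xi> \<in> Xit f \<Longrightarrow> w \<gamma> (frag_of \<xi>) = v (ga f \<gamma> \<xi>)"
proof -
  assume xi: "\<xi> \<in> Xit f"
  have "w \<gamma> (frag_of \<xi>) = (\<Sum>\<zeta>\<in>Xit f. if \<zeta> = \<xi> then v (ga f \<gamma> \<zeta>) else 0)"
    unfolding w_def by (intro sum.cong) (auto simp: lookup_single when_def)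
  then show ?thesis using xi finX by simp
qed

definition theta :: "('k set set \<Rightarrow>\<^sub>0 int) \<Rightarrow> ('k set set \<Rightarrow>\<^sub>0 rat)" where
  "theta x = (\<Sum>\<gamma>\<in>C. Poly_Mapping.single (inv\<^bsub>H f\<^esub> \<gamma>) (w \<gamma> x))"

lemma lookup_theta: "lk (theta x) d = (if d \<in> C then w (inv\<^bsub>H f\<^esub> d) x else 0)"
proof -
  have "lk (theta x) d = (\<Sum>\<gamma>\<in>C. if inv\<^bsub>H f\<^esub> \<gamma> = d then w \<gamma> x else 0)"
    by (simp add: theta_def lookup_sum lookup_single when_def)
  also have "\<dots> = (if d \<in> C then w (inv\<^bsub>H f\<^esub> d) x else 0)"
  proof (cases "d \<in> C")
    case True
    have "(\<Sum>\<gamma>\<in>C. if inv\<^bsub>H f\<^esub> \<gamma> = d then w \<gamma> x else 0) = (\<Sum>\<gamma>\<in>C. if \<gamma> = inv\<^bsub>H f\<^esub> d then w \<gamma> x else 0)"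
      by (rule sum.cong) (use True in auto)
    then show ?thesis using True finC by simp
  next
    case False
    have "(\<Sum>\<gamma>\<in>C. if inv\<^bsub>H f\<^esub> \<gamma> = d then w \<gamma> x else 0) = 0"
      by (rule sum.neutral) (use False in auto)
    then show ?thesis using False by simp
  qed
  finally show ?thesis .
qed

lemma theta_keys: "Poly_Mapping.keys (theta x) \<subseteq> C"
  by (auto simp: in_keys_iff lookup_theta split: if_splits)

lemma theta_eqI: "(\<And>d. d \<in> C \<Longrightarrow> lk y d = w (inv\<^bsub>H f\<^esub> d) x) \<Longrightarrow> Poly_Mapping.keys y \<subseteq> C \<Longrightarrow> y = theta x"
  by (rule poly_mapping_eqI) (auto simp: lookup_theta in_keys_iff)

lemma theta_add: "theta (x + y) = theta x + theta y" and theta_diff: "theta (x - y) = theta x - theta y" and theta_zero: "theta 0 = 0"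
  by (rule poly_mapping_eqI; simp add: lookup_theta w_add w_diff w_zero lookup_add lookup_minus)+

lemma theta_zero_iff: "theta x = 0 \<longleftrightarrow> (\<forall>\<gamma>\<in>C. w \<gamma> x = 0)"
proof
  assume h: "theta x = 0"
  show "\<forall>\<gamma>\<in>C. w \<gamma> x = 0"
  proof
    fix \<gamma> assume "\<gamma> \<in> C"
    then show "w \<gamma> x = 0" using lookup_theta[of x "inv\<^bsub>H f\<^esub> \<gamma>"] h by simp
  qed
next
  assume "\<forall>\<gamma>\<in>C. w \<gamma> x = 0"
  then show "theta x = 0" by (intro poly_mapping_eqI) (simp add: lookup_theta)
qed

definition "N = generate FF (dist_relators A sg f)"

lemma relator_w: assumes "x \<in> dist_relators A sg f" "\<gamma> \<in> C" shows "w \<gamma> x = 0" "Poly_Mapping.keys x \<subseteq> Xit f"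
proof -
  obtain \<xi> p where x: "x = frag_of \<xi> - (\<Sum>\<eta>\<in>fib p \<xi>. frag_of \<eta>)" "p \<in> T" "\<xi> \<in> Xit (f \<cdot> iv p)"
    using assms(1) unfolding dist_relators_eq by blast
  have q: "ideal (f \<cdot> iv p)" by (rule ideal_quot[OF T(3)[OF x(2)] f T(2)[OF x(2)]])
  have "f \<subseteq> f \<cdot> iv p" using sub_mp_iv[OF sf T(5)[OF x(2)]] .
  then have xi: "\<xi> \<in> Xit f" using Xit_mono[OF f q] x(3) by blast
  have fX: "fib p \<xi> \<subseteq> Xit f" by (rule fib_Xit_T[OF x(2,3)])
  have "(\<Sum>\<eta>\<in>fib p \<xi>. w \<gamma> (frag_of \<eta>)) = (\<Sum>\<eta>\<in>fib p \<xi>. v (ga f \<gamma> \<eta>))"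
    by (rule sum.cong[OF refl w_frag]) (use fX in blast)
  then have "w \<gamma> x = v (ga f \<gamma> \<xi>) - (\<Sum>\<eta>\<in>fib p \<xi>. v (ga f \<gamma> \<eta>))"
    unfolding x(1) w_diff w_sum w_frag[OF xi] by simp
  then show "w \<gamma> x = 0" using dist_rel[OF T(1)[OF x(2)] f T(2)[OF x(2)] x(3) assms(2)] by simp
  have "(\<Sum>\<eta>\<in>fib p \<xi>. frag_of \<eta>) \<in> carrier FF"
    by (rule sum_closed_free_Abelian_group) (use fX in auto)
  then have "Poly_Mapping.keys (\<Sum>\<eta>\<in>fib p \<xi>. frag_of \<eta>) \<subseteq> Xit f" by simp
  then show "Poly_Mapping.keys x \<subseteq> Xit f" unfolding x(1) using keys_diff[of "frag_of \<xi>" "\<Sum>\<eta>\<in>fib p \<xi>. frag_of \<eta>"] xi by auto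
qed

lemma closed_relI: assumes "0 \<in> M" "\<And>x y. x \<in> M \<Longrightarrow> y \<in> M \<Longrightarrow> x - y \<in> M" "dist_relators A sg f \<subseteq> M" shows "closed_rel M"
  using assms by (auto simp: closed_rel_def)

lemma BB_generates_all: assumes M: "closed_rel M" and BM: "frag_of ` BB \<subseteq> M" and x: "Poly_Mapping.keys x \<subseteq> Xit f"
  shows "x \<in> M"
  using x
proof (induction rule: frag_on_induct)
  case zero then show ?case using closed_rel(1)[OF M] .
next
  case (diff x y) then show ?case using closed_rel(2)[OF M] by blast
next
  case (base a) then show ?case using BB_generates[OF M BM] by blast
qed

interpretation F: comm_group FF by (rule abelian_free_Abelian_group)

lemma rel_carrier: "dist_relators A sg f \<subseteq> carrier FF"
  using relator_w(2)[OF _ Hf.one_closed] by auto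

lemma N_subgroup: "subgroup N FF" unfolding N_def by (rule F.generate_is_subgroup[OF rel_carrier])

lemma N_zero: "0 \<in> N" using subgroup.one_closed[OF N_subgroup] by simp

lemma N_keys: "x \<in> N \<Longrightarrow> Poly_Mapping.keys x \<subseteq> Xit f"
  using subsetD[OF subgroup.subset[OF N_subgroup], of x] by simp

lemma N_diff: "x \<in> N \<Longrightarrow> y \<in> N \<Longrightarrow> x - y \<in> N"
  using subgroup.m_closed[OF N_subgroup, of x "- y"] subgroup.m_inv_closed[OF N_subgroup, of y] N_keys[of y] by simp

lemma N_theta: "n \<in> N \<Longrightarrow> theta n = 0"
  unfolding N_def
proof (induction rule: generate.induct)
  case one then show ?case by (simp add: theta_zero)
next
  case (incl h) then show ?case using relator_w(1) theta_zero_iff by blast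
next
  case (inv h)
  then have "Poly_Mapping.keys h \<subseteq> Xit f" using subsetD[OF rel_carrier, of h] by simp
  moreover have "theta (0 - h) = 0" unfolding theta_diff theta_zero using inv relator_w(1) theta_zero_iff by simp
  ultimately show ?case by simp
next
  case (eng h1 h2) then show ?case by (simp add: theta_add)
qed

text \<open>At the conductor \<open>g\<close> of \<open>\<psi>\<close> the Euler product over \<open>p | g\<close> is \<open>1\<close>.\<close>

lemma char_coefficient:
  assumes psi: "\<psi> \<in> hom (H f) complex_units"
  shows "\<exists>g. ideal g \<and> f \<subseteq> g \<and> (\<Sum>\<tau>\<in>C. of_rat (v (ga f \<tau> (cl 1 g))) * \<psi> \<tau>) \<noteq> 0"
proof -
  let ?ch = "\<lambda>\<sigma>. \<psi> (\<sigma> f)"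
  note ch = pullback_char(2)[OF f psi]
  obtain c where c: "has_conductor A sg ?ch c" "f \<subseteq> c" using conductor_exists[OF ch f pullback_char(3)[OF f psi]] by blast
  have ci: "ideal c" using c(1) by (simp add: has_conductor_def)
  have "ideal_dvd A c c" using dvd_iff[OF ci ci] by simp
  then have "factors_through A sg ?ch c" using c(1) ci by (simp add: has_conductor_def)
  then obtain \<phi> where phi: "\<phi> \<in> hom (H c) complex_units" "\<forall>\<sigma>\<in>carrier GG. \<psi> (\<sigma> f) = \<phi> (\<sigma> c)"
    unfolding factors_through_def by blast
  have pp: "\<psi> \<gamma> = \<phi> (pr c \<gamma>)" if "\<gamma> \<in> C" for \<gamma>
    using phi(2) lift[OF f that] GG_pr[OF lift(1)[OF f that] f ci c(2)] by metis
  let ?ch' = "\<lambda>\<sigma>. \<phi> (\<sigma> c)"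
  have "factors_through A sg ?ch' g = factors_through A sg ?ch g" for g
    unfolding factors_through_def using phi(2) by auto
  then have c': "has_conductor A sg ?ch' c" using c(1) unfolding has_conductor_def by simp
  have "char_at A sg ?ch' c p = 0" if "maxi p" "c \<subseteq> p" for p
    using dvd_iff[OF maxi_ideal[OF that(1)] ci] that(2) by (simp add: char_at_def)
  then have "Pf ?ch' c c = 1" unfolding Pf_def by (intro prod.neutral) simp
  then have S: "(\<Sum>\<delta>\<in>carrier (H c). of_rat (v (ga c \<delta> (cl 1 c))) * \<phi> \<delta>) = 1"
    using char_sum_eq[OF ci phi(1) c' subset_refl] by simp
  have xc: "cl 1 c \<in> Xit c" by (rule one_Xit[OF ci ci subset_refl])
  have "(\<Sum>\<tau>\<in>C. of_rat (v (ga f \<tau> (cl 1 c))) * \<psi> \<tau>) =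
      (\<Sum>\<tau>\<in>C. of_rat (v (ga c (pr c \<tau>) (cl 1 c))) * \<phi> (pr c \<tau>))"
    using pp ga_pr[OF f ci c(2) xc] by (intro sum.cong) auto
  also have "\<dots> = of_nat (card (ker f c)) * 1"
    using sum_fibre[OF f ci c(2), of "\<lambda>\<delta>. of_rat (v (ga c \<delta> (cl 1 c))) * \<phi> \<delta>"] S by simp
  finally have "(\<Sum>\<tau>\<in>C. of_rat (v (ga f \<tau> (cl 1 c))) * \<psi> \<tau>) = of_nat (card (ker f c))" by simp
  moreover have "card (ker f c) \<noteq> 0" using ker_closed(2,3)[OF f ci c(2)] by auto
  ultimately show ?thesis using ci c(2) by (intro exI[of _ c]) simp
qed

text \<open>A relation among the images of \<open>BB\<close> would, as \<open>BB\<close> has at most as many elements as the ray class group, yield a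
  nonzero function on the group orthogonal to all translates of the values of \<open>v\<close> on \<open>BB\<close>, hence on \<open>Xit f\<close>; its Fourier
  coefficients vanish by \<open>char_coefficient\<close>.\<close>

theorem theta_kernel: assumes x: "Poly_Mapping.keys x \<subseteq> Xit f" shows "theta x = 0 \<longleftrightarrow> x \<in> N"
proof
  assume "x \<in> N"
  then show "theta x = 0" by (rule N_theta)
next
  assume th0: "theta x = 0"
  \<comment> \<open>By generation M contains x, so x can be replaced by an integral combination y of
    classes in \<open>BB\<close>; the claim becomes y = 0.\<close>
  define M where "M = {n + y | n y. n \<in> N \<and> Poly_Mapping.keys y \<subseteq> BB}"
  have "closed_rel M"
  proof (rule closed_relI)
    show "0 \<in> M" unfolding M_def using N_zero by (auto intro!: exI[of _ 0])
    show "a - b \<in> M" if ab: "a \<in> M" "b \<in> M" for a b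
    proof -
      obtain n y n' y' where "a = n + y" "b = n' + y'" "n \<in> N" "n' \<in> N" "Poly_Mapping.keys y \<subseteq> BB" "Poly_Mapping.keys y' \<subseteq> BB"
        using ab unfolding M_def by blast
      moreover from this have "a - b = (n - n') + (y - y')" by simp
      moreover have "Poly_Mapping.keys (y - y') \<subseteq> BB" using calculation keys_diff[of y y'] by blast
      ultimately show ?thesis unfolding M_def using N_diff by blast
    qed
    show "dist_relators A sg f \<subseteq> M"
    proof
      fix r assume "r \<in> dist_relators A sg f"
      then have "r \<in> N" unfolding N_def by (rule generate.incl)
      then show "r \<in> M" unfolding M_def by (intro CollectI exI[of _ r] exI[of _ 0]) simp
    qed
  qed
  moreover have "frag_of ` BB \<subseteq> M"
  proof clarify
    fix b assume "b \<in> BB"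
    then show "frag_of b \<in> M"
      unfolding M_def by (intro CollectI exI[of _ 0] exI[of _ "frag_of b"]) (simp add: N_zero)
  qed
  ultimately have "x \<in> M" using BB_generates_all x by blast
  then obtain n y where ny: "x = n + y" "n \<in> N" "Poly_Mapping.keys y \<subseteq> BB" unfolding M_def by blast
  have "theta y = 0" using th0 ny(1) N_theta[OF ny(2)] by (simp add: theta_add)
  then have wy: "w \<gamma> y = 0" if "\<gamma> \<in> C" for \<gamma> using that theta_zero_iff by blast
  have "y = 0"
  proof (rule ccontr)
    assume "y \<noteq> 0"
    then obtain b0 where "b0 \<in> Poly_Mapping.keys y" using keys_eq_empty by blast
    then have b0: "b0 \<in> BB" "lk y b0 \<noteq> 0" using ny(3) by (auto simp: in_keys_iff)
    define m where "m b \<gamma> = (of_rat (v (ga f \<gamma> b)) :: complex)" for b \<gamma>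
    have dep: "(\<Sum>b\<in>BB. of_int (lk y b) * m b \<gamma>) = 0" if g: "\<gamma> \<in> C" for \<gamma>
    proof -
      have "w \<gamma> y = (\<Sum>b\<in>BB. of_int (lk y b) * v (ga f \<gamma> b))"
        unfolding w_def
      proof (rule sum.mono_neutral_right[OF finX BB_Xit], rule ballI)
        fix i assume "i \<in> Xit f - BB"
        then have "i \<notin> Poly_Mapping.keys y" using ny(3) by blast
        then show "of_int (lk y i) * v (ga f \<gamma> i) = 0" by (simp add: in_keys_iff)
      qed
      then have "(of_rat (\<Sum>b\<in>BB. of_int (lk y b) * v (ga f \<gamma> b)) :: complex) = 0" using wy[OF g] by simp
      then show ?thesis by (simp add: m_def of_rat_sum of_rat_mult)
    qed
    obtain l where l: "\<exists>h\<in>C. l h \<noteq> 0" "\<forall>b\<in>BB. (\<Sum>h\<in>C. l h * m b h) = 0"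
      using dependent_kernel[OF card_BB(1) finC card_BB(2) b0(1), of "\<lambda>b. of_int (lk y b)" m] b0(2) dep by auto
    \<comment> \<open>The relators are annihilated by every \<open>w \<gamma>\<close>, so the
      elements orthogonal to l form a subgroup to which the generation theorem applies once more: l
      is orthogonal to all classes.\<close>
    define M2 where "M2 = {x. (\<Sum>\<gamma>\<in>C. l \<gamma> * of_rat (w \<gamma> x)) = 0}"
    have "closed_rel M2"
    proof (rule closed_relI)
      show "0 \<in> M2" by (simp add: M2_def w_zero)
      show "a - b \<in> M2" if "a \<in> M2" "b \<in> M2" for a b
        using that by (simp add: M2_def w_diff of_rat_diff right_diff_distrib sum_subtractf)
      show "dist_relators A sg f \<subseteq> M2" using relator_w(1) by (auto simp: M2_def intro!: sum.neutral)
    qed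
    moreover have "frag_of ` BB \<subseteq> M2"
    proof clarify
      fix b assume "b \<in> BB"
      then show "frag_of b \<in> M2" using l(2) w_frag[of b] BB_Xit by (auto simp: M2_def m_def)
    qed
    ultimately have M2: "frag_of \<xi> \<in> M2" if "\<xi> \<in> Xit f" for \<xi> using BB_generates that by blast
    have lz: "(\<Sum>\<gamma>\<in>C. l \<gamma> * m \<xi> \<gamma>) = 0" if "\<xi> \<in> Xit f" for \<xi>
      using M2[OF that] by (simp add: M2_def w_frag[OF that] m_def)
    have "l \<gamma> = 0" if g: "\<gamma> \<in> C" for \<gamma>
    proof (rule Hf.fourier_zero[OF finC _ g])
      fix \<psi> assume psi: "\<psi> \<in> hom (H f) complex_units"
      \<comment> \<open>Weighting the translates of [1 + g] by the inverse character produces the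
        factor \<psi>(\<gamma>). After the sums are exchanged, orthogonality says that the
        coefficient of l at \<psi> times a nonzero number is 0.\<close>
      define \<psi>' where "\<psi>' = (\<lambda>x. inverse (\<psi> x))"
      have psi': "\<psi>' \<in> hom (H f) complex_units" unfolding \<psi>'_def by (rule cchar_inverse[OF psi])
      obtain g where g: "ideal g" "f \<subseteq> g" "(\<Sum>\<tau>\<in>C. of_rat (v (ga f \<tau> (cl 1 g))) * \<psi>' \<tau>) \<noteq> 0"
        using char_coefficient[OF psi'] by blast
      have xg: "cl 1 g \<in> Xit f" by (rule one_Xit[OF f g(1,2)])
      let ?S = "\<Sum>\<tau>\<in>C. m (cl 1 g) \<tau> * \<psi>' \<tau>"
      have inner: "(\<Sum>\<sigma>\<in>C. m (ga f \<sigma> (cl 1 g)) \<gamma> * \<psi>' \<sigma>) = \<psi> \<gamma> * ?S" if gc: "\<gamma> \<in> C" for \<gamma>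
      proof -
        have "?S = (\<Sum>\<sigma>\<in>C. m (cl 1 g) (\<sigma> \<otimes>\<^bsub>H f\<^esub> \<gamma>) * \<psi>' (\<sigma> \<otimes>\<^bsub>H f\<^esub> \<gamma>))"
          by (rule Hf.sum_translate[OF gc, symmetric])
        also have "\<dots> = (\<Sum>\<sigma>\<in>C. \<psi>' \<gamma> * (m (ga f \<sigma> (cl 1 g)) \<gamma> * \<psi>' \<sigma>))"
        proof (rule sum.cong[OF refl])
          fix \<sigma> assume s: "\<sigma> \<in> C"
          have "ga f (\<sigma> \<otimes>\<^bsub>H f\<^esub> \<gamma>) (cl 1 g) = ga f \<gamma> (ga f \<sigma> (cl 1 g))"
            using ga_mult[OF f xg gc s] Hf.m_comm[OF s gc] by simp
          then show "m (cl 1 g) (\<sigma> \<otimes>\<^bsub>H f\<^esub> \<gamma>) * \<psi>' (\<sigma> \<otimes>\<^bsub>H f\<^esub> \<gamma>) = \<psi>' \<gamma> * (m (ga f \<sigma> (cl 1 g)) \<gamma> * \<psi>' \<sigma>)"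
            using cchar_mult[OF psi' s gc] by (simp add: m_def)
        qed
        finally show ?thesis using cchar_nonzero[OF psi gc] by (simp add: \<psi>'_def sum_distrib_left[symmetric])
      qed
      have "0 = (\<Sum>\<sigma>\<in>C. \<psi>' \<sigma> * (\<Sum>\<gamma>\<in>C. l \<gamma> * m (ga f \<sigma> (cl 1 g)) \<gamma>))"
        using lz ga_cord(1)[OF f xg] by simp
      also have "\<dots> = (\<Sum>\<gamma>\<in>C. l \<gamma> * (\<Sum>\<sigma>\<in>C. m (ga f \<sigma> (cl 1 g)) \<gamma> * \<psi>' \<sigma>))"
        unfolding sum_distrib_left by (subst sum.swap) (simp add: ac_simps)
      also have "\<dots> = (\<Sum>\<gamma>\<in>C. l \<gamma> * \<psi> \<gamma>) * ?S"
        unfolding sum_distrib_right by (intro sum.cong) (auto simp: inner)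
      finally show "(\<Sum>\<gamma>\<in>C. l \<gamma> * \<psi> \<gamma>) = 0" using g(3) by (simp add: m_def)
    qed
    then show False using l(1) by blast
  qed
  then show "x \<in> N" using ny by simp
qed

section \<open>Equivariance and the image of the map\<close>

definition shift :: "'k set set \<Rightarrow> ('k set set \<Rightarrow>\<^sub>0 int) \<Rightarrow> ('k set set \<Rightarrow>\<^sub>0 int)" where
  "shift \<gamma> = frag_extend (\<lambda>\<xi>. frag_of (ga f \<gamma> \<xi>))"

lemma shift_add: "shift \<gamma> (x + y) = shift \<gamma> x + shift \<gamma> y" and shift_diff: "shift \<gamma> (x - y) = shift \<gamma> x - shift \<gamma> y"
  by (simp_all add: shift_def frag_extend_add frag_extend_diff)

lemma shift_keys: assumes "Poly_Mapping.keys x \<subseteq> Xit f" "\<gamma> \<in> C" shows "Poly_Mapping.keys (shift \<gamma> x) \<subseteq> Xit f"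
proof -
  have "Poly_Mapping.keys (shift \<gamma> x) \<subseteq> (\<Union>\<xi>\<in>Poly_Mapping.keys x. Poly_Mapping.keys (frag_of (ga f \<gamma> \<xi>)))"
    unfolding shift_def by (rule keys_frag_extend)
  then show ?thesis using assms ga_cord(1)[OF f _ assms(2)] by fastforce
qed

lemma shift_w: assumes x: "Poly_Mapping.keys x \<subseteq> Xit f" and c: "\<gamma> \<in> C" "\<alpha> \<in> C"
  shows "w \<alpha> (shift \<gamma> x) = w (\<alpha> \<otimes>\<^bsub>H f\<^esub> \<gamma>) x"
  using x
proof (induction rule: frag_on_induct)
  case zero then show ?case by (simp add: shift_def w_zero)
next
  case (diff x y) then show ?case by (simp add: shift_diff w_diff)
next
  case (base a)
  then show ?case using w_frag[OF base] w_frag[OF ga_cord(1)[OF f base c(1)]] ga_mult[OF f base c(2,1)] by (simp add: shift_def)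
qed

lemma shift_inv: assumes x: "Poly_Mapping.keys x \<subseteq> Xit f" and c: "\<gamma> \<in> C"
  shows "shift \<gamma> (shift (inv\<^bsub>H f\<^esub> \<gamma>) x) = x"
  using x
proof (induction rule: frag_on_induct)
  case zero then show ?case by (simp add: shift_def)
next
  case (diff x y) then show ?case by (simp add: shift_diff)
next
  case (base a)
  then show ?case using ga_mult[OF f base c, of "inv\<^bsub>H f\<^esub> \<gamma>"] ga_one[OF f base] c by (simp add: shift_def)
qed

text \<open>The coefficient of the product at d involves theta x at \<gamma>^-1 d, that is, w at
  d^-1 \<gamma>, which is w at d^-1 of the shifted element. The inverse in the definition of
  \<open>theta\<close> is what makes left multiplication correspond to the action.\<close>

lemma gring_theta: assumes x: "Poly_Mapping.keys x \<subseteq> Xit f" and r: "Poly_Mapping.keys r \<subseteq> C"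
    and n: "\<And>\<gamma>. \<gamma> \<in> C \<Longrightarrow> lk r \<gamma> = of_int (n \<gamma>)"
  shows "gring_mult (H f) r (theta x) = theta (\<Sum>\<gamma>\<in>C. frag_cmul (n \<gamma>) (shift \<gamma> x))"
proof (rule theta_eqI)
  note L = Hf.lookup_gring_mult[OF finC r theta_keys]
  show "Poly_Mapping.keys (gring_mult (H f) r (theta x)) \<subseteq> C" by (rule Hf.keys_gring_mult[OF finC r theta_keys])
  fix d assume d: "d \<in> C"
  have "lk (gring_mult (H f) r (theta x)) d = (\<Sum>\<gamma>\<in>C. lk r \<gamma> * lk (theta x) (inv\<^bsub>H f\<^esub> \<gamma> \<otimes>\<^bsub>H f\<^esub> d))"
    using L d by simp
  also have "\<dots> = (\<Sum>\<gamma>\<in>C. of_int (n \<gamma>) * w (inv\<^bsub>H f\<^esub> d \<otimes>\<^bsub>H f\<^esub> \<gamma>) x)"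
    by (rule sum.cong[OF refl]) (use d in \<open>simp add: n lookup_theta Hf.inv_mult_group\<close>)
  also have "\<dots> = w (inv\<^bsub>H f\<^esub> d) (\<Sum>\<gamma>\<in>C. frag_cmul (n \<gamma>) (shift \<gamma> x))"
    unfolding w_sum w_cmul by (rule sum.cong[OF refl]) (use d shift_w[OF x] in simp)
  finally show "lk (gring_mult (H f) r (theta x)) d = w (inv\<^bsub>H f\<^esub> d) (\<Sum>\<gamma>\<in>C. frag_cmul (n \<gamma>) (shift \<gamma> x))" .
qed

lemma gring_single: assumes x: "Poly_Mapping.keys x \<subseteq> Xit f" and c: "\<gamma> \<in> C"
  shows "gring_mult (H f) (Poly_Mapping.single \<gamma> 1) (theta x) = theta (shift \<gamma> x)"
proof -
  have "gring_mult (H f) (Poly_Mapping.single \<gamma> 1) (theta x) = theta (\<Sum>\<delta>\<in>C. frag_cmul (if \<delta> = \<gamma> then 1 else 0) (shift \<delta> x))"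
    by (rule gring_theta[OF x]) (use c in \<open>auto simp: lookup_single when_def\<close>)
  also have "(\<Sum>\<delta>\<in>C. frag_cmul (if \<delta> = \<gamma> then 1 else 0) (shift \<delta> x)) = (\<Sum>\<delta>\<in>C. if \<delta> = \<gamma> then shift \<delta> x else 0)"
    by (rule sum.cong) auto
  also have "\<dots> = shift \<gamma> x" using c finC by simp
  finally show ?thesis .
qed

text \<open>The lifts t drop out because [1 + g] is f-torsion, so only the component of a lift at
  level f acts on it.\<close>

lemma Uprime_gens_eq: "Uprime_gens A sg u f = {theta (frag_of (cl 1 g)) | g. ideal g \<and> f \<subseteq> g}"
proof -
  have e: "(\<Sum>\<gamma>\<in>C. Poly_Mapping.single (inv\<^bsub>H f\<^esub> \<gamma>) (u (frag_of (act A sg (t \<gamma>) (hclass A sg (1 +o g)))))) = theta (frag_of (cl 1 g))"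
    if g: "ideal g" "f \<subseteq> g" and t: "\<forall>\<gamma>\<in>C. t \<gamma> \<in> carrier GG \<and> t \<gamma> f = \<gamma>" for g t
  proof -
    have xg: "cl 1 g \<in> Xit f" by (rule one_Xit[OF f g])
    show ?thesis unfolding theta_def
    proof (rule sum.cong[OF refl])
      fix \<gamma> assume c: "\<gamma> \<in> C"
      have "act A sg (t \<gamma>) (cl 1 g) = ga f \<gamma> (cl 1 g)" using act_ga[OF _ f xg, of "t \<gamma>"] t c by simp
      then show "Poly_Mapping.single (inv\<^bsub>H f\<^esub> \<gamma>) (u (frag_of (act A sg (t \<gamma>) (hclass A sg (1 +o g))))) =
        Poly_Mapping.single (inv\<^bsub>H f\<^esub> \<gamma>) (w \<gamma> (frag_of (cl 1 g)))"
        using w_frag[OF xg, of \<gamma>] by (simp add: v_def flip: cl_def)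
    qed
  qed
  have l: "\<forall>\<gamma>\<in>C. lift f \<gamma> \<in> carrier GG \<and> lift f \<gamma> f = \<gamma>" using lift[OF f] by blast
  have d: "ideal g \<and> ideal_dvd A g f \<longleftrightarrow> ideal g \<and> f \<subseteq> g" for g using dvd_iff[OF _ f] by blast
  show ?thesis
  proof
    show "Uprime_gens A sg u f \<subseteq> {theta (frag_of (cl 1 g)) | g. ideal g \<and> f \<subseteq> g}"
    proof
      fix z assume "z \<in> Uprime_gens A sg u f"
      then obtain g t where z: "ideal g \<and> ideal_dvd A g f" "\<forall>\<gamma>\<in>C. t \<gamma> \<in> carrier GG \<and> t \<gamma> f = \<gamma>"
        "z = (\<Sum>\<gamma>\<in>C. Poly_Mapping.single (inv\<^bsub>H f\<^esub> \<gamma>) (u (frag_of (act A sg (t \<gamma>) (hclass A sg (1 +o g))))))"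
        unfolding Uprime_gens_def by auto
      have g: "ideal g" "f \<subseteq> g" using z(1) unfolding d by simp_all
      show "z \<in> {theta (frag_of (cl 1 g)) | g. ideal g \<and> f \<subseteq> g}"
        unfolding z(3) e[OF g z(2)] using g by (intro CollectI exI[of _ g]) simp
    qed
    show "{theta (frag_of (cl 1 g)) | g. ideal g \<and> f \<subseteq> g} \<subseteq> Uprime_gens A sg u f"
    proof clarify
      fix g assume g: "ideal g" "f \<subseteq> g"
      show "theta (frag_of (cl 1 g)) \<in> Uprime_gens A sg u f"
        unfolding Uprime_gens_def
        by (intro CollectI exI[of _ g] exI[of _ "lift f"])
          (use e[OF g l] g d[of g] l in simp)
    qed
  qed
qed

lemma image_submodule: "int_gring_submodule (H f) (theta ` carrier FF)"
  unfolding int_gring_submodule_def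
proof (intro conjI ballI)
  show "theta ` carrier FF \<subseteq> rat_gring (H f)" using theta_keys by (auto simp: rat_gring_def)
  show "0 \<in> theta ` carrier FF" using theta_zero by (intro image_eqI[of _ _ 0]) auto
next
  fix a b assume "a \<in> theta ` carrier FF" "b \<in> theta ` carrier FF"
  then obtain x y where xy: "a = theta x" "b = theta y" "x \<in> carrier FF" "y \<in> carrier FF" by blast
  have "x + y \<in> carrier FF" using F.m_closed[OF xy(3,4)] by simp
  then have "theta (x + y) \<in> theta ` carrier FF" by blast
  then show "a + b \<in> theta ` carrier FF" using theta_add[of x y] xy(1,2) by simp
next
  fix r a assume r: "r \<in> int_gring (H f)" and "a \<in> theta ` carrier FF"
  then obtain x where x: "a = theta x" "Poly_Mapping.keys x \<subseteq> Xit f" by auto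
  have "\<forall>\<gamma>. \<exists>n. lk r \<gamma> = of_int n" using r by (auto simp: int_gring_def elim: Ints_cases)
  then obtain n where n: "\<And>\<gamma>. lk r \<gamma> = of_int (n \<gamma>)" by metis
  have rk: "Poly_Mapping.keys r \<subseteq> C" using r by (auto simp: int_gring_def rat_gring_def)
  have "(\<Sum>\<gamma>\<in>C. frag_cmul (n \<gamma>) (shift \<gamma> x)) \<in> carrier FF"
  proof (rule sum_closed_free_Abelian_group)
    fix \<gamma> assume c: "\<gamma> \<in> C"
    show "frag_cmul (n \<gamma>) (shift \<gamma> x) \<in> carrier FF" using shift_keys[OF x(2) c] keys_cmul[of "n \<gamma>" "shift \<gamma> x"] by auto
  qed
  then show "gring_mult (H f) r a \<in> theta ` carrier FF" unfolding x(1) gring_theta[OF x(2) rk n] by blast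
qed

text \<open>A submodule containing the generators contains the image of every class: the class is a
  translate of [1 + g] with g its order, and translation becomes multiplication by a group
  element.\<close>

lemma Uprime_carrier: "carrier (Uprime A sg u f) = theta ` carrier FF"
proof -
  have "int_gring_submodule (H f) hull Uprime_gens A sg u f = theta ` carrier FF"
  proof (rule hull_unique)
    show "Uprime_gens A sg u f \<subseteq> theta ` carrier FF" unfolding Uprime_gens_eq using one_Xit[OF f] by auto
    show "int_gring_submodule (H f) (theta ` carrier FF)" by (rule image_submodule)
    fix S assume gS: "Uprime_gens A sg u f \<subseteq> S" and S: "int_gring_submodule (H f) S"
    have smul: "gring_mult (H f) r y \<in> S" if "r \<in> int_gring (H f)" "y \<in> S" for r y
      using S that by (auto simp: int_gring_submodule_def)
    have sadd: "a + b \<in> S" if "a \<in> S" "b \<in> S" for a b using S that by (auto simp: int_gring_submodule_def)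
    have single_int: "Poly_Mapping.single \<gamma> (of_int k) \<in> int_gring (H f)" if "\<gamma> \<in> C" for \<gamma> and k :: int
      using that by (auto simp: int_gring_def rat_gring_def lookup_single when_def split: if_splits)
    \<comment> \<open>Submodules are described by closure under sums and group ring multiples, so
      negation is obtained as multiplication by -1.\<close>
    have theta_uminus: "gring_mult (H f) (Poly_Mapping.single \<one>\<^bsub>H f\<^esub> (of_int (-1))) (theta x) = theta (- x)"
      if x: "Poly_Mapping.keys x \<subseteq> Xit f" for x
    proof (rule theta_eqI)
      have k: "Poly_Mapping.keys (Poly_Mapping.single \<one>\<^bsub>H f\<^esub> (of_int (-1) :: rat)) \<subseteq> C" by simp
      note L = Hf.lookup_gring_mult[OF finC k theta_keys]
      show "Poly_Mapping.keys (gring_mult (H f) (Poly_Mapping.single \<one>\<^bsub>H f\<^esub> (of_int (-1))) (theta x)) \<subseteq> C"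
        by (rule Hf.keys_gring_mult[OF finC k theta_keys])
      fix d assume d: "d \<in> C"
      have "lk (gring_mult (H f) (Poly_Mapping.single \<one>\<^bsub>H f\<^esub> (of_int (-1))) (theta x)) d
          = (\<Sum>\<gamma>\<in>C. if \<gamma> = \<one>\<^bsub>H f\<^esub> then - lk (theta x) d else 0)"
        unfolding L using d by (auto simp: lookup_single when_def intro!: sum.cong)
      also have "\<dots> = w (inv\<^bsub>H f\<^esub> d) (- x)" using finC d w_diff[of "inv\<^bsub>H f\<^esub> d" 0 x] by (simp add: lookup_theta w_zero)
      finally show "lk (gring_mult (H f) (Poly_Mapping.single \<one>\<^bsub>H f\<^esub> (of_int (-1))) (theta x)) d = w (inv\<^bsub>H f\<^esub> d) (- x)" .
    qed
    have "theta x \<in> S" if "Poly_Mapping.keys x \<subseteq> Xit f" for x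
      using that
    proof (induction rule: frag_on_induct)
      case zero then show ?case using S theta_zero by (simp add: int_gring_submodule_def)
    next
      case (diff x y)
      have "theta (- y) \<in> S" using smul[OF single_int[OF Hf.one_closed] diff.IH(2)] theta_uminus[OF diff.hyps(2)] by metis
      then have "theta x + theta (- y) \<in> S" by (rule sadd[OF diff.IH(1)])
      then show ?case using theta_add[of x "- y"] by simp
    next
      case (base \<xi>)
      have xX: "\<xi> \<in> Xi A sg" by (rule Xit_Xi[OF f base])
      define g where "g = cord \<xi>"
      have g: "ideal g" "f \<subseteq> g" unfolding g_def using cord_ideal[OF xX] Xit_cord[OF f base] by auto
      obtain \<delta> where d: "\<delta> \<in> carrier (H g)" "\<xi> = ga g \<delta> (cl 1 g)" using Xi_orbit_ga[OF xX] unfolding g_def[symmetric] by (elim bexE)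
      have "\<delta> \<in> pr g ` C" unfolding pr_surj[OF f g] by (rule d(1))
      then obtain \<gamma> where c: "\<gamma> \<in> C" "pr g \<gamma> = \<delta>" by auto
      have xg: "cl 1 g \<in> Xit f" "cl 1 g \<in> Xit g" using one_Xit f g by auto
      have "\<xi> = ga f \<gamma> (cl 1 g)" using ga_pr[OF f g xg(2) c(1)] c(2) d(2) by simp
      then have "frag_of \<xi> = shift \<gamma> (frag_of (cl 1 g))" by (simp add: shift_def)
      then have "theta (frag_of \<xi>) = gring_mult (H f) (Poly_Mapping.single \<gamma> (of_int 1)) (theta (frag_of (cl 1 g)))"
        using gring_single[of "frag_of (cl 1 g)" \<gamma>] xg(1) c(1) by simp
      moreover have "theta (frag_of (cl 1 g)) \<in> S" using gS g unfolding Uprime_gens_eq by blast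
      ultimately show ?case using smul[OF single_int[OF c(1)]] by metis
    qed
    then show "theta ` carrier FF \<subseteq> S" by auto
  qed
  then show ?thesis by (simp add: Uprime_def)
qed

text \<open>\<open>theta\<close> maps onto U'(f) with kernel N, so it induces an isomorphism from
  U(f), and \<phi> is the inverse of that. Since \<open>Uact\<close> takes images of cosets,
  equivariance requires that the shift carries N onto N, not merely into it.\<close>

theorem Uprime_iso_Umod: "\<exists>\<phi>. \<phi> \<in> iso (Uprime A sg u f) (Umod A sg f) \<and>
    (\<forall>\<sigma>\<in>carrier GG. \<forall>x\<in>carrier (Uprime A sg u f).
       \<phi> (gring_mult (H f) (Poly_Mapping.single (\<sigma> f) 1) x) = Uact A sg \<sigma> (\<phi> x))"
proof -
  let ?U = "Uprime A sg u f"
  have mU: "x \<otimes>\<^bsub>?U\<^esub> y = x + y" "\<one>\<^bsub>?U\<^esub> = 0" for x y by (simp_all add: Uprime_def)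
  have gU: "group ?U"
  proof (rule groupI)
    fix x y assume "x \<in> carrier ?U" "y \<in> carrier ?U"
    then show "x \<otimes>\<^bsub>?U\<^esub> y \<in> carrier ?U"
      using image_submodule unfolding Uprime_carrier mU int_gring_submodule_def by blast
  next
    show "\<one>\<^bsub>?U\<^esub> \<in> carrier ?U" using image_submodule unfolding Uprime_carrier mU int_gring_submodule_def by blast
  next
    fix x assume "x \<in> carrier ?U"
    then obtain y where y: "Poly_Mapping.keys y \<subseteq> Xit f" "x = theta y" unfolding Uprime_carrier by auto
    have "theta (- y) + theta y = 0" using theta_add[of "- y" y] theta_zero by simp
    moreover have "theta (- y) \<in> carrier ?U" unfolding Uprime_carrier using y(1) by auto
    ultimately show "\<exists>y\<in>carrier ?U. y \<otimes>\<^bsub>?U\<^esub> x = \<one>\<^bsub>?U\<^esub>" unfolding mU y(2) by blast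
  qed (auto simp: mU add.assoc)
  interpret theta: group_hom FF ?U theta
    using gU by (auto simp: group_hom_def group_hom_axioms_def hom_def mU theta_add Uprime_carrier)
  have ker: "kernel FF ?U theta = N"
  proof -
    have "x \<in> kernel FF ?U theta \<longleftrightarrow> x \<in> N" for x
      using theta_kernel[of x] N_keys[of x] by (auto simp: kernel_def mU)
    then show ?thesis by blast
  qed
  have Um: "Umod A sg f = FF Mod kernel FF ?U theta" unfolding ker N_def Umod_def ..
  let ?T = "\<lambda>X. the_elem (theta ` X)"
  have iso: "?T \<in> iso (Umod A sg f) ?U" unfolding Um by (rule theta.FactGroup_iso_set) (simp add: Uprime_carrier)
  have gM: "group (Umod A sg f)" unfolding Um by (rule normal.factorgroup_is_group[OF theta.normal_kernel])
  let ?\<phi> = "inv_into (carrier (Umod A sg f)) ?T"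
  have phi: "?\<phi> \<in> iso ?U (Umod A sg f)" by (rule group.iso_set_sym[OF gM iso])
  have inj: "inj_on ?T (carrier (Umod A sg f))" and img: "?T ` carrier (Umod A sg f) = carrier ?U"
    using iso by (auto simp: iso_def bij_betw_def)
  have cosets: "carrier (Umod A sg f) = {(\<lambda>n. n + x) ` N | x. x \<in> carrier FF}"
  proof -
    have e: "N #>\<^bsub>FF\<^esub> x = (\<lambda>n. n + x) ` N" for x by (auto simp: r_coset_def)
    have "carrier (FF Mod N) = {N #>\<^bsub>FF\<^esub> x | x. x \<in> carrier FF}"
      unfolding FactGroup_def RCOSETS_def by (simp del: carrier_free_Abelian_group_iff) blast
    then show ?thesis unfolding Um ker e .
  qed
  have Tc: "?T ((\<lambda>n. n + x) ` N) = theta x" if x: "x \<in> carrier FF" for x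
  proof -
    have "theta (n + x) = theta x" if "n \<in> N" for n using theta_kernel[OF N_keys[OF that]] that by (simp add: theta_add)
    then have "theta ` (\<lambda>n. n + x) ` N = {theta x}" using N_zero by force
    then show ?thesis by simp
  qed
  have eqv: "?\<phi> (gring_mult (H f) (Poly_Mapping.single (\<sigma> f) 1) y) = Uact A sg \<sigma> (?\<phi> y)"
    if s: "\<sigma> \<in> carrier GG" and y: "y \<in> carrier ?U" for \<sigma> y
  proof -
    obtain x where x: "x \<in> carrier FF" "y = theta x" using y unfolding Uprime_carrier by blast
    have xk: "Poly_Mapping.keys x \<subseteq> Xit f" using x(1) by simp
    let ?g = "\<sigma> f"
    have gc: "?g \<in> C" by (rule GG_H[OF s f])
    have gi: "inv\<^bsub>H f\<^esub> ?g \<in> C" using gc by simp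
    have D: "(\<lambda>n. n + x) ` N \<in> carrier (Umod A sg f)" unfolding cosets using x(1) by blast
    have py: "?\<phi> y = (\<lambda>n. n + x) ` N" using inv_into_f_f[OF inj D] Tc[OF x(1)] x(2) by simp
    \<comment> \<open>Stability of N is read off from its description as the kernel of
      \<open>theta\<close>, where a shift only permutes the conditions
      \<open>w \<alpha> n = 0\<close>.\<close>
    have shN: "shift c n \<in> N" if "n \<in> N" "c \<in> C" for c n
    proof -
      have k: "Poly_Mapping.keys n \<subseteq> Xit f" by (rule N_keys[OF that(1)])
      have "theta n = 0" using theta_kernel[OF k] that(1) by simp
      then have "\<forall>\<alpha>\<in>C. w \<alpha> (shift c n) = 0" using theta_zero_iff shift_w[OF k that(2)] that(2) by simp
      then have "theta (shift c n) = 0" using theta_zero_iff by blast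
      then show ?thesis using theta_kernel[OF shift_keys[OF k that(2)]] by simp
    qed
    have act_shift: "frag_extend (\<lambda>\<xi>. frag_of (act A sg \<sigma> \<xi>)) z = shift ?g z" if "Poly_Mapping.keys z \<subseteq> Xit f" for z
      unfolding shift_def by (rule frag_extend_eq) (use that act_ga[OF s f] in auto)
    have "Uact A sg \<sigma> ((\<lambda>n. n + x) ` N) = (\<lambda>n. n + shift ?g x) ` N"
    proof -
      have "Uact A sg \<sigma> ((\<lambda>n. n + x) ` N) = (\<lambda>n. shift ?g (n + x)) ` N"
        unfolding Uact_def image_image
      proof (rule image_cong[OF refl])
        fix n assume "n \<in> N"
        then have "Poly_Mapping.keys (n + x) \<subseteq> Xit f" using N_keys xk keys_add[of n x] by blast
        then show "frag_extend (\<lambda>\<xi>. frag_of (act A sg \<sigma> \<xi>)) (n + x) = shift ?g (n + x)" by (rule act_shift)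
      qed
      also have "\<dots> = (\<lambda>n. n + shift ?g x) ` N"
      proof
        show "(\<lambda>n. shift ?g (n + x)) ` N \<subseteq> (\<lambda>n. n + shift ?g x) ` N" using shN gc by (auto simp: shift_add)
        show "(\<lambda>n. n + shift ?g x) ` N \<subseteq> (\<lambda>n. shift ?g (n + x)) ` N"
        proof clarify
          fix n assume n: "n \<in> N"
          have "n + shift ?g x = shift ?g (shift (inv\<^bsub>H f\<^esub> ?g) n + x)" using shift_inv[OF N_keys[OF n] gc] by (simp add: shift_add)
          then show "n + shift ?g x \<in> (\<lambda>n. shift ?g (n + x)) ` N" using shN[OF n gi] by blast
        qed
      qed
      finally show ?thesis .
    qed
    moreover have sx: "shift ?g x \<in> carrier FF" using shift_keys[OF xk gc] by simp
    have "(\<lambda>n. n + shift ?g x) ` N \<in> carrier (Umod A sg f)" unfolding cosets using sx by blast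
    from inv_into_f_f[OF inj this] have "?\<phi> (theta (shift ?g x)) = (\<lambda>n. n + shift ?g x) ` N" using Tc[OF sx] by simp
    moreover have "gring_mult (H f) (Poly_Mapping.single ?g 1) y = theta (shift ?g x)"
      unfolding x(2) by (rule gring_single[OF xk gc])
    ultimately show ?thesis unfolding py by simp
  qed
  show ?thesis using phi eqv by (intro exI[of _ ?\<phi>]) blast
qed

end

theorem mainTheorem3:
  fixes A :: "'k::topological_field set"
    and sg :: "'k \<Rightarrow> 'k"
    and \<mu> :: "('k set \<Rightarrow> 'k set set) measure"
    and u :: "('k set set \<Rightarrow>\<^sub>0 int) \<Rightarrow> rat"
    and f :: "'k set"
  assumes "basic_data A sg"
    and "is_haar_prob A sg \<mu>"
    and "is_universal_hom A sg \<mu> u"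
    and "integral_ideal A f"
  shows "\<exists>\<phi>. \<phi> \<in> iso (Uprime A sg u f) (Umod A sg f) \<and>
    (\<forall>\<sigma>\<in>carrier (ray_lim A sg). \<forall>x\<in>carrier (Uprime A sg u f).
       \<phi> (gring_mult (ray_group A sg f) (Poly_Mapping.single (\<sigma> f) 1) x) = Uact A sg \<sigma> (\<phi> x))"
proof -
  interpret anderson A sg \<mu> u f
    by unfold_locales (use assms in auto)
  show ?thesis by (rule Uprime_iso_Umod)
qed

end
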